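(* Let $\gamma\in\mathbb{R}$ and let $V:[0,\infty)\to\mathbb{R}$ be measurable with $\int_0^\infty |V(x)|\,dx<\infty$. Let $H$ and $H_0$ be the self-adjoint operators in $L_2(0,\infty)$ given by $-\frac{d^2}{dx^2}+V$ and $-\frac{d^2}{dx^2}$, respectively, with boundary condition $u'(0)=\gamma u(0)$, let $R(z)=(H-z)^{-1}$, $R_0(z)=(H_0-z)^{-1}$, and let $w$ be the Jost function. Then for every $z\in\rho(H)\cap\rho(H_0)$, writing $\zeta=z^{1/2}$ with $\operatorname{Im}\zeta>0$, $$\operatorname{Tr}\big(R_0(z)-R(z)\big)=\frac{1}{2\zeta}\left(\frac{\dot w(\zeta)}{w(\zeta)}+\frac{i}{\gamma-i\zeta}\right).$$
   Context: The operator $H$ is defined through the quadratic form $\int_0^\infty(|u'|^2+V|u|^2)\,dx+\gamma|u(0)|^2$ with form domain $H^1(0,\infty)$, and $H_0$ is the same operator with $V\equiv0$; $\rho(\cdot)$ denotes the resolvent set. Consider the equation $-u''+V(x)u=\zeta^2u$ on $x>0$ (solutions are $u\in C^1([0,\infty))$ with $u'$ locally absolutely continuous, the equation holding a.e.). The regular solution $\varphi(x,\zeta)$ is the unique solution with $\varphi(0,\zeta)=1$, $\varphi'(0,\zeta)=\gamma$. For $\operatorname{Im}\zeta\ge0$, $\zeta\ne0$, the Jost solution $\theta(x,\zeta)$ is the unique solution with $\theta(x,\zeta)=e^{i\zeta x}(1+o(1))$, $\theta'(x,\zeta)=i\zeta e^{i\zeta x}(1+o(1))$ as $x\to\infty$.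 The Jost function is the ($x$-independent) Wronskian $w(\zeta)=\varphi'(x,\zeta)\theta(x,\zeta)-\theta'(x,\zeta)\varphi(x,\zeta)=\gamma\theta(0,\zeta)-\theta'(0,\zeta)$; it is analytic in $\operatorname{Im}\zeta>0$. Primes denote derivatives in $x$, and the dot denotes the derivative in $\zeta$. *)

theory Defs
  imports "HOL-Analysis.Analysis"
begin

section \<open>The complex Hilbert space \<open>L\<^sub>2(0,\<infinity>)\<close>\<close>

text \<open>Functions on the half-line are represented by functions on \<^typ>\<open>real\<close>; their values at
  negative arguments are irrelevant.\<close>

abbreviation halfline :: "real measure" where
  "halfline \<equiv> lebesgue_on {0..}"

definition square_integrable :: "(real \<Rightarrow> complex) \<Rightarrow> bool" where
  "square_integrable f \<longleftrightarrow>
     f \<in> borel_measurable halfline \<and> integrable halfline (\<lambda>x. (cmod (f x))\<^sup>2)"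

definition ae_eq :: "(real \<Rightarrow> complex) \<Rightarrow> (real \<Rightarrow> complex) \<Rightarrow> bool" where
  "ae_eq f g \<longleftrightarrow> square_integrable f \<and> square_integrable g \<and> (AE x in halfline. f x = g x)"

lemma square_integrable_zero [simp]: "square_integrable (\<lambda>x. 0)"
  by (simp add: square_integrable_def)

lemma square_integrable_mult:
  assumes "square_integrable f" "square_integrable g"
  shows "integrable halfline (\<lambda>x. f x * cnj (g x))"
proof (rule Bochner_Integration.integrable_bound)
  show "integrable halfline (\<lambda>x. (cmod (f x))\<^sup>2 + (cmod (g x))\<^sup>2)"
    using assms by (auto simp: square_integrable_def)
  have m: "f \<in> borel_measurable halfline" "g \<in> borel_measurable halfline"
    using assms by (auto simp: square_integrable_def)
  have "cnj \<in> borel_measurable borel"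
    by (intro borel_measurable_continuous_onI continuous_on_cnj continuous_on_id)
  from measurable_compose[OF m(2) this] m(1)
  show "(\<lambda>x. f x * cnj (g x)) \<in> borel_measurable halfline"
    by (rule borel_measurable_times[rotated])
  have "a * b \<le> a\<^sup>2 + b\<^sup>2" for a b :: real
    using sum_squares_bound[of a b] zero_le_power2[of a] zero_le_power2[of b] by linarith
  then show "AE x in halfline. norm (f x * cnj (g x)) \<le> norm ((cmod (f x))\<^sup>2 + (cmod (g x))\<^sup>2)"
    by (intro always_eventually allI) (simp add: norm_mult)
qed

lemma square_integrable_add:
  assumes "square_integrable f" "square_integrable g"
  shows "square_integrable (\<lambda>x. f x + g x)"
  unfolding square_integrable_def
proof
  have m: "f \<in> borel_measurable halfline" "g \<in> borel_measurable halfline"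
    using assms by (auto simp: square_integrable_def)
  then show "(\<lambda>x. f x + g x) \<in> borel_measurable halfline"
    by (rule borel_measurable_add)
  show "integrable halfline (\<lambda>x. (cmod (f x + g x))\<^sup>2)"
  proof (rule Bochner_Integration.integrable_bound)
    show "integrable halfline (\<lambda>x. 2 * (cmod (f x))\<^sup>2 + 2 * (cmod (g x))\<^sup>2)"
      using assms by (auto simp: square_integrable_def)
    show "(\<lambda>x. (cmod (f x + g x))\<^sup>2) \<in> borel_measurable halfline"
      by (intro borel_measurable_power measurable_compose[OF _ borel_measurable_norm]
            borel_measurable_add m)
    have "(cmod (a + b))\<^sup>2 \<le> 2 * (cmod a)\<^sup>2 + 2 * (cmod b)\<^sup>2" for a b
    proof -
      have "(cmod (a + b))\<^sup>2 \<le> (cmod a + cmod b)\<^sup>2"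
        by (intro power_mono norm_triangle_ineq) auto
      also have "\<dots> \<le> 2 * (cmod a)\<^sup>2 + 2 * (cmod b)\<^sup>2"
        using zero_le_power2[of "cmod a - cmod b"] by (simp add: power2_eq_square algebra_simps)
      finally show ?thesis .
    qed
    then show "AE x in halfline. norm ((cmod (f x + g x))\<^sup>2)
        \<le> norm (2 * (cmod (f x))\<^sup>2 + 2 * (cmod (g x))\<^sup>2)"
      by (intro always_eventually allI) simp
  qed
qed

lemma square_integrable_cmult:
  assumes "square_integrable f"
  shows "square_integrable (\<lambda>x. c * f x)"
  using assms by (auto simp: square_integrable_def norm_mult power_mult_distrib)

lemma ae_eqI:
  "square_integrable f \<Longrightarrow> square_integrable g \<Longrightarrow> (\<And>x. f x = g x) \<Longrightarrow> ae_eq f g"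
  by (simp add: ae_eq_def)

lemma ae_eqD:
  assumes "ae_eq f g"
  shows "square_integrable f" "square_integrable g" "AE x in halfline. f x = g x"
  using assms by (simp_all add: ae_eq_def)

lemma ae_eq_part_equivp: "part_equivp ae_eq"
proof (rule part_equivpI)
  show "\<exists>f. ae_eq f f"
    by (rule exI[of _ "\<lambda>x. 0"]) (simp add: ae_eq_def)
  show "symp ae_eq"
  proof (rule sympI)
    fix f g assume fg: "ae_eq f g"
    have "AE x in halfline. g x = f x"
      using ae_eqD(3)[OF fg] by eventually_elim simp
    with ae_eqD(1,2)[OF fg] show "ae_eq g f"
      by (simp add: ae_eq_def)
  qed
  show "transp ae_eq"
  proof (rule transpI)
    fix f g h assume fg: "ae_eq f g" and gh: "ae_eq g h"
    have "AE x in halfline. f x = h x"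
      using ae_eqD(3)[OF fg] ae_eqD(3)[OF gh] by eventually_elim simp
    with ae_eqD(1)[OF fg] ae_eqD(2)[OF gh] show "ae_eq f h"
      by (simp add: ae_eq_def)
  qed
qed

quotient_type l2 = "real \<Rightarrow> complex" / partial: ae_eq
  by (rule ae_eq_part_equivp)

lift_definition cinner :: "l2 \<Rightarrow> l2 \<Rightarrow> complex"
  is "\<lambda>f g. LINT x|halfline. f x * cnj (g x)"
proof -
  fix f f' g g'
  assume *: "ae_eq f f'" "ae_eq g g'"
  have "AE x in halfline. f x * cnj (g x) = f' x * cnj (g' x)"
    using ae_eqD(3)[OF *(1)] ae_eqD(3)[OF *(2)] by eventually_elim simp
  moreover have "integrable halfline (\<lambda>x. f x * cnj (g x))"
    "integrable halfline (\<lambda>x. f' x * cnj (g' x))"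
    using ae_eqD(1,2)[OF *(1)] ae_eqD(1,2)[OF *(2)] by (simp_all add: square_integrable_mult)
  ultimately show "(LINT x|halfline. f x * cnj (g x)) = (LINT x|halfline. f' x * cnj (g' x))"
    by (intro integral_cong_AE borel_measurable_integrable)
qed

lift_definition cscale :: "complex \<Rightarrow> l2 \<Rightarrow> l2" (infixr "*\<^sub>C" 75)
  is "\<lambda>c f x. c * f x"
proof -
  fix c f g
  assume *: "ae_eq f g"
  have "AE x in halfline. c * f x = c * g x"
    using ae_eqD(3)[OF *] by eventually_elim simp
  with ae_eqD(1,2)[OF *] show "ae_eq (\<lambda>x. c * f x) (\<lambda>x. c * g x)"
    by (simp add: ae_eq_def square_integrable_cmult)
qed

instantiation l2 :: real_vector
begin

lift_definition zero_l2 :: l2 is "\<lambda>x. 0"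
  by (simp add: ae_eq_def)

lift_definition plus_l2 :: "l2 \<Rightarrow> l2 \<Rightarrow> l2" is "\<lambda>f g x. f x + g x"
proof -
  fix f f' g g'
  assume *: "ae_eq f f'" "ae_eq g g'"
  have "AE x in halfline. f x + g x = f' x + g' x"
    using ae_eqD(3)[OF *(1)] ae_eqD(3)[OF *(2)] by eventually_elim simp
  with ae_eqD(1,2)[OF *(1)] ae_eqD(1,2)[OF *(2)]
  show "ae_eq (\<lambda>x. f x + g x) (\<lambda>x. f' x + g' x)"
    by (simp add: ae_eq_def square_integrable_add)
qed

definition "scaleR_l2 (r::real) (f::l2) = of_real r *\<^sub>C f"

definition "uminus_l2 (f::l2) = (-1) *\<^sub>C f"

definition "minus_l2 (f::l2) g = f + (-1) *\<^sub>C g"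

instance
proof
  fix f g h :: l2 and a b :: real
  note sq = square_integrable_add square_integrable_cmult ae_eqD(1)
  show "f + g + h = f + (g + h)"
    by transfer (rule ae_eqI, (intro sq; assumption)+, simp add: add.assoc)
  show "f + g = g + f"
    by transfer (rule ae_eqI, (intro sq; assumption)+, simp add: add.commute)
  show "0 + f = f"
    by transfer simp
  show "- f + f = 0"
    unfolding uminus_l2_def by transfer (rule ae_eqI, (intro sq square_integrable_zero; assumption)+, simp)
  show "f - g = f + - g"
    by (simp add: uminus_l2_def minus_l2_def)
  show "a *\<^sub>R (f + g) = a *\<^sub>R f + a *\<^sub>R g"
    unfolding scaleR_l2_def by transfer (rule ae_eqI, (intro sq; assumption)+, simp add: ring_distribs)
  show "(a + b) *\<^sub>R f = a *\<^sub>R f + b *\<^sub>R f"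
    unfolding scaleR_l2_def by transfer (rule ae_eqI, (intro sq; assumption)+, simp add: ring_distribs)
  show "a *\<^sub>R b *\<^sub>R f = (a * b) *\<^sub>R f"
    unfolding scaleR_l2_def by transfer (rule ae_eqI, (intro sq; assumption)+, simp add: mult.assoc)
  show "1 *\<^sub>R f = f"
    unfolding scaleR_l2_def by transfer simp
qed

end

lemma cinner_add_left: "cinner (f + g) h = cinner f h + cinner g h"
  by transfer (simp add: ae_eq_def square_integrable_mult ring_distribs)

lemma cinner_cscale_left: "cinner (c *\<^sub>C f) h = c * cinner f h"
  by transfer (simp add: ae_eq_def mult.assoc)

lemma cinner_commute: "cinner f g = cnj (cinner g f)"
  by transfer (simp add: mult.commute flip: Bochner_Integration.integral_cnj)

lemma cinner_self:
  "Im (cinner f f) = 0" "0 \<le> Re (cinner f f)" "Re (cinner f f) = 0 \<longleftrightarrow> f = 0"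
proof -
  have *: "cinner f f = of_real (LINT x|halfline. (cmod (rep_l2 f x))\<^sup>2)"
    by (simp add: cinner.rep_eq complex_norm_square[symmetric] flip: of_real_power)
  show "Im (cinner f f) = 0" "0 \<le> Re (cinner f f)"
    by (simp_all add: * integral_nonneg_AE)
  have "ae_eq (rep_l2 f) (rep_l2 f)"
    using Quotient_l2 by (metis Quotient_rep_reflp)
  then have sq: "square_integrable (rep_l2 f)"
    by (simp add: ae_eq_def)
  then have "Re (cinner f f) = 0 \<longleftrightarrow> (AE x in halfline. (cmod (rep_l2 f x))\<^sup>2 = 0)"
    unfolding * by (simp add: square_integrable_def integral_nonneg_eq_0_iff_AE del: power_eq_0_iff)
  also have "\<dots> \<longleftrightarrow> ae_eq (rep_l2 f) (\<lambda>x. 0)"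
    using sq by (simp add: ae_eq_def)
  also have "\<dots> \<longleftrightarrow> f = 0"
    using Quotient_rel[OF Quotient_l2, of "rep_l2 f" "\<lambda>x. 0"]
      \<open>ae_eq (rep_l2 f) (rep_l2 f)\<close> Quotient_abs_rep[OF Quotient_l2, of f]
    by (simp add: zero_l2.abs_eq ae_eq_def)
  finally show "Re (cinner f f) = 0 \<longleftrightarrow> f = 0" .
qed

instantiation l2 :: real_inner
begin

definition "inner_l2 f g = Re (cinner f g)"

definition "norm_l2 (f::l2) = sqrt (Re (cinner f f))"

definition "sgn_l2 (f::l2) = f /\<^sub>R norm f"

definition "dist_l2 (f::l2) g = norm (f - g)"

definition
  "(uniformity :: (l2 \<times> l2) filter) = (INF e\<in>{0 <..}. principal {(x, y). dist x y < e})"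

definition
  "open (U :: l2 set) \<longleftrightarrow> (\<forall>x\<in>U. eventually (\<lambda>(x', y). x' = x \<longrightarrow> y \<in> U) uniformity)"

instance
proof
  fix f g h :: l2 and r :: real and U :: "l2 set"
  show "inner f g = inner g f"
    unfolding inner_l2_def by (subst cinner_commute) simp
  show "inner (f + g) h = inner f h + inner g h"
    by (simp add: inner_l2_def cinner_add_left)
  show "inner (r *\<^sub>R f) g = r * inner f g"
    by (simp add: inner_l2_def scaleR_l2_def cinner_cscale_left)
  show "0 \<le> inner f f" "inner f f = 0 \<longleftrightarrow> f = 0"
    by (simp_all add: inner_l2_def cinner_self)
  show "norm f = sqrt (inner f f)"
    by (simp add: norm_l2_def inner_l2_def)
  show "sgn f = f /\<^sub>R norm f" "dist f g = norm (f - g)"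
    by (rule sgn_l2_def dist_l2_def)+
  show "uniformity = (INF e\<in>{0 <..}. principal {(x, y :: l2). dist x y < e})"
    by (rule uniformity_l2_def)
  show "open U \<longleftrightarrow> (\<forall>x\<in>U. eventually (\<lambda>(x', y). x' = x \<longrightarrow> y \<in> U) uniformity)"
    by (rule open_l2_def)
qed

end


section \<open>Trace-class operators on \<open>L\<^sub>2(0,\<infinity>)\<close>\<close>

definition bounded_clinear :: "(l2 \<Rightarrow> l2) \<Rightarrow> bool" where
  "bounded_clinear T \<longleftrightarrow> bounded_linear T \<and> (\<forall>c f. T (c *\<^sub>C f) = c *\<^sub>C T f)"

text \<open>An orthonormal basis is a maximal orthonormal system. Since \<open>L\<^sub>2(0,\<infinity>)\<close> is separable
  and infinite-dimensional, all its orthonormal bases can be indexed by the natural numbers.\<close>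

definition orthonormal_basis :: "(nat \<Rightarrow> l2) \<Rightarrow> bool" where
  "orthonormal_basis e \<longleftrightarrow>
     (\<forall>m n. cinner (e m) (e n) = (if m = n then 1 else 0)) \<and>
     (\<forall>f. (\<forall>n. cinner f (e n) = 0) \<longrightarrow> f = 0)"

text \<open>\<open>P = |T|\<close>, i.e. \<open>P\<close> is a nonnegative bounded operator with \<open>P\<^sup>2 = T\<^sup>* T\<close>; the adjoint is
  expressed through the inner product.\<close>

definition is_abs_op :: "(l2 \<Rightarrow> l2) \<Rightarrow> (l2 \<Rightarrow> l2) \<Rightarrow> bool" where
  "is_abs_op T P \<longleftrightarrow>
     bounded_clinear P \<and> (\<forall>f. cinner (P f) f \<in> \<real>\<^sub>\<ge>\<^sub>0) \<and>
     (\<forall>f g. cinner (P (P f)) g = cinner (T f) (T g))"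

definition trace_class :: "(l2 \<Rightarrow> l2) \<Rightarrow> bool" where
  "trace_class T \<longleftrightarrow>
     bounded_clinear T \<and>
     (\<exists>P e. is_abs_op T P \<and> orthonormal_basis e \<and> summable (\<lambda>n. cinner (P (e n)) (e n)))"

text \<open>The trace is the common value of the series over all orthonormal bases.\<close>

definition op_trace :: "(l2 \<Rightarrow> l2) \<Rightarrow> complex" where
  "op_trace T = (THE t. \<forall>e. orthonormal_basis e \<longrightarrow> (\<lambda>n. cinner (T (e n)) (e n)) sums t)"


section \<open>Unbounded operators, resolvents\<close>

text \<open>An unbounded operator \<open>A\<close> is given by its graph \<open>{(u, A u) | u \<in> dom A}\<close>.\<close>

definition is_resolvent :: "(l2 \<times> l2) set \<Rightarrow> complex \<Rightarrow> (l2 \<Rightarrow> l2) \<Rightarrow> bool" where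
  "is_resolvent A z R \<longleftrightarrow>
     bounded_clinear R \<and>
     (\<forall>f. \<exists>g. (R f, g) \<in> A \<and> g - z *\<^sub>C R f = f) \<and>
     (\<forall>(u, g) \<in> A. R (g - z *\<^sub>C u) = u)"

definition resolvent_set :: "(l2 \<times> l2) set \<Rightarrow> complex set" where
  "resolvent_set A = {z. \<exists>R. is_resolvent A z R}"

definition resolvent :: "(l2 \<times> l2) set \<Rightarrow> complex \<Rightarrow> l2 \<Rightarrow> l2" where
  "resolvent A z = (THE R. is_resolvent A z R)"


section \<open>The Schroedinger operator\<close>

text \<open>\<open>f\<close> is locally absolutely continuous on \<open>[0,\<infinity>)\<close> and \<open>g\<close> is its almost everywhere defined
  derivative: absolutely continuous functions are the primitives of integrable functions.\<close>

definition locally_ac_deriv :: "(real \<Rightarrow> complex) \<Rightarrow> (real \<Rightarrow> complex) \<Rightarrow> bool" where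
  "locally_ac_deriv f g \<longleftrightarrow>
     (\<forall>x\<ge>0. integrable (lebesgue_on {0..x}) g \<and> f x = f 0 + (LINT t|lebesgue_on {0..x}. g t))"

text \<open>\<open>u\<close> is the continuous representative of an element of the Sobolev space \<open>H\<^sup>1(0,\<infinity>)\<close>, and
  \<open>u'\<close> is a representative of its derivative (unique up to null sets).\<close>

definition sobolev_H1 :: "(real \<Rightarrow> complex) \<Rightarrow> (real \<Rightarrow> complex) \<Rightarrow> bool" where
  "sobolev_H1 u u' \<longleftrightarrow> square_integrable u \<and> square_integrable u' \<and> locally_ac_deriv u u'"

text \<open>The sesquilinear form whose diagonal \<open>u = v\<close> is the quadratic form
  \<open>\<integral>\<^sub>0\<^sup>\<infinity> (|u'|\<^sup>2 + V |u|\<^sup>2) dx + \<gamma> |u(0)|\<^sup>2\<close>.\<close>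

definition energy_form ::
  "(real \<Rightarrow> real) \<Rightarrow> real \<Rightarrow> (real \<Rightarrow> complex) \<Rightarrow> (real \<Rightarrow> complex) \<Rightarrow>
     (real \<Rightarrow> complex) \<Rightarrow> (real \<Rightarrow> complex) \<Rightarrow> complex" where
  "energy_form V \<gamma> u u' v v' =
     (LINT x|halfline. u' x * cnj (v' x) + complex_of_real (V x) * u x * cnj (v x))
       + complex_of_real \<gamma> * u 0 * cnj (v 0)"

text \<open>The operator associated with the form: \<open>u \<in> dom H\<close> and \<open>H u = h\<close> iff \<open>u\<close> lies in the form
  domain and \<open>energy_form (u, v) = \<langle>h, v\<rangle>\<close> for every \<open>v\<close> in the form domain.\<close>

definition schroedinger_op :: "(real \<Rightarrow> real) \<Rightarrow> real \<Rightarrow> (l2 \<times> l2) set" where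
  "schroedinger_op V \<gamma> =
     {(abs_l2 u, h) | u h. \<exists>u'. sobolev_H1 u u' \<and>
        (\<forall>v v'. sobolev_H1 v v' \<longrightarrow> energy_form V \<gamma> u u' v v' = cinner h (abs_l2 v))}"


section \<open>Regular solution, Jost solution, Jost function\<close>

abbreviation hderiv :: "(real \<Rightarrow> complex) \<Rightarrow> real \<Rightarrow> complex" where
  "hderiv u x \<equiv> vector_derivative u (at x within {0..})"

definition is_solution :: "(real \<Rightarrow> real) \<Rightarrow> complex \<Rightarrow> (real \<Rightarrow> complex) \<Rightarrow> bool" where
  "is_solution V \<zeta> u \<longleftrightarrow>
     (\<forall>x\<ge>0. u differentiable (at x within {0..})) \<and> continuous_on {0..} (hderiv u) \<and>
     (\<exists>u''. locally_ac_deriv (hderiv u) u'' \<and>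
        (AE x in halfline. - u'' x + complex_of_real (V x) * u x = \<zeta>\<^sup>2 * u x))"

text \<open>Membership in \<^term>\<open>extensional {0..}\<close> fixes the irrelevant values at negative arguments,
  which makes the solutions unique as functions on \<^typ>\<open>real\<close>.\<close>

definition regular_solution :: "(real \<Rightarrow> real) \<Rightarrow> real \<Rightarrow> complex \<Rightarrow> real \<Rightarrow> complex" where
  "regular_solution V \<gamma> \<zeta> =
     (THE \<phi>. \<phi> \<in> extensional {0..} \<and> is_solution V \<zeta> \<phi> \<and>
        \<phi> 0 = 1 \<and> hderiv \<phi> 0 = complex_of_real \<gamma>)"

definition jost_solution :: "(real \<Rightarrow> real) \<Rightarrow> complex \<Rightarrow> real \<Rightarrow> complex" where
  "jost_solution V \<zeta> =
     (THE \<theta>. \<theta> \<in> extensional {0..} \<and> is_solution V \<zeta> \<theta> \<and>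
        ((\<lambda>x. \<theta> x / exp (\<i> * \<zeta> * of_real x)) \<longlongrightarrow> 1) at_top \<and>
        ((\<lambda>x. hderiv \<theta> x / (\<i> * \<zeta> * exp (\<i> * \<zeta> * of_real x))) \<longlongrightarrow> 1) at_top)"

definition wronskian :: "(real \<Rightarrow> complex) \<Rightarrow> (real \<Rightarrow> complex) \<Rightarrow> real \<Rightarrow> complex" where
  "wronskian u v x = hderiv u x * v x - hderiv v x * u x"

text \<open>The Wronskian of two solutions does not depend on \<open>x\<close>; it is evaluated at \<open>x = 0\<close>, where it
  is \<open>\<gamma> \<theta>(0,\<zeta>) - \<theta>'(0,\<zeta>)\<close>.\<close>

definition jost_function :: "(real \<Rightarrow> real) \<Rightarrow> real \<Rightarrow> complex \<Rightarrow> complex" where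
  "jost_function V \<gamma> \<zeta> = wronskian (regular_solution V \<gamma> \<zeta>) (jost_solution V \<zeta>) 0"

end

theory Submission
  imports Defs "HOL-Real_Asymp.Real_Asymp"
begin

text \<open>
  Write \<open>R = R(z)\<close>, \<open>R\<^sub>0 = R\<^sub>0(z)\<close>, and let \<open>G\<close>, \<open>G\<^sub>0\<close> be their kernels, so that
  \<open>G(x, y) = \<phi>(y) \<theta>(x) / w\<close> for \<open>y \<le> x\<close>. Testing the weak equations against each other gives
  \<open>\<langle>(R\<^sub>0 - R) f, g\<rangle> = \<integral> V(x) (R f)(x) (R\<^sub>0 (cnj g))(x) dx\<close>. As the rows of \<open>G\<close> and \<open>G\<^sub>0\<close> are bounded in
  \<open>L\<^sub>2\<close>, Bessel's inequality bounds \<open>\<Sum> |\<langle>(R\<^sub>0 - R) e\<^sub>n, f\<^sub>n\<rangle>|\<close> over orthonormal systems by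
  \<open>\<integral> |V|\<close>, hence \<open>R\<^sub>0 - R\<close> is of trace class, and Parseval's identity yields
  \<open>Tr (R\<^sub>0 - R) = \<integral> V(x) \<integral> G\<^sub>0(x, y) G(x, y) dy dx\<close>. An integration by parts with the Wronskians
  of the free and the perturbed solutions turns the right-hand side into the limit of
  \<open>\<integral>\<^sub>0\<^sup>X (\<phi>\<^sub>0 \<theta>\<^sub>0 / w\<^sub>0 - \<phi> \<theta> / w) dx\<close>.

  On the other hand \<open>w(\<eta>) = W\<^sub>X(\<phi>(\<zeta>), \<theta>(\<eta>)) - (\<eta>\<^sup>2 - \<zeta>\<^sup>2) \<integral>\<^sub>0\<^sup>X \<phi>(\<zeta>) \<theta>(\<eta>) dx\<close>. With
  \<open>\<theta>(x, \<eta>) = exp (i \<eta> x) m(x, \<eta>)\<close>, where \<open>m\<close> is Lipschitz in \<open>\<eta>\<close> with a constant that tends to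
  zero as \<open>x \<rightarrow> \<infinity>\<close>, the difference quotient of \<open>w\<close> at \<open>\<zeta>\<close> differs from
  \<open>i X w - i exp (i \<zeta> X) \<phi>(X) - 2 \<zeta> \<integral>\<^sub>0\<^sup>X \<phi> \<theta> dx\<close> by \<open>O(\<integral>\<^sub>X\<^sup>\<infinity> |V|)\<close>. Subtracting the same
  identity for \<open>V = 0\<close>, where the error vanishes, gives the trace formula.
\<close>

section \<open>The Hilbert space\<close>

text \<open>The solution \<open>\<phi>\<close> is frozen at \<open>\<zeta>\<close> while
  \<open>\<eta>\<close> varies: its data \<open>1\<close> and \<open>\<gamma>\<close> at 0 do not
  depend on the spectral parameter, so its Wronskian with \<open>\<theta>(\<eta>)\<close> at 0 is
  \<open>w(\<eta>)\<close>, and only the Jost solution has to be followed in \<open>\<eta>\<close>.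
  The term \<open>i X w\<close> grows with \<open>X\<close>; it is removed by multiplying the free
  identity, where it reads \<open>i X w0\<close>, by \<open>w / w0\<close> and subtracting.
  Membership of \<open>z\<close> in the resolvent sets gives, besides the resolvents themselves,
  \<open>w \<noteq> 0\<close> and \<open>w0 \<noteq> 0\<close>. Two obstacles shape the proof. Since
  \<open>V\<close> is merely integrable, \<open>\<phi>'\<close> and \<open>\<theta>'\<close> are
  only absolutely continuous, and differentiation is replaced by integrated identities. And trace
  class refers to \<open>|T|\<close>, the trace to all orthonormal bases; so completeness of the
  space, a basis and a square root of \<open>T\<^sup>* T\<close> have to be constructed, the last
  one from the binomial series of \<open>sqrt (1 - A)\<close> for a contraction
  \<open>A\<close>.\<close>

lemma square_integrable_rep: "square_integrable (rep_l2 f)"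
  using Quotient_rep_reflp[OF Quotient_l2, of f] by (simp add: ae_eq_def)

lemma abs_rep_l2: "abs_l2 (rep_l2 f) = f"
  by (rule Quotient_abs_rep[OF Quotient_l2])

lemma ae_eq_refl: "square_integrable f \<Longrightarrow> ae_eq f f"
  by (simp add: ae_eq_def)

lemma abs_l2_cong: "ae_eq f g \<Longrightarrow> abs_l2 f = abs_l2 g"
  using Quotient_rel[OF Quotient_l2, of f g] by (auto simp: ae_eq_def)

lemma cinner_abs_l2:
  "square_integrable f \<Longrightarrow> square_integrable g \<Longrightarrow>
    cinner (abs_l2 f) (abs_l2 g) = (LINT x|halfline. f x * cnj (g x))"
  by (simp add: cinner.abs_eq ae_eq_refl)

lemma abs_l2_add:
  "square_integrable f \<Longrightarrow> square_integrable g \<Longrightarrow> abs_l2 f + abs_l2 g = abs_l2 (\<lambda>x. f x + g x)"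
  by (simp add: plus_l2.abs_eq ae_eq_refl)

lemma abs_l2_cscale: "square_integrable f \<Longrightarrow> c *\<^sub>C abs_l2 f = abs_l2 (\<lambda>x. c * f x)"
  by (simp add: cscale.abs_eq ae_eq_refl)

lemma cinner_add_right: "cinner f (g + h) = cinner f g + cinner f h"
  by (metis cinner_add_left cinner_commute complex_cnj_add)

lemma cinner_cscale_right: "cinner f (c *\<^sub>C g) = cnj c * cinner f g"
  by (metis cinner_cscale_left cinner_commute complex_cnj_mult)

lemma cinner_zero_left: "cinner 0 g = 0"
  using cinner_add_left[of 0 0 g] by simp

lemma cinner_zero_right: "cinner g 0 = 0"
  using cinner_add_right[of g 0 0] by simp

lemma cinner_diff_left: "cinner (f - g) h = cinner f h - cinner g h"
  by (simp add: minus_l2_def cinner_add_left cinner_cscale_left)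

lemma cinner_diff_right: "cinner h (f - g) = cinner h f - cinner h g"
  by (simp add: minus_l2_def cinner_add_right cinner_cscale_right)

lemma cinner_sum_left: "cinner (\<Sum>i\<in>I. f i) h = (\<Sum>i\<in>I. cinner (f i) h)"
  by (induction I rule: infinite_finite_induct) (simp_all add: cinner_zero_left cinner_add_left)

lemma cinner_sum_right: "cinner h (\<Sum>i\<in>I. f i) = (\<Sum>i\<in>I. cinner h (f i))"
  by (induction I rule: infinite_finite_induct) (simp_all add: cinner_zero_right cinner_add_right)

lemma cinner_scaleR_left: "cinner (r *\<^sub>R f) h = of_real r * cinner f h"
  by (simp add: scaleR_l2_def cinner_cscale_left)

lemma cinner_scaleR_right: "cinner h (r *\<^sub>R f) = of_real r * cinner h f"
  by (simp add: scaleR_l2_def cinner_cscale_right)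

lemmas cinner_simps = cinner_add_left cinner_add_right cinner_diff_left cinner_diff_right
  cinner_cscale_left cinner_cscale_right cinner_zero_left cinner_zero_right
  cinner_sum_left cinner_sum_right cinner_scaleR_left cinner_scaleR_right

lemma cinner_self_norm: "cinner f f = of_real ((norm f)\<^sup>2)"
  using cinner_self[of f] by (simp add: norm_l2_def complex_eq_iff)

lemma l2_eqI: "(\<And>h. cinner f h = cinner g h) \<Longrightarrow> f = g"
proof -
  assume *: "\<And>h. cinner f h = cinner g h"
  have "cinner (f - g) (f - g) = 0"
    by (simp add: cinner_diff_left *)
  then show "f = g"
    by (simp add: cinner_self_norm)
qed

text \<open>The class \<open>real_vector\<close> covers real scalars only; this supplies the module
  laws for complex ones.\<close>

interpretation cscale: vector_space cscale
  by unfold_locales (rule l2_eqI; simp add: cinner_simps ring_distribs)+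

lemma norm_cscale: "norm (c *\<^sub>C f) = cmod c * norm f"
proof -
  have "complex_of_real ((norm (c *\<^sub>C f))\<^sup>2) = of_real ((cmod c * norm f)\<^sup>2)"
    unfolding cinner_self_norm[of "c *\<^sub>C f", symmetric]
    using complex_norm_square[of c]
    by (simp add: cinner_self_norm[of f] cinner_simps power_mult_distrib mult.assoc)
  then show ?thesis
    by (simp del: of_real_power add: power2_eq_iff_nonneg)
qed

text \<open>The class \<open>real_inner\<close> gives the Cauchy-Schwarz inequality for the real
  part of \<open>cinner\<close>. Rotating \<open>f\<close> by the phase \<open>c\<close> makes the
  inner product real and nonnegative, so nothing is lost in passing to the real part.\<close>

lemma cmod_cinner_le: "cmod (cinner f g) \<le> norm f * norm g"
proof -
  define c where "c = cnj (sgn (cinner f g))"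
  have "c * cinner f g = of_real (cmod (cinner f g))"
  proof (cases "cinner f g = 0")
    case False
    have "c * cinner f g = of_real ((cmod (cinner f g))\<^sup>2) / of_real (cmod (cinner f g))"
      unfolding complex_norm_square by (simp add: c_def sgn_eq)
    then show ?thesis
      using False by (simp add: power2_eq_square)
  qed simp
  then have "cmod (cinner f g) = Re (cinner (c *\<^sub>C f) g)"
    by (simp add: cinner_simps)
  also have "\<dots> = inner (c *\<^sub>C f) g"
    by (simp add: inner_l2_def)
  also have "\<dots> \<le> norm (c *\<^sub>C f) * norm g"
    by (rule norm_cauchy_schwarz)
  also have "\<dots> \<le> norm f * norm g"
    by (intro mult_right_mono) (auto simp: norm_cscale c_def norm_sgn mult_left_le_one_le)
  finally show ?thesis .
qed

lemma bounded_linear_cinner_left: "bounded_linear (\<lambda>f. cinner f g)"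
  by (rule bounded_linear_intro[where K = "norm g"])
     (auto simp: cinner_simps cmod_cinner_le scaleR_conv_of_real)

lemma bounded_linear_cinner_right: "bounded_linear (\<lambda>f. cinner g f)"
  by (rule bounded_linear_intro[where K = "norm g"])
     (use cmod_cinner_le[of g] in \<open>auto simp: cinner_simps scaleR_conv_of_real mult.commute\<close>)

lemma bounded_linear_cscale: "bounded_linear (cscale c)"
  by (rule bounded_linear_intro[where K = "cmod c"])
     (auto simp: norm_cscale cscale.scale_right_distrib scaleR_l2_def mult.commute)

text \<open>The squared norm as an extended nonnegative integral: it makes sense before square
  integrability is known, and it is the form to which Fatou's lemma applies.\<close>

definition nn_norm2 :: "(real \<Rightarrow> complex) \<Rightarrow> ennreal" where
  "nn_norm2 f = (\<integral>\<^sup>+ x. ennreal ((cmod (f x))\<^sup>2) \<partial>halfline)"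

lemma square_integrable_iff_nn_norm2:
  assumes "f \<in> borel_measurable halfline"
  shows "square_integrable f \<longleftrightarrow> nn_norm2 f < \<infinity>"
  using assms unfolding square_integrable_def nn_norm2_def
  by (subst integrable_iff_bounded) auto

lemma nn_norm2_eq_norm:
  assumes "square_integrable f"
  shows "nn_norm2 f = ennreal ((norm (abs_l2 f))\<^sup>2)"
proof -
  have "complex_of_real ((norm (abs_l2 f))\<^sup>2) = of_real (LINT x|halfline. (cmod (f x))\<^sup>2)"
    unfolding cinner_self_norm[symmetric] using assms
    by (simp add: cinner_abs_l2 complex_norm_square[symmetric] flip: of_real_power)
  then have "(norm (abs_l2 f))\<^sup>2 = (LINT x|halfline. (cmod (f x))\<^sup>2)"
    by (simp only: of_real_eq_iff)
  then show ?thesis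
    using assms unfolding square_integrable_def nn_norm2_def
    by (simp add: nn_integral_eq_integral)
qed

lemma abs_l2_diff:
  "square_integrable f \<Longrightarrow> square_integrable g \<Longrightarrow> abs_l2 f - abs_l2 g = abs_l2 (\<lambda>x. f x - g x)"
  using abs_l2_add[of f "\<lambda>x. (-1) * g x"] abs_l2_cscale[of g "-1"] square_integrable_cmult[of g "-1"]
  by (simp add: minus_l2_def)

lemma square_integrable_diff:
  "square_integrable f \<Longrightarrow> square_integrable g \<Longrightarrow> square_integrable (\<lambda>x. f x - g x)"
  using square_integrable_add[of f "\<lambda>x. (-1) * g x"] square_integrable_cmult[of g "-1"] by simp

lemma borel_measurable_square_integrable:
  "square_integrable f \<Longrightarrow> f \<in> borel_measurable halfline"
  by (simp add: square_integrable_def)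

lemma square_integrable_cmod:
  "square_integrable f \<Longrightarrow> square_integrable (\<lambda>x. of_real (cmod (f x)))"
  by (auto simp: square_integrable_def)

lemma norm_abs_l2_cmod:
  assumes "square_integrable f"
  shows "norm (abs_l2 (\<lambda>x. complex_of_real (cmod (f x)))) = norm (abs_l2 f)"
proof -
  have "ennreal ((norm (abs_l2 (\<lambda>x. complex_of_real (cmod (f x)))))\<^sup>2) = ennreal ((norm (abs_l2 f))\<^sup>2)"
    using nn_norm2_eq_norm[OF assms] nn_norm2_eq_norm[OF square_integrable_cmod[OF assms]]
    by (simp add: nn_norm2_def)
  then show ?thesis
    by (simp add: power2_eq_iff_nonneg)
qed

lemma abs_l2_sum:
  assumes "\<And>i. i \<in> I \<Longrightarrow> square_integrable (f i)" "finite I"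
  shows "square_integrable (\<lambda>x. \<Sum>i\<in>I. f i x) \<and> abs_l2 (\<lambda>x. \<Sum>i\<in>I. f i x) = (\<Sum>i\<in>I. abs_l2 (f i))"
  using assms(2,1)
proof (induction I rule: finite_induct)
  case empty
  then show ?case by (simp add: zero_l2.abs_eq)
next
  case (insert a I)
  then show ?case
    using abs_l2_add[of "f a" "\<lambda>x. \<Sum>i\<in>I. f i x"] square_integrable_add[of "f a" "\<lambda>x. \<Sum>i\<in>I. f i x"]
    by simp
qed

text \<open>Riesz--Fischer: along a rapidly converging subsequence the representatives converge almost
  everywhere, and Fatou's lemma identifies the limit.\<close>

instance l2 :: banach
proof
  fix X :: "nat \<Rightarrow> l2"
  assume X: "Cauchy X"
  have "\<forall>n. \<exists>N. \<forall>i\<ge>N. \<forall>j\<ge>N. norm (X i - X j) < (1/2)^n"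
    using X unfolding Cauchy_def dist_norm by simp
  then obtain N where N: "\<And>n i j. i \<ge> N n \<Longrightarrow> j \<ge> N n \<Longrightarrow> norm (X i - X j) < (1/2)^n"
    by metis
  \<comment> \<open>Summing all earlier thresholds gives \<open>N n \<le> r m\<close> for
    \<open>n \<le> m\<close>; the summand \<open>n\<close> makes the sequence strictly
    increasing.\<close>
  define r where "r n = (\<Sum>k\<le>n. N k) + n" for n
  have r_mono: "strict_mono r"
    unfolding strict_mono_Suc_iff r_def by simp
  have rN: "r m \<ge> N n" if "m \<ge> n" for m n
  proof -
    have "N n \<le> (\<Sum>k\<le>m. N k)"
      using that by (intro member_le_sum) auto
    then show ?thesis by (simp add: r_def)
  qed
  define f where "f n = rep_l2 (X (r n))" for n
  have sq: "square_integrable (f n)" for n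
    by (simp add: f_def square_integrable_rep)
  note [measurable] = borel_measurable_square_integrable[OF sq]
  have fX: "abs_l2 (f n) = X (r n)" for n
    by (simp add: f_def abs_rep_l2)
  have nn_diff: "nn_norm2 (\<lambda>x. f m x - f n x) \<le> ennreal (((1/2)^n)\<^sup>2)" if "m \<ge> n" for m n
  proof -
    have "nn_norm2 (\<lambda>x. f m x - f n x) = ennreal ((norm (X (r m) - X (r n)))\<^sup>2)"
      by (subst nn_norm2_eq_norm) (simp_all add: square_integrable_diff sq flip: abs_l2_diff fX)
    also have "\<dots> \<le> ennreal (((1/2)^n)\<^sup>2)"
      using N[OF rN rN, of n m n] that by (intro ennreal_leI power_mono) auto
    finally show ?thesis .
  qed
  define d where "d n x = cmod (f (Suc n) x - f n x)" for n x
  have [measurable]: "d n \<in> borel_measurable halfline" for n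
    unfolding d_def by measurable
  define G where "G k x = (\<Sum>n<k. d n x)" for k x
  have [measurable]: "G n \<in> borel_measurable halfline" for n
    unfolding G_def by measurable
  \<comment> \<open>The increments have norm at most \<open>(1/2)^n\<close>, so their sum has norm
    at most 2; hence the bound 4 for the square, independent of \<open>k\<close>.\<close>
  have G_bound: "(\<integral>\<^sup>+ x. ennreal ((G k x)\<^sup>2) \<partial>halfline) \<le> ennreal 4" for k
  proof -
    have sqd: "square_integrable (\<lambda>x. complex_of_real (d n x))" for n
      unfolding d_def by (intro square_integrable_cmod square_integrable_diff sq)
    have nd: "norm (abs_l2 (\<lambda>x. complex_of_real (d n x))) \<le> (1/2)^n" for n
    proof -
      have "norm (abs_l2 (\<lambda>x. complex_of_real (d n x))) = norm (X (r (Suc n)) - X (r n))"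
        unfolding d_def
        by (subst norm_abs_l2_cmod) (simp_all add: square_integrable_diff sq flip: abs_l2_diff fX)
      then show ?thesis
        using N[OF rN rN, of n "Suc n" n] by simp
    qed
    have *: "square_integrable (\<lambda>x. complex_of_real (G k x))"
      "abs_l2 (\<lambda>x. complex_of_real (G k x)) = (\<Sum>n<k. abs_l2 (\<lambda>x. complex_of_real (d n x)))"
      using abs_l2_sum[of "{..<k}" "\<lambda>n x. complex_of_real (d n x)"] sqd by (auto simp: G_def)
    have "norm (abs_l2 (\<lambda>x. complex_of_real (G k x))) \<le> (\<Sum>n<k. (1/2)^n)"
      unfolding * by (rule order_trans[OF norm_sum]) (intro sum_mono nd)
    also have "\<dots> \<le> 2"
      by (simp add: geometric_sum)
    finally have "(norm (abs_l2 (\<lambda>x. complex_of_real (G k x))))\<^sup>2 \<le> 2\<^sup>2"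
      by (intro power_mono) auto
    moreover have "(\<integral>\<^sup>+ x. ennreal ((G k x)\<^sup>2) \<partial>halfline) = nn_norm2 (\<lambda>x. complex_of_real (G k x))"
      by (simp add: nn_norm2_def)
    ultimately show ?thesis
      using nn_norm2_eq_norm[OF *(1)] by (simp add: ennreal_leI del: ennreal_numeral)
  qed
  have incG: "incseq (\<lambda>k x. ennreal ((G k x)\<^sup>2))"
    unfolding incseq_def le_fun_def G_def d_def
    by (intro allI impI ennreal_leI power_mono sum_mono2 sum_nonneg) auto
  have "(\<integral>\<^sup>+ x. (SUP k. ennreal ((G k x)\<^sup>2)) \<partial>halfline) = (SUP k. \<integral>\<^sup>+ x. ennreal ((G k x)\<^sup>2) \<partial>halfline)"
    by (rule nn_integral_monotone_convergence_SUP[OF incG]) simp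
  also have "\<dots> \<le> ennreal 4"
    by (intro SUP_least G_bound)
  finally have "(\<integral>\<^sup>+ x. (SUP k. ennreal ((G k x)\<^sup>2)) \<partial>halfline) \<noteq> \<infinity>"
    by (auto simp: top_unique)
  then have AE_fin: "AE x in halfline. (SUP k. ennreal ((G k x)\<^sup>2)) \<noteq> \<infinity>"
    by (intro nn_integral_PInf_AE) simp_all
  \<comment> \<open>Where the sequence diverges, \<open>lim\<close> is an unspecified value;
    \<open>F\<close> is measurable all the same, and the divergence set will be null.\<close>
  define F where "F x = lim (\<lambda>n. f n x)" for x
  have [measurable]: "F \<in> borel_measurable halfline"
    unfolding F_def by measurable
  have conv: "AE x in halfline. (\<lambda>n. f n x) \<longlonglongrightarrow> F x"
    using AE_fin
  proof eventually_elim
    case (elim x)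
    then obtain B where B: "(SUP k. ennreal ((G k x)\<^sup>2)) = ennreal B" "B \<ge> 0"
      by (cases "SUP k. ennreal ((G k x)\<^sup>2)") auto
    have Gk: "G k x \<le> sqrt B" for k
    proof -
      have "ennreal ((G k x)\<^sup>2) \<le> ennreal B"
        unfolding B(1)[symmetric] by (rule SUP_upper) simp
      then have "(G k x)\<^sup>2 \<le> B" using B(2) by simp
      then show ?thesis by (rule real_le_rsqrt)
    qed
    have "summable (\<lambda>n. d n x)"
      by (rule summableI_nonneg_bounded[of _ "sqrt B"]) (use Gk in \<open>auto simp: d_def G_def\<close>)
    then have "summable (\<lambda>n. f (Suc n) x - f n x)"
      unfolding d_def by (rule summable_norm_cancel)
    then have "convergent (\<lambda>n. \<Sum>k<n. f (Suc k) x - f k x)"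
      by (simp add: summable_iff_convergent)
    moreover have "(\<Sum>k<n. f (Suc k) x - f k x) = f n x - f 0 x" for n
      by (induction n) simp_all
    ultimately have "convergent (\<lambda>n. f n x - f 0 x)"
      by simp
    then have "convergent (\<lambda>n. (f n x - f 0 x) + f 0 x)"
      by (intro convergent_add convergent_const)
    then show ?case
      by (simp add: F_def convergent_LIMSEQ_iff)
  qed
  have Fn: "nn_norm2 (\<lambda>x. F x - f n x) \<le> ennreal (((1/2)^n)\<^sup>2)" for n
  proof -
    have "nn_norm2 (\<lambda>x. F x - f n x) = (\<integral>\<^sup>+ x. liminf (\<lambda>m. ennreal ((cmod (f m x - f n x))\<^sup>2)) \<partial>halfline)"
      unfolding nn_norm2_def
    proof (rule nn_integral_cong_AE)
      show "AE x in halfline. ennreal ((cmod (F x - f n x))\<^sup>2) = liminf (\<lambda>m. ennreal ((cmod (f m x - f n x))\<^sup>2))"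
        using conv
      proof eventually_elim
        case (elim x)
        then have "(\<lambda>m. ennreal ((cmod (f m x - f n x))\<^sup>2)) \<longlonglongrightarrow> ennreal ((cmod (F x - f n x))\<^sup>2)"
          by (intro tendsto_ennrealI tendsto_intros)
        then show ?case
          by (rule lim_imp_Liminf[OF sequentially_bot, symmetric])
      qed
    qed
    also have "\<dots> \<le> liminf (\<lambda>m. nn_norm2 (\<lambda>x. f m x - f n x))"
      unfolding nn_norm2_def by (rule nn_integral_liminf) simp
    also have "\<dots> \<le> liminf (\<lambda>m. ennreal (((1/2)^n)\<^sup>2))"
      by (intro Liminf_mono) (use nn_diff in \<open>auto simp: eventually_sequentially\<close>)
    also have "\<dots> = ennreal (((1/2)^n)\<^sup>2)"
      by (rule Liminf_const) simp
    finally show ?thesis .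
  qed
  have sqFn: "square_integrable (\<lambda>x. F x - f n x)" for n
    using Fn[of n] by (subst square_integrable_iff_nn_norm2) (auto simp: le_less_trans)
  have sqF: "square_integrable F"
    using square_integrable_add[OF sqFn[of 0] sq[of 0]] by simp
  have normF: "norm (abs_l2 F - X (r n)) \<le> (1/2)^n" for n
  proof -
    have "ennreal ((norm (abs_l2 F - X (r n)))\<^sup>2) \<le> ennreal (((1/2)^n)\<^sup>2)"
      using Fn[of n] nn_norm2_eq_norm[OF sqFn[of n]] abs_l2_diff[OF sqF sq[of n]] fX by simp
    then show ?thesis
      by (simp add: power2_le_iff_abs_le)
  qed
  have "(\<lambda>n. X (r n)) \<longlonglongrightarrow> abs_l2 F"
  proof (rule Lim_null[THEN iffD2], rule Lim_null_comparison)
    show "\<forall>\<^sub>F n in sequentially. norm (X (r n) - abs_l2 F) \<le> (1/2)^n"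
      using normF by (simp add: norm_minus_commute)
    show "(\<lambda>n. (1/2::real)^n) \<longlonglongrightarrow> 0"
      by (rule LIMSEQ_power_zero) simp
  qed
  then have "(X \<circ> r) \<longlonglongrightarrow> abs_l2 F"
    by (simp add: o_def)
  from Cauchy_converges_subseq[OF X r_mono this] show "convergent X"
    by (rule convergentI)
qed

lemma cinner_zero_commute: "cinner f g = 0 \<Longrightarrow> cinner g f = 0"
  by (subst cinner_commute) simp

section \<open>Orthonormal systems\<close>

text \<open>The index set matters in the trace class criterion, where the second of the two systems
  is known to be orthonormal only for some of the indices.\<close>

definition orthonormal_on :: "nat set \<Rightarrow> (nat \<Rightarrow> l2) \<Rightarrow> bool" where
  "orthonormal_on I e \<longleftrightarrow> (\<forall>m\<in>I. \<forall>n\<in>I. cinner (e m) (e n) = (if m = n then 1 else 0))"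

text \<open>Gram--Schmidt applied to linearly dependent vectors produces zeros; allowing them avoids
  re-indexing.\<close>

definition orthonormal0 :: "(nat \<Rightarrow> l2) \<Rightarrow> bool" where
  "orthonormal0 e \<longleftrightarrow> (\<forall>m n. cinner (e m) (e n) = (if m = n \<and> e n \<noteq> 0 then 1 else 0))"

lemma orthonormal0I_basis: "orthonormal_basis e \<Longrightarrow> orthonormal0 e"
  unfolding orthonormal_basis_def orthonormal0_def
  by (metis cinner_zero_left zero_neq_one)

lemma norm_sum_orthonormal:
  assumes "finite I" "\<And>m n. m \<in> I \<Longrightarrow> n \<in> I \<Longrightarrow> m \<noteq> n \<Longrightarrow> cinner (e m) (e n) = 0"
    "\<And>n. n \<in> I \<Longrightarrow> norm (e n) \<le> 1"
  shows "(norm (\<Sum>n\<in>I. a n *\<^sub>C e n))\<^sup>2 \<le> (\<Sum>n\<in>I. (cmod (a n))\<^sup>2)"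
proof -
  have "complex_of_real ((norm (\<Sum>n\<in>I. a n *\<^sub>C e n))\<^sup>2)
      = (\<Sum>m\<in>I. \<Sum>n\<in>I. a m * (cnj (a n) * cinner (e m) (e n)))"
    unfolding cinner_self_norm[symmetric]
    by (subst cinner_sum_left)
       (simp only: cinner_sum_right cinner_cscale_left cinner_cscale_right sum_distrib_left mult.left_commute)
  also have "\<dots> = (\<Sum>m\<in>I. \<Sum>n\<in>I. if m = n then a m * (cnj (a m) * cinner (e m) (e m)) else 0)"
    by (intro sum.cong refl) (auto simp: assms(2))
  also have "\<dots> = (\<Sum>m\<in>I. of_real ((cmod (a m) * norm (e m))\<^sup>2))"
    using assms(1) by (simp add: cinner_self_norm complex_norm_square mult.assoc power_mult_distrib
        del: of_real_power) 
  finally have "(norm (\<Sum>n\<in>I. a n *\<^sub>C e n))\<^sup>2 = (\<Sum>m\<in>I. (cmod (a m) * norm (e m))\<^sup>2)"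
    by (simp only: of_real_eq_iff of_real_sum[symmetric])
  also have "\<dots> \<le> (\<Sum>m\<in>I. (cmod (a m))\<^sup>2)"
    using assms(3) by (intro sum_mono power_mono) (auto simp: mult_left_le)
  finally show ?thesis .
qed

text \<open>With \<open>g\<close> the sum of the components of \<open>f\<close> and \<open>S\<close>
  the left-hand side, the inner product of \<open>f\<close> and \<open>g\<close> is \<open>S\<close>
  and the squared norm of \<open>g\<close> is at most \<open>S\<close>; expanding the squared norm
  of \<open>f - g\<close> then gives the claim.\<close>

lemma bessel:
  assumes "finite I" "\<And>m n. m \<in> I \<Longrightarrow> n \<in> I \<Longrightarrow> m \<noteq> n \<Longrightarrow> cinner (e m) (e n) = 0"
    "\<And>n. n \<in> I \<Longrightarrow> norm (e n) \<le> 1"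
  shows "(\<Sum>n\<in>I. (cmod (cinner f (e n)))\<^sup>2) \<le> (norm f)\<^sup>2"
proof -
  define S where "S = (\<Sum>n\<in>I. (cmod (cinner f (e n)))\<^sup>2)"
  define g where "g = (\<Sum>n\<in>I. cinner f (e n) *\<^sub>C e n)"
  have g: "(norm g)\<^sup>2 \<le> S"
    unfolding g_def S_def by (rule norm_sum_orthonormal[OF assms])
  have fg: "cinner f g = of_real S"
    by (simp add: g_def S_def cinner_simps complex_norm_square mult.commute del: of_real_power)
  have "0 \<le> (norm (f - g))\<^sup>2" by simp
  also have "(norm (f - g))\<^sup>2 = (norm f)\<^sup>2 - 2 * inner f g + (norm g)\<^sup>2"
    by (simp add: power2_norm_eq_inner inner_diff inner_commute)
  also have "inner f g = S" by (simp add: inner_l2_def fg)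
  finally show ?thesis using g by (simp add: S_def)
qed

lemma orthonormal0_norm: "orthonormal0 e \<Longrightarrow> norm (e n) \<le> 1"
  and orthonormal0_orth: "orthonormal0 e \<Longrightarrow> m \<noteq> n \<Longrightarrow> cinner (e m) (e n) = 0"
proof -
  assume "orthonormal0 e"
  then have "complex_of_real ((norm (e n))\<^sup>2) \<in> {0, 1}"
    unfolding cinner_self_norm[symmetric] by (auto simp: orthonormal0_def)
  then have "(norm (e n))\<^sup>2 = 0 \<or> (norm (e n))\<^sup>2 = 1"
    by (metis insertE of_real_eq_0_iff of_real_eq_1_iff singletonD)
  then show "norm (e n) \<le> 1"
    using norm_ge_zero[of "e n"] by (auto simp: power2_eq_1_iff simp del: norm_ge_zero)
next
  assume "orthonormal0 e" "m \<noteq> n"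
  then show "cinner (e m) (e n) = 0" by (simp add: orthonormal0_def)
qed

lemma orthonormal_on_bessel:
  assumes "finite I" "orthonormal_on I e"
  shows "(\<Sum>n\<in>I. (cmod (cinner f (e n)))\<^sup>2) \<le> (norm f)\<^sup>2"
proof (rule bessel[OF assms(1)])
  show "norm (e n) \<le> 1" if "n \<in> I" for n
  proof -
    have "complex_of_real ((norm (e n))\<^sup>2) = 1"
      unfolding cinner_self_norm[symmetric] using assms(2) that by (simp add: orthonormal_on_def)
    then have "(norm (e n))\<^sup>2 = 1"
      using of_real_eq_1_iff by blast
    then show ?thesis by (simp add: power2_eq_1_iff) (smt (verit) norm_ge_zero)
  qed
qed (use assms in \<open>auto simp: orthonormal_on_def\<close>)

text \<open>A block of the vector series is controlled by the same block of the scalar series of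
  squares, so the Cauchy criterion carries over and completeness yields the sum.\<close>

lemma orthonormal0_summable:
  assumes e: "orthonormal0 e" and a: "summable (\<lambda>n. (cmod (a n))\<^sup>2)"
  shows "summable (\<lambda>n. a n *\<^sub>C e n)"
proof (rule summable_Cauchy[THEN iffD2], intro allI impI)
  fix \<epsilon> :: real assume \<epsilon>: "\<epsilon> > 0"
  then have "\<epsilon>\<^sup>2 > 0" by simp
  from summable_Cauchy[THEN iffD1, OF a, rule_format, OF this]
  obtain N where N: "\<And>m n. m \<ge> N \<Longrightarrow> norm (\<Sum>k=m..<n. (cmod (a k))\<^sup>2) < \<epsilon>\<^sup>2"
    by blast
  have "norm (\<Sum>k=m..<n. a k *\<^sub>C e k) < \<epsilon>" if "m \<ge> N" for m n
  proof -
    have "(norm (\<Sum>k=m..<n. a k *\<^sub>C e k))\<^sup>2 \<le> (\<Sum>k=m..<n. (cmod (a k))\<^sup>2)"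
      using orthonormal0_norm[OF e] orthonormal0_orth[OF e] by (intro norm_sum_orthonormal) auto
    also have "\<dots> < \<epsilon>\<^sup>2"
      using N[OF that, of n] by simp
    finally show ?thesis
      using \<epsilon> by (intro power2_less_imp_less[of _ \<epsilon>]) auto
  qed
  then show "\<exists>N. \<forall>m\<ge>N. \<forall>n. norm (\<Sum>k=m..<n. a k *\<^sub>C e k) < \<epsilon>"
    by blast
qed

lemma orthonormal0_summable_coeff:
  assumes e: "orthonormal0 e"
  shows "summable (\<lambda>n. (cmod (cinner f (e n)))\<^sup>2)"
proof (rule summableI_nonneg_bounded[where x = "(norm f)\<^sup>2"])
  show "(\<Sum>i<n. (cmod (cinner f (e i)))\<^sup>2) \<le> (norm f)\<^sup>2" for n
    using orthonormal0_norm[OF e] orthonormal0_orth[OF e] by (intro bessel) auto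
qed simp

text \<open>The inner product passes through the series by continuity and only the term
  \<open>n = m\<close> survives; if \<open>e m = 0\<close>, that term and the coefficient of
  \<open>f\<close> are both zero.\<close>

lemma orthonormal0_remainder_orth:
  assumes e: "orthonormal0 e"
  shows "cinner (f - (\<Sum>n. cinner f (e n) *\<^sub>C e n)) (e m) = 0"
proof -
  have s: "summable (\<lambda>n. cinner f (e n) *\<^sub>C e n)"
    by (intro orthonormal0_summable orthonormal0_summable_coeff e)
  have "cinner (\<Sum>n. cinner f (e n) *\<^sub>C e n) (e m) = (\<Sum>n. cinner f (e n) * cinner (e n) (e m))"
    using bounded_linear.suminf[OF bounded_linear_cinner_left s, of "e m"]
    by (simp add: cinner_simps)
  also have "\<dots> = (\<Sum>n\<in>{m}. cinner f (e n) * cinner (e n) (e m))"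
    by (rule suminf_finite) (auto simp: orthonormal0_orth[OF e])
  also have "\<dots> = cinner f (e m)"
    using e by (auto simp: orthonormal0_def cinner_simps)
  finally show ?thesis by (simp add: cinner_simps)
qed

lemma basis_sums:
  assumes e: "orthonormal_basis e"
  shows "(\<lambda>n. cinner f (e n) *\<^sub>C e n) sums f"
proof -
  note e0 = orthonormal0I_basis[OF e]
  have "f - (\<Sum>n. cinner f (e n) *\<^sub>C e n) = 0"
    using e orthonormal0_remainder_orth[OF e0] unfolding orthonormal_basis_def by blast
  moreover have "summable (\<lambda>n. cinner f (e n) *\<^sub>C e n)"
    by (intro orthonormal0_summable orthonormal0_summable_coeff e0)
  ultimately show ?thesis
    by (simp add: sums_iff)
qed

lemma parseval:
  assumes e: "orthonormal_basis e"
  shows "(\<lambda>n. cinner f (e n) * cinner (e n) g) sums cinner f g"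
  using bounded_linear.sums[OF bounded_linear_cinner_left basis_sums[OF e, of f], of g]
  by (simp add: cinner_simps)

lemma cauchy_schwarz_sum:
  fixes a b :: "nat \<Rightarrow> complex"
  shows "(\<Sum>n\<in>I. cmod (a n) * cmod (b n)) \<le> sqrt (\<Sum>n\<in>I. (cmod (a n))\<^sup>2) * sqrt (\<Sum>n\<in>I. (cmod (b n))\<^sup>2)"
  using L2_set_mult_ineq[of "\<lambda>n. cmod (a n)" "\<lambda>n. cmod (b n)" I] by (simp add: L2_set_def)

section \<open>Adjoints\<close>

lemma bounded_clinear_bounded_linear: "bounded_clinear T \<Longrightarrow> bounded_linear T"
  by (simp add: bounded_clinear_def)

lemma bounded_clinear_cscale: "bounded_clinear T \<Longrightarrow> T (c *\<^sub>C f) = c *\<^sub>C T f"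
  by (simp add: bounded_clinear_def)

lemma bounded_clinear_sum_cscale:
  "bounded_clinear T \<Longrightarrow> T (\<Sum>n\<in>I. a n *\<^sub>C e n) = (\<Sum>n\<in>I. a n *\<^sub>C T (e n))"
  by (simp add: bounded_clinear_cscale linear_sum[OF bounded_linear.linear[OF bounded_clinear_bounded_linear]])

text \<open>The adjoint is written down in coordinates, with coefficients
  \<open>cinner g (T (e n))\<close>. Their square summability is a self-improving estimate: if
  \<open>S\<close> is a partial sum of the squares and \<open>h g N\<close> the corresponding
  vector, then \<open>S = cinner g (T (h g N))\<close>, which is at most
  \<open>norm g * K * sqrt S\<close>, and a factor \<open>sqrt S\<close> cancels.\<close>

lemma adjoint_exists:
  assumes T: "bounded_clinear T" and e: "orthonormal_basis e"
  shows "\<exists>T'. bounded_clinear T' \<and> (\<forall>f g. cinner (T f) g = cinner f (T' g))"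
proof -
  interpret T: bounded_linear T using T by (rule bounded_clinear_bounded_linear)
  obtain K where K: "\<And>f. norm (T f) \<le> norm f * K" "K > 0" using T.pos_bounded by blast
  note e0 = orthonormal0I_basis[OF e]
  define h where "h g N = (\<Sum>n<N. cinner g (T (e n)) *\<^sub>C e n)" for g and N :: nat
  have cinner_h: "(\<Sum>n<N. (cmod (cinner g (T (e n))))\<^sup>2) \<le> (K * norm g)\<^sup>2" for g N
  proof -
    define S where "S = (\<Sum>n<N. (cmod (cinner g (T (e n))))\<^sup>2)"
    have S0: "S \<ge> 0" by (simp add: S_def sum_nonneg)
    have "complex_of_real S = cinner g (T (h g N))"
      unfolding h_def bounded_clinear_sum_cscale[OF T]
      by (simp add: S_def cinner_simps complex_norm_square mult.commute del: of_real_power)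
    then have "S \<le> cmod (cinner g (T (h g N)))"
      using S0 by (metis abs_of_nonneg norm_of_real order_refl)
    also have "\<dots> \<le> norm g * (norm (h g N) * K)"
      by (intro order_trans[OF cmod_cinner_le] mult_left_mono K) auto
    also have "\<dots> \<le> norm g * (sqrt S * K)"
    proof -
      have "norm (h g N) \<le> sqrt S"
        unfolding h_def S_def using orthonormal0_norm[OF e0] orthonormal0_orth[OF e0]
        by (intro real_le_rsqrt norm_sum_orthonormal) auto
      then show ?thesis using K(2) by (intro mult_left_mono mult_right_mono) auto
    qed
    finally have "S \<le> (K * norm g) * sqrt S"
      by (simp add: mult_ac)
    then have "sqrt S * sqrt S \<le> (K * norm g) * sqrt S"
      using S0 by simp
    then have "sqrt S \<le> K * norm g"
      by (smt (verit) K(2) S0 mult_le_cancel_right mult_nonneg_nonneg norm_ge_zero real_sqrt_ge_zero)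
    then have "(sqrt S)\<^sup>2 \<le> (K * norm g)\<^sup>2"
      using S0 by (intro power_mono) auto
    then show ?thesis using S0 by (simp add: S_def)
  qed
  define T' where "T' g = (\<Sum>n. cinner g (T (e n)) *\<^sub>C e n)" for g
  have sm: "summable (\<lambda>n. cinner g (T (e n)) *\<^sub>C e n)" for g
    by (intro orthonormal0_summable[OF e0] summableI_nonneg_bounded[OF _ cinner_h]) simp
  have adj: "cinner (T f) g = cinner f (T' g)" for f g
  proof -
    have "(\<lambda>n. cinner (T (cinner f (e n) *\<^sub>C e n)) g) sums cinner (T f) g"
      by (intro bounded_linear.sums[OF bounded_linear_cinner_left] T.sums basis_sums e)
    then have 1: "(\<lambda>n. cinner f (e n) * cinner (T (e n)) g) sums cinner (T f) g"
      by (simp add: bounded_clinear_cscale[OF T] cinner_simps)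
    have "(\<lambda>n. cinner f (cinner g (T (e n)) *\<^sub>C e n)) sums cinner f (T' g)"
      unfolding T'_def by (intro bounded_linear.sums[OF bounded_linear_cinner_right] summable_sums sm)
    then have "(\<lambda>n. cnj (cinner g (T (e n))) * cinner f (e n)) sums cinner f (T' g)"
      by (simp add: cinner_simps)
    then have "(\<lambda>n. cinner f (e n) * cinner (T (e n)) g) sums cinner f (T' g)"
      using cinner_commute[of "T (e _)" g] by (simp add: mult.commute)
    then show ?thesis using 1 sums_unique2 by blast
  qed
  have ext: "f = g" if "\<And>h. cinner h f = cinner h g" for f g
    using that by (intro l2_eqI) (metis cinner_commute)
  have "bounded_linear T'"
  proof (rule bounded_linear_intro[where K = K])
    show "T' (x + y) = T' x + T' y" "T' (r *\<^sub>R x) = r *\<^sub>R T' x" for x y r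
      by (rule ext, simp add: cinner_simps flip: adj)+
    show "norm (T' g) \<le> norm g * K" for g
    proof -
      have "(\<lambda>N. h g N) \<longlonglongrightarrow> T' g"
        unfolding h_def T'_def by (intro summable_LIMSEQ sm)
      then have "(\<lambda>N. norm (h g N)) \<longlonglongrightarrow> norm (T' g)"
        by (rule tendsto_norm)
      moreover have "norm (h g N) \<le> norm g * K" for N
      proof (rule power2_le_imp_le)
        have "(norm (h g N))\<^sup>2 \<le> (\<Sum>n<N. (cmod (cinner g (T (e n))))\<^sup>2)"
          unfolding h_def using orthonormal0_norm[OF e0] orthonormal0_orth[OF e0]
          by (intro norm_sum_orthonormal) auto
        also note cinner_h
        finally show "(norm (h g N))\<^sup>2 \<le> (norm g * K)\<^sup>2" by (simp add: mult.commute)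
      qed (use K in auto)
      ultimately show ?thesis
        by (intro LIMSEQ_le_const2) auto
    qed
  qed
  moreover have "T' (c *\<^sub>C f) = c *\<^sub>C T' f" for c f
    by (rule ext) (simp add: cinner_simps flip: adj)
  ultimately show ?thesis
    using adj by (auto simp: bounded_clinear_def)
qed

section \<open>Existence of orthonormal bases\<close>

text \<open>Each new vector refers to all earlier ones, while primitive recursion offers only the
  predecessor; hence the recursion carries the whole list. As \<open>inverse 0 = 0\<close>, a
  dependent vector, whose remainder vanishes, is sent to 0 instead of being normalised.\<close>

primrec gs_list :: "(nat \<Rightarrow> l2) \<Rightarrow> nat \<Rightarrow> l2 list" where
  "gs_list d 0 = []"
| "gs_list d (Suc n) = gs_list d n @
    [let g = d n - (\<Sum>k<n. cinner (d n) (gs_list d n ! k) *\<^sub>C gs_list d n ! k)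
     in of_real (inverse (norm g)) *\<^sub>C g]"

definition gram_schmidt :: "(nat \<Rightarrow> l2) \<Rightarrow> nat \<Rightarrow> l2" where
  "gram_schmidt d n = gs_list d (Suc n) ! n"

lemma length_gs_list: "length (gs_list d n) = n"
  by (induction n) auto

lemma gs_list_nth: "k < n \<Longrightarrow> gs_list d n ! k = gram_schmidt d k"
proof (induction n)
  case (Suc n)
  then show ?case
    by (cases "k = n") (auto simp: gram_schmidt_def nth_append length_gs_list)
qed simp

definition gs_remainder :: "(nat \<Rightarrow> l2) \<Rightarrow> nat \<Rightarrow> l2" where
  "gs_remainder d n = d n - (\<Sum>k<n. cinner (d n) (gram_schmidt d k) *\<^sub>C gram_schmidt d k)"

lemma gram_schmidt_eq:
  "gram_schmidt d n = of_real (inverse (norm (gs_remainder d n))) *\<^sub>C gs_remainder d n"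
proof -
  have "gs_remainder d n = d n - (\<Sum>k<n. cinner (d n) (gs_list d n ! k) *\<^sub>C gs_list d n ! k)"
    unfolding gs_remainder_def by (intro arg_cong[where f = "(-) (d n)"] sum.cong) (simp_all add: gs_list_nth)
  then show ?thesis
    by (simp add: gram_schmidt_def nth_append length_gs_list Let_def)
qed

lemma gram_schmidt_self:
  "cinner (gram_schmidt d n) (gram_schmidt d n) = (if gram_schmidt d n \<noteq> 0 then 1 else 0)"
proof (cases "gs_remainder d n = 0")
  case True
  then show ?thesis by (simp add: gram_schmidt_eq cinner_simps)
next
  case False
  then have "norm (gram_schmidt d n) = 1"
    by (simp add: gram_schmidt_eq norm_cscale norm_inverse)
  then show ?thesis by (auto simp: cinner_self_norm)
qed

lemma gram_schmidt_orth_less: "m < n \<Longrightarrow> cinner (gram_schmidt d n) (gram_schmidt d m) = 0"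
proof (induction n arbitrary: m rule: less_induct)
  case (less n)
  have orth: "cinner (gram_schmidt d k) (gram_schmidt d m) = 0" if "k < n" "k \<noteq> m" for k
  proof (cases "m < k")
    case True
    then show ?thesis using less.IH[OF that(1)] by blast
  next
    case False
    then have "k < m" using that by simp
    then have "cinner (gram_schmidt d m) (gram_schmidt d k) = 0"
      using less.IH[OF less.prems] by blast
    then show ?thesis by (rule cinner_zero_commute)
  qed
  have "(\<Sum>k<n. cinner (d n) (gram_schmidt d k) * cinner (gram_schmidt d k) (gram_schmidt d m))
      = (\<Sum>k<n. if k = m then cinner (d n) (gram_schmidt d m) * cinner (gram_schmidt d m) (gram_schmidt d m) else 0)"
    by (intro sum.cong) (auto simp: orth)
  \<comment> \<open>If the \<open>m\<close>-th vector is zero, both sides are zero; otherwise it has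
    norm 1.\<close>
  also have "\<dots> = cinner (d n) (gram_schmidt d m)"
    using less.prems by (simp add: gram_schmidt_self cinner_simps)
  finally have "cinner (gs_remainder d n) (gram_schmidt d m) = 0"
    by (simp add: gs_remainder_def cinner_simps)
  then show ?case by (subst (1) gram_schmidt_eq) (simp add: cinner_simps)
qed

lemma orthonormal0_gram_schmidt: "orthonormal0 (gram_schmidt d)"
  unfolding orthonormal0_def
proof (intro allI)
  fix m n
  show "cinner (gram_schmidt d m) (gram_schmidt d n) = (if m = n \<and> gram_schmidt d n \<noteq> 0 then 1 else 0)"
    using gram_schmidt_orth_less[of m n d] gram_schmidt_orth_less[of n m d] gram_schmidt_self[of d n]
    by (cases m n rule: linorder_cases) (simp_all add: cinner_zero_commute)
qed

text \<open>Every Gram-Schmidt vector is a finite linear combination of the \<open>d k\<close>. The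
  set \<open>S\<close> will be the range of an operator, or the orthogonal complement of a
  vector.\<close>

lemma gram_schmidt_mem:
  assumes "\<And>n. d n \<in> S" "\<And>f g. f \<in> S \<Longrightarrow> g \<in> S \<Longrightarrow> f - g \<in> S" "\<And>c f. f \<in> S \<Longrightarrow> c *\<^sub>C f \<in> S"
  shows "gram_schmidt d n \<in> S"
proof (induction n rule: less_induct)
  case (less n)
  have z: "0 \<in> S" using assms(2)[OF assms(1) assms(1), of 0 0] by simp
  have "f + g \<in> S" if "f \<in> S" "g \<in> S" for f g
    using assms(2)[OF that(1) assms(2)[OF z that(2)]] by simp
  then have "(\<Sum>k\<in>I. cinner (d n) (gram_schmidt d k) *\<^sub>C gram_schmidt d k) \<in> S" if "I \<subseteq> {..<n}" for I
    using that by (induction I rule: infinite_finite_induct) (auto intro!: assms(3) less z)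
  then show ?case
    by (subst gram_schmidt_eq) (auto simp: gs_remainder_def intro!: assms)
qed

lemma orth_gram_schmidt_imp:
  assumes "\<And>n. cinner f (gram_schmidt d n) = 0"
  shows "cinner f (d n) = 0"
proof -
  have "cinner f (gs_remainder d n) = 0"
  proof (cases "gs_remainder d n = 0")
    case False
    have "cinner f (gram_schmidt d n) = of_real (inverse (norm (gs_remainder d n))) * cinner f (gs_remainder d n)"
      by (subst gram_schmidt_eq) (simp add: cinner_simps)
    with assms False show ?thesis by simp
  qed (simp add: cinner_simps)
  then show ?thesis
    by (simp add: gs_remainder_def cinner_simps assms)
qed

section \<open>A countable total family of indicator functions\<close>

lemma indicator_square_integrable:
  "square_integrable (indicator {0..q})" 
proof -
  have *: "{0..q} = {0..q} \<inter> {0..}" by auto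
  have m: "{0..q} \<in> sets halfline"
    by (auto simp: sets_restrict_space_iff)
  have "emeasure halfline {0..q} < \<infinity>"
    by (subst emeasure_restrict_space) (auto simp: emeasure_lborel_Icc_eq)
  then have "integrable halfline (indicator {0..q} :: real \<Rightarrow> real)"
    using m by simp
  moreover have "(cmod (indicator {0..q} x))\<^sup>2 = indicator {0..q} x" for x
    by (auto simp: indicator_def)
  moreover have "(indicator {0..q} :: real \<Rightarrow> complex) \<in> borel_measurable halfline"
    using m by (rule borel_measurable_indicator)
  ultimately show ?thesis
    unfolding square_integrable_def by simp
qed

text \<open>The rationals are enumerated by \<open>from_nat\<close>, possibly with repetitions;
  negative ones give the zero vector. The Gram-Schmidt procedure tolerates both.\<close>

definition test_fun :: "nat \<Rightarrow> l2" where
  "test_fun n = abs_l2 (indicator {0..real_of_rat (from_nat n)})"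

lemma sigma_finite_lebesgue: "sigma_finite_measure (lebesgue :: real measure)"
proof
  obtain A :: "real set set" where A: "countable A" "A \<subseteq> sets lborel" "\<Union>A = space lborel"
      "\<And>a. a \<in> A \<Longrightarrow> emeasure lborel a \<noteq> \<infinity>"
    using sigma_finite_measure.sigma_finite_countable[OF sigma_finite_lborel] by metis
  then show "\<exists>A::real set set. countable A \<and> A \<subseteq> sets lebesgue \<and> \<Union>A = space lebesgue \<and>
      (\<forall>a\<in>A. emeasure lebesgue a \<noteq> \<infinity>)"
    by (intro exI[of _ A]) (auto simp: subset_iff)
qed

text \<open>A pi-lambda argument: the rays \<open>{..a}\<close> form an intersection-stable
  generator of the Borel sets, and the sets on which the integral of \<open>F\<close> vanishes are
  closed under complements and disjoint unions. A Lebesgue set differs from a Borel set only by a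
  null set, and a function with vanishing integrals over all measurable sets is zero almost
  everywhere.\<close>

lemma integral_intervals_zero_imp_AE:
  fixes F :: "real \<Rightarrow> complex"
  assumes int: "integrable (lebesgue_on {0..b}) F"
    and z: "\<And>a. a \<le> b \<Longrightarrow> (LINT x|lebesgue_on {0..a}. F x) = 0"
  shows "AE x in lebesgue_on {0..b}. F x = 0"
proof -
  let ?F = "\<lambda>x. indicator {0..b} x *\<^sub>R F x"
  have intF: "integrable lebesgue ?F"
    using int by (subst (asm) integrable_restrict_space) auto
  have zA: "(LINT x|lebesgue. indicator A x *\<^sub>R ?F x) = 0" if "A \<in> sets borel" for A
  proof -
    have *: "A \<in> sigma_sets UNIV (range atMost)"
      using that by (simp add: borel_eq_atMost)
    have "Int_stable (range (atMost :: real \<Rightarrow> _))"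
      by (auto simp: Int_stable_def)
    then show ?thesis
      using subset_UNIV[of "range atMost :: real set set", folded Pow_UNIV] *
    proof (induction rule: sigma_sets_induct_disjoint)
      case (basic A)
      then obtain a where A: "A = {..a}" by auto
      have "(LINT x|lebesgue. indicator A x *\<^sub>R ?F x) = (LINT x|lebesgue. indicator {0..min a b} x *\<^sub>R F x)"
        unfolding A by (intro Bochner_Integration.integral_cong) (auto simp: indicator_def)
      also have "\<dots> = (LINT x|lebesgue_on {0..min a b}. F x)"
        by (subst integral_restrict_space) auto
      finally show ?case using z by simp
    next
      case empty
      show ?case by simp
    next
      case (compl A)
      then have A: "A \<in> sets borel" by (simp add: borel_eq_atMost)
      have "(LINT x|lebesgue. indicator (UNIV - A) x *\<^sub>R ?F x)
          = (LINT x|lebesgue. ?F x - indicator A x *\<^sub>R ?F x)"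
        by (intro Bochner_Integration.integral_cong) (auto simp: indicator_def)
      also have "\<dots> = (LINT x|lebesgue. ?F x) - (LINT x|lebesgue. indicator A x *\<^sub>R ?F x)"
        using A by (intro Bochner_Integration.integral_diff intF integrable_mult_indicator) auto
      also have "(LINT x|lebesgue. ?F x) = (LINT x|lebesgue_on {0..b}. F x)"
        by (subst integral_restrict_space) auto
      finally show ?case using z compl by simp
    next
      case (union A)
      then have A: "A i \<in> sets borel" for i by (auto simp: borel_eq_atMost)
      have "(LINT x|lebesgue. indicator (\<Union>i. A i) x *\<^sub>R ?F x) = (\<Sum>i. LINT x|lebesgue. indicator (A i) x *\<^sub>R ?F x)"
        using lebesgue_integral_countable_add[of A lebesgue ?F] A union
          set_integrable_def integrable_mult_indicator[OF _ intF]
        unfolding set_lebesgue_integral_def set_integrable_def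
        by (auto simp: disjoint_family_on_def)
      then show ?case using union by simp
    qed
  qed
  have "AE x in lebesgue. ?F x = 0"
  proof (rule sigma_finite_measure.density_zero[OF sigma_finite_lebesgue intF])
    fix A :: "real set" assume "A \<in> sets lebesgue"
    then obtain S N N' where A: "S \<in> sets borel" "N \<subseteq> N'" "N' \<in> null_sets lborel" "A = S \<union> N"
      by (rule sets_completionE) auto
    have "N \<in> null_sets lebesgue"
      using A by (meson completion.complete2 null_sets_completionI)
    then have "AE x in lebesgue. x \<notin> N" by (rule AE_not_in)
    then have "AE x in lebesgue. indicator A x *\<^sub>R ?F x = indicator S x *\<^sub>R ?F x"
      by eventually_elim (auto simp: A indicator_def)
    then have "(LINT x|lebesgue. indicator A x *\<^sub>R ?F x) = (LINT x|lebesgue. indicator S x *\<^sub>R ?F x)"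
      using A(1) \<open>A \<in> sets lebesgue\<close>
      by (intro integral_cong_AE borel_measurable_integrable integrable_mult_indicator[OF _ intF]) simp_all
    then show "set_lebesgue_integral lebesgue A ?F = 0"
      using zA[OF A(1)] by (simp add: set_lebesgue_integral_def)
  qed
  then show ?thesis
    by (subst AE_restrict_space_iff) (auto simp: indicator_def elim!: eventually_mono)
qed

lemma square_integrable_imp_integrable_Icc:
  assumes "square_integrable f"
  shows "integrable (lebesgue_on {0..b}) f"
proof -
  have "integrable halfline (\<lambda>x. f x * cnj (indicator {0..b} x))"
    by (intro square_integrable_mult assms indicator_square_integrable)
  then have "integrable lebesgue (\<lambda>x. indicator {0..} x *\<^sub>R (f x * cnj (indicator {0..b} x)))"
    by (subst (asm) integrable_restrict_space) auto
  also have "(\<lambda>x. indicator {0..} x *\<^sub>R (f x * cnj (indicator {0..b} x))) = (\<lambda>x. indicator {0..b} x *\<^sub>R f x)"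
    by (auto simp: indicator_def)
  finally show ?thesis
    by (subst integrable_restrict_space) auto
qed

lemma halfline_integral_indicator:
  fixes f :: "real \<Rightarrow> complex"
  shows "(LINT x|halfline. f x * cnj (indicator {0..b} x)) = (LINT x|lebesgue_on {0..b}. f x)"
proof -
  have "(LINT x|halfline. f x * cnj (indicator {0..b} x))
      = (LINT x|lebesgue. indicator {0..} x *\<^sub>R (f x * cnj (indicator {0..b} x)))"
    by (subst integral_restrict_space) auto
  also have "(\<lambda>x. indicator {0..} x *\<^sub>R (f x * cnj (indicator {0..b} x))) = (\<lambda>x. indicator {0..b} x *\<^sub>R f x)"
    by (auto simp: indicator_def)
  also have "(LINT x|lebesgue. indicator {0..b} x *\<^sub>R f x) = (LINT x|lebesgue_on {0..b}. f x)"
    by (subst integral_restrict_space) auto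
  finally show ?thesis .
qed

text \<open>The primitive of a representative vanishes at all rationals, hence everywhere by
  continuity; so all integrals over intervals starting at 0 vanish.\<close>

lemma test_fun_total:
  assumes "\<And>n. cinner f (test_fun n) = 0"
  shows "f = 0"
proof -
  define F where "F = rep_l2 f"
  have sq: "square_integrable F" by (simp add: F_def square_integrable_rep)
  have f: "f = abs_l2 F" by (simp add: F_def abs_rep_l2)
  have int: "integrable (lebesgue_on {0..b}) F" for b
    by (rule square_integrable_imp_integrable_Icc[OF sq])
  have rat: "(LINT x|lebesgue_on {0..real_of_rat q}. F x) = 0" for q
    using assms[of "to_nat q"] unfolding f test_fun_def
    by (simp add: cinner_abs_l2 sq indicator_square_integrable halfline_integral_indicator)
  have z: "(LINT x|lebesgue_on {0..a}. F x) = 0" for a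
  proof (cases "a \<ge> 0")
    case True
    define \<Phi> where "\<Phi> x = (LINT t|lebesgue_on {0..x}. F t)" for x
    have "continuous_on {0..a+1} \<Phi>"
    proof -
      have "\<Phi> x = integral {0..x} F" if "x \<in> {0..a+1}" for x
        unfolding \<Phi>_def by (intro lebesgue_integral_eq_integral int) auto
      moreover have "F integrable_on {0..a+1}"
        by (intro integrable_on_lebesgue_on int) auto
      then have "continuous_on {0..a+1} (\<lambda>x. integral {0..x} F)"
        by (rule indefinite_integral_continuous_1)
      ultimately show ?thesis
        using continuous_on_cong by (metis (no_types, lifting))
    qed
    then have cont: "(\<Phi> \<longlongrightarrow> \<Phi> a) (at a within {0..a+1})"
      using True by (auto simp: continuous_on_def)
    \<comment> \<open>The approximation is from the right, so that the rationals stay in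
      \<open>{0..a+1}\<close> even for \<open>a = 0\<close>.\<close>
    have "\<exists>q. real_of_rat q \<in> {a<..<a + 1 / real (Suc n)}" for n
    proof -
      have "a < a + 1 / real (Suc n)" by simp
      from Rats_dense_in_real[OF this] show ?thesis by (auto simp: Rats_def)
    qed
    then obtain q where q: "\<And>n. real_of_rat (q n) \<in> {a<..<a + 1 / real (Suc n)}"
      by metis
    have "(\<lambda>n. real_of_rat (q n)) \<longlonglongrightarrow> a"
    proof (rule tendsto_sandwich)
      show "\<forall>\<^sub>F n in sequentially. a \<le> real_of_rat (q n)" "\<forall>\<^sub>F n in sequentially. real_of_rat (q n) \<le> a + 1 / real (Suc n)"
        using q by (auto intro!: always_eventually less_imp_le)
      show "(\<lambda>n. a + 1 / real (Suc n)) \<longlonglongrightarrow> a"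
        using tendsto_add[OF tendsto_const[of a] LIMSEQ_inverse_real_of_nat] by (simp add: inverse_eq_divide)
    qed simp
    moreover have "real_of_rat (q n) \<in> {0..a+1}" "real_of_rat (q n) \<noteq> a" for n
    proof -
      have "a + 1 / real (Suc n) \<le> a + 1" by simp
      then show "real_of_rat (q n) \<in> {0..a+1}" "real_of_rat (q n) \<noteq> a"
        using q[of n] True unfolding greaterThanLessThan_iff atLeastAtMost_iff by linarith+
    qed
    ultimately have "filterlim (\<lambda>n. real_of_rat (q n)) (at a within {0..a+1}) sequentially"
      unfolding filterlim_at by auto
    from filterlim_compose[OF cont this] have "(\<lambda>n. \<Phi> (real_of_rat (q n))) \<longlonglongrightarrow> \<Phi> a" .
    then have "(\<lambda>n. 0) \<longlonglongrightarrow> \<Phi> a" unfolding \<Phi>_def rat .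
    then have "\<Phi> a = 0" by (simp add: LIMSEQ_const_iff)
    then show ?thesis by (simp add: \<Phi>_def)
  qed (auto simp: integral_restrict_space)
  have "AE x in lebesgue_on {0..real n}. F x = 0" for n
    by (intro integral_intervals_zero_imp_AE int z)
  then have "AE x in lebesgue. x \<in> {0..real n} \<longrightarrow> F x = 0" for n
    by (subst (asm) AE_restrict_space_iff) auto
  then have "AE x in lebesgue. \<forall>n. x \<in> {0..real n} \<longrightarrow> F x = 0"
    by (subst AE_all_countable) blast
  then have "AE x in halfline. F x = 0"
  proof (subst AE_restrict_space_iff)
    show "AE x in lebesgue. x \<in> {0..} \<longrightarrow> F x = 0"
      if "AE x in lebesgue. \<forall>n. x \<in> {0..real n} \<longrightarrow> F x = 0"
      using that by eventually_elim (auto intro: real_nat_ceiling_ge)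
  qed auto
  then have "abs_l2 F = abs_l2 (\<lambda>x. 0)"
    by (intro abs_l2_cong) (simp add: ae_eq_def sq)
  then show ?thesis by (simp add: f zero_l2.abs_eq)
qed

text \<open>An infinite orthonormal system, introduced to show that the space has infinite
  dimension.\<close>

definition unit_step :: "nat \<Rightarrow> l2" where
  "unit_step k = abs_l2 (indicator {real k..<real k + 1})"

lemma cinner_unit_step: "cinner (unit_step j) (unit_step k) = (if j = k then 1 else 0)"
proof -
  have m: "{real k..<real k + 1} \<in> sets halfline" for k
    by (auto simp: sets_restrict_space_iff)
  have em: "emeasure halfline {real k..<real k + 1} = 1" for k
    by (subst emeasure_restrict_space) (auto simp: emeasure_lborel_Ico)
  have int: "integrable halfline (indicator {real k..<real k + 1} :: real \<Rightarrow> real)" for k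
    using m[of k] em[of k] by simp
  have sq: "square_integrable (indicator {real k..<real k + 1})" for k
  proof -
    have "(\<lambda>x. (cmod (indicator {real k..<real k + 1} x))\<^sup>2) = indicator {real k..<real k + 1}"
      by (auto simp: indicator_def)
    then show ?thesis
      using int[of k] borel_measurable_indicator[OF m[of k]] by (simp add: square_integrable_def)
  qed
  have "cinner (unit_step j) (unit_step k)
      = (LINT x|halfline. indicator {real j..<real j + 1} x * cnj (indicator {real k..<real k + 1} x))"
    by (simp add: unit_step_def cinner_abs_l2 sq)
  also have "\<dots> = (LINT x|halfline. (if j = k then complex_of_real (indicator {real k..<real k + 1} x) else 0))"
    by (intro Bochner_Integration.integral_cong) (auto simp: indicator_def)
  also have "\<dots> = (if j = k then 1 else 0)"
  proof -
    have "{real k..<real k + 1} \<inter> {0..} = {real k..<real k + 1}" by auto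
    then show ?thesis using em[of k] by (simp add: measure_def)
  qed
  finally show ?thesis .
qed

text \<open>A dimension count by a double sum. If only the \<open>c n\<close> with
  \<open>n \<in> I\<close> were nonzero, expansion in them would turn the total squared norm of
  \<open>card I + 1\<close> unit steps into a double sum of squared coefficients. Bessel's
  inequality for the unit steps, applied to each \<open>c n\<close>, bounds this sum by
  \<open>card I\<close>.\<close>

lemma total_orthonormal0_infinite:
  assumes c: "orthonormal0 c" and total: "\<And>f. (\<And>n. cinner f (c n) = 0) \<Longrightarrow> f = 0"
  shows "infinite {n. c n \<noteq> 0}"
proof
  assume fin: "finite {n. c n \<noteq> 0}"
  define I where "I = {n. c n \<noteq> 0}"
  have I: "finite I" using fin by (simp add: I_def)
  have orth: "orthonormal_on I c"
    using c by (auto simp: orthonormal_on_def orthonormal0_def I_def)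
  have expand: "f = (\<Sum>n\<in>I. cinner f (c n) *\<^sub>C c n)" for f
  proof -
    have "f - (\<Sum>n\<in>I. cinner f (c n) *\<^sub>C c n) = 0"
    proof (rule total)
      fix m
      have "(\<Sum>n\<in>I. cinner f (c n) * cinner (c n) (c m)) = (\<Sum>n\<in>I. if n = m then cinner f (c n) else 0)"
        using c by (intro sum.cong) (auto simp: orthonormal0_def I_def)
      also have "\<dots> = cinner f (c m)"
        using I by (auto simp: I_def cinner_simps)
      finally show "cinner (f - (\<Sum>n\<in>I. cinner f (c n) *\<^sub>C c n)) (c m) = 0"
        by (simp add: cinner_simps)
    qed
    then show ?thesis by simp
  qed
  have norm_eq: "(norm f)\<^sup>2 = (\<Sum>n\<in>I. (cmod (cinner f (c n)))\<^sup>2)" for f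
  proof -
    have "complex_of_real ((norm f)\<^sup>2) = cinner f (\<Sum>n\<in>I. cinner f (c n) *\<^sub>C c n)"
      using expand[of f] cinner_self_norm[of f] by simp
    also have "\<dots> = of_real (\<Sum>n\<in>I. (cmod (cinner f (c n)))\<^sup>2)"
      by (simp add: cinner_simps complex_norm_square mult.commute del: of_real_power)
    finally show ?thesis by (simp only: of_real_eq_iff)
  qed
  \<comment> \<open>The set \<open>{..card I}\<close> has one element more than
    \<open>I\<close>.\<close>
  define K where "K = {..card I}"
  have u: "orthonormal_on K unit_step" "finite K"
    by (simp_all add: orthonormal_on_def cinner_unit_step K_def)
  have nu: "(norm (unit_step k))\<^sup>2 = 1" for k
  proof -
    have "complex_of_real ((norm (unit_step k))\<^sup>2) = 1"
      unfolding cinner_self_norm[symmetric] by (simp add: cinner_unit_step)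
    then show ?thesis using of_real_eq_1_iff by blast
  qed
  have "real (card K) = (\<Sum>k\<in>K. (norm (unit_step k))\<^sup>2)"
    by (simp add: nu)
  also have "\<dots> = (\<Sum>n\<in>I. \<Sum>k\<in>K. (cmod (cinner (unit_step k) (c n)))\<^sup>2)"
    by (subst sum.swap) (simp add: norm_eq)
  also have "\<dots> \<le> (\<Sum>n\<in>I. (norm (c n))\<^sup>2)"
  proof (intro sum_mono)
    fix n
    have "cmod (cinner (unit_step k) (c n)) = cmod (cinner (c n) (unit_step k))" for k
      by (subst cinner_commute) simp
    then show "(\<Sum>k\<in>K. (cmod (cinner (unit_step k) (c n)))\<^sup>2) \<le> (norm (c n))\<^sup>2"
      using orthonormal_on_bessel[OF u(2) u(1), of "c n"] by simp
  qed
  also have "\<dots> \<le> (\<Sum>n\<in>I. 1)"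
    using orthonormal0_norm[OF c] by (intro sum_mono power_le_one) auto
  finally show False by (simp add: K_def)
qed

text \<open>A basis is indexed by all natural numbers, so the zeros are skipped by enumerating the
  infinite set of nonzero indices. The enumeration \<open>r\<close> is returned because a caller may
  have to know from which \<open>c k\<close> a basis vector stems.\<close>

lemma orthonormal_basis_of_total:
  assumes c: "orthonormal0 c" and total: "\<And>f. (\<And>n. cinner f (c n) = 0) \<Longrightarrow> f = 0"
  obtains r where "strict_mono r" "orthonormal_basis (\<lambda>n. c (r n))"
proof
  let ?I = "{n. c n \<noteq> 0}"
  have inf: "infinite ?I" by (rule total_orthonormal0_infinite[OF assms])
  show sm: "strict_mono (enumerate ?I)"
    using inf by (rule strict_mono_enumerate)
  have nz: "c (enumerate ?I n) \<noteq> 0" for n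
    using enumerate_in_set[OF inf, of n] by blast
  show "orthonormal_basis (\<lambda>n. c (enumerate ?I n))"
    unfolding orthonormal_basis_def
  proof (intro conjI allI impI)
    fix m n
    show "cinner (c (enumerate ?I m)) (c (enumerate ?I n)) = (if m = n then 1 else 0)"
      using c nz strict_mono_eq[OF sm, of m n] unfolding orthonormal0_def by metis
  next
    fix f assume f: "\<forall>n. cinner f (c (enumerate ?I n)) = 0"
    show "f = 0"
    proof (rule total)
      fix n
      show "cinner f (c n) = 0"
      proof (cases "c n = 0")
        case False
        then obtain m where "enumerate ?I m = n" using enumerate_Ex[of ?I n] inf by auto
        then show ?thesis using f by auto
      qed (simp add: cinner_simps)
    qed
  qed
qed

lemma orthonormal_basis_exists: "\<exists>e. orthonormal_basis e"
proof -
  have "f = 0" if "\<And>n. cinner f (gram_schmidt test_fun n) = 0" for f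
    by (rule test_fun_total, rule orth_gram_schmidt_imp, rule that)
  from orthonormal_basis_of_total[OF orthonormal0_gram_schmidt this] show ?thesis
    by metis
qed

text \<open>The description in \<open>op_trace\<close> quantifies over all bases, so its uniqueness
  rests on the existence of one.\<close>

lemma op_trace_eqI:
  assumes "\<And>e. orthonormal_basis e \<Longrightarrow> (\<lambda>n. cinner (T (e n)) (e n)) sums t"
  shows "op_trace T = t"
  unfolding op_trace_def
proof (rule the_equality)
  fix t' assume "\<forall>e. orthonormal_basis e \<longrightarrow> (\<lambda>n. cinner (T (e n)) (e n)) sums t'"
  moreover obtain e where "orthonormal_basis e" using orthonormal_basis_exists by blast
  ultimately show "t' = t" using assms sums_unique2 by blast
qed (use assms in blast)

section \<open>The absolute value of an operator\<close>

text \<open>Coefficients of the binomial series of \<open>sqrt (1 - x)\<close>.\<close>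

definition sqrt_coeff :: "nat \<Rightarrow> real" where
  "sqrt_coeff n = (1/2 gchoose n) * (-1) ^ n"

lemma sqrt_coeff_0: "sqrt_coeff 0 = 1"
  by (simp add: sqrt_coeff_def)

text \<open>Both signs come from \<open>(-1) ^ m * (-1/2 gchoose m) \<ge> 0\<close>. The alternating
  partial sums for the exponent \<open>1/2\<close> equal exactly this expression, and absorption
  writes the coefficient with index \<open>n + 1\<close> as a negative multiple of it.\<close>

lemma sqrt_coeff_neg: "sqrt_coeff (Suc n) \<le> 0"
  and sqrt_coeff_partial_sum: "(\<Sum>k\<le>n. sqrt_coeff k) \<ge> 0"
proof -
  have pos: "(-1) ^ m * ((-1/2 :: real) gchoose m) \<ge> 0" for m
  proof -
    have "(-1/2 :: real) gchoose m = (-1) ^ m * (of_nat m - (-1/2) - 1 gchoose m)"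
      by (rule gbinomial_negated_upper)
    moreover have "(of_nat m - (-1/2) - 1 :: real) gchoose m \<ge> 0"
      unfolding gbinomial_prod_rev by (intro divide_nonneg_nonneg prod_nonneg) auto
    ultimately show ?thesis by (simp add: mult.assoc[symmetric] power_mult_distrib[symmetric])
  qed
  show "(\<Sum>k\<le>n. sqrt_coeff k) \<ge> 0"
    using gbinomial_sum_lower_neg[of "1/2::real" n] pos[of n] by (simp add: sqrt_coeff_def)
  have "(1/2::real) gchoose Suc n = ((1/2) / of_nat (Suc n)) * ((1/2 - 1) gchoose n)"
    using gbinomial_absorption'[of "Suc n" "1/2::real"] by simp
  then have "sqrt_coeff (Suc n) = - ((1/2) / of_nat (Suc n) * ((-1) ^ n * ((-1/2) gchoose n)))"
    by (simp add: sqrt_coeff_def)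
  then show "sqrt_coeff (Suc n) \<le> 0"
    using pos[of n] by (simp add: divide_nonneg_nonneg)
qed

text \<open>The leading coefficient is 1, all others are nonpositive, and the partial sums never
  become negative; so the others cannot outweigh 1 in absolute value. The bound 1 is what makes the
  square root below a nonnegative operator.\<close>

lemma summable_sqrt_coeff: "summable (\<lambda>n. \<bar>sqrt_coeff (Suc n)\<bar>)"
  and suminf_sqrt_coeff_le: "(\<Sum>n. \<bar>sqrt_coeff (Suc n)\<bar>) \<le> 1"
proof -
  have b: "(\<Sum>k<n. \<bar>sqrt_coeff (Suc k)\<bar>) \<le> 1" for n
  proof -
    have "(\<Sum>k<n. \<bar>sqrt_coeff (Suc k)\<bar>) = - (\<Sum>k<n. sqrt_coeff (Suc k))"
      using sqrt_coeff_neg by (simp add: abs_of_nonpos sum_negf)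
    also have "(\<Sum>k<n. sqrt_coeff (Suc k)) = (\<Sum>k\<le>n. sqrt_coeff k) - 1"
      by (simp add: lessThan_Suc_atMost[symmetric] sum.lessThan_Suc_shift sqrt_coeff_0 del: sum.lessThan_Suc)
    finally show ?thesis using sqrt_coeff_partial_sum[of n] by simp
  qed
  show s: "summable (\<lambda>n. \<bar>sqrt_coeff (Suc n)\<bar>)"
    by (rule summableI_nonneg_bounded[OF _ b]) simp
  show "(\<Sum>n. \<bar>sqrt_coeff (Suc n)\<bar>) \<le> 1"
    by (rule suminf_le_const[OF s b])
qed

text \<open>The square of the series of \<open>sqrt (1 - x)\<close> is \<open>1 - x\<close>,
  coefficient by coefficient; this is Vandermonde's identity for
  \<open>1/2 + 1/2 = 1\<close>.\<close>

lemma sqrt_coeff_convolution: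
  "(\<Sum>k\<le>n. sqrt_coeff k * sqrt_coeff (n - k)) = (if n = 0 then 1 else if n = 1 then -1 else 0)"
proof -
  have "(\<Sum>k\<le>n. sqrt_coeff k * sqrt_coeff (n - k))
      = (-1)^n * (\<Sum>k=0..n. ((1/2::real) gchoose k) * ((1/2) gchoose (n - k)))"
    unfolding sum_distrib_left atMost_atLeast0
  proof (intro sum.cong refl)
    fix k assume "k \<in> {0..n}"
    then have "(-1::real) ^ n = (-1) ^ k * (-1) ^ (n - k)"
      by (simp flip: power_add)
    then show "sqrt_coeff k * sqrt_coeff (n - k) = (-1)^n * (((1/2) gchoose k) * ((1/2) gchoose (n - k)))"
      by (simp add: sqrt_coeff_def mult_ac)
  qed
  also have "\<dots> = (-1)^n * ((1/2 + 1/2 :: real) gchoose n)"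
    by (simp only: gbinomial_Vandermonde)
  also have "(1/2 + 1/2 :: real) gchoose n = of_nat (1 choose n)"
    by (simp add: binomial_gbinomial)
  also have "(-1)^n * real (1 choose n) = (if n = 0 then 1 else if n = 1 then -1 else 0)"
    by (auto simp: binomial_eq_0_iff)
  finally show ?thesis .
qed

text \<open>\<open>P\<close> is the binomial series of \<open>sqrt (1 - A)\<close>, absolutely
  convergent because the powers of a contraction are contractions. In the quadratic form the term of
  index 0 contributes the squared norm of \<open>f\<close>, and the remaining terms can take away at
  most as much. The identity for \<open>P (P f)\<close> is the Cauchy product of the series with
  itself.\<close>

lemma positive_contraction_sqrt:
  assumes A: "bounded_clinear A" and sa: "\<And>f g. cinner (A f) g = cinner f (A g)"
    and contr: "\<And>f. norm (A f) \<le> norm f"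
  shows "\<exists>P. bounded_clinear P \<and> (\<forall>f g. cinner (P f) g = cinner f (P g)) \<and>
    (\<forall>f. Re (cinner (P f) f) \<ge> 0) \<and> (\<forall>f. P (P f) = f - A f)"
proof -
  define a where "a = sqrt_coeff"
  have Apow_add: "(A ^^ n) (f + g) = (A ^^ n) f + (A ^^ n) g" for n f g
    by (induction n) (simp_all add: linear_add[OF bounded_linear.linear[OF bounded_clinear_bounded_linear[OF A]]])
  have Apow_c: "(A ^^ n) (c *\<^sub>C f) = c *\<^sub>C (A ^^ n) f" for n c f
    by (induction n) (simp_all add: bounded_clinear_cscale[OF A])
  have Apow_norm: "norm ((A ^^ n) f) \<le> norm f" for n f
    by (induction n) (auto intro: order_trans[OF contr])
  have Apow_sa: "cinner ((A ^^ n) f) g = cinner f ((A ^^ n) g)" for n f g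
    by (induction n arbitrary: f g) (simp_all add: sa funpow_swap1)
  have sum_a: "summable (\<lambda>n. \<bar>a n\<bar>)"
    using summable_sqrt_coeff summable_Suc_iff[of "\<lambda>n. \<bar>a n\<bar>"] by (simp add: a_def)
  have sm: "summable (\<lambda>n. norm (a n *\<^sub>R (A ^^ n) f))" for f
  proof (rule summable_comparison_test')
    show "summable (\<lambda>n. \<bar>a n\<bar> * norm f)" using sum_a by (rule summable_mult2)
    show "norm (norm (a n *\<^sub>R (A ^^ n) f)) \<le> \<bar>a n\<bar> * norm f" for n
      using Apow_norm by (simp add: mult_left_mono)
  qed
  define P where "P f = (\<Sum>n. a n *\<^sub>R (A ^^ n) f)" for f
  have Ps: "(\<lambda>n. a n *\<^sub>R (A ^^ n) f) sums P f" for f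
    unfolding P_def by (intro summable_sums summable_norm_cancel[OF sm])
  have Pc: "(\<lambda>n. of_real (a n) * cinner ((A ^^ n) f) g) sums cinner (P f) g" for f g
    using bounded_linear.sums[OF bounded_linear_cinner_left Ps, of f g] by (simp add: cinner_simps)
  have Pc': "(\<lambda>n. of_real (a n) * cinner ((A ^^ n) f) g) sums cinner f (P g)" for f g
    using bounded_linear.sums[OF bounded_linear_cinner_right Ps, of f g]
    by (simp add: cinner_simps Apow_sa)
  have Psa: "cinner (P f) g = cinner f (P g)" for f g
    using Pc Pc' sums_unique2 by blast
  have Padd: "P (f + g) = P f + P g" for f g
    using sums_add[OF Ps[of f] Ps[of g]] Ps[of "f + g"] sums_unique2
    by (force simp: Apow_add scaleR_add_right)
  have Pscale: "P (c *\<^sub>C f) = c *\<^sub>C P f" for c f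
  proof -
    have "a n *\<^sub>R (A ^^ n) (c *\<^sub>C f) = c *\<^sub>C (a n *\<^sub>R (A ^^ n) f)" for n
      by (simp add: Apow_c scaleR_l2_def mult.commute)
    then have "(\<lambda>n. c *\<^sub>C (a n *\<^sub>R (A ^^ n) f)) sums P (c *\<^sub>C f)"
      using Ps[of "c *\<^sub>C f"] by simp
    then show ?thesis
      using bounded_linear.sums[OF bounded_linear_cscale Ps, of c f] sums_unique2 by blast
  qed
  have Pnorm: "norm (P f) \<le> norm f * (\<Sum>n. \<bar>a n\<bar>)" for f
  proof -
    have "norm (P f) \<le> (\<Sum>n. norm (a n *\<^sub>R (A ^^ n) f))"
      unfolding P_def by (rule summable_norm[OF sm])
    also have "\<dots> \<le> (\<Sum>n. \<bar>a n\<bar> * norm f)"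
      using Apow_norm by (intro suminf_le sm summable_mult2 sum_a) (simp add: mult_left_mono)
    finally show ?thesis using suminf_mult2[OF sum_a, of "norm f"] by (simp add: mult.commute)
  qed
  have bP: "bounded_clinear P"
    unfolding bounded_clinear_def
  proof (intro conjI allI bounded_linear_intro[where K = "\<Sum>n. \<bar>a n\<bar>"])
    show "P (r *\<^sub>R f) = r *\<^sub>R P f" for r f by (simp add: scaleR_l2_def Pscale)
  qed (simp_all add: Padd Pscale Pnorm)
  have pos: "Re (cinner (P f) f) \<ge> 0" for f
  proof -
    define t where "t n = Re (cinner ((A ^^ n) f) f)" for n
    have t: "\<bar>t n\<bar> \<le> (norm f)\<^sup>2" for n
    proof -
      have "\<bar>t n\<bar> \<le> norm ((A ^^ n) f) * norm f"
        unfolding t_def by (rule order_trans[OF abs_Re_le_cmod cmod_cinner_le])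
      also have "\<dots> \<le> norm f * norm f" by (intro mult_right_mono Apow_norm) auto
      finally show ?thesis by (simp add: power2_eq_square)
    qed
    have "(\<lambda>n. a n * t n) sums Re (cinner (P f) f)"
      using bounded_linear.sums[OF bounded_linear_Re Pc, of f f] by (simp add: t_def)
    then have "(\<lambda>n. a (Suc n) * t (Suc n)) sums (Re (cinner (P f) f) - a 0 * t 0)"
      using sums_Suc_iff[of "\<lambda>n. a n * t n" "Re (cinner (P f) f) - a 0 * t 0"] by simp
    then have 1: "(\<lambda>n. a (Suc n) * t (Suc n)) sums (Re (cinner (P f) f) - (norm f)\<^sup>2)"
      by (simp add: t_def a_def sqrt_coeff_0 cinner_self_norm)
    have 2: "(\<lambda>n. - \<bar>a (Suc n)\<bar> * (norm f)\<^sup>2) sums (- (\<Sum>n. \<bar>a (Suc n)\<bar>) * (norm f)\<^sup>2)"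
      using summable_sqrt_coeff unfolding a_def by (intro sums_mult2 sums_minus summable_sums)
    have "- \<bar>a (Suc n)\<bar> * (norm f)\<^sup>2 \<le> a (Suc n) * t (Suc n)" for n
      using mult_left_mono[OF t[of "Suc n"], of "\<bar>a (Suc n)\<bar>"]
      by (simp add: abs_mult[symmetric] abs_le_iff)
    from sums_le[OF this 2 1] have "- (\<Sum>n. \<bar>a (Suc n)\<bar>) * (norm f)\<^sup>2 \<le> Re (cinner (P f) f) - (norm f)\<^sup>2" .
    moreover have "(\<Sum>n. \<bar>a (Suc n)\<bar>) * (norm f)\<^sup>2 \<le> 1 * (norm f)\<^sup>2"
      using suminf_sqrt_coeff_le unfolding a_def by (intro mult_right_mono) auto
    ultimately show ?thesis by simp
  qed
  have PP: "P (P f) = f - A f" for f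
  proof (rule l2_eqI)
    fix g
    define c where "c n = cinner ((A ^^ n) f) g" for n
    have cb: "cmod (c n) \<le> norm f * norm g" for n
      unfolding c_def by (rule order_trans[OF cmod_cinner_le]) (intro mult_right_mono Apow_norm norm_ge_zero)
    \<comment> \<open>The double series for \<open>cinner (P f) (P g)\<close>. Summed by rows it
      gives this inner product; summed along the diagonals \<open>i + j = n\<close> it retains only
      \<open>n = 0\<close> and \<open>n = 1\<close>.\<close>
    define h where "h = (\<lambda>(i, j). complex_of_real (a i * a j) * c (i + j))"
    have abs_a: "Infinite_Sum.abs_summable_on (\<lambda>n. \<bar>a n\<bar>) UNIV"
      using sum_a by (simp add: summable_on_UNIV_nonneg_real_iff)
    have prod_sum: "Infinite_Sum.abs_summable_on (\<lambda>(i, j). a i * a j * (norm f * norm g)) (UNIV \<times> UNIV)"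
      unfolding Infinite_Sum.abs_summable_on_Sigma_iff
    proof (intro conjI ballI)
      show "Infinite_Sum.abs_summable_on (\<lambda>j. case (i, j) of (i, j) \<Rightarrow> a i * a j * (norm f * norm g)) UNIV" for i
        using summable_on_cmult_right[OF abs_a, of "\<bar>a i\<bar> * (norm f * norm g)"]
        by (simp add: abs_mult mult_ac)
      have "(\<Sum>\<^sub>\<infinity>j. norm (case (i, j) of (i, j) \<Rightarrow> a i * a j * (norm f * norm g)))
          = \<bar>a i\<bar> * ((norm f * norm g) * (\<Sum>\<^sub>\<infinity>j. \<bar>a j\<bar>))" for i
        using infsum_cmult_right'[of "\<bar>a i\<bar> * (norm f * norm g)" "\<lambda>j. \<bar>a j\<bar>" UNIV]
        by (simp add: abs_mult mult_ac)
      then show "Infinite_Sum.abs_summable_on (\<lambda>i. \<Sum>\<^sub>\<infinity>j. norm (case (i, j) of (i, j) \<Rightarrow> a i * a j * (norm f * norm g))) UNIV"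
        using summable_on_cmult_left[OF abs_a, of "(norm f * norm g) * (\<Sum>\<^sub>\<infinity>j. \<bar>a j\<bar>)"]
        by (simp add: abs_mult infsum_nonneg)
    qed
    have "Infinite_Sum.abs_summable_on h (UNIV \<times> UNIV)"
      by (rule Infinite_Sum.abs_summable_on_comparison_test[OF prod_sum])
         (auto simp: h_def norm_mult abs_mult intro!: mult_left_mono cb)
    then have "h summable_on UNIV \<times> UNIV"
      by (rule Infinite_Sum.abs_summable_summable)
    then obtain S where S: "(h has_sum S) (UNIV \<times> UNIV)"
      by (auto simp: summable_on_def)
    have "((\<lambda>i. of_real (a i) * cinner ((A ^^ i) f) (P g)) has_sum S) UNIV"
    proof (rule has_sum_SigmaD[OF S])
      fix i
      have "(\<lambda>j. of_real (a i) * (of_real (a j) * cinner ((A ^^ j) ((A ^^ i) f)) g)) sums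
          (of_real (a i) * cinner ((A ^^ i) f) (P g))"
        unfolding Psa[symmetric] by (intro sums_mult Pc)
      then have "(\<lambda>j. h (i, j)) sums (of_real (a i) * cinner ((A ^^ i) f) (P g))"
        by (simp add: h_def c_def funpow_add[unfolded o_def, THEN fun_cong, symmetric] mult.assoc add.commute)
      moreover have "summable (\<lambda>j. norm (h (i, j)))"
      proof (rule summable_comparison_test')
        show "summable (\<lambda>j. \<bar>a j\<bar> * (\<bar>a i\<bar> * (norm f * norm g)))"
          by (intro summable_mult2 sum_a)
        show "norm (norm (h (i, j))) \<le> \<bar>a j\<bar> * (\<bar>a i\<bar> * (norm f * norm g))" for j
          using mult_left_mono[OF cb[of "i + j"], of "\<bar>a j\<bar> * \<bar>a i\<bar>"]
          by (simp add: h_def norm_mult abs_mult mult_ac)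
      qed
      ultimately show "((\<lambda>j. h (i, j)) has_sum of_real (a i) * cinner ((A ^^ i) f) (P g)) UNIV"
        by (intro norm_summable_imp_has_sum)
    qed
    then have S1: "S = cinner (P f) (P g)"
      using Pc[of f "P g"] has_sum_imp_sums sums_unique2 by blast
    \<comment> \<open>The pair \<open>(n, k)\<close> with \<open>k \<le> n\<close> stands for the
      index pair \<open>(k, n - k)\<close> on the \<open>n\<close>-th diagonal.\<close>
    have bij: "bij_betw (\<lambda>(n, k). (k, n - k)) (Sigma UNIV (\<lambda>n::nat. {..n})) (UNIV \<times> UNIV)"
      by (rule bij_betwI[where g = "\<lambda>(i, j). (i + j, i)"]) auto
    have "((\<lambda>x. h (case x of (n, k) \<Rightarrow> (k, n - k))) has_sum S) (Sigma UNIV (\<lambda>n::nat. {..n}))"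
      using has_sum_reindex_bij_betw[OF bij, of h S] S by simp
    then have "((\<lambda>n. of_real (if n = 0 then 1 else if n = 1 then -1 else 0) * c n) has_sum S) UNIV"
    proof (rule has_sum_SigmaD)
      fix n
      have "(\<Sum>k\<le>n. h (k, n - k)) = of_real (\<Sum>k\<le>n. sqrt_coeff k * sqrt_coeff (n - k)) * c n"
        by (simp add: h_def a_def sum_distrib_right)
      then show "((\<lambda>k. h (case (n, k) of (n, k) \<Rightarrow> (k, n - k))) has_sum
          of_real (if n = 0 then 1 else if n = 1 then -1 else 0) * c n) {..n}"
        by (intro has_sum_finiteI) (simp_all add: sqrt_coeff_convolution)
    qed
    then have "(\<lambda>n. of_real (if n = 0 then 1 else if n = 1 then -1 else 0) * c n) sums S"
      by (rule has_sum_imp_sums)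
    moreover have "(\<lambda>n. of_real (if n = 0 then 1 else if n = 1 then -1 else 0) * c n) sums
        (\<Sum>n\<in>{0, 1}. of_real (if n = 0 then 1 else if n = 1 then -1 else 0) * c n)"
      by (intro sums_finite) auto
    ultimately have "S = c 0 - c 1"
      using sums_unique2 by fastforce
    then show "cinner (P (P f)) g = cinner (f - A f) g"
      using S1 Psa by (simp add: c_def cinner_simps)
  qed
  show ?thesis using bP Psa pos PP by blast
qed

text \<open>With \<open>S\<close> the adjoint of \<open>T\<close> composed with \<open>T\<close>,
  the operator \<open>A = 1 - S / K\<^sup>2\<close> is a contraction: in the squared norm of
  \<open>A f\<close> the mixed term removes \<open>2 * r * (norm (T f))\<^sup>2\<close>, and the
  quadratic term returns at most half of that because
  \<open>norm (S f) \<le> K * norm (T f)\<close>. So \<open>S\<close> is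
  \<open>K\<^sup>2 * (1 - A)\<close>, with square root \<open>K * sqrt (1 - A)\<close>.\<close>

lemma abs_op_exists:
  assumes T: "bounded_clinear T"
  shows "\<exists>P. is_abs_op T P \<and> (\<forall>f g. cinner (P f) g = cinner f (P g))"
proof -
  obtain e where e: "orthonormal_basis e" using orthonormal_basis_exists by blast
  obtain T' where T': "bounded_clinear T'" "\<And>f g. cinner (T f) g = cinner f (T' g)"
    using adjoint_exists[OF T e] by blast
  obtain K where K: "K > 0" "\<And>f. norm (T f) \<le> norm f * K"
    using bounded_linear.pos_bounded[OF bounded_clinear_bounded_linear[OF T]] by blast
  define S where "S f = T' (T f)" for f
  have bS: "bounded_linear S"
    unfolding S_def by (intro bounded_linear_compose[OF bounded_clinear_bounded_linear[OF T'(1)]]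
        bounded_clinear_bounded_linear[OF T])
  have cS: "S (c *\<^sub>C f) = c *\<^sub>C S f" for c f
    by (simp add: S_def bounded_clinear_cscale[OF T] bounded_clinear_cscale[OF T'(1)])
  have S: "cinner (S f) g = cinner (T f) (T g)" for f g
    unfolding S_def by (metis T'(2) cinner_commute)
  have S': "cinner f (S g) = cinner (T f) (T g)" for f g
    by (simp add: S_def flip: T'(2))
  have normS: "norm (S f) \<le> K * norm (T f)" for f
  proof -
    have "(norm (S f))\<^sup>2 = Re (cinner (S f) (S f))"
      by (simp add: cinner_self_norm)
    also have "\<dots> \<le> cmod (cinner (T f) (T (S f)))"
      unfolding S by (rule complex_Re_le_cmod)
    also have "\<dots> \<le> norm (T f) * (norm (S f) * K)"
      by (intro order_trans[OF cmod_cinner_le] mult_left_mono K) auto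
    finally have "norm (S f) * norm (S f) \<le> (K * norm (T f)) * norm (S f)"
      by (simp add: power2_eq_square mult_ac)
    then show ?thesis
      using K(1) by (cases "norm (S f) = 0") (auto simp: mult_le_cancel_right simp del: norm_eq_zero)
  qed
  define r where "r = 1 / K\<^sup>2"
  have r: "r > 0" using K by (simp add: r_def)
  define A where "A f = f - r *\<^sub>R S f" for f
  have bA: "bounded_clinear A"
    unfolding bounded_clinear_def
  proof (intro conjI allI)
    show "bounded_linear A"
      unfolding A_def by (intro bounded_linear_sub bounded_linear_ident
          bounded_linear_compose[OF bounded_linear_scaleR_right bS])
    show "A (c *\<^sub>C f) = c *\<^sub>C A f" for c f
      by (simp add: A_def cS cscale.scale_right_diff_distrib scaleR_l2_def mult.commute)
  qed
  have saA: "cinner (A f) g = cinner f (A g)" for f g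
    by (simp add: A_def cinner_simps S S')
  have contr: "norm (A f) \<le> norm f" for f
  proof (rule power2_le_imp_le)
    have "(norm (A f))\<^sup>2 = (norm f)\<^sup>2 - 2 * r * inner f (S f) + r\<^sup>2 * (norm (S f))\<^sup>2"
      unfolding A_def power2_norm_eq_inner
      by (simp add: inner_diff inner_commute power2_eq_square algebra_simps)
    also have "inner f (S f) = (norm (T f))\<^sup>2"
      by (simp add: inner_l2_def S' cinner_self_norm)
    also have "r\<^sup>2 * (norm (S f))\<^sup>2 \<le> r\<^sup>2 * (K * norm (T f))\<^sup>2"
      by (intro mult_left_mono power_mono normS) auto
    also have "\<dots> = r * (norm (T f))\<^sup>2"
      using K by (simp add: r_def power2_eq_square field_simps)
    finally have "(norm (A f))\<^sup>2 \<le> (norm f)\<^sup>2 - r * (norm (T f))\<^sup>2" by simp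
    also have "\<dots> \<le> (norm f)\<^sup>2" using r by simp
    finally show "(norm (A f))\<^sup>2 \<le> (norm f)\<^sup>2" .
  qed simp
  obtain Q where Q: "bounded_clinear Q" "\<And>f g. cinner (Q f) g = cinner f (Q g)"
      "\<And>f. Re (cinner (Q f) f) \<ge> 0" "\<And>f. Q (Q f) = f - A f"
    using positive_contraction_sqrt[OF bA saA contr] by blast
  define P where "P f = K *\<^sub>R Q f" for f
  have bP: "bounded_clinear P"
    unfolding bounded_clinear_def
  proof (intro conjI allI)
    show "bounded_linear P"
      unfolding P_def
      by (rule bounded_linear_compose[OF bounded_linear_scaleR_right bounded_clinear_bounded_linear[OF Q(1)]])
    show "P (c *\<^sub>C f) = c *\<^sub>C P f" for c f
      by (simp add: P_def bounded_clinear_cscale[OF Q(1)] scaleR_l2_def mult.commute)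
  qed
  have saP: "cinner (P f) g = cinner f (P g)" for f g
    by (simp add: P_def cinner_simps Q(2))
  have PP: "cinner (P (P f)) g = cinner (T f) (T g)" for f g
  proof -
    have "P (P f) = K *\<^sub>R K *\<^sub>R Q (Q f)"
      unfolding P_def
      by (simp add: linear_scale[OF bounded_linear.linear[OF bounded_clinear_bounded_linear[OF Q(1)]]])
    then have "cinner (P (P f)) g = of_real K * of_real K * cinner (Q (Q f)) g"
      by (simp add: cinner_simps)
    also have "\<dots> = cinner (S f) g"
      using K by (simp add: Q(4) A_def cinner_simps r_def power2_eq_square)
    finally show ?thesis by (simp add: S)
  qed
  have pos: "cinner (P f) f \<in> \<real>\<^sub>\<ge>\<^sub>0" for f
  proof -
    have "Im (cinner (P f) f) = 0"
      using saP[of f f] cinner_commute[of "P f" f] by (metis complex_cnj_cancel_iff Reals_cnj_iff complex_is_Real_iff)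
    moreover have "Re (cinner (P f) f) \<ge> 0"
      using Q(3)[of f] K by (simp add: P_def cinner_simps)
    ultimately show ?thesis by (simp add: complex_nonneg_Reals_iff)
  qed
  show ?thesis
    using bP saP PP pos by (intro exI[of _ P]) (simp add: is_abs_op_def)
qed

section \<open>A criterion for trace class\<close>

text \<open>For an orthonormal basis inside \<open>ran P \<union> ker P\<close>, \<open>P = |T|\<close>, the vectors \<open>T g\<close> with
  \<open>e = P g\<close> are orthonormal and \<open>\<langle>P e, e\<rangle> = \<langle>T e, T g\<rangle>\<close>. This replaces the polar decomposition.\<close>

lemma trace_classI:
  assumes T: "bounded_clinear T"
    and M: "\<And>I e f. finite I \<Longrightarrow> orthonormal_on I e \<Longrightarrow> orthonormal_on I f \<Longrightarrow>
      (\<Sum>n\<in>I. cmod (cinner (T (e n)) (f n))) \<le> M"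
  shows "trace_class T"
proof -
  obtain P where P: "is_abs_op T P" and saP: "\<And>f g. cinner (P f) g = cinner f (P g)"
    using abs_op_exists[OF T] by blast
  have cP: "bounded_clinear P" and pos: "\<And>f. cinner (P f) f \<in> \<real>\<^sub>\<ge>\<^sub>0"
    and PP: "\<And>f g. cinner (P f) (P g) = cinner (T f) (T g)"
    using P saP unfolding is_abs_op_def by metis+
  have linP: "linear P"
    using cP by (simp add: bounded_clinear_def bounded_linear.linear)
  \<comment> \<open>An orthonormal system inside the range of \<open>P\<close>, spanning the images
    of the test functions.\<close>
  define d where "d = gram_schmidt (\<lambda>n. P (test_fun n))"
  have d0: "orthonormal0 d" unfolding d_def by (rule orthonormal0_gram_schmidt)
  have "d n \<in> range P" for n
    unfolding d_def
  proof (rule gram_schmidt_mem)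
    show "f - g \<in> range P" if "f \<in> range P" "g \<in> range P" for f g
      using that by (auto simp flip: linear_diff[OF linP])
    show "c *\<^sub>C f \<in> range P" if "f \<in> range P" for c f
      using that by (auto simp flip: bounded_clinear_cscale[OF cP])
  qed auto
  then have "\<forall>n. \<exists>g. d n = P g" by (auto simp: image_iff)
  then obtain g where g: "\<And>n. d n = P (g n)" by (auto dest: choice)
  \<comment> \<open>The parts of the test functions orthogonal to all \<open>d k\<close>.
    Orthonormalised, they give vectors \<open>d'\<close> orthogonal to the images of the test
    functions under \<open>P\<close>, hence in the kernel of the self-adjoint
    \<open>P\<close>.\<close>
  define q where "q n = test_fun n - (\<Sum>k. cinner (test_fun n) (d k) *\<^sub>C d k)" for n
  define d' where "d' = gram_schmidt q"
  have d'0: "orthonormal0 d'" unfolding d'_def by (rule orthonormal0_gram_schmidt)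
  have q_orth: "cinner (q n) (d m) = 0" for n m
    unfolding q_def by (rule orthonormal0_remainder_orth[OF d0])
  have d'_orth: "cinner (d' n) (d m) = 0" for n m
  proof -
    have "d' n \<in> {f. cinner f (d m) = 0}"
      unfolding d'_def using q_orth by (intro gram_schmidt_mem) (auto simp: cinner_simps)
    then show ?thesis by simp
  qed
  have Pd': "P (d' n) = 0" for n
  proof (rule test_fun_total)
    fix k
    have "cinner (d' n) (P (test_fun k)) = 0"
      using d'_orth orth_gram_schmidt_imp[of "d' n" "\<lambda>n. P (test_fun n)" k] unfolding d_def by blast
    then show "cinner (P (d' n)) (test_fun k) = 0" by (simp add: saP)
  qed
  \<comment> \<open>Even indices carry the vectors from the range of \<open>P\<close>, odd indices
    those from its kernel, so the parity of \<open>r n\<close> later tells which kind a basis vector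
    is.\<close>
  define c where "c n = (if even n then d (n div 2) else d' (n div 2))" for n
  have c0: "orthonormal0 c"
    unfolding orthonormal0_def
  proof (intro allI)
    fix m n :: nat
    have mn: "m = n \<longleftrightarrow> m div 2 = n div 2" if "even m \<longleftrightarrow> even n"
      using that by presburger
    show "cinner (c m) (c n) = (if m = n \<and> c n \<noteq> 0 then 1 else 0)"
    proof (cases "even m"; cases "even n")
      assume "even m" "even n"
      then show ?thesis
        using mn d0[unfolded orthonormal0_def, rule_format, of "m div 2" "n div 2"] by (simp add: c_def)
    next
      assume "odd m" "odd n"
      then show ?thesis
        using mn d'0[unfolded orthonormal0_def, rule_format, of "m div 2" "n div 2"] by (simp add: c_def)
    next
      assume mn: "odd m" "even n"
      then have "m \<noteq> n" by blast
      with mn show ?thesis using d'_orth by (simp add: c_def)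
    next
      assume mn: "even m" "odd n"
      then have "m \<noteq> n" by blast
      with mn show ?thesis using cinner_zero_commute[OF d'_orth] by (simp add: c_def)
    qed
  qed
  have c_total: "f = 0" if f: "\<And>n. cinner f (c n) = 0" for f
  proof (rule test_fun_total)
    fix k
    have fd: "cinner f (d n) = 0" for n using f[of "2 * n"] by (simp add: c_def)
    have "cinner f (d' n) = 0" for n using f[of "2 * n + 1"] by (simp add: c_def)
    then have fq: "cinner f (q k) = 0"
      unfolding d'_def by (rule orth_gram_schmidt_imp)
    have s: "summable (\<lambda>j. cinner (test_fun k) (d j) *\<^sub>C d j)"
      by (intro orthonormal0_summable orthonormal0_summable_coeff d0)
    have "cinner f (\<Sum>j. cinner (test_fun k) (d j) *\<^sub>C d j) = 0"
      using bounded_linear.suminf[OF bounded_linear_cinner_right s, of f] by (simp add: cinner_simps fd)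
    then show "cinner f (test_fun k) = 0"
      using fq by (simp add: q_def cinner_simps)
  qed
  obtain r where r: "strict_mono r" "orthonormal_basis (\<lambda>n. c (r n))"
    using orthonormal_basis_of_total[OF c0 c_total] by blast
  define e where "e n = c (r n)" for n
  define G where "G n = g (r n div 2)" for n
  have e: "orthonormal_basis e" using r(2) by (simp add: e_def[abs_def])
  have bound: "(\<Sum>n<N. Re (cinner (P (e n)) (e n))) \<le> M" for N
  proof -
    \<comment> \<open>The indices whose basis vector lies in the range of \<open>P\<close>; the
      other basis vectors are annihilated by \<open>P\<close> and contribute nothing.\<close>
    define I where "I = {n. n < N \<and> even (r n)}"
    have eG: "e n = P (G n)" if "n \<in> I" for n
      using that by (simp add: e_def c_def G_def g I_def)
    have on: "orthonormal_on I e"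
      using e by (simp add: orthonormal_on_def orthonormal_basis_def)
    have on': "orthonormal_on I (\<lambda>n. T (G n))"
      unfolding orthonormal_on_def
    proof (intro ballI)
      fix m n assume "m \<in> I" "n \<in> I"
      then have "cinner (T (G m)) (T (G n)) = cinner (e m) (e n)"
        by (simp add: eG flip: PP)
      then show "cinner (T (G m)) (T (G n)) = (if m = n then 1 else 0)"
        using e by (simp add: orthonormal_basis_def)
    qed
    have "(\<Sum>n<N. Re (cinner (P (e n)) (e n))) = (\<Sum>n\<in>I. Re (cinner (P (e n)) (e n)))"
    proof (rule sum.mono_neutral_right)
      show "\<forall>n\<in>{..<N} - I. Re (cinner (P (e n)) (e n)) = 0"
        using Pd' by (auto simp: I_def e_def c_def cinner_simps)
    qed (auto simp: I_def)
    also have "\<dots> \<le> (\<Sum>n\<in>I. cmod (cinner (T (e n)) (T (G n))))"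
    proof (rule sum_mono)
      fix n assume "n \<in> I"
      then have "cinner (P (e n)) (e n) = cinner (T (e n)) (T (G n))"
        using PP[of "e n" "G n"] by (simp add: eG)
      then show "Re (cinner (P (e n)) (e n)) \<le> cmod (cinner (T (e n)) (T (G n)))"
        by (simp add: complex_Re_le_cmod)
    qed
    also have "\<dots> \<le> M"
      by (rule M[OF _ on on']) (simp add: I_def)
    finally show ?thesis .
  qed
  have "summable (\<lambda>n. Re (cinner (P (e n)) (e n)))"
    using pos by (intro summableI_nonneg_bounded[OF _ bound]) (simp add: complex_nonneg_Reals_iff)
  then have "summable (\<lambda>n. complex_of_real (Re (cinner (P (e n)) (e n))))"
    by (rule summable_of_real)
  moreover have "complex_of_real (Re (cinner (P (e n)) (e n))) = cinner (P (e n)) (e n)" for n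
    using pos[of "e n"] by (auto simp: complex_nonneg_Reals_iff complex_eq_iff)
  ultimately have "summable (\<lambda>n. cinner (P (e n)) (e n))" by simp
  then show ?thesis
    unfolding trace_class_def using T P e by blast
qed

text \<open>\<open>T\<close> is an integral of the rank one operators sending \<open>f\<close> to
  \<open>cinner f (K x) *\<^sub>C K0 x\<close>, with weight \<open>V x\<close>. Cauchy-Schwarz over
  the index followed by Bessel bounds the sums pointwise in \<open>x\<close> by
  \<open>M\<^sup>2\<close>, for any pair of orthonormal systems. This single bound serves the trace
  class criterion and, as a dominating function, the passage to the limit in Parseval's
  identity.\<close>

lemma trace_class_of_kernel:
  fixes K K0 :: "real \<Rightarrow> l2" and V :: "real \<Rightarrow> real"
  assumes T: "bounded_clinear T" and V: "integrable halfline V"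
    and K: "\<And>x. x \<ge> 0 \<Longrightarrow> norm (K x) \<le> M" "\<And>x. x \<ge> 0 \<Longrightarrow> norm (K0 x) \<le> M"
    and meas: "\<And>f. (\<lambda>x. cinner f (K x)) \<in> borel_measurable halfline"
      "\<And>f. (\<lambda>x. cinner (K0 x) f) \<in> borel_measurable halfline"
    and TK: "\<And>f g. cinner (T f) g = (LINT x|halfline. of_real (V x) * (cinner f (K x) * cinner (K0 x) g))"
  shows "trace_class T" "op_trace T = (LINT x|halfline. of_real (V x) * cinner (K0 x) (K x))"
proof -
  have M0: "M \<ge> 0" using K(1)[of 0] norm_ge_zero[of "K 0"] by linarith
  have [measurable]: "V \<in> borel_measurable halfline" using V by (rule borel_measurable_integrable)
  note [measurable] = meas
  have absV: "integrable halfline (\<lambda>x. \<bar>V x\<bar> * M\<^sup>2)"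
    using V by simp
  have cs: "(\<Sum>n\<in>I. cmod (cinner (e n) (K x) * cinner (K0 x) (f n))) \<le> M\<^sup>2"
    if I: "finite I" "orthonormal_on I e" "orthonormal_on I f" and x: "x \<ge> 0" for I e f x
  proof -
    have "(\<Sum>n\<in>I. cmod (cinner (e n) (K x) * cinner (K0 x) (f n)))
        = (\<Sum>n\<in>I. cmod (cinner (K x) (e n)) * cmod (cinner (K0 x) (f n)))"
      by (intro sum.cong refl) (metis cinner_commute complex_mod_cnj norm_mult)
    also have "\<dots> \<le> sqrt (\<Sum>n\<in>I. (cmod (cinner (K x) (e n)))\<^sup>2) * sqrt (\<Sum>n\<in>I. (cmod (cinner (K0 x) (f n)))\<^sup>2)"
      by (rule cauchy_schwarz_sum)
    also have "\<dots> \<le> norm (K x) * norm (K0 x)"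
      using orthonormal_on_bessel[OF I(1,2)] orthonormal_on_bessel[OF I(1,3)]
      by (intro mult_mono real_le_lsqrt) (auto simp: sum_nonneg)
    also have "\<dots> \<le> M * M"
      using K x M0 by (intro mult_mono) auto
    finally show ?thesis by (simp add: power2_eq_square)
  qed
  have single: "cmod (cinner f (K x) * cinner (K0 x) g) \<le> M\<^sup>2 * (norm f * norm g)" if x: "x \<ge> 0" for f g x
  proof -
    have "cmod (cinner f (K x) * cinner (K0 x) g) \<le> (norm f * norm (K x)) * (norm (K0 x) * norm g)"
      unfolding norm_mult by (intro mult_mono cmod_cinner_le) auto
    also have "\<dots> \<le> (norm f * M) * (M * norm g)"
      using K x M0 by (intro mult_mono) auto
    finally show ?thesis by (simp add: power2_eq_square mult_ac)
  qed
  have intg: "integrable halfline (\<lambda>x. of_real (V x) * (cinner f (K x) * cinner (K0 x) g))" for f g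
  proof (rule Bochner_Integration.integrable_bound)
    show "integrable halfline (\<lambda>x. \<bar>V x\<bar> * (M\<^sup>2 * (norm f * norm g)))" using V by simp
    show "AE x in halfline. norm (complex_of_real (V x) * (cinner f (K x) * cinner (K0 x) g))
        \<le> norm (\<bar>V x\<bar> * (M\<^sup>2 * (norm f * norm g)))"
      using single by (intro AE_I2) (auto simp: norm_mult abs_mult intro!: mult_left_mono)
  qed measurable
  show "trace_class T"
  proof (rule trace_classI[OF T])
    fix I e f
    assume I: "finite I" "orthonormal_on I e" "orthonormal_on I f"
    have "(\<Sum>n\<in>I. cmod (cinner (T (e n)) (f n)))
        \<le> (\<Sum>n\<in>I. LINT x|halfline. norm (complex_of_real (V x) * (cinner (e n) (K x) * cinner (K0 x) (f n))))"
      unfolding TK by (intro sum_mono integral_norm_bound)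
    also have "\<dots> = (LINT x|halfline. (\<Sum>n\<in>I. norm (complex_of_real (V x) * (cinner (e n) (K x) * cinner (K0 x) (f n)))))"
      by (rule Bochner_Integration.integral_sum[symmetric]) (intro integrable_norm intg)
    also have "\<dots> \<le> (LINT x|halfline. \<bar>V x\<bar> * M\<^sup>2)"
    proof (rule integral_mono[OF _ absV])
      show "integrable halfline (\<lambda>x. \<Sum>n\<in>I. norm (complex_of_real (V x) * (cinner (e n) (K x) * cinner (K0 x) (f n))))"
        by (intro Bochner_Integration.integrable_sum integrable_norm intg)
      fix x assume "x \<in> space halfline"
      then have x: "x \<ge> 0" by simp
      show "(\<Sum>n\<in>I. norm (complex_of_real (V x) * (cinner (e n) (K x) * cinner (K0 x) (f n)))) \<le> \<bar>V x\<bar> * M\<^sup>2"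
        using mult_left_mono[OF cs[OF I x], of "\<bar>V x\<bar>"] by (simp add: norm_mult sum_distrib_left)
    qed
    finally show "(\<Sum>n\<in>I. cmod (cinner (T (e n)) (f n))) \<le> (LINT x|halfline. \<bar>V x\<bar> * M\<^sup>2)" .
  qed
  show "op_trace T = (LINT x|halfline. of_real (V x) * cinner (K0 x) (K x))"
  proof (rule op_trace_eqI)
    fix e assume e: "orthonormal_basis e"
    then have on: "orthonormal_on I e" for I
      by (simp add: orthonormal_on_def orthonormal_basis_def)
    have "(\<lambda>N. LINT x|halfline. of_real (V x) * (\<Sum>n<N. cinner (K0 x) (e n) * cinner (e n) (K x)))
        \<longlonglongrightarrow> (LINT x|halfline. of_real (V x) * cinner (K0 x) (K x))"
    proof (rule integral_dominated_convergence[where w = "\<lambda>x. \<bar>V x\<bar> * M\<^sup>2"])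
      have lim: "(\<lambda>N. \<Sum>n<N. cinner (K0 x) (e n) * cinner (e n) (K x)) \<longlonglongrightarrow> cinner (K0 x) (K x)" for x
        using parseval[OF e, of "K0 x" "K x"] by (simp add: sums_def)
      show "(\<lambda>x. of_real (V x) * (\<Sum>n<N. cinner (K0 x) (e n) * cinner (e n) (K x))) \<in> borel_measurable halfline" for N
        by measurable
      \<comment> \<open>Both families are only weakly measurable; their inner product is measurable
        as a pointwise limit of Parseval sums.\<close>
      have "(\<lambda>x. cinner (K0 x) (K x)) \<in> borel_measurable halfline"
        by (rule borel_measurable_LIMSEQ_metric[OF _ lim]) measurable
      then show "(\<lambda>x. complex_of_real (V x) * cinner (K0 x) (K x)) \<in> borel_measurable halfline"
        by measurable
      show "AE x in halfline. (\<lambda>N. of_real (V x) * (\<Sum>n<N. cinner (K0 x) (e n) * cinner (e n) (K x)))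
          \<longlonglongrightarrow> complex_of_real (V x) * cinner (K0 x) (K x)"
        by (intro AE_I2 tendsto_mult tendsto_const lim)
      show "AE x in halfline. norm (complex_of_real (V x) * (\<Sum>n<N. cinner (K0 x) (e n) * cinner (e n) (K x))) \<le> \<bar>V x\<bar> * M\<^sup>2" for N
      proof (rule AE_I2)
        fix x assume "x \<in> space halfline"
        then have x: "x \<ge> 0" by simp
        have "norm (\<Sum>n<N. cinner (K0 x) (e n) * cinner (e n) (K x))
            \<le> (\<Sum>n<N. cmod (cinner (e n) (K x) * cinner (K0 x) (e n)))"
          by (rule order_trans[OF norm_sum]) (simp add: mult.commute)
        also have "\<dots> \<le> M\<^sup>2" by (rule cs[OF _ on on x]) simp
        finally show "norm (complex_of_real (V x) * (\<Sum>n<N. cinner (K0 x) (e n) * cinner (e n) (K x))) \<le> \<bar>V x\<bar> * M\<^sup>2"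
          by (simp add: norm_mult mult_left_mono)
      qed
    qed (rule absV)
    also have "(\<lambda>N. LINT x|halfline. of_real (V x) * (\<Sum>n<N. cinner (K0 x) (e n) * cinner (e n) (K x)))
        = (\<lambda>N. \<Sum>n<N. cinner (T (e n)) (e n))"
    proof
      fix N
      have "(LINT x|halfline. of_real (V x) * (\<Sum>n<N. cinner (K0 x) (e n) * cinner (e n) (K x)))
          = (LINT x|halfline. (\<Sum>n<N. of_real (V x) * (cinner (e n) (K x) * cinner (K0 x) (e n))))"
        by (simp add: sum_distrib_left mult.commute)
      also have "\<dots> = (\<Sum>n<N. cinner (T (e n)) (e n))"
        unfolding TK by (rule Bochner_Integration.integral_sum) (rule intg)
      finally show "(LINT x|halfline. of_real (V x) * (\<Sum>n<N. cinner (K0 x) (e n) * cinner (e n) (K x)))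
          = (\<Sum>n<N. cinner (T (e n)) (e n))" .
    qed
    finally show "(\<lambda>n. cinner (T (e n)) (e n)) sums (LINT x|halfline. of_real (V x) * cinner (K0 x) (K x))"
      by (simp add: sums_def)
  qed
qed

section \<open>Calculus of locally absolutely continuous functions\<close>

abbreviation seg :: "real \<Rightarrow> real \<Rightarrow> (real \<Rightarrow> 'a::euclidean_space) \<Rightarrow> 'a" where
  "seg a b f \<equiv> (LINT t|lebesgue_on {a..b}. f t)"

abbreviation seg_integrable :: "real \<Rightarrow> real \<Rightarrow> (real \<Rightarrow> 'a::euclidean_space) \<Rightarrow> bool" where
  "seg_integrable a b f \<equiv> integrable (lebesgue_on {a..b}) f"

lemma seg_eq_integral: "seg_integrable a b f \<Longrightarrow> seg a b f = integral {a..b} f"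
  by (rule lebesgue_integral_eq_integral) auto

lemma seg_combine:
  assumes "a \<le> b" "b \<le> c" "seg_integrable a c f"
  shows "seg a c f = seg a b f + seg b c f"
proof -
  have "seg_integrable a b f" "seg_integrable b c f"
    using assms by (auto intro: integrable_subinterval[OF assms(3)])
  moreover have "integral {a..b} f + integral {b..c} f = integral {a..c} f"
    using assms by (intro Henstock_Kurzweil_Integration.integral_combine integrable_on_lebesgue_on) auto
  ultimately show ?thesis
    using assms by (simp add: seg_eq_integral)
qed

lemma seg_self: "seg a a f = 0"
proof -
  have "emeasure (lebesgue_on {a..a}) {a..a} = 0"
    by (subst emeasure_restrict_space) auto
  then have "AE t in lebesgue_on {a..a}. f t = 0"
    by (intro AE_I[where N = "{a..a}"]) (auto simp: sets_restrict_space_iff)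
  then show ?thesis by (rule integral_eq_zero_AE)
qed

lemmas seg_self' [simp] = seg_self[simplified]

lemma seg_integrable_halfline_iff:
  assumes "0 \<le> a"
  shows "seg_integrable a b f \<longleftrightarrow> integrable halfline (\<lambda>t. indicator {a..b} t *\<^sub>R f t)"
proof -
  have "indicator {0..} t *\<^sub>R indicator {a..b} t *\<^sub>R f t = indicator {a..b} t *\<^sub>R f t" for t
    using assms by (auto simp: indicator_def)
  then show ?thesis
    by (simp add: integrable_restrict_space del: scaleR_scaleR)
qed

lemma seg_halfline:
  assumes "0 \<le> a"
  shows "seg a b f = (LINT t|halfline. indicator {a..b} t *\<^sub>R f t)"
proof -
  have "indicator {0..} t *\<^sub>R indicator {a..b} t *\<^sub>R f t = indicator {a..b} t *\<^sub>R f t" for t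
    using assms by (auto simp: indicator_def)
  then show ?thesis
    by (simp add: integral_restrict_space del: scaleR_scaleR)
qed

lemma Icc_sets_halfline: "0 \<le> a \<Longrightarrow> {a..b} \<in> sets halfline"
  by (auto simp: sets_restrict_space_iff)

lemma halfline_seg_integrable:
  assumes "integrable halfline f" "0 \<le> a" shows "seg_integrable a b f"
  using integrable_mult_indicator[OF Icc_sets_halfline[OF assms(2)] assms(1)]
  by (simp add: seg_integrable_halfline_iff assms)

lemma borel_measurable_continuous_halfline:
  "continuous_on {0..} (f :: real \<Rightarrow> 'a::euclidean_space) \<Longrightarrow> f \<in> borel_measurable halfline"
  by (rule continuous_imp_measurable_on_sets_lebesgue) auto

lemma seg_integrable_continuous:
  assumes "continuous_on {0..} f" "0 \<le> a" shows "seg_integrable a b f"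
  by (intro continuous_imp_integrable_real continuous_on_subset[OF assms(1)]) (use assms in auto)

lemma seg_integrable_mult:
  fixes f g :: "real \<Rightarrow> complex"
  assumes f: "seg_integrable a b f" and g: "continuous_on {a..b} g"
  shows "seg_integrable a b (\<lambda>t. f t * g t)"
proof -
  have "compact (g ` {a..b})" using g by (intro compact_continuous_image) auto
  then obtain B where B: "\<And>t. t \<in> {a..b} \<Longrightarrow> cmod (g t) \<le> B"
    using compact_imp_bounded bounded_iff by (metis imageI)
  show ?thesis
  proof (rule Bochner_Integration.integrable_bound)
    show "seg_integrable a b (\<lambda>t. B * norm (f t))" using f by simp
    have "g \<in> borel_measurable (lebesgue_on {a..b})"
      using g by (rule continuous_imp_measurable_on_sets_lebesgue) auto
    then show "(\<lambda>t. f t * g t) \<in> borel_measurable (lebesgue_on {a..b})"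
      using borel_measurable_integrable[OF f] by (rule borel_measurable_times[rotated])
    show "AE t in lebesgue_on {a..b}. norm (f t * g t) \<le> norm (B * norm (f t))"
    proof (rule AE_I2)
      fix t assume "t \<in> space (lebesgue_on {a..b})"
      then have t: "t \<in> {a..b}" by simp
      have "norm (f t * g t) \<le> B * norm (f t)"
        unfolding norm_mult mult.commute[of "cmod (f t)"] by (rule mult_right_mono[OF B[OF t] norm_ge_zero])
      then show "norm (f t * g t) \<le> norm (B * norm (f t))"
        unfolding real_norm_def by (rule order_trans[OF _ abs_ge_self])
    qed
  qed
qed

lemma integrable_mult_bounded:
  fixes f g :: "real \<Rightarrow> complex"
  assumes f: "integrable halfline f" and g: "g \<in> borel_measurable halfline" "\<And>t. t \<ge> 0 \<Longrightarrow> cmod (g t) \<le> B"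
  shows "integrable halfline (\<lambda>t. f t * g t)"
proof (rule Bochner_Integration.integrable_bound)
  show "integrable halfline (\<lambda>t. B * norm (f t))" using f by simp
  show "(\<lambda>t. f t * g t) \<in> borel_measurable halfline"
    using borel_measurable_integrable[OF f] g(1) by (rule borel_measurable_times)
  have "norm (f t * g t) \<le> norm (B * norm (f t))" if "t \<ge> 0" for t
  proof -
    have "norm (f t * g t) \<le> B * norm (f t)"
      unfolding norm_mult mult.commute[of "cmod (f t)"] by (rule mult_right_mono[OF g(2)[OF that] norm_ge_zero])
    then show ?thesis unfolding real_norm_def by (rule order_trans[OF _ abs_ge_self])
  qed
  then show "AE t in halfline. norm (f t * g t) \<le> norm (B * norm (f t))"
    by (intro AE_I2) auto
qed

lemma tendsto_seg_halfline:
  fixes f :: "real \<Rightarrow> 'a::euclidean_space"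
  assumes f: "integrable halfline f"
  shows "((\<lambda>X. seg 0 X f) \<longlongrightarrow> (LINT t|halfline. f t)) at_top"
  unfolding seg_halfline[OF order_refl]
proof (rule integral_dominated_convergence_at_top[where w = "\<lambda>t. norm (f t)"])
  show "f \<in> borel_measurable halfline" using f by simp
  show "(\<lambda>t. indicator {0..X} t *\<^sub>R f t) \<in> borel_measurable halfline" for X
    using integrable_mult_indicator[OF Icc_sets_halfline[OF order_refl] f] by simp
  show "\<forall>\<^sub>F X in at_top. AE t in halfline. norm (indicator {0..X} t *\<^sub>R f t) \<le> norm (f t)"
    by (intro always_eventually allI AE_I2) (auto simp: indicator_def)
  have "((\<lambda>X. indicator {0..X} t *\<^sub>R f t) \<longlongrightarrow> f t) at_top" if "t \<ge> 0" for t
    by (intro tendsto_eventually eventually_mono[OF eventually_ge_at_top[of t]])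
       (simp add: indicator_def that)
  then show "AE t in halfline. ((\<lambda>X. indicator {0..X} t *\<^sub>R f t) \<longlongrightarrow> f t) at_top"
    by (intro AE_I2) auto
qed (use f in simp)

lemma locally_ac_derivD:
  assumes "locally_ac_deriv f g" "0 \<le> x"
  shows "f x = f 0 + seg 0 x g" "seg_integrable 0 x g"
  using assms unfolding locally_ac_deriv_def by blast+

lemma locally_ac_deriv_diff:
  assumes "locally_ac_deriv f g" "0 \<le> x" "x \<le> y"
  shows "f y - f x = seg x y g" "seg_integrable x y g"
proof -
  have "f y = f 0 + seg 0 y g" "f x = f 0 + seg 0 x g" "seg_integrable 0 y g"
    using assms by (auto intro: locally_ac_derivD)
  moreover from this have "seg 0 y g = seg 0 x g + seg x y g"
    using assms by (intro seg_combine) auto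
  ultimately show "f y - f x = seg x y g" by simp
  show "seg_integrable x y g"
    using \<open>seg_integrable 0 y g\<close> by (rule integrable_subinterval) (use assms in auto)
qed

lemma locally_ac_deriv_cong:
  assumes "locally_ac_deriv f g" "\<And>x. x \<ge> 0 \<Longrightarrow> f x = f' x" "\<And>x. x \<ge> 0 \<Longrightarrow> g x = g' x"
  shows "locally_ac_deriv f' g'"
  unfolding locally_ac_deriv_def
proof (intro allI impI conjI)
  fix x :: real assume x: "x \<ge> 0"
  have "seg_integrable 0 x g \<longleftrightarrow> seg_integrable 0 x g'"
    using assms(3) by (intro Bochner_Integration.integrable_cong) auto
  then show "seg_integrable 0 x g'" using locally_ac_derivD(2)[OF assms(1) x] by blast
  have "seg 0 x g = seg 0 x g'"
    using assms(3) by (intro Bochner_Integration.integral_cong) auto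
  moreover have "f x = f 0 + seg 0 x g"
    by (rule locally_ac_derivD(1)[OF assms(1) x])
  ultimately show "f' x = f' 0 + seg 0 x g'"
    using assms(2)[OF x] assms(2)[OF order_refl] by simp
qed

lemma continuous_on_halflineI:
  assumes "\<And>b. b \<ge> 0 \<Longrightarrow> continuous_on {0..b} (f :: real \<Rightarrow> 'a::topological_space)"
  shows "continuous_on {0..} f"
  unfolding continuous_on_eq_continuous_within
proof
  fix x :: real assume "x \<in> {0..}"
  then have x: "x \<ge> 0" by simp
  have "continuous (at x within {0..x+1}) f"
    using assms[of "x+1"] x by (auto simp: continuous_on_eq_continuous_within)
  moreover have "at x within {0..x+1} = at x within {0..}"
    by (rule at_within_nhd[of _ "{x-1<..<x+1}"]) auto
  ultimately show "continuous (at x within {0..}) f" by simp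
qed

lemma continuous_on_seg:
  fixes g :: "real \<Rightarrow> 'a::euclidean_space"
  assumes "\<And>b. seg_integrable 0 b g"
  shows "continuous_on {0..} (\<lambda>x. seg 0 x g)"
proof (rule continuous_on_halflineI)
  fix b :: real
  have "continuous_on {0..b} (\<lambda>x. integral {0..x} g)"
    by (intro indefinite_integral_continuous_1 integrable_on_lebesgue_on assms) auto
  then show "continuous_on {0..b} (\<lambda>x. seg 0 x g)"
    by (simp add: seg_eq_integral[OF assms])
qed

lemma locally_ac_deriv_continuous:
  assumes "locally_ac_deriv f g" shows "continuous_on {0..} f"
proof (rule continuous_on_halflineI)
  fix b :: real assume b: "b \<ge> 0"
  have int: "g integrable_on {0..b}"
    by (intro integrable_on_lebesgue_on locally_ac_derivD(2)[OF assms b]) simp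
  have "continuous_on {0..b} (\<lambda>x. f 0 + integral {0..x} g)"
    by (intro continuous_intros indefinite_integral_continuous_1 int)
  then show "continuous_on {0..b} f"
  proof (rule continuous_on_eq)
    fix x assume "x \<in> {0..b}"
    then have x: "0 \<le> x" by simp
    show "f 0 + integral {0..x} g = f x"
      using locally_ac_derivD[OF assms x] by (simp add: seg_eq_integral)
  qed
qed

text \<open>Absolutely continuous functions are only differentiable almost everywhere. Identities
  between them are obtained from increments that are quadratically small in a monotone
  continuous parameter \<open>Q\<close>: as a function of \<open>Q\<close> such a function has derivative zero.\<close>

lemma quadratic_increments_constant:
  fixes \<Phi> :: "real \<Rightarrow> 'a::real_normed_vector" and Q :: "real \<Rightarrow> real"
  assumes ab: "a \<le> b" and Q: "continuous_on {a..b} Q"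
    and mono: "\<And>x y. a \<le> x \<Longrightarrow> x \<le> y \<Longrightarrow> y \<le> b \<Longrightarrow> Q x \<le> Q y"
    and C: "\<And>x y. a \<le> x \<Longrightarrow> x \<le> y \<Longrightarrow> y \<le> b \<Longrightarrow> norm (\<Phi> y - \<Phi> x) \<le> C * (Q y - Q x)\<^sup>2"
  shows "\<Phi> b = \<Phi> a"
proof -
  have "\<exists>x. a \<le> x \<and> x \<le> b \<and> Q x = s" if "s \<in> {Q a..Q b}" for s
    using IVT'[of Q a s b] that ab Q by auto
  \<comment> \<open>\<open>g\<close> selects a point on each level of \<open>Q\<close>.
    \<open>Q\<close> may be constant on intervals, but the quadratic bound forces
    \<open>\<Phi>\<close> to be constant there too, so the selection does not matter.\<close>
  then obtain g where g: "\<And>s. s \<in> {Q a..Q b} \<Longrightarrow> a \<le> g s \<and> g s \<le> b \<and> Q (g s) = s"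
    by metis
  define \<Psi> where "\<Psi> s = \<Phi> (g s)" for s
  have C2: "norm (\<Phi> y - \<Phi> x) \<le> C * (Q y - Q x)\<^sup>2" if "a \<le> x" "x \<le> b" "a \<le> y" "y \<le> b" for x y
    using C[of x y] C[of y x] that
    by (cases "x \<le> y") (simp_all add: norm_minus_commute power2_commute)
  have \<Psi>: "norm (\<Psi> t - \<Psi> s) \<le> C * (t - s)\<^sup>2" if "s \<in> {Q a..Q b}" "t \<in> {Q a..Q b}" for s t
    using C2[of "g s" "g t"] g[OF that(1)] g[OF that(2)] by (simp add: \<Psi>_def)
  have "\<exists>c. \<forall>s\<in>{Q a..Q b}. \<Psi> s = c"
  proof (rule has_derivative_zero_constant)
    fix s assume s: "s \<in> {Q a..Q b}"
    show "(\<Psi> has_derivative (\<lambda>h. 0)) (at s within {Q a..Q b})"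
      unfolding has_derivative_within
    proof (intro conjI bounded_linear_zero)
      show "((\<lambda>t. (1 / norm (t - s)) *\<^sub>R (\<Psi> t - (\<Psi> s + 0))) \<longlongrightarrow> 0) (at s within {Q a..Q b})"
      proof (rule Lim_null_comparison)
        show "\<forall>\<^sub>F t in at s within {Q a..Q b}. norm ((1 / norm (t - s)) *\<^sub>R (\<Psi> t - (\<Psi> s + 0))) \<le> C * \<bar>t - s\<bar>"
          unfolding eventually_at_filter
        proof (intro always_eventually allI impI)
          fix t assume t: "t \<noteq> s" "t \<in> {Q a..Q b}"
          have "norm (\<Psi> t - \<Psi> s) / \<bar>t - s\<bar> \<le> C * (t - s)\<^sup>2 / \<bar>t - s\<bar>"
            using \<Psi>[OF s t(2)] by (intro divide_right_mono) auto
          also have "\<dots> = C * \<bar>t - s\<bar>"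
          proof -
            have "(t - s)\<^sup>2 = \<bar>t - s\<bar> * \<bar>t - s\<bar>" by (simp add: power2_eq_square)
            then have "C * (t - s)\<^sup>2 / \<bar>t - s\<bar> = (C * \<bar>t - s\<bar>) * \<bar>t - s\<bar> / \<bar>t - s\<bar>"
              by (simp only: mult.assoc)
            also have "\<dots> = C * \<bar>t - s\<bar>"
              using t(1) by (intro nonzero_mult_div_cancel_right) simp
            finally show ?thesis .
          qed
          finally show "norm ((1 / norm (t - s)) *\<^sub>R (\<Psi> t - (\<Psi> s + 0))) \<le> C * \<bar>t - s\<bar>"
            by (simp add: divide_inverse mult.commute)
        qed
        have "((\<lambda>t. C * \<bar>t - s\<bar>) \<longlongrightarrow> C * \<bar>s - s\<bar>) (at s within {Q a..Q b})"
          by (intro tendsto_intros)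
        then show "((\<lambda>t. C * \<bar>t - s\<bar>) \<longlongrightarrow> 0) (at s within {Q a..Q b})" by simp
      qed
    qed
  qed simp
  then obtain c where c: "\<And>s. s \<in> {Q a..Q b} \<Longrightarrow> \<Psi> s = c" by blast
  have Qab: "Q a \<le> Q b" using mono ab by simp
  have "\<Phi> x = \<Psi> (Q x)" if "Q x \<in> {Q a..Q b}" "a \<le> x" "x \<le> b" for x
    using C2[of "g (Q x)" x] g[OF that(1)] that(2,3) by (simp add: \<Psi>_def)
  from this[of a] this[of b] c[of "Q a"] c[of "Q b"] Qab ab show ?thesis by simp
qed

lemma seg_norm_le: "norm (seg a b f) \<le> seg a b (\<lambda>t. norm (f t))"
  by (rule integral_norm_bound)

lemma seg_norm_mult_le:
  fixes f g :: "real \<Rightarrow> complex"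
  assumes f: "seg_integrable a b f" and g: "continuous_on {a..b} g"
    and B: "\<And>t. t \<in> {a..b} \<Longrightarrow> cmod (g t) \<le> B"
  shows "cmod (seg a b (\<lambda>t. f t * g t)) \<le> B * seg a b (\<lambda>t. cmod (f t))"
proof -
  have "cmod (seg a b (\<lambda>t. f t * g t)) \<le> seg a b (\<lambda>t. cmod (f t * g t))"
    by (rule seg_norm_le)
  also have "\<dots> \<le> seg a b (\<lambda>t. B * cmod (f t))"
  proof (rule integral_mono)
    show "seg_integrable a b (\<lambda>t. cmod (f t * g t))"
      by (intro integrable_norm seg_integrable_mult f g)
    fix t assume "t \<in> space (lebesgue_on {a..b})"
    then show "cmod (f t * g t) \<le> B * cmod (f t)"
      unfolding norm_mult mult.commute[of "cmod (f t)"] by (intro mult_right_mono B) auto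
  qed (use f in simp)
  finally show ?thesis by simp
qed

text \<open>The monotone parameter is the primitive \<open>Q\<close> of
  \<open>cmod (u' t) + cmod (v' t)\<close>. Over \<open>{x..y}\<close> the difference between the
  increment of \<open>u v\<close> and the integral of \<open>u' v + u v'\<close> splits into three
  terms. Each is a product of two quantities bounded by \<open>Q y - Q x\<close>, whence the
  constant 3.\<close>

lemma locally_ac_deriv_mult:
  assumes u: "locally_ac_deriv u u'" and v: "locally_ac_deriv v v'"
  shows "locally_ac_deriv (\<lambda>x. u x * v x) (\<lambda>x. u' x * v x + u x * v' x)"
  unfolding locally_ac_deriv_def
proof (intro allI impI conjI)
  fix b :: real assume b: "b \<ge> 0"
  have cu: "continuous_on {x..y} u" and cv: "continuous_on {x..y} v" if "0 \<le> x" for x y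
    using locally_ac_deriv_continuous[OF u] locally_ac_deriv_continuous[OF v] that
    by (auto elim!: continuous_on_subset)
  note du = locally_ac_deriv_diff[OF u] and dv = locally_ac_deriv_diff[OF v]
  have int1: "seg_integrable x y (\<lambda>t. u' t * v t)" if "0 \<le> x" "x \<le> y" for x y
    by (intro seg_integrable_mult du(2) cv that)
  have int2: "seg_integrable x y (\<lambda>t. u t * v' t)" if "0 \<le> x" "x \<le> y" for x y
    using seg_integrable_mult[OF dv(2) cu] that by (simp add: mult.commute)
  have int: "seg_integrable x y (\<lambda>t. u' t * v t + u t * v' t)" if "0 \<le> x" "x \<le> y" for x y
    by (intro Bochner_Integration.integrable_add int1 int2 that)
  show "seg_integrable 0 b (\<lambda>t. u' t * v t + u t * v' t)" by (rule int[OF order_refl b])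
  define q where "q t = cmod (u' t) + cmod (v' t)" for t
  have intq: "seg_integrable x y q" if "0 \<le> x" "x \<le> y" for x y
    unfolding q_def by (intro Bochner_Integration.integrable_add integrable_norm du(2) dv(2) that)
  define Q where "Q x = seg 0 x q" for x
  define \<Phi> where "\<Phi> x = u x * v x - seg 0 x (\<lambda>t. u' t * v t + u t * v' t)" for x
  have Qd: "Q y - Q x = seg x y q" if "0 \<le> x" "x \<le> y" for x y
    using seg_combine[of 0 x y q] intq[of 0 y] that by (simp add: Q_def)
  have Qmono: "Q x \<le> Q y" if "0 \<le> x" "x \<le> y" for x y
  proof -
    have "seg x y q \<ge> 0" by (rule Bochner_Integration.integral_nonneg) (simp add: q_def)
    then show ?thesis using Qd[OF that] by simp
  qed
  have qle: "seg x y (\<lambda>t. cmod (u' t)) \<le> seg x y q" "seg x y (\<lambda>t. cmod (v' t)) \<le> seg x y q"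
    if "0 \<le> x" "x \<le> y" for x y
    by (intro integral_mono integrable_norm du(2) dv(2) intq that; simp add: q_def)+
  have "\<Phi> b = \<Phi> 0"
  proof (rule quadratic_increments_constant[of 0 b Q \<Phi> 3])
    show "continuous_on {0..b} Q"
    proof -
      have "continuous_on {0..b} (\<lambda>x. integral {0..x} q)"
        by (intro indefinite_integral_continuous_1 integrable_on_lebesgue_on intq b) auto
      then show ?thesis
        by (rule continuous_on_eq) (auto simp: Q_def seg_eq_integral intq)
    qed
    fix x y :: real assume xy: "0 \<le> x" "x \<le> y" "y \<le> b"
    define \<Delta> where "\<Delta> = Q y - Q x"
    have \<Delta>0: "\<Delta> \<ge> 0" using Qmono[OF xy(1,2)] by (simp add: \<Delta>_def)
    have ub: "cmod (u t - u x) \<le> \<Delta>" and vb: "cmod (v t - v x) \<le> \<Delta>" if "t \<in> {x..y}" for t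
    proof -
      have t: "0 \<le> x" "x \<le> t" using that xy by auto
      have "cmod (u t - u x) \<le> seg x t q" "cmod (v t - v x) \<le> seg x t q"
        unfolding du(1)[OF t] dv(1)[OF t] by (rule order_trans[OF seg_norm_le qle(1)[OF t]],
            rule order_trans[OF seg_norm_le qle(2)[OF t]])
      moreover have "seg x t q \<le> \<Delta>"
        using Qmono[of t y] Qd[OF t] that xy by (simp add: \<Delta>_def)
      ultimately show "cmod (u t - u x) \<le> \<Delta>" "cmod (v t - v x) \<le> \<Delta>" by linarith+
    qed
    have A: "cmod (seg x y (\<lambda>t. u' t * (v x - v t))) \<le> \<Delta> * \<Delta>"
    proof -
      have "cmod (seg x y (\<lambda>t. u' t * (v x - v t))) \<le> \<Delta> * seg x y (\<lambda>t. cmod (u' t))"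
        using vb by (intro seg_norm_mult_le du(2) xy continuous_intros cv) (simp add: norm_minus_commute)
      also have "\<dots> \<le> \<Delta> * \<Delta>"
        using qle(1)[OF xy(1,2)] Qd[OF xy(1,2)] by (intro mult_left_mono \<Delta>0) (simp add: \<Delta>_def)
      finally show ?thesis .
    qed
    have B: "cmod (seg x y (\<lambda>t. v' t * (u x - u t))) \<le> \<Delta> * \<Delta>"
    proof -
      have "cmod (seg x y (\<lambda>t. v' t * (u x - u t))) \<le> \<Delta> * seg x y (\<lambda>t. cmod (v' t))"
        using ub by (intro seg_norm_mult_le dv(2) xy continuous_intros cu) (simp add: norm_minus_commute)
      also have "\<dots> \<le> \<Delta> * \<Delta>"
        using qle(2)[OF xy(1,2)] Qd[OF xy(1,2)] by (intro mult_left_mono \<Delta>0) (simp add: \<Delta>_def)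
      finally show ?thesis .
    qed
    have D: "cmod ((u y - u x) * (v y - v x)) \<le> \<Delta> * \<Delta>"
      unfolding norm_mult using ub[of y] vb[of y] xy \<Delta>0 by (intro mult_mono) auto
    have sA: "seg x y (\<lambda>t. u' t * (v x - v t)) = (u y - u x) * v x - seg x y (\<lambda>t. u' t * v t)"
      unfolding du(1)[OF xy(1,2)] right_diff_distrib
      using du(2)[OF xy(1,2)] int1[OF xy(1,2)] by (subst Bochner_Integration.integral_diff) auto
    have sB: "seg x y (\<lambda>t. v' t * (u x - u t)) = (v y - v x) * u x - seg x y (\<lambda>t. u t * v' t)"
      unfolding dv(1)[OF xy(1,2)] right_diff_distrib
      using dv(2)[OF xy(1,2)] int2[OF xy(1,2)]
      by (subst Bochner_Integration.integral_diff) (auto simp: mult.commute)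
    have "seg 0 y (\<lambda>t. u' t * v t + u t * v' t) - seg 0 x (\<lambda>t. u' t * v t + u t * v' t)
        = seg x y (\<lambda>t. u' t * v t + u t * v' t)"
      using seg_combine[OF xy(1,2) int] xy by simp
    also have "\<dots> = seg x y (\<lambda>t. u' t * v t) + seg x y (\<lambda>t. u t * v' t)"
      by (intro Bochner_Integration.integral_add int1 int2 xy)
    finally have "\<Phi> y - \<Phi> x = seg x y (\<lambda>t. u' t * (v x - v t)) + seg x y (\<lambda>t. v' t * (u x - u t))
        + (u y - u x) * (v y - v x)"
      unfolding sA sB by (simp add: \<Phi>_def algebra_simps)
    then have "cmod (\<Phi> y - \<Phi> x) \<le> \<Delta> * \<Delta> + \<Delta> * \<Delta> + \<Delta> * \<Delta>"
      using norm_triangle_mono[OF norm_triangle_mono[OF A B] D] by simp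
    then show "cmod (\<Phi> y - \<Phi> x) \<le> 3 * (Q y - Q x)\<^sup>2"
      by (simp add: \<Delta>_def power2_eq_square)
    show "Q x \<le> Q y" by (rule Qmono[OF xy(1,2)])
  qed (rule b)
  then show "u b * v b = u 0 * v 0 + seg 0 b (\<lambda>t. u' t * v t + u t * v' t)"
    by (simp add: \<Phi>_def seg_self algebra_simps)
qed

lemma locally_ac_derivI:
  assumes "\<And>x. 0 \<le> x \<Longrightarrow> seg_integrable 0 x g" "\<And>x. 0 \<le> x \<Longrightarrow> f x = f 0 + seg 0 x g"
  shows "locally_ac_deriv f g"
  using assms unfolding locally_ac_deriv_def by blast

lemma locally_ac_deriv_add:
  assumes "locally_ac_deriv u u'" "locally_ac_deriv v v'"
  shows "locally_ac_deriv (\<lambda>x. u x + v x) (\<lambda>x. u' x + v' x)"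
proof (rule locally_ac_derivI)
  fix x :: real assume x: "0 \<le> x"
  note u = locally_ac_derivD[OF assms(1) x] and v = locally_ac_derivD[OF assms(2) x]
  show "seg_integrable 0 x (\<lambda>x. u' x + v' x)" using u v by simp
  show "u x + v x = u 0 + v 0 + seg 0 x (\<lambda>x. u' x + v' x)"
    using u v by (subst u(1), subst v(1)) simp
qed

lemma locally_ac_deriv_cmult:
  assumes "locally_ac_deriv u u'"
  shows "locally_ac_deriv (\<lambda>x. c * u x) (\<lambda>x. c * u' x)"
proof (rule locally_ac_derivI)
  fix x :: real assume x: "0 \<le> x"
  note u = locally_ac_derivD[OF assms(1) x]
  show "seg_integrable 0 x (\<lambda>x. c * u' x)" using u by simp
  show "c * u x = c * u 0 + seg 0 x (\<lambda>x. c * u' x)"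
    by (subst u(1)) (simp add: distrib_left)
qed

lemma locally_ac_deriv_diff':
  assumes "locally_ac_deriv u u'" "locally_ac_deriv v v'"
  shows "locally_ac_deriv (\<lambda>x. u x - v x) (\<lambda>x. u' x - v' x)"
  using locally_ac_deriv_add[OF assms(1) locally_ac_deriv_cmult[OF assms(2), of "-1"]] by simp

lemma locally_ac_deriv_const: "locally_ac_deriv (\<lambda>x. c) (\<lambda>x. 0)"
  by (rule locally_ac_derivI) simp_all

lemma locally_ac_deriv_cnj:
  assumes "locally_ac_deriv u u'"
  shows "locally_ac_deriv (\<lambda>x. cnj (u x)) (\<lambda>x. cnj (u' x))"
proof (rule locally_ac_derivI)
  fix x :: real assume x: "0 \<le> x"
  note u = locally_ac_derivD[OF assms(1) x]
  show "seg_integrable 0 x (\<lambda>x. cnj (u' x))" using u by simp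
  show "cnj (u x) = cnj (u 0) + seg 0 x (\<lambda>x. cnj (u' x))"
    by (subst u(1)) simp
qed

lemma locally_ac_deriv_seg:
  assumes "\<And>b. seg_integrable 0 b g"
  shows "locally_ac_deriv (\<lambda>x. c + seg 0 x g) g"
  by (rule locally_ac_derivI) (simp_all add: assms seg_self)

lemma locally_ac_deriv_C1:
  assumes u: "\<And>x. x \<ge> 0 \<Longrightarrow> (u has_vector_derivative u' x) (at x within {0..})"
    and c: "continuous_on {0..} u'"
  shows "locally_ac_deriv u u'"
  unfolding locally_ac_deriv_def
proof (intro allI impI conjI)
  fix b :: real assume b: "b \<ge> 0"
  show int: "seg_integrable 0 b u'" by (rule seg_integrable_continuous[OF c]) simp
  have "(u' has_integral (u b - u 0)) {0..b}"
    by (intro fundamental_theorem_of_calculus b has_vector_derivative_within_subset[OF u]) auto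
  then have "integral {0..b} u' = u b - u 0" by (rule integral_unique)
  then show "u b = u 0 + seg 0 b u'" using int by (simp add: seg_eq_integral)
qed

lemma locally_ac_deriv_has_vector_derivative:
  assumes u: "locally_ac_deriv u u'" and c: "continuous_on {0..} u'" and x: "x \<ge> 0"
  shows "(u has_vector_derivative u' x) (at x within {0..})"
proof -
  have "((\<lambda>y. u 0 + integral {0..y} u') has_vector_derivative u' x) (at x within {0..x+1})"
    using x continuous_on_subset[OF c, of "{0..x+1}"]
    by (auto intro!: derivative_eq_intros integral_has_vector_derivative)
  then have "((\<lambda>y. u 0 + integral {0..y} u') has_vector_derivative u' x) (at x within {0..})"
    by (subst (asm) at_within_nhd[of x "{x-1<..<x+1}" "{0..x+1}" "{0..}"]) auto
  then show ?thesis
  proof (rule has_vector_derivative_transform_within[where d = 1])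
    fix y :: real assume "y \<in> {0..}"
    then show "u 0 + integral {0..y} u' = u y"
      using locally_ac_derivD[OF u, of y] by (simp add: seg_eq_integral)
  qed (use x in auto)
qed

text \<open>The substitution \<open>s = Q t\<close>, although \<open>Q\<close> is only absolutely
  continuous. Over a short interval the error has two sources, freezing the exponential under the
  integral and linearising it in \<open>Q\<close>; each is at most \<open>\<bar>l\<bar> * M\<close>
  times the square of the increment of \<open>Q\<close>.\<close>

lemma seg_exp:
  fixes v :: "real \<Rightarrow> real"
  assumes v: "\<And>x. seg_integrable 0 x v" "\<And>x. v x \<ge> 0" and l: "l \<noteq> 0" and b: "b \<ge> 0"
  defines "Q \<equiv> \<lambda>x. seg 0 x v"
  shows "seg 0 b (\<lambda>t. v t * exp (l * Q t)) = (exp (l * Q b) - 1) / l"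
    "seg_integrable 0 b (\<lambda>t. v t * exp (l * Q t))"
proof -
  have Qc: "continuous_on {0..} Q" unfolding Q_def by (rule continuous_on_seg[OF v(1)])
  have vs: "seg_integrable x y v" if "0 \<le> x" for x y
    using integrable_subinterval[OF v(1)[of y]] that by auto
  have Qd: "Q y - Q x = seg x y v" if "0 \<le> x" "x \<le> y" for x y
    using seg_combine[of 0 x y v] v(1) that by (simp add: Q_def)
  have Qmono: "Q x \<le> Q y" if "0 \<le> x" "x \<le> y" for x y
  proof -
    have "seg x y v \<ge> 0" by (rule Bochner_Integration.integral_nonneg) (simp add: v(2))
    then show ?thesis using Qd[OF that] by simp
  qed
  have Q0: "Q 0 = 0" by (simp add: Q_def seg_self)
  \<comment> \<open>A bound for \<open>exp (l * s)\<close> on the range of \<open>Q\<close> for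
    either sign of \<open>l\<close>: positive \<open>l\<close> occurs for the forward and negative
    \<open>l\<close> for the backward Volterra equation.\<close>
  define M where "M = exp (\<bar>l\<bar> * Q b)"
  have eM: "exp (l * s) \<le> M" if "0 \<le> s" "s \<le> Q b" for s
  proof -
    have "l * s \<le> \<bar>l\<bar> * Q b"
      using that by (meson abs_ge_self abs_ge_zero mult_mono order_trans)
    then show ?thesis by (simp add: M_def)
  qed
  have der: "((\<lambda>x. exp (l * x)) has_real_derivative l * exp (l * x)) (at x)" for x
    by (auto intro!: derivative_eq_intros)
  have lip: "\<bar>exp (l * s) - exp (l * r)\<bar> \<le> \<bar>l\<bar> * M * (s - r)" if "0 \<le> r" "r \<le> s" "s \<le> Q b" for r s
  proof (cases "r = s")
    case False
    then have "r < s" using that by simp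
    then obtain z where z: "r < z" "z < s" "exp (l * s) - exp (l * r) = (s - r) * (l * exp (l * z))"
      using MVT2[OF _ der] by metis
    have "\<bar>exp (l * s) - exp (l * r)\<bar> = (s - r) * (\<bar>l\<bar> * exp (l * z))"
      using z \<open>r < s\<close> by (simp add: abs_mult)
    also have "\<dots> \<le> (s - r) * (\<bar>l\<bar> * M)"
      using z that by (intro mult_left_mono eM) auto
    finally show ?thesis by (simp add: mult_ac)
  qed simp
  have Ec: "continuous_on {0..} (\<lambda>t. exp (l * Q t))"
    by (intro continuous_intros Qc)
  have int: "seg_integrable x y (\<lambda>t. v t * exp (l * Q t))" if "0 \<le> x" for x y
  proof -
    have "seg_integrable x y (\<lambda>t. complex_of_real (v t) * complex_of_real (exp (l * Q t)))"
      by (intro seg_integrable_mult continuous_intros continuous_on_subset[OF Qc] integrable_of_real vs that)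
         (use that in auto)
    then have "seg_integrable x y (\<lambda>t. complex_of_real (v t * exp (l * Q t)))" by simp
    then show ?thesis by (simp only: complex_of_real_integrable_eq)
  qed
  show "seg_integrable 0 b (\<lambda>t. v t * exp (l * Q t))" by (rule int) simp
  define \<Phi> where "\<Phi> x = seg 0 x (\<lambda>t. v t * exp (l * Q t)) - exp (l * Q x) / l" for x
  have "\<Phi> b = \<Phi> 0"
  proof (rule quadratic_increments_constant[of 0 b Q \<Phi> "2 * \<bar>l\<bar> * M"])
    show "continuous_on {0..b} Q" by (rule continuous_on_subset[OF Qc]) auto
    fix x y :: real assume xy: "0 \<le> x" "x \<le> y" "y \<le> b"
    show "Q x \<le> Q y" by (rule Qmono[OF xy(1,2)])
    define \<Delta> where "\<Delta> = Q y - Q x"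
    have \<Delta>0: "\<Delta> \<ge> 0" using Qmono[OF xy(1,2)] by (simp add: \<Delta>_def)
    have M0: "M \<ge> 0" by (simp add: M_def)
    have 1: "\<bar>seg x y (\<lambda>t. v t * (exp (l * Q t) - exp (l * Q x)))\<bar> \<le> \<bar>l\<bar> * M * \<Delta> * \<Delta>"
    proof -
      have "\<bar>seg x y (\<lambda>t. v t * (exp (l * Q t) - exp (l * Q x)))\<bar>
          \<le> seg x y (\<lambda>t. norm (v t * (exp (l * Q t) - exp (l * Q x))))"
        using seg_norm_le[of x y "\<lambda>t. v t * (exp (l * Q t) - exp (l * Q x))"] by simp
      also have "\<dots> \<le> seg x y (\<lambda>t. v t * (\<bar>l\<bar> * M * \<Delta>))"
      proof (rule integral_mono)
        show "seg_integrable x y (\<lambda>t. norm (v t * (exp (l * Q t) - exp (l * Q x))))"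
          unfolding right_diff_distrib
          by (intro integrable_norm Bochner_Integration.integrable_diff int integrable_mult_left vs xy)
        show "seg_integrable x y (\<lambda>t. v t * (\<bar>l\<bar> * M * \<Delta>))" by (intro integrable_mult_left vs xy)
        fix t assume "t \<in> space (lebesgue_on {x..y})"
        then have t: "x \<le> t" "t \<le> y" by auto
        have "\<bar>exp (l * Q t) - exp (l * Q x)\<bar> \<le> \<bar>l\<bar> * M * (Q t - Q x)"
          using Qmono[of 0 x] Qmono[of x t] Qmono[of t b] Q0 t xy by (intro lip) auto
        also have "\<dots> \<le> \<bar>l\<bar> * M * \<Delta>"
          using Qmono[of t y] t xy M0 by (intro mult_left_mono) (auto simp: \<Delta>_def)
        finally show "norm (v t * (exp (l * Q t) - exp (l * Q x))) \<le> v t * (\<bar>l\<bar> * M * \<Delta>)"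
          using v(2)[of t] by (simp add: abs_mult mult_left_mono)
      qed
      also have "\<dots> = \<bar>l\<bar> * M * \<Delta> * \<Delta>"
        using Qd[OF xy(1,2)] vs[OF xy(1)] by (simp add: \<Delta>_def)
      finally show ?thesis .
    qed
    have 2: "\<bar>exp (l * Q x) * \<Delta> - (exp (l * Q y) - exp (l * Q x)) / l\<bar> \<le> \<bar>l\<bar> * M * \<Delta> * \<Delta>"
    proof (cases "Q x = Q y")
      case False
      then have "Q x < Q y" using \<Delta>0 by (simp add: \<Delta>_def)
      then obtain z where z: "Q x < z" "z < Q y" "exp (l * Q y) - exp (l * Q x) = (Q y - Q x) * (l * exp (l * z))"
        using MVT2[OF _ der] by metis
      have "exp (l * Q x) * \<Delta> - (exp (l * Q y) - exp (l * Q x)) / l = (exp (l * Q x) - exp (l * z)) * \<Delta>"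
        unfolding z(3) using l by (simp add: \<Delta>_def field_simps)
      then have "\<bar>exp (l * Q x) * \<Delta> - (exp (l * Q y) - exp (l * Q x)) / l\<bar> = \<bar>exp (l * z) - exp (l * Q x)\<bar> * \<Delta>"
        using \<Delta>0 by (simp add: abs_mult abs_minus_commute)
      also have "\<dots> \<le> (\<bar>l\<bar> * M * (z - Q x)) * \<Delta>"
        using z Qmono[of 0 x] Qmono[of y b] Q0 xy \<Delta>0 by (intro mult_right_mono lip) auto
      also have "\<dots> \<le> (\<bar>l\<bar> * M * \<Delta>) * \<Delta>"
        using z M0 \<Delta>0 by (intro mult_right_mono mult_left_mono) (auto simp: \<Delta>_def)
      finally show ?thesis .
    qed (simp add: \<Delta>_def)
    have "seg 0 y (\<lambda>t. v t * exp (l * Q t)) - seg 0 x (\<lambda>t. v t * exp (l * Q t)) = seg x y (\<lambda>t. v t * exp (l * Q t))"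
      using seg_combine[of 0 x y "\<lambda>t. v t * exp (l * Q t)"] int[of 0 y] xy by simp
    moreover have "seg x y (\<lambda>t. v t * (exp (l * Q t) - exp (l * Q x)))
        = seg x y (\<lambda>t. v t * exp (l * Q t)) - \<Delta> * exp (l * Q x)"
      unfolding right_diff_distrib \<Delta>_def Qd[OF xy(1,2)]
      by (subst Bochner_Integration.integral_diff) (auto intro!: int vs xy integrable_mult_left)
    ultimately have "\<Phi> y - \<Phi> x = seg x y (\<lambda>t. v t * (exp (l * Q t) - exp (l * Q x)))
        + (exp (l * Q x) * \<Delta> - (exp (l * Q y) - exp (l * Q x)) / l)"
      by (simp add: \<Phi>_def diff_divide_distrib)
    then show "norm (\<Phi> y - \<Phi> x) \<le> 2 * \<bar>l\<bar> * M * (Q y - Q x)\<^sup>2"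
      using 1 2 unfolding \<Delta>_def[symmetric] real_norm_def by (simp add: power2_eq_square mult_ac)
  qed (rule b)
  then show "seg 0 b (\<lambda>t. v t * exp (l * Q t)) = (exp (l * Q b) - 1) / l"
    by (simp add: \<Phi>_def seg_self Q0 diff_divide_distrib)
qed

section \<open>Volterra equations with integrable weight\<close>

text \<open>The integral operator with kernel \<open>k x t * V t\<close> is a contraction with
  factor 1/2 in the weighted supremum norm of \<open>u / p\<close>. With a suitable weight this
  holds for every size of \<open>V\<close>, and it treats equations integrated from 0 and from
  infinity alike. \<open>B\<close> converts weighted bounds into plain ones.\<close>

locale volterra =
  fixes k :: "real \<Rightarrow> real \<Rightarrow> complex" and V p :: "real \<Rightarrow> real" and C B :: real
  assumes V: "integrable halfline V"
    and kC: "\<And>x t. 0 \<le> x \<Longrightarrow> 0 \<le> t \<Longrightarrow> cmod (k x t) \<le> C"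
    and kmeas: "\<And>x. 0 \<le> x \<Longrightarrow> k x \<in> borel_measurable halfline"
    and kcont: "\<And>t. 0 \<le> t \<Longrightarrow> continuous_on {0..} (\<lambda>x. k x t)"
    and pcont: "continuous_on {0..} p"
    and p1: "\<And>x. 0 \<le> x \<Longrightarrow> 1 \<le> p x"
    and pB: "\<And>x. 0 \<le> x \<Longrightarrow> p x \<le> B"
    and contr: "\<And>x. 0 \<le> x \<Longrightarrow> (LINT t|halfline. cmod (k x t) * \<bar>V t\<bar> * p t) \<le> p x / 2"
begin

definition K :: "(real \<Rightarrow> complex) \<Rightarrow> real \<Rightarrow> complex" where
  "K u x = (LINT t|halfline. k x t * of_real (V t) * u t)"

lemma C_nonneg: "0 \<le> C"
  using kC[of 0 0] norm_ge_zero[of "k 0 0"] by linarith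

lemma K_meas:
  assumes "continuous_on {0..} u" "0 \<le> x"
  shows "(\<lambda>t. k x t * of_real (V t) * u t) \<in> borel_measurable halfline"
proof -
  have [measurable]: "V \<in> borel_measurable halfline" "k x \<in> borel_measurable halfline"
    "u \<in> borel_measurable halfline"
    using V kmeas[OF assms(2)] borel_measurable_continuous_halfline[OF assms(1)] by auto
  show ?thesis by measurable
qed

lemma K_norm:
  assumes G: "\<And>t. 0 \<le> t \<Longrightarrow> cmod (u t) \<le> G" and "0 \<le> x" "0 \<le> t"
  shows "norm (k x t * of_real (V t) * u t) \<le> C * \<bar>V t\<bar> * G"
  unfolding norm_mult norm_of_real
  using kC[OF assms(2,3)] G[OF assms(3)] C_nonneg by (intro mult_mono) auto

lemma K_integrable:
  assumes u: "continuous_on {0..} u" and G: "\<And>t. 0 \<le> t \<Longrightarrow> cmod (u t) \<le> G" and x: "0 \<le> x"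
  shows "integrable halfline (\<lambda>t. k x t * of_real (V t) * u t)"
proof (rule Bochner_Integration.integrable_bound[OF _ K_meas[OF u x]])
  show "integrable halfline (\<lambda>t. C * \<bar>V t\<bar> * G)" using V by simp
  show "AE t in halfline. norm (k x t * of_real (V t) * u t) \<le> norm (C * \<bar>V t\<bar> * G)"
  proof (rule AE_I2)
    fix t assume "t \<in> space halfline"
    then have "norm (k x t * of_real (V t) * u t) \<le> C * \<bar>V t\<bar> * G"
      by (intro K_norm G x) auto
    then show "norm (k x t * of_real (V t) * u t) \<le> norm (C * \<bar>V t\<bar> * G)"
      unfolding real_norm_def by (rule order_trans[OF _ abs_ge_self])
  qed
qed

lemma K_continuous:
  assumes u: "continuous_on {0..} u" and G: "\<And>t. 0 \<le> t \<Longrightarrow> cmod (u t) \<le> G"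
  shows "continuous_on {0..} (K u)"
proof (rule continuous_on_sequentiallyI)
  fix s :: "nat \<Rightarrow> real" and a
  assume s: "\<forall>n. s n \<in> {0..}" and a: "a \<in> {0..}" and lim: "s \<longlonglongrightarrow> a"
  show "(\<lambda>n. K u (s n)) \<longlonglongrightarrow> K u a"
    unfolding K_def
  proof (rule integral_dominated_convergence[where w = "\<lambda>t. C * \<bar>V t\<bar> * G"])
    show "integrable halfline (\<lambda>t. C * \<bar>V t\<bar> * G)" using V by simp
    show "(\<lambda>t. k a t * of_real (V t) * u t) \<in> borel_measurable halfline"
      using a by (intro K_meas u) auto
    show "(\<lambda>t. k (s n) t * of_real (V t) * u t) \<in> borel_measurable halfline" for n
      using s by (intro K_meas u) auto
    show "AE t in halfline. norm (k (s n) t * of_real (V t) * u t) \<le> C * \<bar>V t\<bar> * G" for n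
      using s by (intro AE_I2 K_norm G) auto
    show "AE t in halfline. (\<lambda>n. k (s n) t * of_real (V t) * u t) \<longlonglongrightarrow> k a t * of_real (V t) * u t"
    proof (rule AE_I2)
      fix t assume "t \<in> space halfline"
      then have "(\<lambda>n. k (s n) t) \<longlonglongrightarrow> k a t"
        using continuous_on_tendsto_compose[OF kcont lim, of t] s a by simp
      then show "(\<lambda>n. k (s n) t * of_real (V t) * u t) \<longlonglongrightarrow> k a t * of_real (V t) * u t"
        by (intro tendsto_intros)
    qed
  qed
qed

lemma p_pos: "0 \<le> x \<Longrightarrow> 0 < p x"
  using p1[of x] by simp

lemma weight_integrable:
  assumes "0 \<le> x" shows "integrable halfline (\<lambda>t. cmod (k x t) * \<bar>V t\<bar> * p t)"
proof (rule Bochner_Integration.integrable_bound)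
  have "continuous_on {0..} (\<lambda>t. complex_of_real (p t))" by (intro continuous_intros pcont)
  moreover have "cmod (complex_of_real (p t)) \<le> B" if "0 \<le> t" for t
    using p1[OF that] pB[OF that] by simp
  ultimately show "integrable halfline (\<lambda>t. k x t * of_real (V t) * of_real (p t))"
    by (rule K_integrable[OF _ _ assms])
  have [measurable]: "V \<in> borel_measurable halfline" "k x \<in> borel_measurable halfline"
    "p \<in> borel_measurable halfline"
    using V kmeas[OF assms] borel_measurable_continuous_halfline[OF pcont] by auto
  show "(\<lambda>t. cmod (k x t) * \<bar>V t\<bar> * p t) \<in> borel_measurable halfline" by measurable
  show "AE t in halfline. norm (cmod (k x t) * \<bar>V t\<bar> * p t) \<le> norm (k x t * of_real (V t) * of_real (p t))"
    by (intro AE_I2) (simp add: norm_mult abs_mult)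
qed

lemma K_weighted:
  assumes u: "continuous_on {0..} u" and S: "\<And>t. 0 \<le> t \<Longrightarrow> cmod (u t) \<le> S * p t" and x: "0 \<le> x"
  shows "cmod (K u x) \<le> S * p x / 2"
proof -
  have S0: "0 \<le> S"
    using S[of 0] p_pos[of 0] norm_ge_zero[of "u 0"] zero_le_mult_iff[of S "p 0"] by linarith
  have ub: "cmod (u t) \<le> S * B" if "0 \<le> t" for t
    using S[OF that] mult_left_mono[OF pB[OF that] S0] by linarith
  have "cmod (K u x) \<le> (LINT t|halfline. norm (k x t * of_real (V t) * u t))"
    unfolding K_def by (rule integral_norm_bound)
  also have "\<dots> \<le> (LINT t|halfline. S * (cmod (k x t) * \<bar>V t\<bar> * p t))"
  proof (rule integral_mono)
    show "integrable halfline (\<lambda>t. norm (k x t * of_real (V t) * u t))"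
      by (intro integrable_norm K_integrable[OF u ub x])
    show "integrable halfline (\<lambda>t. S * (cmod (k x t) * \<bar>V t\<bar> * p t))"
      by (intro integrable_mult_right weight_integrable x)
    fix t assume "t \<in> space halfline"
    then have "cmod (k x t) * \<bar>V t\<bar> * cmod (u t) \<le> cmod (k x t) * \<bar>V t\<bar> * (S * p t)"
      by (intro mult_left_mono S) auto
    then show "norm (k x t * of_real (V t) * u t) \<le> S * (cmod (k x t) * \<bar>V t\<bar> * p t)"
      by (simp add: norm_mult mult_ac)
  qed
  also have "\<dots> = S * (LINT t|halfline. cmod (k x t) * \<bar>V t\<bar> * p t)" by simp
  also have "\<dots> \<le> S * (p x / 2)" by (intro mult_left_mono contr x S0)
  finally show ?thesis by simp
qed

text \<open>The a priori bound \<open>G\<close> serves to make the weighted supremum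
  \<open>S\<close> finite, so that \<open>S \<le> a + S / 2\<close> can be solved for
  \<open>S\<close>; \<open>G\<close> does not enter the result. The estimate is later applied to
  differences of Jost solutions as well.\<close>

lemma solution_bound:
  assumes u: "continuous_on {0..} u" and G: "\<And>t. 0 \<le> t \<Longrightarrow> cmod (u t) \<le> G"
    and g: "\<And>x. 0 \<le> x \<Longrightarrow> cmod (u x - K u x) \<le> a" and x: "0 \<le> x"
  shows "cmod (u x) \<le> 2 * a * B"
proof -
  define S where "S = (SUP x\<in>{0..}. cmod (u x) / p x)"
  have bdd: "bdd_above ((\<lambda>x. cmod (u x) / p x) ` {0..})"
  proof (rule bdd_aboveI2)
    fix x :: real assume "x \<in> {0..}"
    then have x: "0 \<le> x" by simp
    have "cmod (u x) / p x \<le> cmod (u x) / 1"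
      using p1[OF x] by (intro divide_left_mono) auto
    then show "cmod (u x) / p x \<le> G" using G[OF x] by simp
  qed
  have up: "cmod (u t) \<le> S * p t" if "0 \<le> t" for t
  proof -
    have "cmod (u t) / p t \<le> S" unfolding S_def using that by (intro cSUP_upper bdd) auto
    then show ?thesis using p_pos[OF that] by (simp add: pos_divide_le_eq)
  qed
  have a0: "0 \<le> a" using g[of 0] norm_ge_zero[of "u 0 - K u 0"] by linarith
  have "S \<le> a + S / 2"
    unfolding S_def
  proof (rule cSUP_least)
    fix x :: real assume "x \<in> {0..}"
    then have x: "0 \<le> x" by simp
    have "cmod (u x) \<le> cmod (u x - K u x) + cmod (K u x)"
      using norm_triangle_ineq[of "u x - K u x" "K u x"] by simp
    also have "\<dots> \<le> a + S * p x / 2"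
      by (intro add_mono g x K_weighted[OF u up])
    also have "\<dots> \<le> (a + S / 2) * p x"
      using mult_left_mono[OF p1[OF x] a0] by (simp add: algebra_simps)
    finally show "cmod (u x) / p x \<le> a + (SUP x\<in>{0..}. cmod (u x) / p x) / 2"
      using p_pos[OF x] by (simp add: pos_divide_le_eq S_def)
  qed simp
  then have S: "S \<le> 2 * a" by simp
  have "cmod (u x) \<le> S * p x" by (rule up[OF x])
  also have "\<dots> \<le> 2 * a * p x" using S p_pos[OF x] by (intro mult_right_mono) auto
  also have "\<dots> \<le> 2 * a * B" using a0 by (intro mult_left_mono pB x) auto
  finally show ?thesis .
qed

text \<open>Banach's fixed point theorem for \<open>w = u / p\<close> in the space of bounded
  continuous functions. Its elements live on the whole line, so \<open>max x 0\<close> extends the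
  values constantly to negative arguments.\<close>

lemma solution_exists:
  assumes g: "continuous_on {0..} g" and a: "\<And>x. 0 \<le> x \<Longrightarrow> cmod (g x) \<le> a"
  shows "\<exists>u. continuous_on {0..} u \<and> (\<forall>x\<ge>0. cmod (u x) \<le> 2 * a * B) \<and> (\<forall>x\<ge>0. u x = g x + K u x)"
proof -
  define W where "W w t = complex_of_real (p t) * apply_bcontfun w t" for w t
  have Wc: "continuous_on {0..} (W w)" for w
    unfolding W_def by (intro continuous_on_mult continuous_on_of_real pcont continuous_on_apply_bcontfun)
  have Wn: "cmod (W w t) \<le> norm w * p t" if "0 \<le> t" for w t
  proof -
    have "cmod (W w t) = p t * cmod (apply_bcontfun w t)"
      using p_pos[OF that] by (simp add: W_def norm_mult)
    also have "\<dots> \<le> p t * norm w"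
      using p_pos[OF that] by (intro mult_left_mono norm_bounded) auto
    finally show ?thesis by (simp add: mult.commute)
  qed
  have Wb: "cmod (W w t) \<le> norm w * B" if "0 \<le> t" for w t
    using Wn[OF that, of w] mult_left_mono[OF pB[OF that] norm_ge_zero[of w]] by linarith
  define F where "F w x = (g x + K (W w) x) / of_real (p x)" for w x
  have Fc: "continuous_on {0..} (F w)" for w
    unfolding F_def
    by (intro continuous_intros g pcont K_continuous[OF Wc Wb]) (auto dest: p_pos)
  have a0: "0 \<le> a" using a[of 0] norm_ge_zero[of "g 0"] by linarith
  have Fn: "cmod (F w x) \<le> a + norm w / 2" if "0 \<le> x" for w x
  proof -
    have "cmod (g x + K (W w) x) \<le> a + norm w * p x / 2"
      by (rule order_trans[OF norm_triangle_ineq add_mono[OF a[OF that] K_weighted[OF Wc Wn that]]])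
    also have "\<dots> \<le> (a + norm w / 2) * p x"
      using mult_left_mono[OF p1[OF that] a0] by (simp add: algebra_simps)
    finally show ?thesis using p_pos[OF that] by (simp add: F_def norm_divide pos_divide_le_eq)
  qed
  have cmax: "continuous_on UNIV (\<lambda>x::real. max x 0)"
    by (intro continuous_intros)
  have Fb: "(\<lambda>x. F w (max x 0)) \<in> bcontfun" for w
  proof (rule bcontfun_normI)
    show "continuous_on UNIV (\<lambda>x. F w (max x 0))"
      by (rule continuous_on_compose2[OF Fc cmax]) auto
    show "cmod (F w (max x 0)) \<le> a + norm w / 2" for x by (rule Fn) simp
  qed
  define \<Phi> where "\<Phi> w = Bcontfun (\<lambda>x. F w (max x 0))" for w
  have \<Phi>: "apply_bcontfun (\<Phi> w) x = F w (max x 0)" for w x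
    unfolding \<Phi>_def by (simp add: Bcontfun_inverse[OF Fb])
  have "\<exists>!w. \<Phi> w = w"
  proof (rule banach_fix_type[of "1/2"]; (intro allI)?)
    fix w v
    show "dist (\<Phi> w) (\<Phi> v) \<le> 1 / 2 * dist w v"
    proof (rule dist_bound)
      fix x :: real
      define y where "y = max x 0"
      have y: "0 \<le> y" by (simp add: y_def)
      have i: "integrable halfline (\<lambda>t. k y t * of_real (V t) * W w t)" for w
        by (rule K_integrable[OF Wc Wb y])
      have "K (W w) y - K (W v) y = (LINT t|halfline. k y t * of_real (V t) * W w t - k y t * of_real (V t) * W v t)"
        unfolding K_def by (rule Bochner_Integration.integral_diff[OF i i, symmetric])
      also have "\<dots> = K (W (w - v)) y"
        unfolding K_def by (intro Bochner_Integration.integral_cong) (simp_all add: W_def algebra_simps)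
      finally have "K (W w) y - K (W v) y = K (W (w - v)) y" .
      then have "F w y - F v y = K (W (w - v)) y / of_real (p y)"
        by (simp add: F_def diff_divide_distrib[symmetric])
      moreover have "cmod (K (W (w - v)) y) \<le> norm (w - v) * p y / 2"
        by (rule K_weighted[OF Wc Wn y])
      ultimately have "cmod (F w y - F v y) \<le> norm (w - v) / 2"
        using p_pos[OF y] by (simp add: norm_divide pos_divide_le_eq)
      then show "dist (apply_bcontfun (\<Phi> w) x) (apply_bcontfun (\<Phi> v) x) \<le> 1 / 2 * dist w v"
        by (simp add: \<Phi> dist_norm y_def)
    qed
  qed auto
  then obtain w where w: "\<Phi> w = w" by blast
  have eq: "W w x = g x + K (W w) x" if "0 \<le> x" for x
  proof -
    have "apply_bcontfun w x = F w x" using \<Phi>[of w x] that by (simp add: w)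
    then show ?thesis using p_pos[OF that] by (simp add: W_def F_def)
  qed
  have "cmod (W w x) \<le> 2 * a * B" if "0 \<le> x" for x
  proof (rule solution_bound[OF Wc Wb _ that])
    fix y :: real assume y: "0 \<le> y"
    have "W w y - K (W w) y = g y" by (subst eq[OF y]) simp
    then show "cmod (W w y - K (W w) y) \<le> a" using a[OF y] by simp
  qed
  then show ?thesis using Wc eq by blast
qed

end

lemma seg_V_integrable:
  assumes "integrable halfline V" shows "seg_integrable 0 x (\<lambda>t. \<bar>V t :: real\<bar>)"
  using assms by (intro halfline_seg_integrable) auto

lemma seg_le_total:
  fixes v :: "real \<Rightarrow> real"
  assumes "integrable halfline v" "\<And>t. 0 \<le> v t"
  shows "seg 0 x v \<le> (LINT t|halfline. v t)"
  unfolding seg_halfline[OF order_refl] using assms integrable_mult_indicator[OF Icc_sets_halfline[OF order_refl] assms(1)]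
  by (intro integral_mono) (auto simp: indicator_def)

lemma seg_nonneg:
  fixes v :: "real \<Rightarrow> real"
  assumes "\<And>t. 0 \<le> v t"
  shows "0 \<le> seg a b v"
  by (rule Bochner_Integration.integral_nonneg) (rule assms)

text \<open>For this weight \<open>p\<close>, the integral of
  \<open>C * \<bar>V t\<bar> * p t\<close> over \<open>{0..x}\<close> is
  \<open>(p x - 1) / 2\<close>; the factor 2 in the exponent produces the contraction factor
  1/2.\<close>

lemma volterra_forward:
  assumes V: "integrable halfline V" and C: "0 < C"
    and kC: "\<And>x t. 0 \<le> x \<Longrightarrow> 0 \<le> t \<Longrightarrow> cmod (k x t) \<le> C"
    and kmeas: "\<And>x. 0 \<le> x \<Longrightarrow> k x \<in> borel_measurable halfline"
    and kcont: "\<And>t. 0 \<le> t \<Longrightarrow> continuous_on {0..} (\<lambda>x. k x t)"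
    and kz: "\<And>x t. x < t \<Longrightarrow> k x t = 0"
  shows "volterra k V (\<lambda>x. exp (2 * C * seg 0 x (\<lambda>t. \<bar>V t\<bar>))) C (exp (2 * C * (LINT t|halfline. \<bar>V t\<bar>)))"
proof -
  define Q where "Q x = seg 0 x (\<lambda>t. \<bar>V t\<bar>)" for x
  have Vs: "seg_integrable 0 x (\<lambda>t. \<bar>V t\<bar>)" for x by (rule seg_V_integrable[OF V])
  have Qc: "continuous_on {0..} Q" unfolding Q_def by (rule continuous_on_seg[OF Vs])
  have Q0: "0 \<le> Q x" for x unfolding Q_def by (rule seg_nonneg) simp
  have QB: "Q x \<le> (LINT t|halfline. \<bar>V t\<bar>)" for x
    unfolding Q_def by (rule seg_le_total) (use V in auto)
  have "volterra k V (\<lambda>x. exp (2 * C * Q x)) C (exp (2 * C * (LINT t|halfline. \<bar>V t\<bar>)))"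
  proof
    show "continuous_on {0..} (\<lambda>x. exp (2 * C * Q x))" by (intro continuous_intros Qc)
    show "1 \<le> exp (2 * C * Q x)" for x using Q0[of x] C by simp
    show "exp (2 * C * Q x) \<le> exp (2 * C * (LINT t|halfline. \<bar>V t\<bar>))" for x using QB[of x] C by simp
    fix x :: real assume x: "0 \<le> x"
    note se = seg_exp[OF Vs, of "2 * C" x, folded Q_def]
    have int: "integrable halfline (\<lambda>t. C * (indicator {0..x} t *\<^sub>R (\<bar>V t\<bar> * exp (2 * C * Q t))))"
      using se(2) C x seg_integrable_halfline_iff[of 0 x "\<lambda>t. \<bar>V t\<bar> * exp (2 * C * Q t)"] by (intro integrable_mult_right) auto
    have "(LINT t|halfline. cmod (k x t) * \<bar>V t\<bar> * exp (2 * C * Q t))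
        \<le> (LINT t|halfline. C * (indicator {0..x} t *\<^sub>R (\<bar>V t\<bar> * exp (2 * C * Q t))))"
    proof (rule integral_mono'[OF int])
      fix t assume "t \<in> space halfline"
      then have "cmod (k x t) \<le> C * indicator {0..x} t"
        using kz[of x t] kC[OF x, of t] by (auto simp: indicator_def)
      then have "cmod (k x t) * (\<bar>V t\<bar> * exp (2 * C * Q t)) \<le> C * indicator {0..x} t * (\<bar>V t\<bar> * exp (2 * C * Q t))"
        by (intro mult_right_mono) auto
      then show "cmod (k x t) * \<bar>V t\<bar> * exp (2 * C * Q t) \<le> C * (indicator {0..x} t *\<^sub>R (\<bar>V t\<bar> * exp (2 * C * Q t)))"
        by (simp add: mult_ac)
      show "0 \<le> C * (indicator {0..x} t *\<^sub>R (\<bar>V t\<bar> * exp (2 * C * Q t)))"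
        using C by (auto simp: indicator_def)
    qed
    also have "\<dots> = C * seg 0 x (\<lambda>t. \<bar>V t\<bar> * exp (2 * C * Q t))"
      by (simp add: seg_halfline)
    also have "\<dots> \<le> exp (2 * C * Q x) / 2"
      using se(1) C x by (simp add: field_simps)
    finally show "(LINT t|halfline. cmod (k x t) * \<bar>V t\<bar> * exp (2 * C * Q t)) \<le> exp (2 * C * Q x) / 2" .
  qed (use V kC kmeas kcont in auto)
  then show ?thesis by (simp add: Q_def)
qed

text \<open>The exponent now contains the mass \<open>N - Q x\<close> of \<open>V\<close> beyond
  \<open>x\<close>, so that the weight decreases to 1 at infinity and the integral of
  \<open>C * \<bar>V t\<bar> * p t\<close> beyond \<open>x\<close> is at most
  \<open>(p x - 1) / 2\<close>.\<close>

lemma volterra_backward: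
  assumes V: "integrable halfline V" and C: "0 < C"
    and kC: "\<And>x t. 0 \<le> x \<Longrightarrow> 0 \<le> t \<Longrightarrow> cmod (k x t) \<le> C"
    and kmeas: "\<And>x. 0 \<le> x \<Longrightarrow> k x \<in> borel_measurable halfline"
    and kcont: "\<And>t. 0 \<le> t \<Longrightarrow> continuous_on {0..} (\<lambda>x. k x t)"
    and kz: "\<And>x t. t < x \<Longrightarrow> k x t = 0"
  defines "N \<equiv> (LINT t|halfline. \<bar>V t\<bar>)"
  shows "volterra k V (\<lambda>x. exp (2 * C * (N - seg 0 x (\<lambda>t. \<bar>V t\<bar>)))) C (exp (2 * C * N))"
proof -
  define Q where "Q x = seg 0 x (\<lambda>t. \<bar>V t\<bar>)" for x
  have Va: "integrable halfline (\<lambda>t. \<bar>V t\<bar>)" using V by simp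
  have Vs: "seg_integrable 0 x (\<lambda>t. \<bar>V t\<bar>)" for x by (rule seg_V_integrable[OF V])
  have Qc: "continuous_on {0..} Q" unfolding Q_def by (rule continuous_on_seg[OF Vs])
  have Q0: "0 \<le> Q x" for x unfolding Q_def by (rule seg_nonneg) simp
  have QN: "Q x \<le> N" for x
    unfolding Q_def N_def by (rule seg_le_total) (use V in auto)
  define h where "h t = \<bar>V t\<bar> * exp (2 * C * (N - Q t))" for t
  have heq: "h t = exp (2 * C * N) * (\<bar>V t\<bar> * exp (- (2 * C) * Q t))" for t
    by (simp add: h_def exp_add[symmetric] algebra_simps)
  have h0: "0 \<le> h t" for t by (simp add: h_def)
  have hint: "integrable halfline h"
  proof (rule Bochner_Integration.integrable_bound)
    show "integrable halfline (\<lambda>t. \<bar>V t\<bar> * exp (2 * C * N))" using Va by simp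
    have [measurable]: "V \<in> borel_measurable halfline" "Q \<in> borel_measurable halfline"
      using V borel_measurable_continuous_halfline[OF Qc] by auto
    show "h \<in> borel_measurable halfline" unfolding h_def by measurable
    have "\<bar>V t\<bar> * exp (2 * C * (N - Q t)) \<le> \<bar>V t\<bar> * exp (2 * C * N)" for t
      using Q0[of t] C by (intro mult_left_mono) auto
    then show "AE t in halfline. norm (h t) \<le> norm (\<bar>V t\<bar> * exp (2 * C * N))"
      by (intro AE_I2) (simp add: h_def)
  qed
  have hseg: "seg 0 x h = (exp (2 * C * N) - exp (2 * C * (N - Q x))) / (2 * C)" if x: "0 \<le> x" for x
  proof -
    have "seg 0 x h = exp (2 * C * N) * seg 0 x (\<lambda>t. \<bar>V t\<bar> * exp (- (2 * C) * Q t))"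
      unfolding heq by simp
    also have "seg 0 x (\<lambda>t. \<bar>V t\<bar> * exp (- (2 * C) * Q t)) = (exp (- (2 * C) * Q x) - 1) / (- (2 * C))"
      unfolding Q_def using C x by (intro seg_exp Vs) auto
    also have "exp (2 * C * N) * ((exp (- (2 * C) * Q x) - 1) / (- (2 * C)))
        = (exp (2 * C * N) - exp (2 * C * N) * exp (- (2 * C) * Q x)) / (2 * C)"
      using C by (simp add: field_simps)
    also have "exp (2 * C * N) * exp (- (2 * C) * Q x) = exp (2 * C * (N - Q x))"
      by (simp add: exp_add[symmetric] algebra_simps)
    finally show ?thesis .
  qed
  have htot: "(LINT t|halfline. h t) \<le> exp (2 * C * N) / (2 * C) - 1 / (2 * C)"
  proof (rule tendsto_upperbound[OF tendsto_seg_halfline[OF hint]])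
    have "seg 0 X h \<le> exp (2 * C * N) / (2 * C) - 1 / (2 * C)" if "0 \<le> X" for X
    proof -
      have "1 \<le> exp (2 * C * (N - Q X))" using QN[of X] C by simp
      then show ?thesis unfolding hseg[OF that] using C by (simp add: field_simps)
    qed
    then show "\<forall>\<^sub>F X in at_top. seg 0 X h \<le> exp (2 * C * N) / (2 * C) - 1 / (2 * C)"
      by (intro eventually_mono[OF eventually_ge_at_top[of 0]])
  qed simp
  have "volterra k V (\<lambda>x. exp (2 * C * (N - Q x))) C (exp (2 * C * N))"
  proof
    show "continuous_on {0..} (\<lambda>x. exp (2 * C * (N - Q x)))" by (intro continuous_intros Qc)
    show "1 \<le> exp (2 * C * (N - Q x))" for x using QN[of x] C by simp
    show "exp (2 * C * (N - Q x)) \<le> exp (2 * C * N)" for x using Q0[of x] C by simp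
    fix x :: real assume x: "0 \<le> x"
    have int0: "integrable halfline (\<lambda>t. indicator {0..x} t *\<^sub>R h t)"
      by (intro integrable_mult_indicator Icc_sets_halfline hint) simp
    have "(LINT t|halfline. cmod (k x t) * \<bar>V t\<bar> * exp (2 * C * (N - Q t)))
        \<le> (LINT t|halfline. C * (h t - indicator {0..x} t *\<^sub>R h t))"
    proof (rule integral_mono_AE')
      show "integrable halfline (\<lambda>t. C * (h t - indicator {0..x} t *\<^sub>R h t))"
        by (intro integrable_mult_right Bochner_Integration.integrable_diff hint int0)
      \<comment> \<open>At \<open>t = x\<close> the kernel may be nonzero while the indicator
        already removes the right-hand side; the comparison therefore holds almost everywhere
        only.\<close>
      have "AE t in lebesgue. t \<noteq> x"
        by (rule AE_completion) (rule AE_lborel_singleton)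
      then have ne: "AE t in halfline. t \<noteq> x"
        by (subst AE_restrict_space_iff) auto
      show "AE t in halfline. cmod (k x t) * \<bar>V t\<bar> * exp (2 * C * (N - Q t)) \<le> C * (h t - indicator {0..x} t *\<^sub>R h t)"
        using ne AE_space
      proof eventually_elim
        case (elim t)
        then have "cmod (k x t) \<le> C * (1 - indicator {0..x} t)"
          using kz[of t x] kC[OF x, of t] by (auto simp: indicator_def)
        then have "cmod (k x t) * h t \<le> C * (1 - indicator {0..x} t) * h t"
          by (intro mult_right_mono h0)
        then show ?case by (simp add: h_def algebra_simps)
      qed
      show "AE t in halfline. 0 \<le> C * (h t - indicator {0..x} t *\<^sub>R h t)"
        using C h0 by (intro AE_I2) (auto simp: indicator_def)
    qed
    also have "\<dots> = C * ((LINT t|halfline. h t) - seg 0 x h)"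
      using hint int0 by (simp add: seg_halfline)
    also have "\<dots> \<le> C * ((exp (2 * C * N) / (2 * C) - 1 / (2 * C)) - (exp (2 * C * N) - exp (2 * C * (N - Q x))) / (2 * C))"
      unfolding hseg[OF x] using C htot by (intro mult_left_mono) auto
    also have "\<dots> \<le> exp (2 * C * (N - Q x)) / 2"
      using C by (simp add: field_simps)
    finally show "(LINT t|halfline. cmod (k x t) * \<bar>V t\<bar> * exp (2 * C * (N - Q t))) \<le> exp (2 * C * (N - Q x)) / 2" .
  qed (use V kC kmeas kcont in auto)
  then show ?thesis by (simp add: Q_def)
qed

section \<open>Solutions of the Schroedinger equation\<close>

text \<open>A first-order system in which \<open>p\<close> is the derivative of \<open>u\<close>.
  Since the second derivative enters only through its integral, it can be prescribed at every point,
  which disposes of the exceptional null set.\<close>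

definition sol :: "(real \<Rightarrow> real) \<Rightarrow> complex \<Rightarrow> (real \<Rightarrow> complex) \<Rightarrow> (real \<Rightarrow> complex) \<Rightarrow> bool" where
  "sol V \<zeta> u p \<longleftrightarrow> locally_ac_deriv u p \<and> locally_ac_deriv p (\<lambda>x. (of_real (V x) - \<zeta>\<^sup>2) * u x)"

lemma sol_cong:
  assumes "sol V \<zeta> u p" "\<And>x. 0 \<le> x \<Longrightarrow> u x = v x" "\<And>x. 0 \<le> x \<Longrightarrow> p x = r x"
  shows "sol V \<zeta> v r"
proof -
  note u = assms(1)[unfolded sol_def]
  have "locally_ac_deriv v r"
    by (rule locally_ac_deriv_cong[OF conjunct1[OF u] assms(2,3)])
  moreover have "locally_ac_deriv r (\<lambda>x. (of_real (V x) - \<zeta>\<^sup>2) * v x)"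
    by (rule locally_ac_deriv_cong[OF conjunct2[OF u] assms(3)]) (simp_all add: assms(2))
  ultimately show ?thesis unfolding sol_def by blast
qed

lemma sol_continuous:
  assumes "sol V \<zeta> u p" shows "continuous_on {0..} u" "continuous_on {0..} p"
  using assms unfolding sol_def by (auto intro: locally_ac_deriv_continuous)

lemma sol_cmult: "sol V \<zeta> u p \<Longrightarrow> sol V \<zeta> (\<lambda>x. c * u x) (\<lambda>x. c * p x)"
  using locally_ac_deriv_cmult[of u p c] locally_ac_deriv_cmult[of p _ c]
  unfolding sol_def by (force simp: mult.left_commute)

text \<open>This makes one-sided derivatives unique, in particular at the endpoint 0.\<close>

lemma at_within_halfline_neq_bot:
  assumes "0 \<le> x" shows "at x within {0::real..} \<noteq> bot"
proof -
  have "x islimpt {0..}"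
    unfolding islimpt_approachable
  proof (intro allI impI)
    fix e :: real assume "0 < e"
    then show "\<exists>y\<in>{0..}. y \<noteq> x \<and> dist y x < e"
      using assms by (intro bexI[of _ "x + e / 2"]) (auto simp: dist_real_def)
  qed
  then show ?thesis by (simp add: trivial_limit_within)
qed

lemma hderiv_eqI: "(u has_vector_derivative p) (at x within {0..}) \<Longrightarrow> 0 \<le> x \<Longrightarrow> hderiv u x = p"
  by (rule vector_derivative_within[OF at_within_halfline_neq_bot])

lemma sol_hderiv:
  assumes "sol V \<zeta> u p" "0 \<le> x"
  shows "(u has_vector_derivative p x) (at x within {0..})" "hderiv u x = p x"
proof -
  show "(u has_vector_derivative p x) (at x within {0..})"
    using assms sol_continuous[OF assms(1)]
    by (intro locally_ac_deriv_has_vector_derivative) (auto simp: sol_def)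
  then show "hderiv u x = p x"
    using assms(2) by (rule hderiv_eqI)
qed

lemma sol_is_solution:
  assumes "sol V \<zeta> u p" shows "is_solution V \<zeta> u"
  unfolding is_solution_def
proof (intro conjI allI impI exI[of _ "\<lambda>x. (of_real (V x) - \<zeta>\<^sup>2) * u x"])
  show "u differentiable (at x within {0..})" if "0 \<le> x" for x
    using sol_hderiv(1)[OF assms that] by (rule differentiableI_vector)
  show "continuous_on {0..} (hderiv u)"
    using sol_continuous(2)[OF assms] by (rule continuous_on_eq) (simp add: sol_hderiv(2)[OF assms])
  show "locally_ac_deriv (hderiv u) (\<lambda>x. (of_real (V x) - \<zeta>\<^sup>2) * u x)"
    by (rule locally_ac_deriv_cong[OF conjunct2[OF assms[unfolded sol_def]]])
       (simp_all add: sol_hderiv(2)[OF assms])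
  show "AE x in halfline. - ((of_real (V x) - \<zeta>\<^sup>2) * u x) + of_real (V x) * u x = \<zeta>\<^sup>2 * u x"
    by (intro AE_I2) (simp add: algebra_simps)
qed

text \<open>The given second derivative agrees with \<open>(V - \<zeta>\<^sup>2) * u\<close> up to a
  null set, which the integral does not see.\<close>

lemma is_solution_sol:
  assumes V: "integrable halfline V" and u: "is_solution V \<zeta> u"
  shows "sol V \<zeta> u (hderiv u)"
proof -
  have d: "(u has_vector_derivative hderiv u x) (at x within {0..})" if "0 \<le> x" for x
    using u that by (simp add: is_solution_def vector_derivative_works)
  have c: "continuous_on {0..} (hderiv u)" using u by (simp add: is_solution_def)
  have ac: "locally_ac_deriv u (hderiv u)" by (rule locally_ac_deriv_C1[OF d c])
  obtain u'' where u'': "locally_ac_deriv (hderiv u) u''"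
    "AE x in halfline. - u'' x + complex_of_real (V x) * u x = \<zeta>\<^sup>2 * u x"
    using u by (auto simp: is_solution_def)
  have cu: "continuous_on {0..} u" by (rule locally_ac_deriv_continuous[OF ac])
  have "AE x in lebesgue. x \<in> {0..} \<longrightarrow> u'' x = (of_real (V x) - \<zeta>\<^sup>2) * u x"
    using u''(2) by (subst (asm) AE_restrict_space_iff) (auto simp: algebra_simps elim!: eventually_mono)
  then have ae: "AE x in lebesgue_on {0..b}. u'' x = (of_real (V x) - \<zeta>\<^sup>2) * u x" for b
    by (subst AE_restrict_space_iff) (auto elim!: eventually_mono)
  have int: "seg_integrable 0 b (\<lambda>x. (of_real (V x) - \<zeta>\<^sup>2) * u x)" for b
  proof -
    have "seg_integrable 0 b (\<lambda>x. complex_of_real (V x))"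
      using V by (intro halfline_seg_integrable integrable_of_real) auto
    moreover have "seg_integrable 0 b (\<lambda>x. \<zeta>\<^sup>2)"
      by (rule seg_integrable_continuous) auto
    ultimately have "seg_integrable 0 b (\<lambda>x. of_real (V x) - \<zeta>\<^sup>2)"
      by (rule Bochner_Integration.integrable_diff)
    then show ?thesis
      by (rule seg_integrable_mult) (auto intro: continuous_on_subset[OF cu])
  qed
  have "locally_ac_deriv (hderiv u) (\<lambda>x. (of_real (V x) - \<zeta>\<^sup>2) * u x)"
  proof (rule locally_ac_derivI[OF int])
    fix x :: real assume x: "0 \<le> x"
    have "seg 0 x u'' = seg 0 x (\<lambda>x. (of_real (V x) - \<zeta>\<^sup>2) * u x)"
      using locally_ac_derivD(2)[OF u''(1) x] int
      by (intro integral_cong_AE borel_measurable_integrable ae)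
    then show "hderiv u x = hderiv u 0 + seg 0 x (\<lambda>x. (of_real (V x) - \<zeta>\<^sup>2) * u x)"
      using locally_ac_derivD(1)[OF u''(1) x] by simp
  qed
  then show ?thesis using ac by (simp add: sol_def)
qed

text \<open>Potential and spectral parameter may both differ. Equal potentials are used for the
  derivative of the Jost function, equal parameters for the trace integral, and when both agree the
  Wronskian is constant.\<close>

lemma wronskian_ac:
  assumes "sol V1 \<zeta> u p" "sol V2 \<eta> v r"
  shows "locally_ac_deriv (\<lambda>x. p x * v x - r x * u x)
    (\<lambda>x. (of_real (V1 x - V2 x) - (\<zeta>\<^sup>2 - \<eta>\<^sup>2)) * (u x * v x))"
proof -
  have "locally_ac_deriv (\<lambda>x. p x * v x - r x * u x)
    (\<lambda>x. ((of_real (V1 x) - \<zeta>\<^sup>2) * u x * v x + p x * r x) - ((of_real (V2 x) - \<eta>\<^sup>2) * v x * u x + r x * p x))"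
    using assms unfolding sol_def by (intro locally_ac_deriv_diff' locally_ac_deriv_mult) auto
  then show ?thesis
    by (rule locally_ac_deriv_cong) (simp_all add: algebra_simps)
qed

lemma wronskian_const:
  assumes "sol V \<zeta> u p" "sol V \<zeta> v r" "0 \<le> x"
  shows "p x * v x - r x * u x = p 0 * v 0 - r 0 * u 0"
  using locally_ac_derivD(1)[OF wronskian_ac[OF assms(1,2)] assms(3)] by simp

text \<open>Uniqueness as linear algebra: the Wronskians of \<open>u\<close> and of \<open>v\<close>
  with \<open>f\<close> agree at \<open>a\<close>, hence at \<open>x\<close>, and likewise with
  \<open>g\<close>. The two resulting linear equations for the differences at \<open>x\<close> have
  the nonzero Wronskian of \<open>f\<close> and \<open>g\<close> as determinant.\<close>

lemma sol_unique:
  assumes f: "sol V \<zeta> f f'" "sol V \<zeta> g g'" "f' 0 * g 0 - g' 0 * f 0 \<noteq> 0"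
    and u: "sol V \<zeta> u p" and v: "sol V \<zeta> v r" and a: "0 \<le> a" "u a = v a" "p a = r a" and x: "0 \<le> x"
  shows "u x = v x" "p x = r x"
proof -
  have *: "f' x * (u x - v x) = (p x - r x) * f x" if f: "sol V \<zeta> f f'" for f f'
  proof -
    have W: "f' x * u x - p x * f x = f' a * u a - p a * f a" "f' x * v x - r x * f x = f' a * v a - r a * f a"
      using wronskian_const[OF f u x] wronskian_const[OF f u a(1)]
        wronskian_const[OF f v x] wronskian_const[OF f v a(1)] by simp_all
    then have "f' x * u x - p x * f x = f' x * v x - r x * f x" using a by simp
    then show ?thesis by (simp add: algebra_simps)
  qed
  have W: "f' x * g x - g' x * f x \<noteq> 0"
    using wronskian_const[OF f(1,2) x] f(3) by simp
  have "(f' x * g x - g' x * f x) * (u x - v x) = 0"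
    using *[OF f(1)] *[OF f(2)] by algebra
  then show uv: "u x = v x" using W by simp
  have "(f' x * g x - g' x * f x) * (p x - r x) = 0"
    using *[OF f(1)] *[OF f(2)] by algebra
  then show "p x = r x" using W by simp
qed

section \<open>Variation of constants and the Volterra kernels\<close>

lemma locally_ac_deriv_exp: "locally_ac_deriv (\<lambda>x. exp (c * of_real x)) (\<lambda>x. c * exp (c * of_real x))"
proof (rule locally_ac_deriv_C1)
  fix x :: real
  have "((\<lambda>z. exp (c * z)) has_field_derivative c * exp (c * of_real x)) (at (of_real x))"
    by (auto intro!: derivative_eq_intros)
  then show "((\<lambda>x. exp (c * of_real x)) has_vector_derivative c * exp (c * of_real x)) (at x within {0..})"
    by (rule has_vector_derivative_real_field)
qed (intro continuous_intros)

text \<open>In the derivative of \<open>u\<close> the terms containing the derivatives of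
  \<open>a\<close> and \<open>b\<close> cancel, so \<open>p\<close> is formed as if \<open>a\<close>
  and \<open>b\<close> were constant; in the derivative of \<open>p\<close> the same terms add up to
  \<open>V u\<close>.\<close>

lemma variation_of_constants:
  assumes z: "\<zeta> \<noteq> 0"
    and a: "locally_ac_deriv a (\<lambda>t. exp (- (\<i> * \<zeta>) * of_real t) * (of_real (V t) * u t))"
    and b: "locally_ac_deriv b (\<lambda>t. exp (\<i> * \<zeta> * of_real t) * (of_real (V t) * u t))"
    and u: "\<And>x. 0 \<le> x \<Longrightarrow> u x = (exp (\<i> * \<zeta> * of_real x) * a x - exp (- (\<i> * \<zeta>) * of_real x) * b x) / (2 * \<i> * \<zeta>)"
    and p: "\<And>x. 0 \<le> x \<Longrightarrow> p x = (exp (\<i> * \<zeta> * of_real x) * a x + exp (- (\<i> * \<zeta>) * of_real x) * b x) / 2"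
  shows "sol V \<zeta> u p"
proof -
  let ?e = "\<lambda>x. exp (\<i> * \<zeta> * complex_of_real x)" and ?f = "\<lambda>x. exp (- (\<i> * \<zeta>) * complex_of_real x)"
  let ?h = "\<lambda>x. of_real (V x) * u x"
  have ef: "?e x * (?f x * y) = y" "?f x * (?e x * y) = y" for x y
    by (simp_all add: mult.assoc[symmetric] exp_add[symmetric])
  have E: "locally_ac_deriv (\<lambda>x. ?e x * a x) (\<lambda>x. \<i> * \<zeta> * ?e x * a x + ?e x * (?f x * ?h x))"
    by (rule locally_ac_deriv_mult[OF locally_ac_deriv_exp a])
  have F: "locally_ac_deriv (\<lambda>x. ?f x * b x) (\<lambda>x. - (\<i> * \<zeta>) * ?f x * b x + ?f x * (?e x * ?h x))"
    by (rule locally_ac_deriv_mult[OF locally_ac_deriv_exp b])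
  have "locally_ac_deriv (\<lambda>x. 1 / (2 * \<i> * \<zeta>) * (?e x * a x - ?f x * b x))
      (\<lambda>x. 1 / (2 * \<i> * \<zeta>) * ((\<i> * \<zeta> * ?e x * a x + ?e x * (?f x * ?h x)) - (- (\<i> * \<zeta>) * ?f x * b x + ?f x * (?e x * ?h x))))"
    by (intro locally_ac_deriv_cmult locally_ac_deriv_diff' E F)
  then have 1: "locally_ac_deriv u p"
    by (rule locally_ac_deriv_cong) (use z in \<open>simp_all add: u p ef field_simps\<close>)
  have "locally_ac_deriv (\<lambda>x. 1 / 2 * (?e x * a x + ?f x * b x))
      (\<lambda>x. 1 / 2 * ((\<i> * \<zeta> * ?e x * a x + ?e x * (?f x * ?h x)) + (- (\<i> * \<zeta>) * ?f x * b x + ?f x * (?e x * ?h x))))"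
    by (intro locally_ac_deriv_cmult locally_ac_deriv_add E F)
  then have 2: "locally_ac_deriv p (\<lambda>x. (of_real (V x) - \<zeta>\<^sup>2) * u x)"
  proof (rule locally_ac_deriv_cong)
    fix x :: real assume x: "0 \<le> x"
    show "1 / 2 * (?e x * a x + ?f x * b x) = p x" by (simp add: p[OF x])
    have "\<i> * \<zeta> * ?e x * a x - \<i> * \<zeta> * ?f x * b x = 2 * (- \<zeta>\<^sup>2 * u x)"
      using z by (simp add: u[OF x] field_simps power2_eq_square)
    then show "1 / 2 * ((\<i> * \<zeta> * ?e x * a x + ?e x * (?f x * ?h x)) + (- (\<i> * \<zeta>) * ?f x * b x + ?f x * (?e x * ?h x)))
        = (of_real (V x) - \<zeta>\<^sup>2) * u x"
      unfolding ef by (simp add: algebra_simps)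
  qed
  from 1 2 show ?thesis by (simp add: sol_def)
qed

text \<open>This is \<open>sin (\<zeta> s) / \<zeta>\<close>, the kernel of the free equation,
  multiplied by \<open>exp (i \<zeta> s)\<close>. The factor makes it bounded for
  \<open>s \<ge> 0\<close> in the upper half-plane.\<close>

definition green_kernel :: "complex \<Rightarrow> real \<Rightarrow> complex" where
  "green_kernel \<zeta> s = (exp (2 * \<i> * \<zeta> * of_real s) - 1) / (2 * \<i> * \<zeta>)"

lemma norm_exp_i: "cmod (exp (\<i> * \<zeta> * of_real x)) = exp (- Im \<zeta> * x)"
  "cmod (exp (2 * \<i> * \<zeta> * of_real x)) = exp (- 2 * Im \<zeta> * x)"
  by (simp_all add: norm_exp_eq_Re)

lemma green_kernel_0 [simp]: "green_kernel \<zeta> 0 = 0"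
  by (simp add: green_kernel_def)

lemma norm_exp_2i_le_1: "0 < Im \<zeta> \<Longrightarrow> 0 \<le> s \<Longrightarrow> cmod (exp (2 * \<i> * \<zeta> * of_real s)) \<le> 1"
  unfolding norm_exp_i by simp

lemma green_kernel_bound:
  assumes "0 < Im \<zeta>" "0 \<le> s" shows "cmod (green_kernel \<zeta> s) \<le> 1 / cmod \<zeta>"
proof -
  have "cmod (exp (2 * \<i> * \<zeta> * of_real s) - 1) \<le> 2"
    by (rule order_trans[OF norm_triangle_ineq4 order_trans[OF add_mono[OF norm_exp_2i_le_1[OF assms]
            order_eq_refl[OF norm_one]]]]) simp
  then have "cmod (green_kernel \<zeta> s) \<le> 2 / cmod (2 * \<i> * \<zeta>)"
    unfolding green_kernel_def norm_divide by (rule divide_right_mono) simp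
  then show ?thesis by (simp add: norm_mult)
qed

lemma continuous_on_green_kernel: "\<zeta> \<noteq> 0 \<Longrightarrow> continuous_on S (green_kernel \<zeta>)"
  unfolding green_kernel_def[abs_def] by (intro continuous_intros) auto

text \<open>The maximum extends the kernel by zero to \<open>t > x\<close>; the extension is
  continuous because \<open>green_kernel\<close> vanishes at 0.\<close>

lemma green_kernel_forward_volterra:
  assumes V: "integrable halfline V" and z: "0 < Im \<zeta>"
  shows "volterra (\<lambda>x t. green_kernel \<zeta> (max (x - t) 0)) V (\<lambda>x. exp (2 * (1 / cmod \<zeta>) * seg 0 x (\<lambda>t. \<bar>V t\<bar>)))
    (1 / cmod \<zeta>) (exp (2 * (1 / cmod \<zeta>) * (LINT t|halfline. \<bar>V t\<bar>)))"
proof (rule volterra_forward[OF V])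
  have z0: "\<zeta> \<noteq> 0" using z by auto
  then show "0 < 1 / cmod \<zeta>" by simp
  show "cmod (green_kernel \<zeta> (max (x - t) 0)) \<le> 1 / cmod \<zeta>" for x t
    by (rule green_kernel_bound[OF z]) simp
  show "(\<lambda>t. green_kernel \<zeta> (max (x - t) 0)) \<in> borel_measurable halfline" for x
    by (rule borel_measurable_continuous_halfline)
       (rule continuous_on_compose2[OF continuous_on_green_kernel[OF z0, of UNIV]], intro continuous_intros, simp)
  show "continuous_on {0..} (\<lambda>x. green_kernel \<zeta> (max (x - t) 0))" for t
    by (rule continuous_on_compose2[OF continuous_on_green_kernel[OF z0, of UNIV]], intro continuous_intros, simp)
qed simp

lemma green_kernel_backward_volterra:
  assumes V: "integrable halfline V" and z: "0 < Im \<zeta>"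
  shows "volterra (\<lambda>x t. green_kernel \<zeta> (max (t - x) 0)) V
    (\<lambda>x. exp (2 * (1 / cmod \<zeta>) * ((LINT t|halfline. \<bar>V t\<bar>) - seg 0 x (\<lambda>t. \<bar>V t\<bar>))))
    (1 / cmod \<zeta>) (exp (2 * (1 / cmod \<zeta>) * (LINT t|halfline. \<bar>V t\<bar>)))"
proof (rule volterra_backward[OF V])
  have z0: "\<zeta> \<noteq> 0" using z by auto
  then show "0 < 1 / cmod \<zeta>" by simp
  show "cmod (green_kernel \<zeta> (max (t - x) 0)) \<le> 1 / cmod \<zeta>" for x t
    by (rule green_kernel_bound[OF z]) simp
  show "(\<lambda>t. green_kernel \<zeta> (max (t - x) 0)) \<in> borel_measurable halfline" for x
    by (rule borel_measurable_continuous_halfline)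
       (rule continuous_on_compose2[OF continuous_on_green_kernel[OF z0, of UNIV]], intro continuous_intros, simp)
  show "continuous_on {0..} (\<lambda>x. green_kernel \<zeta> (max (t - x) 0))" for t
    by (rule continuous_on_compose2[OF continuous_on_green_kernel[OF z0, of UNIV]], intro continuous_intros, simp)
qed simp

section \<open>Integrals towards infinity\<close>

definition tail :: "real \<Rightarrow> (real \<Rightarrow> 'a::euclidean_space) \<Rightarrow> 'a" where
  "tail x g = (LINT t|halfline. g t) - seg 0 x g"

lemma tail_eq:
  assumes "integrable halfline g"
  shows "tail x g = (LINT t|halfline. g t - indicator {0..x} t *\<^sub>R g t)"
    "integrable halfline (\<lambda>t. g t - indicator {0..x} t *\<^sub>R g t)"
proof -
  have i: "integrable halfline (\<lambda>t. indicator {0..x} t *\<^sub>R g t)"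
    by (intro integrable_mult_indicator Icc_sets_halfline assms) simp
  show "integrable halfline (\<lambda>t. g t - indicator {0..x} t *\<^sub>R g t)"
    by (intro Bochner_Integration.integrable_diff i assms)
  show "tail x g = (LINT t|halfline. g t - indicator {0..x} t *\<^sub>R g t)"
    unfolding tail_def seg_halfline[OF order_refl] by (rule Bochner_Integration.integral_diff[OF assms i, symmetric])
qed

lemma tail_tendsto_0:
  assumes "integrable halfline g" shows "((\<lambda>x. tail x g) \<longlongrightarrow> 0) at_top"
  using tendsto_diff[OF tendsto_const[of "LINT t|halfline. g t"] tendsto_seg_halfline[OF assms]]
  unfolding tail_def by simp

lemma integral_lincomb:
  fixes f g :: "real \<Rightarrow> complex"
  assumes "integrable M f" "integrable M g"
  shows "(LINT t|M. (c * f t - g t) / d) = (c * (LINT t|M. f t) - (LINT t|M. g t)) / d"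
  using assms by simp

text \<open>The factor \<open>c\<close> stands for \<open>exp (-2 i \<zeta> x)\<close>, which is
  large by itself; it has to be combined with the decaying integrand before norms are taken.\<close>

lemma tail_norm_le:
  fixes h :: "real \<Rightarrow> complex" and v :: "real \<Rightarrow> real"
  assumes h: "integrable halfline h" and v: "integrable halfline v"
    and le: "\<And>t. 0 \<le> t \<Longrightarrow> x < t \<Longrightarrow> cmod (c * h t) \<le> v t"
  shows "cmod (c * tail x h) \<le> tail x v"
proof -
  have "c * tail x h = (LINT t|halfline. c * (h t - indicator {0..x} t *\<^sub>R h t))"
    using tail_eq[OF h] by simp
  also have "cmod \<dots> \<le> (LINT t|halfline. cmod (c * (h t - indicator {0..x} t *\<^sub>R h t)))"
    by (rule integral_norm_bound)
  also have "\<dots> \<le> tail x v"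
    unfolding tail_eq(1)[OF v]
  proof (rule integral_mono)
    show "integrable halfline (\<lambda>t. cmod (c * (h t - indicator {0..x} t *\<^sub>R h t)))"
      using tail_eq(2)[OF h] by simp
    fix t assume "t \<in> space halfline"
    then show "cmod (c * (h t - indicator {0..x} t *\<^sub>R h t)) \<le> v t - indicator {0..x} t *\<^sub>R v t"
      using le[of t] by (auto simp: indicator_def)
  qed (rule tail_eq(2)[OF v])
  finally show ?thesis .
qed

lemma continuous_exp: "continuous_on S (\<lambda>t. exp (c * complex_of_real t))"
  by (intro continuous_intros)

lemma seg_integrable_exp:
  assumes "seg_integrable a b g" shows "seg_integrable a b (\<lambda>t. exp (c * complex_of_real t) * g t)"
  unfolding mult.commute[of "exp _"] by (rule seg_integrable_mult[OF assms continuous_exp])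

text \<open>With the prefactor moved under the integral the integrand is
  \<open>exp (2 i \<zeta> (x - t)) g(t)\<close> for \<open>t \<le> x\<close>. It is dominated by
  \<open>g\<close> and tends to zero for each fixed \<open>t\<close>.\<close>

lemma decaying_convolution:
  assumes g: "integrable halfline g" and z: "0 < Im \<zeta>"
  shows "((\<lambda>x. exp (2 * \<i> * \<zeta> * of_real x) * seg 0 x (\<lambda>t. exp (- (2 * \<i> * \<zeta>) * of_real t) * g t)) \<longlongrightarrow> 0) at_top"
proof -
  let ?k = "\<lambda>x t. indicator {0..x} t *\<^sub>R (exp (2 * \<i> * \<zeta> * of_real (x - t)) * g t)"
  have eq: "exp (2 * \<i> * \<zeta> * of_real x) * seg 0 x (\<lambda>t. exp (- (2 * \<i> * \<zeta>) * of_real t) * g t) = (LINT t|halfline. ?k x t)" for x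
    unfolding seg_halfline[OF order_refl]
    by (subst integral_mult_right_zero[symmetric])
       (intro Bochner_Integration.integral_cong refl, simp add: exp_diff exp_minus field_simps)
  have "((\<lambda>x. LINT t|halfline. ?k x t) \<longlongrightarrow> (LINT t|halfline. (0::complex))) at_top"
  proof (rule integral_dominated_convergence_at_top[where w = "\<lambda>t. cmod (g t)"])
    have [measurable]: "g \<in> borel_measurable halfline" using g by simp
    show "?k x \<in> borel_measurable halfline" for x
    proof -
      have [measurable]: "(\<lambda>t. exp (2 * \<i> * \<zeta> * of_real (x - t))) \<in> borel_measurable halfline"
        "indicator {0..x} \<in> borel_measurable halfline"
        by (auto intro!: borel_measurable_continuous_halfline continuous_intros borel_measurable_indicator Icc_sets_halfline)
      show ?thesis by measurable
    qed
    have "cmod (?k x t) \<le> cmod (g t)" for x t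
      using norm_exp_2i_le_1[OF z, of "x - t"]
      by (cases "t \<in> {0..x}") (auto simp: norm_mult mult_left_le_one_le)
    then show "\<forall>\<^sub>F x in at_top. AE t in halfline. cmod (?k x t) \<le> cmod (g t)" by simp
    have "((\<lambda>x. ?k x t) \<longlongrightarrow> 0) at_top" if "0 \<le> t" for t
    proof (rule Lim_null_comparison)
      show "\<forall>\<^sub>F x in at_top. cmod (?k x t) \<le> exp (- 2 * Im \<zeta> * (x - t)) * cmod (g t)"
        unfolding norm_exp_i(2)[symmetric]
        by (intro always_eventually allI) (auto simp: indicator_def norm_mult)
      have "filterlim (\<lambda>x. - 2 * Im \<zeta> * (x - t)) at_bot at_top"
        using z by real_asymp
      then show "((\<lambda>x. exp (- 2 * Im \<zeta> * (x - t)) * cmod (g t)) \<longlongrightarrow> 0) at_top"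
        using tendsto_mult_left_zero[OF filterlim_compose[OF exp_at_bot]] by blast
    qed
    then show "AE t in halfline. ((\<lambda>x. ?k x t) \<longlongrightarrow> 0) at_top" by (intro AE_I2) auto
  qed (use g in auto)
  then show ?thesis unfolding eq by simp
qed

lemma V_mult_integrable:
  assumes V: "integrable halfline V" and u: "continuous_on {0..} u" "\<And>t. 0 \<le> t \<Longrightarrow> cmod (u t) \<le> G"
  shows "integrable halfline (\<lambda>t. complex_of_real (V t) * u t)"
  using V by (intro integrable_mult_bounded[OF _ borel_measurable_continuous_halfline[OF u(1)] u(2)]) auto

text \<open>The exponential in the kernel factors into a function of \<open>x\<close> and one of
  \<open>t\<close>, leaving two primitives of fixed functions. These are the coefficients needed for
  variation of constants.\<close>

lemma forward_representation:
  assumes g: "integrable halfline g"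
  shows "(LINT t|halfline. green_kernel \<zeta> (max (x - t) 0) * g t)
    = (exp (2 * \<i> * \<zeta> * of_real x) * seg 0 x (\<lambda>t. exp (- (2 * \<i> * \<zeta>) * of_real t) * g t) - seg 0 x g) / (2 * \<i> * \<zeta>)"
proof -
  let ?h = "\<lambda>t. exp (- (2 * \<i> * \<zeta>) * of_real t) * g t"
  have ig: "seg_integrable 0 x g" by (rule halfline_seg_integrable[OF g order_refl])
  have ih: "seg_integrable 0 x ?h"
    by (rule seg_integrable_exp[OF ig])
  have "(LINT t|halfline. green_kernel \<zeta> (max (x - t) 0) * g t)
    = (LINT t|halfline. (exp (2 * \<i> * \<zeta> * of_real x) * (indicator {0..x} t *\<^sub>R ?h t) - indicator {0..x} t *\<^sub>R g t) / (2 * \<i> * \<zeta>))"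
  proof (intro Bochner_Integration.integral_cong refl)
    fix t assume "t \<in> space halfline"
    then have t: "0 \<le> t" by simp
    show "green_kernel \<zeta> (max (x - t) 0) * g t
        = (exp (2 * \<i> * \<zeta> * of_real x) * (indicator {0..x} t *\<^sub>R ?h t) - indicator {0..x} t *\<^sub>R g t) / (2 * \<i> * \<zeta>)"
    proof (cases "t \<le> x")
      case True
      have "exp (2 * \<i> * \<zeta> * of_real (x - t)) = exp (2 * \<i> * \<zeta> * of_real x) * exp (- (2 * \<i> * \<zeta>) * of_real t)"
        by (simp add: exp_add[symmetric] algebra_simps)
      then show ?thesis using True t by (simp add: green_kernel_def algebra_simps diff_divide_distrib)
    qed (simp add: max_def)
  qed
  also have "\<dots> = (exp (2 * \<i> * \<zeta> * of_real x) * seg 0 x ?h - seg 0 x g) / (2 * \<i> * \<zeta>)"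
    unfolding seg_halfline[OF order_refl]
    using ig ih by (intro integral_lincomb) (simp_all only: seg_integrable_halfline_iff order_refl)
  finally show ?thesis .
qed

lemma backward_representation:
  assumes g: "integrable halfline g" and z: "0 < Im \<zeta>"
  shows "(LINT t|halfline. green_kernel \<zeta> (max (t - x) 0) * g t)
    = (exp (- (2 * \<i> * \<zeta>) * of_real x) * tail x (\<lambda>t. exp (2 * \<i> * \<zeta> * of_real t) * g t) - tail x g) / (2 * \<i> * \<zeta>)"
    "integrable halfline (\<lambda>t. exp (2 * \<i> * \<zeta> * of_real t) * g t)"
proof -
  let ?h = "\<lambda>t. exp (2 * \<i> * \<zeta> * of_real t) * g t"
  show ih: "integrable halfline ?h"
    using integrable_mult_bounded[OF g borel_measurable_continuous_halfline[OF continuous_exp] norm_exp_2i_le_1[OF z]]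
    by (simp add: mult.commute)
  let ?c = "\<lambda>h t. h t - indicator {0..x} t *\<^sub>R h t"
  have "(LINT t|halfline. green_kernel \<zeta> (max (t - x) 0) * g t)
    = (LINT t|halfline. (exp (- (2 * \<i> * \<zeta>) * of_real x) * ?c ?h t - ?c g t) / (2 * \<i> * \<zeta>))"
  proof (intro Bochner_Integration.integral_cong refl)
    fix t assume "t \<in> space halfline"
    then have t: "0 \<le> t" by simp
    show "green_kernel \<zeta> (max (t - x) 0) * g t
        = (exp (- (2 * \<i> * \<zeta>) * of_real x) * ?c ?h t - ?c g t) / (2 * \<i> * \<zeta>)"
    proof (cases "t \<le> x")
      case False
      have "exp (2 * \<i> * \<zeta> * of_real (t - x)) = exp (- (2 * \<i> * \<zeta>) * of_real x) * exp (2 * \<i> * \<zeta> * of_real t)"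
        by (simp add: exp_add[symmetric] algebra_simps)
      then show ?thesis using False t by (simp add: green_kernel_def algebra_simps diff_divide_distrib)
    qed (use t in \<open>simp add: max_def\<close>)
  qed
  also have "\<dots> = (exp (- (2 * \<i> * \<zeta>) * of_real x) * tail x ?h - tail x g) / (2 * \<i> * \<zeta>)"
    unfolding tail_eq(1)[OF g] tail_eq(1)[OF ih]
    by (rule integral_lincomb[OF tail_eq(2)[OF ih] tail_eq(2)[OF g]])
  finally show "(LINT t|halfline. green_kernel \<zeta> (max (t - x) 0) * g t)
    = (exp (- (2 * \<i> * \<zeta>) * of_real x) * tail x ?h - tail x g) / (2 * \<i> * \<zeta>)" .
qed

section \<open>The regular solution\<close>

lemma exp_i_cancel:
  "exp (\<i> * \<zeta> * of_real x) * (exp (- (\<i> * \<zeta>) * of_real x) * y) = y"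
  "exp (- (\<i> * \<zeta>) * of_real x) * (exp (\<i> * \<zeta> * of_real x) * y) = y"
proof -
  have "exp (\<i> * \<zeta> * of_real x) * exp (- (\<i> * \<zeta>) * of_real x) = 1"
    "exp (- (\<i> * \<zeta>) * of_real x) * exp (\<i> * \<zeta> * of_real x) = 1"
    by (simp_all add: exp_add[symmetric])
  then show "exp (\<i> * \<zeta> * of_real x) * (exp (- (\<i> * \<zeta>) * of_real x) * y) = y"
    "exp (- (\<i> * \<zeta>) * of_real x) * (exp (\<i> * \<zeta> * of_real x) * y) = y"
    by (simp_all only: mult.assoc[symmetric] mult_1_left)
qed

text \<open>The growth is split off: \<open>s = exp (i \<zeta> x) \<phi>\<close> solves a forward
  Volterra equation with the bounded source \<open>n0\<close>. There \<open>A\<close> and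
  \<open>B\<close> are the coefficients of \<open>exp (i \<zeta> x)\<close> and
  \<open>exp (-i \<zeta> x)\<close> in the free solution with the same data at 0. The two limits say
  that \<open>\<phi>\<close> and its derivative behave like those of
  \<open>L exp (-i \<zeta> x)\<close>. General data are allowed so that a fundamental system is
  available too.\<close>

lemma regular_exists:
  assumes V: "integrable halfline V" and z: "0 < Im \<zeta>"
  shows "\<exists>\<phi> \<phi>' C L. sol V \<zeta> \<phi> \<phi>' \<and> \<phi> 0 = \<alpha> \<and> \<phi>' 0 = \<beta> \<and> (\<forall>x\<ge>0. cmod (\<phi> x) \<le> C * exp (Im \<zeta> * x)) \<and>
    ((\<lambda>x. exp (\<i> * \<zeta> * of_real x) * \<phi> x) \<longlongrightarrow> L) at_top \<and>
    ((\<lambda>x. exp (\<i> * \<zeta> * of_real x) * \<phi>' x) \<longlongrightarrow> - (\<i> * \<zeta> * L)) at_top"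
proof -
  have z0: "\<zeta> \<noteq> 0" using z by auto
  define A where "A = (\<alpha> + \<beta> / (\<i> * \<zeta>)) / 2"
  define B where "B = (\<alpha> - \<beta> / (\<i> * \<zeta>)) / 2"
  have AB: "A + B = \<alpha>" "\<i> * \<zeta> * (A - B) = \<beta>"
    using z0 by (simp_all add: A_def B_def field_simps)
  let ?E = "\<lambda>x. exp (2 * \<i> * \<zeta> * complex_of_real x)"
  let ?e = "\<lambda>x. exp (\<i> * \<zeta> * complex_of_real x)" and ?f = "\<lambda>x. exp (- (\<i> * \<zeta>) * complex_of_real x)"
  define n0 where "n0 x = A * ?E x + B" for x
  interpret volterra "\<lambda>x t. green_kernel \<zeta> (max (x - t) 0)" V "\<lambda>x. exp (2 * (1 / cmod \<zeta>) * seg 0 x (\<lambda>t. \<bar>V t\<bar>))"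
    "1 / cmod \<zeta>" "exp (2 * (1 / cmod \<zeta>) * (LINT t|halfline. \<bar>V t\<bar>))"
    by (rule green_kernel_forward_volterra[OF V z])
  have n0c: "continuous_on {0..} n0" unfolding n0_def by (intro continuous_intros)
  have n0b: "cmod (n0 x) \<le> cmod A + cmod B" if "0 \<le> x" for x
    unfolding n0_def
    using norm_exp_2i_le_1[OF z that] by (intro order_trans[OF norm_triangle_ineq] add_mono) (auto simp: norm_mult mult_left_le)
  obtain s G where s: "continuous_on {0..} s" "\<And>x. 0 \<le> x \<Longrightarrow> cmod (s x) \<le> G" "\<And>x. 0 \<le> x \<Longrightarrow> s x = n0 x + K s x"
    using solution_exists[OF n0c n0b] by blast
  define g where "g t = complex_of_real (V t) * s t" for t
  have gi: "integrable halfline g" unfolding g_def by (rule V_mult_integrable[OF V s(1,2)])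
  have gs: "seg_integrable 0 b g" for b by (rule halfline_seg_integrable[OF gi order_refl])
  have hs: "seg_integrable 0 b (\<lambda>t. exp (- (2 * \<i> * \<zeta>) * of_real t) * g t)" for b
    by (rule seg_integrable_exp[OF gs])
  define a where "a x = 2 * \<i> * \<zeta> * A + seg 0 x (\<lambda>t. exp (- (2 * \<i> * \<zeta>) * of_real t) * g t)" for x
  define b where "b x = - 2 * \<i> * \<zeta> * B + seg 0 x g" for x
  have Ks: "K s x = (?E x * seg 0 x (\<lambda>t. exp (- (2 * \<i> * \<zeta>) * of_real t) * g t) - seg 0 x g) / (2 * \<i> * \<zeta>)" for x
    using forward_representation[OF gi, of \<zeta> x] by (simp add: K_def g_def mult.assoc)
  have s_ab: "s x = (?E x * a x - b x) / (2 * \<i> * \<zeta>)" if "0 \<le> x" for x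
    unfolding s(3)[OF that] Ks n0_def a_def b_def using z0 by (simp add: field_simps)
  define \<phi> where "\<phi> x = ?f x * s x" for x
  define \<phi>' where "\<phi>' x = (?e x * a x + ?f x * b x) / 2" for x
  have E: "?E x = ?e x * ?e x" for x by (simp add: exp_add[symmetric] mult.assoc)
  note ef' = exp_i_cancel[where \<zeta> = \<zeta>]
  have sol: "sol V \<zeta> \<phi> \<phi>'"
  proof (rule variation_of_constants[OF z0])
    have "locally_ac_deriv a (\<lambda>t. exp (- (2 * \<i> * \<zeta>) * of_real t) * g t)"
      unfolding a_def by (rule locally_ac_deriv_seg[OF hs])
    then show "locally_ac_deriv a (\<lambda>t. ?f t * (of_real (V t) * \<phi> t))"
    proof (rule locally_ac_deriv_cong)
      fix x :: real
      have "exp (- (2 * \<i> * \<zeta>) * of_real x) = ?f x * ?f x" by (simp add: exp_add[symmetric] mult.assoc)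
      then show "exp (- (2 * \<i> * \<zeta>) * of_real x) * g x = ?f x * (of_real (V x) * \<phi> x)"
        by (simp add: g_def \<phi>_def mult_ac)
    qed simp
    have "locally_ac_deriv b g" unfolding b_def by (rule locally_ac_deriv_seg[OF gs])
    then show "locally_ac_deriv b (\<lambda>t. ?e t * (of_real (V t) * \<phi> t))"
    proof (rule locally_ac_deriv_cong)
      fix x :: real
      have "?e x * (of_real (V x) * \<phi> x) = of_real (V x) * (?e x * (?f x * s x))"
        by (simp only: \<phi>_def mult_ac)
      then show "g x = ?e x * (of_real (V x) * \<phi> x)" unfolding ef' g_def by (rule sym)
    qed simp
    show "\<phi> x = (?e x * a x - ?f x * b x) / (2 * \<i> * \<zeta>)" if "0 \<le> x" for x
    proof -
      have "\<phi> x = (?f x * (?e x * (?e x * a x)) - ?f x * b x) / (2 * \<i> * \<zeta>)"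
        unfolding \<phi>_def s_ab[OF that] E by (simp add: algebra_simps diff_divide_distrib)
      then show ?thesis unfolding ef' .
    qed
  qed (simp add: \<phi>'_def)
  have \<phi>0: "\<phi> 0 = \<alpha>"
    using s(3)[of 0] Ks[of 0] AB(1) by (simp add: \<phi>_def n0_def)
  have \<phi>'0: "\<phi>' 0 = \<beta>"
  proof -
    have "2 * \<i> * \<zeta> * A - 2 * \<i> * \<zeta> * B = 2 * (\<i> * \<zeta> * (A - B))"
      by (simp add: algebra_simps)
    then show ?thesis unfolding AB by (simp add: \<phi>'_def a_def b_def)
  qed
  have bound: "cmod (\<phi> x) \<le> G * exp (Im \<zeta> * x)" if "0 \<le> x" for x
  proof -
    have "cmod (?f x) = exp (Im \<zeta> * x)" by (simp add: norm_exp_eq_Re)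
    then show ?thesis using s(2)[OF that] by (simp add: \<phi>_def norm_mult mult.commute mult_right_mono)
  qed
  define binf where "binf = - 2 * \<i> * \<zeta> * B + (LINT t|halfline. g t)"
  \<comment> \<open>Of the two coefficients \<open>b\<close> converges, whereas \<open>a\<close>
    need not; but \<open>a\<close> only enters with the decaying factor
    \<open>exp (2 i \<zeta> x)\<close>.\<close>
  have blim: "(b \<longlongrightarrow> binf) at_top"
    unfolding b_def[abs_def] binf_def by (intro tendsto_intros tendsto_seg_halfline gi)
  have alim: "((\<lambda>x. ?E x * a x) \<longlongrightarrow> 0) at_top"
  proof -
    have "((\<lambda>x. ?E x) \<longlongrightarrow> 0) at_top"
    proof (rule tendsto_norm_zero_cancel)
      have "filterlim (\<lambda>x. - 2 * Im \<zeta> * x) at_bot at_top" using z by real_asymp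
      from filterlim_compose[OF exp_at_bot this] show "((\<lambda>x. cmod (?E x)) \<longlongrightarrow> 0) at_top"
        unfolding norm_exp_i .
    qed
    then have "((\<lambda>x. ?E x * (2 * \<i> * \<zeta> * A) + ?E x * seg 0 x (\<lambda>t. exp (- (2 * \<i> * \<zeta>) * of_real t) * g t)) \<longlongrightarrow> 0 * (2 * \<i> * \<zeta> * A) + 0) at_top"
      by (intro tendsto_intros decaying_convolution[OF gi z])
    then show ?thesis by (simp add: a_def distrib_left)
  qed
  have lim1: "((\<lambda>x. ?e x * \<phi> x) \<longlongrightarrow> - binf / (2 * \<i> * \<zeta>)) at_top"
  proof -
    have "((\<lambda>x. (?E x * a x - b x) / (2 * \<i> * \<zeta>)) \<longlongrightarrow> (0 - binf) / (2 * \<i> * \<zeta>)) at_top"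
      using z0 by (intro tendsto_intros alim blim) auto
    then have "((\<lambda>x. (?E x * a x - b x) / (2 * \<i> * \<zeta>)) \<longlongrightarrow> - binf / (2 * \<i> * \<zeta>)) at_top" by simp
    then show ?thesis
    proof (rule Lim_transform_eventually)
      have "(?E x * a x - b x) / (2 * \<i> * \<zeta>) = ?e x * \<phi> x" if "0 \<le> x" for x
        unfolding \<phi>_def ef' s_ab[OF that] ..
      then show "\<forall>\<^sub>F x in at_top. (?E x * a x - b x) / (2 * \<i> * \<zeta>) = ?e x * \<phi> x"
        by (intro eventually_mono[OF eventually_ge_at_top[of 0]])
    qed
  qed
  have lim2: "((\<lambda>x. ?e x * \<phi>' x) \<longlongrightarrow> - (\<i> * \<zeta> * (- binf / (2 * \<i> * \<zeta>)))) at_top"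
  proof -
    have eq: "?e x * \<phi>' x = (?E x * a x + b x) / 2" for x
    proof -
      have "?e x * \<phi>' x = (?e x * ?e x * a x + ?e x * (?f x * b x)) / 2"
        unfolding \<phi>'_def by (simp add: algebra_simps)
      then show ?thesis unfolding ef' E .
    qed
    have "((\<lambda>x. (?E x * a x + b x) / 2) \<longlongrightarrow> (0 + binf) / 2) at_top"
      by (intro tendsto_intros alim blim) auto
    moreover have "(0 + binf) / 2 = - (\<i> * \<zeta> * (- binf / (2 * \<i> * \<zeta>)))" using z0 by simp
    ultimately show ?thesis unfolding eq by (simp only:)
  qed
  show ?thesis
    using sol \<phi>0 \<phi>'0 bound lim1 lim2 by blast
qed

text \<open>The solutions with data \<open>(1, 0)\<close> and \<open>(0, 1)\<close> at 0 form a
  fundamental system with Wronskian \<open>-1\<close>.\<close>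

lemma sol_unique':
  assumes V: "integrable halfline V" and z: "0 < Im \<zeta>"
    and u: "sol V \<zeta> u p" and v: "sol V \<zeta> v r" and a: "0 \<le> a" "u a = v a" "p a = r a" and x: "0 \<le> x"
  shows "u x = v x" "p x = r x"
proof -
  obtain f f' where f: "sol V \<zeta> f f'" "f 0 = 1" "f' 0 = 0"
    using regular_exists[OF V z, of 1 0] by blast
  obtain g g' where g: "sol V \<zeta> g g'" "g 0 = 0" "g' 0 = 1"
    using regular_exists[OF V z, of 0 1] by blast
  show "u x = v x" "p x = r x"
    using sol_unique[OF f(1) g(1) _ u v a x] f g by auto
qed

section \<open>The Jost solution\<close>

definition jost_m :: "(real \<Rightarrow> real) \<Rightarrow> complex \<Rightarrow> real \<Rightarrow> complex" where
  "jost_m V \<zeta> = (SOME m. continuous_on {0..} m \<and>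
     (\<forall>x\<ge>0. cmod (m x) \<le> 2 * exp (2 * (1 / cmod \<zeta>) * (LINT t|halfline. \<bar>V t\<bar>))) \<and>
     (\<forall>x\<ge>0. m x = 1 + (LINT t|halfline. green_kernel \<zeta> (max (t - x) 0) * (of_real (V t) * m t))))"

text \<open>The companion of \<open>jost_m\<close> for the derivative of the Jost solution: it is
  \<open>i \<zeta> m + m'\<close> with \<open>m'\<close> computed from the Volterra equation for
  \<open>m\<close>.\<close>

definition jost_P :: "(real \<Rightarrow> real) \<Rightarrow> complex \<Rightarrow> real \<Rightarrow> complex" where
  "jost_P V \<zeta> x = \<i> * \<zeta> - (tail x (\<lambda>t. of_real (V t) * jost_m V \<zeta> t)
     + exp (- (2 * \<i> * \<zeta>) * of_real x) * tail x (\<lambda>t. exp (2 * \<i> * \<zeta> * of_real t) * (of_real (V t) * jost_m V \<zeta> t))) / 2"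

definition theta :: "(real \<Rightarrow> real) \<Rightarrow> complex \<Rightarrow> real \<Rightarrow> complex" where
  "theta V \<zeta> x = exp (\<i> * \<zeta> * of_real x) * jost_m V \<zeta> x"

definition theta' :: "(real \<Rightarrow> real) \<Rightarrow> complex \<Rightarrow> real \<Rightarrow> complex" where
  "theta' V \<zeta> x = exp (\<i> * \<zeta> * of_real x) * jost_P V \<zeta> x"

text \<open>The bound belongs to the choice of \<open>jost_m\<close> because its explicit dependence
  on \<open>\<zeta>\<close> makes it uniform near a given point of the upper half-plane.\<close>

lemma jost_m:
  assumes V: "integrable halfline V" and z: "0 < Im \<zeta>"
  shows "continuous_on {0..} (jost_m V \<zeta>)"
    "0 \<le> x \<Longrightarrow> cmod (jost_m V \<zeta> x) \<le> 2 * exp (2 * (1 / cmod \<zeta>) * (LINT t|halfline. \<bar>V t\<bar>))"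
    "0 \<le> x \<Longrightarrow> jost_m V \<zeta> x = 1 + (LINT t|halfline. green_kernel \<zeta> (max (t - x) 0) * (of_real (V t) * jost_m V \<zeta> t))"
proof -
  interpret volterra "\<lambda>x t. green_kernel \<zeta> (max (t - x) 0)" V
    "\<lambda>x. exp (2 * (1 / cmod \<zeta>) * ((LINT t|halfline. \<bar>V t\<bar>) - seg 0 x (\<lambda>t. \<bar>V t\<bar>)))"
    "1 / cmod \<zeta>" "exp (2 * (1 / cmod \<zeta>) * (LINT t|halfline. \<bar>V t\<bar>))"
    by (rule green_kernel_backward_volterra[OF V z])
  have "\<exists>m. continuous_on {0..} m \<and>
     (\<forall>x\<ge>0. cmod (m x) \<le> 2 * exp (2 * (1 / cmod \<zeta>) * (LINT t|halfline. \<bar>V t\<bar>))) \<and>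
     (\<forall>x\<ge>0. m x = 1 + (LINT t|halfline. green_kernel \<zeta> (max (t - x) 0) * (of_real (V t) * m t)))"
    using solution_exists[of "\<lambda>_. 1" 1] unfolding K_def by (simp add: mult.assoc)
  from someI_ex[OF this, folded jost_m_def]
  show "continuous_on {0..} (jost_m V \<zeta>)"
    "0 \<le> x \<Longrightarrow> cmod (jost_m V \<zeta> x) \<le> 2 * exp (2 * (1 / cmod \<zeta>) * (LINT t|halfline. \<bar>V t\<bar>))"
    "0 \<le> x \<Longrightarrow> jost_m V \<zeta> x = 1 + (LINT t|halfline. green_kernel \<zeta> (max (t - x) 0) * (of_real (V t) * jost_m V \<zeta> t))"
    by blast+
qed

lemma exp_2i_shift:
  "exp (- (2 * \<i> * \<zeta>) * of_real x) * (exp (2 * \<i> * \<zeta> * of_real t) * y) = exp (2 * \<i> * \<zeta> * of_real (t - x)) * y"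
proof -
  have "exp (- (2 * \<i> * \<zeta>) * of_real x) * exp (2 * \<i> * \<zeta> * of_real t) = exp (2 * \<i> * \<zeta> * of_real (t - x))"
    by (simp add: exp_add[symmetric] algebra_simps)
  then show ?thesis by (simp only: mult.assoc[symmetric])
qed

lemma theta_sol:
  assumes V: "integrable halfline V" and z: "0 < Im \<zeta>"
  shows "sol V \<zeta> (theta V \<zeta>) (theta' V \<zeta>)"
    "(jost_m V \<zeta> \<longlongrightarrow> 1) at_top" "(jost_P V \<zeta> \<longlongrightarrow> \<i> * \<zeta>) at_top"
proof -
  have z0: "\<zeta> \<noteq> 0" using z by auto
  let ?m = "jost_m V \<zeta>"
  note m = jost_m[OF V z]
  define g where "g t = complex_of_real (V t) * ?m t" for t
  define M where "M = 2 * exp (2 * (1 / cmod \<zeta>) * (LINT t|halfline. \<bar>V t\<bar>))"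
  define h where "h t = exp (2 * \<i> * \<zeta> * of_real t) * g t" for t
  have gi: "integrable halfline g" unfolding g_def by (rule V_mult_integrable[OF V m(1,2)])
  have hi: "integrable halfline h" unfolding h_def by (rule backward_representation(2)[OF gi z])
  let ?F = "\<lambda>x. exp (- (2 * \<i> * \<zeta>) * complex_of_real x)"
  let ?e = "\<lambda>x. exp (\<i> * \<zeta> * complex_of_real x)" and ?f = "\<lambda>x. exp (- (\<i> * \<zeta>) * complex_of_real x)"
  have F: "?F x = ?f x * ?f x" for x by (simp add: exp_add[symmetric] mult.assoc)
  note ef' = exp_i_cancel[where \<zeta> = \<zeta>]
  have meq: "?m x = 1 + (?F x * tail x h - tail x g) / (2 * \<i> * \<zeta>)" if "0 \<le> x" for x
  proof -
    have "?m x = 1 + (LINT t|halfline. green_kernel \<zeta> (max (t - x) 0) * g t)"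
      unfolding g_def by (rule m(3)[OF that])
    then show ?thesis
      unfolding backward_representation(1)[OF gi z] h_def[abs_def] .
  qed
  have Peq: "jost_P V \<zeta> x = \<i> * \<zeta> - (tail x g + ?F x * tail x h) / 2" for x
    unfolding jost_P_def h_def[abs_def] g_def[abs_def] ..
  \<comment> \<open>With these coefficients the Volterra equation for \<open>jost_m\<close>,
    multiplied by \<open>exp (i \<zeta> x)\<close>, becomes the variation-of-constants
    formula.\<close>
  define a where "a x = 2 * \<i> * \<zeta> - tail x g" for x
  define b where "b x = - tail x h" for x
  have gs: "seg_integrable 0 c g" and hs: "seg_integrable 0 c h" for c
    by (rule halfline_seg_integrable[OF gi order_refl], rule halfline_seg_integrable[OF hi order_refl])
  show "sol V \<zeta> (theta V \<zeta>) (theta' V \<zeta>)"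
  proof (rule variation_of_constants[OF z0])
    have "locally_ac_deriv (\<lambda>x. (2 * \<i> * \<zeta> - (LINT t|halfline. g t)) + seg 0 x g) g"
      by (rule locally_ac_deriv_seg[OF gs])
    then show "locally_ac_deriv a (\<lambda>t. ?f t * (of_real (V t) * theta V \<zeta> t))"
    proof (rule locally_ac_deriv_cong)
      fix x :: real
      have "?f x * (of_real (V x) * theta V \<zeta> x) = of_real (V x) * (?f x * (?e x * ?m x))"
        by (simp only: theta_def mult_ac)
      then show "g x = ?f x * (of_real (V x) * theta V \<zeta> x)" unfolding ef' g_def by (rule sym)
    qed (simp add: a_def tail_def)
    have "locally_ac_deriv (\<lambda>x. - (LINT t|halfline. h t) + seg 0 x h) h"
      by (rule locally_ac_deriv_seg[OF hs])
    then show "locally_ac_deriv b (\<lambda>t. ?e t * (of_real (V t) * theta V \<zeta> t))"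
    proof (rule locally_ac_deriv_cong)
      fix x :: real
      have "exp (2 * \<i> * \<zeta> * of_real x) = ?e x * ?e x" by (simp add: exp_add[symmetric] mult.assoc)
      then show "h x = ?e x * (of_real (V x) * theta V \<zeta> x)"
        by (simp add: h_def g_def theta_def mult_ac)
    qed (simp add: b_def tail_def)
    fix x :: real assume x: "0 \<le> x"
    have eF: "?e x * (?F x * y) = ?f x * y" for y
      unfolding F using ef'(1)[of x "?f x * y"] by (simp add: mult_ac)
    have "theta V \<zeta> x = (?e x * (2 * \<i> * \<zeta> - tail x g) + ?e x * (?F x * tail x h)) / (2 * \<i> * \<zeta>)"
      using z0 by (simp add: theta_def meq[OF x] field_simps)
    then show "theta V \<zeta> x = (?e x * a x - ?f x * b x) / (2 * \<i> * \<zeta>)"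
      unfolding eF by (simp add: a_def b_def)
    have "theta' V \<zeta> x = (?e x * (2 * \<i> * \<zeta> - tail x g) - ?e x * (?F x * tail x h)) / 2"
      by (simp add: theta'_def Peq field_simps)
    then show "theta' V \<zeta> x = (?e x * a x + ?f x * b x) / 2"
      unfolding eF by (simp add: a_def b_def)
  qed
  have Vi: "integrable halfline (\<lambda>t. M * \<bar>V t\<bar>)" using V by simp
  have gM: "cmod (g t) \<le> M * \<bar>V t\<bar>" if "0 \<le> t" for t
    unfolding g_def norm_mult norm_of_real M_def
    by (subst mult.commute) (rule mult_right_mono[OF m(2)[OF that] abs_ge_zero])
  have "\<forall>\<^sub>F x in at_top. cmod (?F x * tail x h) \<le> tail x (\<lambda>t. M * \<bar>V t\<bar>)"
  proof (intro always_eventually allI tail_norm_le hi Vi)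
    fix x t :: real assume t: "0 \<le> t" "x < t"
    have "cmod (?F x * h t) = cmod (exp (2 * \<i> * \<zeta> * of_real (t - x))) * cmod (g t)"
      unfolding h_def exp_2i_shift by (simp add: norm_mult)
    also have "\<dots> \<le> 1 * cmod (g t)"
      using t by (intro mult_right_mono norm_exp_2i_le_1[OF z]) auto
    finally show "cmod (?F x * h t) \<le> M * \<bar>V t\<bar>" using gM[OF t(1)] by simp
  qed
  then have lim: "((\<lambda>x. ?F x * tail x h) \<longlongrightarrow> 0) at_top"
    by (rule Lim_null_comparison) (rule tail_tendsto_0[OF Vi])
  have "((\<lambda>x. 1 + (?F x * tail x h - tail x g) / (2 * \<i> * \<zeta>)) \<longlongrightarrow> 1 + (0 - 0) / (2 * \<i> * \<zeta>)) at_top"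
    using z0 by (intro tendsto_intros lim tail_tendsto_0 gi) auto
  then have "((\<lambda>x. 1 + (?F x * tail x h - tail x g) / (2 * \<i> * \<zeta>)) \<longlongrightarrow> 1) at_top" by simp
  then show "(?m \<longlongrightarrow> 1) at_top"
    by (rule Lim_transform_eventually) (rule eventually_mono[OF eventually_ge_at_top[of 0]], simp only: meq)
  have "((\<lambda>x. \<i> * \<zeta> - (tail x g + ?F x * tail x h) / 2) \<longlongrightarrow> \<i> * \<zeta> - (0 + 0) / 2) at_top"
    by (intro tendsto_intros lim tail_tendsto_0 gi) auto
  then show "(jost_P V \<zeta> \<longlongrightarrow> \<i> * \<zeta>) at_top"
    unfolding Peq[abs_def] by simp
qed

section \<open>Identification of the distinguished solutions and of the Jost function\<close>

lemma regular_solution_eq: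
  assumes V: "integrable halfline V" and z: "0 < Im \<zeta>"
    and u: "sol V \<zeta> u p" "u 0 = 1" "p 0 = of_real \<gamma>" and x: "0 \<le> x"
  shows "regular_solution V \<gamma> \<zeta> x = u x"
proof -
  define r where "r = restrict u {0..}"
  have r: "sol V \<zeta> r p" by (rule sol_cong[OF u(1)]) (simp_all add: r_def)
  have "regular_solution V \<gamma> \<zeta> = r"
    unfolding regular_solution_def
  proof (rule the_equality)
    show "r \<in> extensional {0..} \<and> is_solution V \<zeta> r \<and> r 0 = 1 \<and> hderiv r 0 = complex_of_real \<gamma>"
      using sol_is_solution[OF r] sol_hderiv(2)[OF r, of 0] u by (simp add: r_def)
    fix v assume v: "v \<in> extensional {0..} \<and> is_solution V \<zeta> v \<and> v 0 = 1 \<and> hderiv v 0 = complex_of_real \<gamma>"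
    then have vs: "sol V \<zeta> v (hderiv v)" using is_solution_sol[OF V] by blast
    show "v = r"
    proof
      fix x show "v x = r x"
      proof (cases "0 \<le> x")
        case True
        show ?thesis
          using v u(2,3) by (intro sol_unique'(1)[OF V z vs r order_refl _ _ True]) (simp_all add: r_def)
      next
        case False
        then show ?thesis using v by (simp add: r_def extensional_def)
      qed
    qed
  qed
  then show ?thesis using x by (simp add: r_def)
qed

text \<open>The Wronskian of two Jost solutions is constant and \<open>o(exp (2 i \<zeta> x))\<close>, hence zero.\<close>

lemma jost_solution_eq:
  assumes V: "integrable halfline V" and z: "0 < Im \<zeta>" and x: "0 \<le> x"
  shows "jost_solution V \<zeta> x = theta V \<zeta> x"
proof -
  have z0: "\<zeta> \<noteq> 0" using z by auto
  define r where "r = restrict (theta V \<zeta>) {0..}"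
  have rs: "sol V \<zeta> r (theta' V \<zeta>)" by (rule sol_cong[OF theta_sol(1)[OF V z]]) (simp_all add: r_def)
  have ev: "\<forall>\<^sub>F x in at_top. 0 \<le> (x::real)" by (rule eventually_ge_at_top)
  have "jost_solution V \<zeta> = r"
    unfolding jost_solution_def
  proof (rule the_equality)
    have "((\<lambda>x. r x / exp (\<i> * \<zeta> * of_real x)) \<longlongrightarrow> 1) at_top"
      using theta_sol(2)[OF V z]
      by (rule Lim_transform_eventually) (rule eventually_mono[OF ev], simp add: r_def theta_def)
    moreover have "((\<lambda>x. jost_P V \<zeta> x / (\<i> * \<zeta>)) \<longlongrightarrow> (\<i> * \<zeta>) / (\<i> * \<zeta>)) at_top"
      using z0 by (intro tendsto_intros theta_sol(3)[OF V z]) auto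
    then have "((\<lambda>x. jost_P V \<zeta> x / (\<i> * \<zeta>)) \<longlongrightarrow> 1) at_top" using z0 by simp
    then have "((\<lambda>x. hderiv r x / (\<i> * \<zeta> * exp (\<i> * \<zeta> * of_real x))) \<longlongrightarrow> 1) at_top"
      by (rule Lim_transform_eventually)
         (rule eventually_mono[OF ev], simp add: z0 sol_hderiv(2)[OF rs] theta'_def)
    ultimately show "r \<in> extensional {0..} \<and> is_solution V \<zeta> r \<and>
        ((\<lambda>x. r x / exp (\<i> * \<zeta> * of_real x)) \<longlongrightarrow> 1) at_top \<and>
        ((\<lambda>x. hderiv r x / (\<i> * \<zeta> * exp (\<i> * \<zeta> * of_real x))) \<longlongrightarrow> 1) at_top"
      using sol_is_solution[OF rs] by (simp add: r_def)
    fix v assume v: "v \<in> extensional {0..} \<and> is_solution V \<zeta> v \<and>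
        ((\<lambda>x. v x / exp (\<i> * \<zeta> * of_real x)) \<longlongrightarrow> 1) at_top \<and>
        ((\<lambda>x. hderiv v x / (\<i> * \<zeta> * exp (\<i> * \<zeta> * of_real x))) \<longlongrightarrow> 1) at_top"
    then have vs: "sol V \<zeta> v (hderiv v)" using is_solution_sol[OF V] by blast
    let ?e = "\<lambda>x. exp (\<i> * \<zeta> * complex_of_real x)"
    define n where "n x = v x / ?e x" for x
    define N where "N x = hderiv v x / (\<i> * \<zeta> * ?e x)" for x
    have n: "v x = ?e x * n x" and N: "hderiv v x = \<i> * \<zeta> * ?e x * N x" for x
      using z0 by (simp_all add: n_def N_def)
    have nl: "(n \<longlongrightarrow> 1) at_top" and Nl: "(N \<longlongrightarrow> 1) at_top"
      using v unfolding n_def[abs_def] N_def[abs_def] by auto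
    define W where "W = hderiv v 0 * theta V \<zeta> 0 - theta' V \<zeta> 0 * v 0"
    have W: "hderiv v x * theta V \<zeta> x - theta' V \<zeta> x * v x = W" if "0 \<le> x" for x
      unfolding W_def by (rule wronskian_const[OF vs theta_sol(1)[OF V z] that])
    have "((\<lambda>x. ?e x * ?e x * (\<i> * \<zeta> * N x * jost_m V \<zeta> x - jost_P V \<zeta> x * n x)) \<longlongrightarrow> 0 * 0 * (\<i> * \<zeta> * 1 * 1 - \<i> * \<zeta> * 1)) at_top"
    proof -
      have "(?e \<longlongrightarrow> 0) at_top"
      proof (rule tendsto_norm_zero_cancel)
        have "filterlim (\<lambda>x. - Im \<zeta> * x) at_bot at_top" using z by real_asymp
        from filterlim_compose[OF exp_at_bot this] show "((\<lambda>x. cmod (?e x)) \<longlongrightarrow> 0) at_top"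
          unfolding norm_exp_i .
      qed
      then show ?thesis by (intro tendsto_intros nl Nl theta_sol[OF V z])
    qed
    then have "((\<lambda>x. ?e x * ?e x * (\<i> * \<zeta> * N x * jost_m V \<zeta> x - jost_P V \<zeta> x * n x)) \<longlongrightarrow> 0) at_top" by simp
    then have "((\<lambda>x::real. W) \<longlongrightarrow> 0) at_top"
    proof (rule Lim_transform_eventually)
      show "\<forall>\<^sub>F x in at_top. ?e x * ?e x * (\<i> * \<zeta> * N x * jost_m V \<zeta> x - jost_P V \<zeta> x * n x) = W"
        using ev
      proof eventually_elim
        case (elim x)
        show ?case unfolding W[OF elim, symmetric] n N theta_def theta'_def by (simp add: algebra_simps)
      qed
    qed
    then have W0: "W = 0" by (simp add: tendsto_const_iff)
    \<comment> \<open>A point where \<open>theta\<close> does not vanish: there a zero Wronskian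
      makes the value and the derivative of \<open>v\<close> the same multiple of those of
      \<open>theta\<close>. Uniqueness extends this to all \<open>x\<close>, and the normalisation
      at infinity gives the factor 1.\<close>
    have "\<forall>\<^sub>F x in at_top. jost_m V \<zeta> x \<noteq> 0"
      using tendsto_imp_eventually_ne[OF theta_sol(2)[OF V z], of 0] by simp
    from eventually_conj[OF this ev] obtain x0 where x0: "jost_m V \<zeta> x0 \<noteq> 0" "0 \<le> x0"
      using eventually_happens by force
    have t0: "theta V \<zeta> x0 \<noteq> 0" using x0 by (simp add: theta_def)
    define c where "c = v x0 / theta V \<zeta> x0"
    have vx0: "v x0 = c * theta V \<zeta> x0" using t0 by (simp add: c_def)
    have "(hderiv v x0 - c * theta' V \<zeta> x0) * theta V \<zeta> x0 = 0"
      using W[OF x0(2)] W0 vx0 by (simp add: algebra_simps)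
    then have dvx0: "hderiv v x0 = c * theta' V \<zeta> x0" using t0 by simp
    have vc: "v x = c * theta V \<zeta> x" if "0 \<le> x" for x
      by (rule sol_unique'(1)[OF V z vs sol_cmult[OF theta_sol(1)[OF V z]] x0(2) vx0 dvx0 that])
    have "((\<lambda>x. c * jost_m V \<zeta> x) \<longlongrightarrow> c * 1) at_top"
      by (intro tendsto_intros theta_sol[OF V z])
    moreover have "((\<lambda>x. c * jost_m V \<zeta> x) \<longlongrightarrow> 1) at_top"
      using nl by (rule Lim_transform_eventually)
        (rule eventually_mono[OF ev], simp add: n_def vc theta_def)
    ultimately have "c * 1 = 1" by (rule tendsto_unique[OF trivial_limit_at_top_linorder])
    then have c: "c = 1" by simp
    show "v = r"
    proof
      fix x show "v x = r x"
        using v vc[of x] c by (cases "0 \<le> x") (auto simp: r_def extensional_def)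
    qed
  qed
  then show ?thesis using x by (simp add: r_def)
qed

lemma hderiv_cong:
  assumes "\<And>x. 0 \<le> x \<Longrightarrow> u x = v x" "sol V \<zeta> v p" "0 \<le> x"
  shows "hderiv u x = p x"
proof -
  have "sol V \<zeta> u p" by (rule sol_cong[OF assms(2)]) (simp_all add: assms(1))
  then show ?thesis by (rule sol_hderiv(2)[OF _ assms(3)])
qed

text \<open>The definite descriptions are eliminated: what remains are \<open>jost_m\<close> and
  \<open>jost_P\<close> at 0, whose dependence on \<open>\<zeta>\<close> can be estimated.\<close>

lemma jost_function_eq:
  assumes V: "integrable halfline V" and z: "0 < Im \<zeta>"
  shows "jost_function V \<gamma> \<zeta> = of_real \<gamma> * jost_m V \<zeta> 0 - jost_P V \<zeta> 0"
proof -
  obtain u p where u: "sol V \<zeta> u p" "u 0 = 1" "p 0 = of_real \<gamma>"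
    using regular_exists[OF V z, of 1 "of_real \<gamma>"] by blast
  have "hderiv (regular_solution V \<gamma> \<zeta>) 0 = of_real \<gamma>" "regular_solution V \<gamma> \<zeta> 0 = 1"
    using hderiv_cong[OF regular_solution_eq[OF V z u] u(1), of 0] regular_solution_eq[OF V z u, of 0] u by simp_all
  moreover have "hderiv (jost_solution V \<zeta>) 0 = theta' V \<zeta> 0" "jost_solution V \<zeta> 0 = theta V \<zeta> 0"
    using hderiv_cong[OF jost_solution_eq[OF V z] theta_sol(1)[OF V z], of 0] jost_solution_eq[OF V z, of 0] by simp_all
  ultimately show ?thesis
    by (simp add: jost_function_def wronskian_def theta_def theta'_def)
qed

text \<open>The amplitude \<open>L\<close> of the growing part is found by evaluating the constant
  Wronskian with \<open>theta\<close> at infinity: there it equals \<open>-2 i \<zeta> L\<close>, at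
  0 it is the Jost function.\<close>

lemma regular_props:
  fixes V :: "real \<Rightarrow> real" and \<gamma> :: real and \<zeta> :: complex
  assumes V: "integrable halfline V" and z: "0 < Im \<zeta>"
  defines "\<phi> \<equiv> regular_solution V \<gamma> \<zeta>"
  shows "sol V \<zeta> \<phi> (hderiv \<phi>)" "\<phi> 0 = 1" "hderiv \<phi> 0 = of_real \<gamma>"
    "\<exists>C. \<forall>x\<ge>0. cmod (\<phi> x) \<le> C * exp (Im \<zeta> * x)"
    "0 \<le> x \<Longrightarrow> hderiv \<phi> x * theta V \<zeta> x - theta' V \<zeta> x * \<phi> x = jost_function V \<gamma> \<zeta>"
    "((\<lambda>x. exp (\<i> * \<zeta> * of_real x) * \<phi> x) \<longlongrightarrow> - jost_function V \<gamma> \<zeta> / (2 * \<i> * \<zeta>)) at_top"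
    "((\<lambda>x. exp (\<i> * \<zeta> * of_real x) * hderiv \<phi> x) \<longlongrightarrow> jost_function V \<gamma> \<zeta> / 2) at_top"
proof -
  have z0: "\<zeta> \<noteq> 0" using z by auto
  obtain u p C L where u: "sol V \<zeta> u p" "u 0 = 1" "p 0 = of_real \<gamma>" "\<forall>x\<ge>0. cmod (u x) \<le> C * exp (Im \<zeta> * x)"
    "((\<lambda>x. exp (\<i> * \<zeta> * of_real x) * u x) \<longlongrightarrow> L) at_top"
    "((\<lambda>x. exp (\<i> * \<zeta> * of_real x) * p x) \<longlongrightarrow> - (\<i> * \<zeta> * L)) at_top"
    using regular_exists[OF V z, of 1 "of_real \<gamma>"] by blast
  have \<phi>: "\<phi> x = u x" if "0 \<le> x" for x
    unfolding \<phi>_def by (rule regular_solution_eq[OF V z u(1-3) that])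
  have \<phi>': "hderiv \<phi> x = p x" if "0 \<le> x" for x
    by (rule hderiv_cong[OF \<phi> u(1) that])
  show s: "sol V \<zeta> \<phi> (hderiv \<phi>)" by (rule sol_cong[OF u(1)]) (simp_all add: \<phi> \<phi>')
  show 0: "\<phi> 0 = 1" "hderiv \<phi> 0 = of_real \<gamma>" using u by (simp_all add: \<phi> \<phi>')
  show "\<exists>C. \<forall>x\<ge>0. cmod (\<phi> x) \<le> C * exp (Im \<zeta> * x)" using u(4) by (auto simp: \<phi>)
  have W: "hderiv \<phi> x * theta V \<zeta> x - theta' V \<zeta> x * \<phi> x = jost_function V \<gamma> \<zeta>" if "0 \<le> x" for x
    unfolding wronskian_const[OF s theta_sol(1)[OF V z] that] jost_function_eq[OF V z]
    by (simp add: 0 theta_def theta'_def)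
  then show "0 \<le> x \<Longrightarrow> hderiv \<phi> x * theta V \<zeta> x - theta' V \<zeta> x * \<phi> x = jost_function V \<gamma> \<zeta>" .
  have l1: "((\<lambda>x. exp (\<i> * \<zeta> * of_real x) * \<phi> x) \<longlongrightarrow> L) at_top"
    using u(5) by (rule Lim_transform_eventually) (rule eventually_mono[OF eventually_ge_at_top[of 0]], simp add: \<phi>)
  have l2: "((\<lambda>x. exp (\<i> * \<zeta> * of_real x) * hderiv \<phi> x) \<longlongrightarrow> - (\<i> * \<zeta> * L)) at_top"
    using u(6) by (rule Lim_transform_eventually) (rule eventually_mono[OF eventually_ge_at_top[of 0]], simp add: \<phi>')
  have "((\<lambda>x. exp (\<i> * \<zeta> * of_real x) * hderiv \<phi> x * jost_m V \<zeta> x - exp (\<i> * \<zeta> * of_real x) * \<phi> x * jost_P V \<zeta> x)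
      \<longlongrightarrow> - (\<i> * \<zeta> * L) * 1 - L * (\<i> * \<zeta>)) at_top"
    by (intro tendsto_intros l1 l2 theta_sol[OF V z])
  then have "((\<lambda>x::real. jost_function V \<gamma> \<zeta>) \<longlongrightarrow> - (\<i> * \<zeta> * L) * 1 - L * (\<i> * \<zeta>)) at_top"
    by (rule Lim_transform_eventually)
       (rule eventually_mono[OF eventually_ge_at_top[of 0]], simp add: theta_def theta'_def algebra_simps flip: W)
  then have w: "jost_function V \<gamma> \<zeta> = - 2 * \<i> * \<zeta> * L"
    by (simp add: tendsto_const_iff algebra_simps)
  show "((\<lambda>x. exp (\<i> * \<zeta> * of_real x) * \<phi> x) \<longlongrightarrow> - jost_function V \<gamma> \<zeta> / (2 * \<i> * \<zeta>)) at_top"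
    using l1 z0 by (simp add: w)
  show "((\<lambda>x. exp (\<i> * \<zeta> * of_real x) * hderiv \<phi> x) \<longlongrightarrow> jost_function V \<gamma> \<zeta> / 2) at_top"
    using l2 by (simp add: w mult.assoc)
qed

lemma convergent_bounded_halfline:
  fixes f :: "real \<Rightarrow> complex"
  assumes f: "continuous_on {0..} f" "(f \<longlongrightarrow> l) at_top"
  shows "\<exists>B. \<forall>x\<ge>0. cmod (f x) \<le> B"
proof -
  have "\<forall>\<^sub>F x in at_top. dist (f x) l < 1" using f(2) by (rule tendstoD) simp
  then obtain b where b: "\<And>x. b \<le> x \<Longrightarrow> dist (f x) l < 1" by (auto simp: eventually_at_top_linorder)
  have "compact (f ` {0..b})" using f(1) by (intro compact_continuous_image) (auto elim: continuous_on_subset)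
  then obtain M where M: "\<And>x. x \<in> {0..b} \<Longrightarrow> cmod (f x) \<le> M"
    using compact_imp_bounded bounded_iff by (metis imageI)
  have "cmod (f x) \<le> max M (cmod l + 1)" if "0 \<le> x" for x
  proof (cases "x \<le> b")
    case True
    then show ?thesis using M[of x] that by simp
  next
    case False
    then have "dist (f x) l < 1" using b by simp
    then have "cmod (f x) \<le> cmod l + 1"
      using norm_triangle_sub[of "f x" l] by (simp add: dist_norm)
    then show ?thesis by simp
  qed
  then show ?thesis by blast
qed

section \<open>Dependence of the Jost solution on the spectral parameter\<close>

lemma exp_diff_le:
  assumes "Re a \<le> c" "Re b \<le> c"
  shows "cmod (exp a - exp b) \<le> exp c * cmod (a - b)"
proof (rule field_differentiable_bound[where S = "{z. Re z \<le> c}" and f' = exp])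
  show "convex {z. Re z \<le> c}" by (rule convex_halfspace_Re_le)
  show "(exp has_field_derivative exp z) (at z within {z. Re z \<le> c})" for z
    by (intro DERIV_subset[OF DERIV_exp]) simp
  show "cmod (exp z) \<le> exp c" if "z \<in> {z. Re z \<le> c}" for z
    using that by (simp add: norm_exp_eq_Re)
qed (use assms in auto)

text \<open>The mean value estimate produces a factor \<open>2 s\<close>, which the decay of the
  exponential absorbs: \<open>y exp (-y) \<le> 1\<close> for \<open>y = 2 k s\<close>. Thus the
  Lipschitz constant does not depend on \<open>s\<close>.\<close>

lemma exp_2i_lipschitz:
  assumes "0 < k" "k \<le> Im \<eta>" "k \<le> Im \<zeta>" "0 \<le> s"
  shows "cmod (exp (2 * \<i> * \<eta> * of_real s) - exp (2 * \<i> * \<zeta> * of_real s)) \<le> cmod (\<eta> - \<zeta>) / k"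
proof -
  have "cmod (exp (2 * \<i> * \<eta> * of_real s) - exp (2 * \<i> * \<zeta> * of_real s))
      \<le> exp (- (2 * k * s)) * cmod (2 * \<i> * \<eta> * of_real s - 2 * \<i> * \<zeta> * of_real s)"
    using assms by (intro exp_diff_le) (auto intro: mult_right_mono)
  also have "2 * \<i> * \<eta> * of_real s - 2 * \<i> * \<zeta> * of_real s = 2 * \<i> * of_real s * (\<eta> - \<zeta>)"
    by (simp add: algebra_simps)
  also have "exp (- (2 * k * s)) * cmod (2 * \<i> * of_real s * (\<eta> - \<zeta>)) = (2 * k * s * exp (- (2 * k * s))) * cmod (\<eta> - \<zeta>) / k"
    using assms by (simp add: norm_mult)
  also have "\<dots> \<le> 1 * cmod (\<eta> - \<zeta>) / k"
  proof (intro divide_right_mono mult_right_mono)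
    have "2 * k * s \<le> exp (2 * k * s)"
      using exp_ge_add_one_self[of "2 * k * s"] by linarith
    then show "2 * k * s * exp (- (2 * k * s)) \<le> 1"
      by (simp add: exp_minus field_simps)
  qed (use assms in auto)
  finally show ?thesis by simp
qed

lemma Im_le_imp_norm_ge: "k \<le> Im \<zeta> \<Longrightarrow> k \<le> cmod \<zeta>"
  using abs_Im_le_cmod[of \<zeta>] by linarith

text \<open>One \<open>1 / k\<^sup>2\<close> comes from varying the exponential, the other from
  varying the denominator.\<close>

lemma green_kernel_lipschitz:
  assumes k: "0 < k" "k \<le> Im \<eta>" "k \<le> Im \<zeta>" and s: "0 \<le> s"
  shows "cmod (green_kernel \<eta> s - green_kernel \<zeta> s) \<le> 2 / k\<^sup>2 * cmod (\<eta> - \<zeta>)"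
proof -
  let ?E = "\<lambda>\<zeta>. exp (2 * \<i> * \<zeta> * of_real s)"
  have nz: "\<eta> \<noteq> 0" "\<zeta> \<noteq> 0" and Im: "0 < Im \<eta>" "0 < Im \<zeta>" using k by auto
  have ge: "k \<le> cmod \<eta>" "k \<le> cmod \<zeta>" using k Im_le_imp_norm_ge by blast+
  have "green_kernel \<eta> s - green_kernel \<zeta> s = (?E \<eta> - ?E \<zeta>) / (2 * \<i> * \<eta>) - (?E \<zeta> - 1) * (\<eta> - \<zeta>) / (2 * \<i> * \<eta> * \<zeta>)"
    using nz by (simp add: green_kernel_def field_simps)
  also have "cmod \<dots> \<le> cmod ((?E \<eta> - ?E \<zeta>) / (2 * \<i> * \<eta>)) + cmod ((?E \<zeta> - 1) * (\<eta> - \<zeta>) / (2 * \<i> * \<eta> * \<zeta>))"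
    by (rule norm_triangle_ineq4)
  also have "cmod ((?E \<eta> - ?E \<zeta>) / (2 * \<i> * \<eta>)) \<le> (cmod (\<eta> - \<zeta>) / k) / k"
    unfolding norm_divide
  proof (rule frac_le)
    show "cmod (?E \<eta> - ?E \<zeta>) \<le> cmod (\<eta> - \<zeta>) / k" by (rule exp_2i_lipschitz[OF k s])
    show "k \<le> cmod (2 * \<i> * \<eta>)" using ge(1) k(1) by (simp add: norm_mult)
  qed (use k in auto)
  also have "cmod ((?E \<zeta> - 1) * (\<eta> - \<zeta>) / (2 * \<i> * \<eta> * \<zeta>)) \<le> (2 * cmod (\<eta> - \<zeta>)) / (2 * (k * k))"
    unfolding norm_divide
  proof (rule frac_le)
    have "cmod (?E \<zeta> - 1) \<le> 2"
      by (rule order_trans[OF norm_triangle_ineq4 order_trans[OF add_mono[OF norm_exp_2i_le_1[OF Im(2) s]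
              order_eq_refl[OF norm_one]]]]) simp
    then show "cmod ((?E \<zeta> - 1) * (\<eta> - \<zeta>)) \<le> 2 * cmod (\<eta> - \<zeta>)"
      unfolding norm_mult by (intro mult_right_mono) auto
    have "k * k \<le> cmod \<eta> * cmod \<zeta>" using ge k by (intro mult_mono) auto
    then show "2 * (k * k) \<le> cmod (2 * \<i> * \<eta> * \<zeta>)" by (simp add: norm_mult)
  qed (use k in auto)
  also have "cmod (\<eta> - \<zeta>) / k / k + 2 * cmod (\<eta> - \<zeta>) / (2 * (k * k)) = 2 / k\<^sup>2 * cmod (\<eta> - \<zeta>)"
    using k by (simp add: power2_eq_square field_simps)
  finally show ?thesis by simp
qed

lemma tail_kernel_le:
  fixes f :: "real \<Rightarrow> complex"
  assumes f: "integrable halfline f" and v: "integrable halfline v"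
    and z: "\<And>t. 0 \<le> t \<Longrightarrow> t \<le> x \<Longrightarrow> f t = 0" and le: "\<And>t. 0 \<le> t \<Longrightarrow> x < t \<Longrightarrow> cmod (f t) \<le> v t"
  shows "cmod (LINT t|halfline. f t) \<le> tail x v"
proof -
  have "seg 0 x f = seg 0 x (\<lambda>t. 0)"
    using z by (intro Bochner_Integration.integral_cong) auto
  then have "tail x f = (LINT t|halfline. f t)" by (simp add: tail_def)
  then show ?thesis using tail_norm_le[OF f v, of x 1] le by simp
qed

lemma tail_cmult: "tail x (\<lambda>t. c * f t) = c * tail x f" for f :: "real \<Rightarrow> 'a::{real_normed_field, euclidean_space}"
  unfolding tail_def by (simp add: right_diff_distrib)

lemma tail_diff:
  assumes "integrable halfline f" "integrable halfline g"
  shows "tail x (\<lambda>t. f t - g t) = tail x f - tail x g"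
  using assms halfline_seg_integrable[OF assms(1), of 0 x] halfline_seg_integrable[OF assms(2), of 0 x]
  unfolding tail_def by simp

lemma tail_nonneg:
  fixes v :: "real \<Rightarrow> real"
  assumes "integrable halfline v" "\<And>t. 0 \<le> v t" shows "0 \<le> tail x v"
  using seg_le_total[OF assms, of x] by (simp add: tail_def)

lemma tail_le_total:
  fixes v :: "real \<Rightarrow> real"
  assumes "\<And>t. 0 \<le> v t" shows "tail x v \<le> (LINT t|halfline. v t)"
  using seg_nonneg[OF assms, of 0 x] by (simp add: tail_def)

text \<open>The factor \<open>tail x\<close> is essential, since it makes the error vanish at
  infinity. The difference \<open>d\<close> of the two functions \<open>m\<close> solves the
  Volterra equation at \<open>\<zeta>\<close> with a source of size
  \<open>cmod (\<eta> - \<zeta>) * T x\<close>. The a priori estimate first yields a bound for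
  \<open>d\<close> that is uniform in \<open>x\<close>; inserting it once into the integral
  operator, which only sees \<open>t > x\<close>, restores the factor \<open>T x\<close>. For
  \<open>jost_P\<close> the limit at infinity varies too, so its increment
  \<open>i (\<eta> - \<zeta>)\<close> is subtracted.\<close>

lemma jost_lipschitz:
  assumes V: "integrable halfline V" and z: "0 < Im \<zeta>"
  shows "\<exists>K\<ge>0. \<forall>\<eta>. cmod (\<eta> - \<zeta>) < Im \<zeta> / 2 \<longrightarrow> 0 < Im \<eta> \<and>
    (\<forall>x\<ge>0. cmod (jost_m V \<eta> x - jost_m V \<zeta> x) \<le> K * cmod (\<eta> - \<zeta>) * tail x (\<lambda>t. \<bar>V t\<bar>) \<and>
      cmod (jost_P V \<eta> x - jost_P V \<zeta> x - \<i> * (\<eta> - \<zeta>)) \<le> K * cmod (\<eta> - \<zeta>) * tail x (\<lambda>t. \<bar>V t\<bar>))"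
proof -
  \<comment> \<open>Both \<open>\<zeta>\<close> and every admissible \<open>\<eta>\<close> have
    imaginary part at least \<open>k\<close>, so constants expressed through \<open>k\<close> are
    uniform in \<open>\<eta>\<close>.\<close>
  define k where "k = Im \<zeta> / 2"
  have k: "0 < k" "k \<le> Im \<zeta>" using z by (auto simp: k_def)
  define N where "N = (LINT t|halfline. \<bar>V t\<bar>)"
  define M where "M = 2 * exp (2 * (1 / k) * N)"
  define T where "T x = tail x (\<lambda>t. \<bar>V t\<bar>)" for x
  have N0: "0 \<le> N" unfolding N_def by (rule Bochner_Integration.integral_nonneg) simp
  have Va: "integrable halfline (\<lambda>t. \<bar>V t\<bar>)" using V by simp
  have T0: "0 \<le> T x" for x unfolding T_def by (rule tail_nonneg[OF Va]) simp
  have TN: "T x \<le> N" for x unfolding T_def N_def by (rule tail_le_total) simp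
  have M0: "0 \<le> M" by (simp add: M_def)
  have cVi: "integrable halfline (\<lambda>t. c * \<bar>V t\<bar>)" for c using V by simp
  have Bm: "2 * exp (2 * (1 / cmod \<eta>) * N) \<le> M" if "k \<le> Im \<eta>" for \<eta>
  proof -
    have "1 / cmod \<eta> \<le> 1 / k" using Im_le_imp_norm_ge[OF that] k(1) by (intro frac_le) auto
    then have "2 * (1 / cmod \<eta>) * N \<le> 2 * (1 / k) * N" using N0 by (intro mult_right_mono) auto
    then show ?thesis by (simp add: M_def)
  qed
  have mM: "cmod (jost_m V \<eta> x) \<le> M" if "k \<le> Im \<eta>" "0 \<le> x" for \<eta> x
    using jost_m(2)[OF V _ that(2), of \<eta>] Bm[OF that(1)] that(1) k unfolding N_def by simp
  define c where "c = 2 / k\<^sup>2 * M"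
  define c2 where "c2 = c * N * M"
  define K1 where "K1 = c + c2 / k"
  define K2 where "K2 = c2 + M / k"
  have c0: "0 \<le> c" "0 \<le> c2" using k M0 N0 by (auto simp: c_def c2_def)
  have "0 < Im \<eta> \<and>
    (\<forall>x\<ge>0. cmod (jost_m V \<eta> x - jost_m V \<zeta> x) \<le> (K1 + K2) * cmod (\<eta> - \<zeta>) * T x \<and>
      cmod (jost_P V \<eta> x - jost_P V \<zeta> x - \<i> * (\<eta> - \<zeta>)) \<le> (K1 + K2) * cmod (\<eta> - \<zeta>) * T x)"
    if \<eta>: "cmod (\<eta> - \<zeta>) < Im \<zeta> / 2" for \<eta>
  proof -
    have k\<eta>: "k \<le> Im \<eta>" using \<eta> abs_Im_le_cmod[of "\<eta> - \<zeta>"] by (simp add: k_def)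
    have Im\<eta>: "0 < Im \<eta>" using k\<eta> k by simp
    note m\<eta> = jost_m[OF V Im\<eta>] and m\<zeta> = jost_m[OF V z]
    define D where "D = cmod (\<eta> - \<zeta>)"
    have D0: "0 \<le> D" by (simp add: D_def)
    define d where "d x = jost_m V \<eta> x - jost_m V \<zeta> x" for x
    interpret E: volterra "\<lambda>x t. green_kernel \<eta> (max (t - x) 0)" V
      "\<lambda>x. exp (2 * (1 / cmod \<eta>) * ((LINT t|halfline. \<bar>V t\<bar>) - seg 0 x (\<lambda>t. \<bar>V t\<bar>)))"
      "1 / cmod \<eta>" "exp (2 * (1 / cmod \<eta>) * (LINT t|halfline. \<bar>V t\<bar>))"
      by (rule green_kernel_backward_volterra[OF V Im\<eta>])
    interpret Z: volterra "\<lambda>x t. green_kernel \<zeta> (max (t - x) 0)" V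
      "\<lambda>x. exp (2 * (1 / cmod \<zeta>) * ((LINT t|halfline. \<bar>V t\<bar>) - seg 0 x (\<lambda>t. \<bar>V t\<bar>)))"
      "1 / cmod \<zeta>" "exp (2 * (1 / cmod \<zeta>) * (LINT t|halfline. \<bar>V t\<bar>))"
      by (rule green_kernel_backward_volterra[OF V z])
    have dc: "continuous_on {0..} d" unfolding d_def by (intro continuous_intros m\<eta>(1) m\<zeta>(1))
    have dM: "cmod (d x) \<le> 2 * M" if "0 \<le> x" for x
      unfolding d_def using norm_triangle_ineq4[of "jost_m V \<eta> x" "jost_m V \<zeta> x"] mM[OF k\<eta> that] mM[OF k(2) that] by simp
    have iE: "integrable halfline (\<lambda>t. green_kernel \<eta> (max (t - x) 0) * of_real (V t) * jost_m V \<eta> t)"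
      and iZ: "integrable halfline (\<lambda>t. green_kernel \<zeta> (max (t - x) 0) * of_real (V t) * jost_m V \<eta> t)"
      and iZ': "integrable halfline (\<lambda>t. green_kernel \<zeta> (max (t - x) 0) * of_real (V t) * jost_m V \<zeta> t)"
      and iD: "integrable halfline (\<lambda>t. green_kernel \<zeta> (max (t - x) 0) * of_real (V t) * d t)" if "0 \<le> x" for x
      by (rule E.K_integrable[OF m\<eta>(1) m\<eta>(2) that], assumption, rule Z.K_integrable[OF m\<eta>(1) m\<eta>(2) that], assumption,
          rule Z.K_integrable[OF m\<zeta>(1) m\<zeta>(2) that], assumption, rule Z.K_integrable[OF dc dM that])
    have r: "d x - Z.K d x = (LINT t|halfline. green_kernel \<eta> (max (t - x) 0) * of_real (V t) * jost_m V \<eta> t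
        - green_kernel \<zeta> (max (t - x) 0) * of_real (V t) * jost_m V \<eta> t)" if x: "0 \<le> x" for x
    proof -
      have "Z.K d x = (LINT t|halfline. green_kernel \<zeta> (max (t - x) 0) * of_real (V t) * jost_m V \<eta> t
          - green_kernel \<zeta> (max (t - x) 0) * of_real (V t) * jost_m V \<zeta> t)"
        unfolding Z.K_def d_def by (simp add: right_diff_distrib)
      also have "\<dots> = (LINT t|halfline. green_kernel \<zeta> (max (t - x) 0) * of_real (V t) * jost_m V \<eta> t)
          - (LINT t|halfline. green_kernel \<zeta> (max (t - x) 0) * of_real (V t) * jost_m V \<zeta> t)"
        by (rule Bochner_Integration.integral_diff[OF iZ[OF x] iZ'[OF x]])
      finally have Kd: "Z.K d x = \<dots>" .
      have "d x = (LINT t|halfline. green_kernel \<eta> (max (t - x) 0) * of_real (V t) * jost_m V \<eta> t)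
          - (LINT t|halfline. green_kernel \<zeta> (max (t - x) 0) * of_real (V t) * jost_m V \<zeta> t)"
        unfolding d_def by (subst m\<eta>(3)[OF x], subst m\<zeta>(3)[OF x]) (simp add: mult.assoc)
      then show ?thesis
        unfolding Kd Bochner_Integration.integral_diff[OF iE[OF x] iZ[OF x]] by simp
    qed
    have rT: "cmod (d x - Z.K d x) \<le> c * D * T x" if x: "0 \<le> x" for x
    proof -
      have "cmod (d x - Z.K d x) \<le> tail x (\<lambda>t. (c * D) * \<bar>V t\<bar>)"
        unfolding r[OF x]
      proof (rule tail_kernel_le)
        show "integrable halfline (\<lambda>t. green_kernel \<eta> (max (t - x) 0) * of_real (V t) * jost_m V \<eta> t
            - green_kernel \<zeta> (max (t - x) 0) * of_real (V t) * jost_m V \<eta> t)"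
          by (rule Bochner_Integration.integrable_diff[OF iE[OF x] iZ[OF x]])
        fix t :: real assume t: "0 \<le> t" "x < t"
        have "green_kernel \<eta> (max (t - x) 0) * of_real (V t) * jost_m V \<eta> t - green_kernel \<zeta> (max (t - x) 0) * of_real (V t) * jost_m V \<eta> t
            = (green_kernel \<eta> (t - x) - green_kernel \<zeta> (t - x)) * (of_real (V t) * jost_m V \<eta> t)"
          using t by (simp add: algebra_simps)
        also have "cmod \<dots> \<le> (2 / k\<^sup>2 * D) * (\<bar>V t\<bar> * M)"
          unfolding norm_mult norm_of_real D_def using t k\<eta> k M0
          by (intro mult_mono mult_left_mono mM green_kernel_lipschitz) auto
        also have "\<dots> = (c * D) * \<bar>V t\<bar>" by (simp add: c_def)
        finally show "cmod (green_kernel \<eta> (max (t - x) 0) * of_real (V t) * jost_m V \<eta> t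
            - green_kernel \<zeta> (max (t - x) 0) * of_real (V t) * jost_m V \<eta> t) \<le> (c * D) * \<bar>V t\<bar>" .
      qed (rule cVi, simp add: max_def)
      then show ?thesis unfolding tail_cmult T_def[symmetric] .
    qed
    have dD: "cmod (d x) \<le> c2 * D" if x: "0 \<le> x" for x
    proof -
      have "cmod (d x) \<le> 2 * (c * D * N) * exp (2 * (1 / cmod \<zeta>) * (LINT t|halfline. \<bar>V t\<bar>))"
      proof (rule Z.solution_bound[OF dc dM _ x])
        fix y :: real assume "0 \<le> y"
        then show "cmod (d y - Z.K d y) \<le> c * D * N"
          using rT[of y] mult_left_mono[OF TN[of y], of "c * D"] c0 D0 by simp
      qed
      also have "\<dots> = (c * D * N) * (2 * exp (2 * (1 / cmod \<zeta>) * N))" by (simp add: N_def)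
      also have "\<dots> \<le> (c * D * N) * M" using c0 D0 N0 by (intro mult_left_mono Bm k) auto
      finally show ?thesis by (simp add: c2_def mult_ac)
    qed
    have 1: "cmod (d x) \<le> K1 * D * T x" if x: "0 \<le> x" for x
    proof -
      have "cmod (Z.K d x) \<le> tail x (\<lambda>t. (1 / k * c2 * D) * \<bar>V t\<bar>)"
        unfolding Z.K_def
      proof (rule tail_kernel_le[OF iD[OF x]])
        fix t :: real assume t: "0 \<le> t" "x < t"
        have "cmod (green_kernel \<zeta> (max (t - x) 0)) \<le> 1 / k"
        proof -
          have "cmod (green_kernel \<zeta> (max (t - x) 0)) \<le> 1 / cmod \<zeta>" by (rule green_kernel_bound[OF z]) simp
          also have "\<dots> \<le> 1 / k" using Im_le_imp_norm_ge[OF k(2)] k(1) by (intro frac_le) auto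
          finally show ?thesis .
        qed
        then have "cmod (green_kernel \<zeta> (max (t - x) 0) * of_real (V t) * d t) \<le> 1 / k * \<bar>V t\<bar> * (c2 * D)"
          unfolding norm_mult norm_of_real using k t by (intro mult_mono dD) auto
        then show "cmod (green_kernel \<zeta> (max (t - x) 0) * of_real (V t) * d t) \<le> (1 / k * c2 * D) * \<bar>V t\<bar>"
          by (simp add: mult_ac)
      qed (rule cVi, simp add: max_def)
      then have "cmod (Z.K d x) \<le> c2 / k * D * T x" unfolding tail_cmult T_def[symmetric] by simp
      moreover have "cmod (d x) \<le> cmod (d x - Z.K d x) + cmod (Z.K d x)"
        using norm_triangle_ineq[of "d x - Z.K d x" "Z.K d x"] by simp
      ultimately show ?thesis using rT[OF x] by (simp add: K1_def algebra_simps)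
    qed
    have 2: "cmod (jost_P V \<eta> x - jost_P V \<zeta> x - \<i> * (\<eta> - \<zeta>)) \<le> K2 * D * T x" if x: "0 \<le> x" for x
    proof -
      let ?g = "\<lambda>\<zeta> t. complex_of_real (V t) * jost_m V \<zeta> t"
      let ?h = "\<lambda>\<zeta> t. exp (2 * \<i> * \<zeta> * of_real t) * ?g \<zeta> t"
      let ?F = "\<lambda>\<zeta>. exp (- (2 * \<i> * \<zeta>) * of_real x)"
      have gi: "integrable halfline (?g \<eta>)" "integrable halfline (?g \<zeta>)"
        by (rule V_mult_integrable[OF V m\<eta>(1,2)], assumption, rule V_mult_integrable[OF V m\<zeta>(1,2)], assumption)
      have hi: "integrable halfline (\<lambda>t. ?F \<eta> * ?h \<eta> t)" "integrable halfline (\<lambda>t. ?F \<zeta> * ?h \<zeta> t)"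
        by (intro integrable_mult_right backward_representation(2) gi Im\<eta> z)+
      have "cmod (tail x (?g \<eta>) - tail x (?g \<zeta>)) \<le> tail x (\<lambda>t. (c2 * D) * \<bar>V t\<bar>)"
      proof -
        have "cmod (1 * tail x (\<lambda>t. ?g \<eta> t - ?g \<zeta> t)) \<le> tail x (\<lambda>t. (c2 * D) * \<bar>V t\<bar>)"
        proof (rule tail_norm_le[OF _ cVi])
          fix t :: real assume t: "0 \<le> t" "x < t"
          have "cmod (1 * (?g \<eta> t - ?g \<zeta> t)) = \<bar>V t\<bar> * cmod (d t)"
            by (simp add: d_def norm_mult flip: right_diff_distrib)
          also have "\<dots> \<le> \<bar>V t\<bar> * (c2 * D)" by (intro mult_left_mono dD t) auto
          finally show "cmod (1 * (?g \<eta> t - ?g \<zeta> t)) \<le> (c2 * D) * \<bar>V t\<bar>" by (simp add: mult_ac)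
        qed (intro Bochner_Integration.integrable_diff gi)
        then show ?thesis using tail_diff[OF gi] by simp
      qed
      then have A: "cmod (tail x (?g \<eta>) - tail x (?g \<zeta>)) \<le> c2 * D * T x" unfolding tail_cmult T_def[symmetric] .
      have "cmod (?F \<eta> * tail x (?h \<eta>) - ?F \<zeta> * tail x (?h \<zeta>)) \<le> tail x (\<lambda>t. (c2 * D + D / k * M) * \<bar>V t\<bar>)"
      proof -
        have "cmod (1 * tail x (\<lambda>t. ?F \<eta> * ?h \<eta> t - ?F \<zeta> * ?h \<zeta> t)) \<le> tail x (\<lambda>t. (c2 * D + D / k * M) * \<bar>V t\<bar>)"
        proof (rule tail_norm_le[OF _ cVi])
          fix t :: real assume t: "0 \<le> t" "x < t"
          let ?E = "\<lambda>\<zeta>. exp (2 * \<i> * \<zeta> * of_real (t - x))"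
          have "1 * (?F \<eta> * ?h \<eta> t - ?F \<zeta> * ?h \<zeta> t) = ?E \<eta> * ?g \<eta> t - ?E \<zeta> * ?g \<zeta> t"
            unfolding exp_2i_shift by simp
          also have "\<dots> = of_real (V t) * (?E \<zeta> * d t + (?E \<eta> - ?E \<zeta>) * jost_m V \<eta> t)"
            by (simp add: d_def algebra_simps)
          also have "cmod \<dots> \<le> \<bar>V t\<bar> * (1 * (c2 * D) + D / k * M)"
            unfolding norm_mult norm_of_real
          proof (intro mult_left_mono order_trans[OF norm_triangle_ineq] add_mono)
            show "cmod (?E \<zeta> * d t) \<le> 1 * (c2 * D)"
              unfolding norm_mult using t by (intro mult_mono norm_exp_2i_le_1 z dD) auto
            show "cmod ((?E \<eta> - ?E \<zeta>) * jost_m V \<eta> t) \<le> D / k * M"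
              unfolding norm_mult D_def using t k k\<eta> by (intro mult_mono exp_2i_lipschitz mM) auto
          qed simp
          finally show "cmod (1 * (?F \<eta> * ?h \<eta> t - ?F \<zeta> * ?h \<zeta> t)) \<le> (c2 * D + D / k * M) * \<bar>V t\<bar>"
            by (simp add: mult_ac)
        qed (intro Bochner_Integration.integrable_diff hi)
        then show ?thesis using tail_diff[OF hi] by (simp add: tail_cmult)
      qed
      then have B: "cmod (?F \<eta> * tail x (?h \<eta>) - ?F \<zeta> * tail x (?h \<zeta>)) \<le> (c2 * D + D / k * M) * T x"
        unfolding tail_cmult T_def[symmetric] .
      have "jost_P V \<eta> x - jost_P V \<zeta> x - \<i> * (\<eta> - \<zeta>)
          = - ((tail x (?g \<eta>) - tail x (?g \<zeta>)) + (?F \<eta> * tail x (?h \<eta>) - ?F \<zeta> * tail x (?h \<zeta>))) / 2"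
        unfolding jost_P_def by (simp add: field_simps)
      also have "cmod \<dots> \<le> (c2 * D * T x + (c2 * D + D / k * M) * T x) / 2"
        unfolding norm_divide norm_minus_cancel
        using norm_triangle_mono[OF A B] by (simp add: divide_right_mono)
      \<comment> \<open>Doubling \<open>D / k * M\<close> is a convenient loss that makes the
        average equal to \<open>K2 * D * T x\<close>.\<close>
      also have "\<dots> \<le> (c2 * D * T x + (c2 * D + 2 * D / k * M) * T x) / 2"
        using D0 k M0 T0[of x] by (intro divide_right_mono add_mono mult_right_mono order_refl) auto
      also have "\<dots> = K2 * D * T x"
        by (simp add: K2_def field_simps)
      finally show ?thesis .
    qed
    have "K1 * D * T x \<le> (K1 + K2) * D * T x" "K2 * D * T x \<le> (K1 + K2) * D * T x" for x
      using c0 k M0 D0 T0[of x] by (auto simp: K1_def K2_def intro!: mult_right_mono)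
    then show ?thesis using Im\<eta> 1 2 unfolding D_def d_def by (meson order_trans)
  qed
  moreover have "0 \<le> K1 + K2" using c0 k M0 by (simp add: K1_def K2_def)
  ultimately show ?thesis unfolding T_def by blast
qed

section \<open>The derivative of the Jost function\<close>

text \<open>The limit of this expression as \<open>X\<close> tends to infinity is the derivative of the Jost
  function; it comes from \<open>\<integral>\<^sub>0\<^sup>X \<phi>(\<zeta>) \<theta>(\<eta>) dx\<close> expressed through Wronskians.\<close>

definition approx_deriv :: "(real \<Rightarrow> real) \<Rightarrow> real \<Rightarrow> complex \<Rightarrow> real \<Rightarrow> complex" where
  "approx_deriv V \<gamma> \<zeta> X = \<i> * of_real X * jost_function V \<gamma> \<zeta>
     - \<i> * exp (\<i> * \<zeta> * of_real X) * regular_solution V \<gamma> \<zeta> X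
     - 2 * \<zeta> * seg 0 X (\<lambda>x. regular_solution V \<gamma> \<zeta> x * theta V \<zeta> x)"

text \<open>The order of quantifiers is the point: \<open>C\<close> does not depend on
  \<open>X\<close>, whereas the neighbourhood of \<open>\<zeta>\<close> may depend on
  \<open>X\<close> and \<open>\<epsilon>\<close>. So \<open>\<eta>\<close> can tend to
  \<open>\<zeta>\<close> before \<open>X\<close> tends to infinity.\<close>

lemma jost_difference_quotient:
  assumes V: "integrable halfline V" and z: "0 < Im \<zeta>"
  shows "\<exists>C\<ge>0. \<forall>X\<ge>0. \<forall>\<epsilon>>0. \<forall>\<^sub>F \<eta> in at \<zeta>.
    cmod ((jost_function V \<gamma> \<eta> - jost_function V \<gamma> \<zeta>) / (\<eta> - \<zeta>) - approx_deriv V \<gamma> \<zeta> X)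
      \<le> C * tail X (\<lambda>t. \<bar>V t\<bar>) + \<epsilon>"
proof -
  define \<phi> where "\<phi> = regular_solution V \<gamma> \<zeta>"
  define \<phi>' where "\<phi>' x = hderiv \<phi> x" for x
  note \<phi> = regular_props[OF V z, where \<gamma> = \<gamma>, folded \<phi>_def, folded \<phi>'_def]
  define w where "w = jost_function V \<gamma>"
  let ?e = "\<lambda>\<eta> x. exp (\<i> * \<eta> * complex_of_real x)"
  define T where "T x = tail x (\<lambda>t. \<bar>V t\<bar>)" for x
  define N where "N = (LINT t|halfline. \<bar>V t\<bar>)"
  have Va: "integrable halfline (\<lambda>t. \<bar>V t\<bar>)" using V by simp
  have T0: "0 \<le> T x" for x unfolding T_def by (rule tail_nonneg[OF Va]) simp
  have TN: "T x \<le> N" for x unfolding T_def N_def by (rule tail_le_total) simp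
  obtain K where K: "0 \<le> K" "\<And>\<eta>. cmod (\<eta> - \<zeta>) < Im \<zeta> / 2 \<Longrightarrow> 0 < Im \<eta>"
    "\<And>\<eta> x. cmod (\<eta> - \<zeta>) < Im \<zeta> / 2 \<Longrightarrow> 0 \<le> x \<Longrightarrow> cmod (jost_m V \<eta> x - jost_m V \<zeta> x) \<le> K * cmod (\<eta> - \<zeta>) * T x"
    "\<And>\<eta> x. cmod (\<eta> - \<zeta>) < Im \<zeta> / 2 \<Longrightarrow> 0 \<le> x \<Longrightarrow>
      cmod (jost_P V \<eta> x - jost_P V \<zeta> x - \<i> * (\<eta> - \<zeta>)) \<le> K * cmod (\<eta> - \<zeta>) * T x"
    using jost_lipschitz[OF V z] unfolding T_def by blast
  have \<phi>c: "continuous_on {0..} \<phi>" "continuous_on {0..} \<phi>'" using sol_continuous[OF \<phi>(1)] .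
  obtain B1 where B1: "\<And>x. 0 \<le> x \<Longrightarrow> cmod (?e \<zeta> x * \<phi> x) \<le> B1"
    using convergent_bounded_halfline[OF continuous_on_mult[OF continuous_exp \<phi>c(1)] \<phi>(6)] by blast
  obtain B2 where B2: "\<And>x. 0 \<le> x \<Longrightarrow> cmod (?e \<zeta> x * \<phi>' x) \<le> B2"
    using convergent_bounded_halfline[OF continuous_on_mult[OF continuous_exp \<phi>c(2)] \<phi>(7)] by blast
  have B0: "0 \<le> B1" "0 \<le> B2"
    using B1[of 0] B2[of 0] norm_ge_zero[of "?e \<zeta> 0 * \<phi> 0"] norm_ge_zero[of "?e \<zeta> 0 * \<phi>' 0"] by linarith+
  \<comment> \<open>\<open>B1\<close> and \<open>B2\<close> bound \<open>\<phi>\<close> and its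
    derivative after multiplication by \<open>exp (i \<zeta> X)\<close>; the factor 2 pays for
    having \<open>exp (i \<eta> X)\<close> instead, with \<open>\<eta>\<close> close to
    \<open>\<zeta>\<close>.\<close>
  define C where "C = 2 * (B1 + B2) * K"
  have "\<forall>\<^sub>F \<eta> in at \<zeta>. cmod ((w \<eta> - w \<zeta>) / (\<eta> - \<zeta>) - approx_deriv V \<gamma> \<zeta> X) \<le> C * T X + \<epsilon>"
    if X: "0 \<le> X" and \<epsilon>: "0 < \<epsilon>" for X \<epsilon>
  proof -
    define J where "J \<eta> = seg 0 X (\<lambda>x. \<phi> x * theta V \<eta> x)" for \<eta>
    define m P where "m = jost_m V \<zeta> X" and "P = jost_P V \<zeta> X"
    define d where "d \<eta> = jost_m V \<eta> X - m" for \<eta>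
    define e where "e \<eta> = jost_P V \<eta> X - P - \<i> * (\<eta> - \<zeta>)" for \<eta>
    \<comment> \<open>\<open>main\<close> keeps \<open>m\<close> and \<open>P\<close> at the
      parameter \<open>\<zeta>\<close>, so only exponentials and \<open>J\<close> vary. Its second
      term stems from the leading increment \<open>i (\<eta> - \<zeta>)\<close> of \<open>P\<close>,
      the third from \<open>\<eta>\<^sup>2 - \<zeta>\<^sup>2\<close>. The remaining increments
      \<open>d\<close> and \<open>e\<close> form \<open>rem\<close>, which is small for large
      \<open>X\<close>.\<close>
    define main where "main \<eta> = (?e \<eta> X - ?e \<zeta> X) / (\<eta> - \<zeta>) * (\<phi>' X * m - \<phi> X * P)
        - \<i> * ?e \<eta> X * \<phi> X - (\<eta> + \<zeta>) * J \<eta>" for \<eta>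
    define rem where "rem \<eta> = ?e \<eta> X * (\<phi>' X * d \<eta> - \<phi> X * e \<eta>) / (\<eta> - \<zeta>)" for \<eta>
    have near: "\<forall>\<^sub>F \<eta> in at \<zeta>. cmod (\<eta> - \<zeta>) < Im \<zeta> / 2 \<and> \<eta> \<noteq> \<zeta>"
      unfolding eventually_at using z by (intro exI[of _ "Im \<zeta> / 2"]) (auto simp: dist_norm)
    have wN: "w \<eta> = \<phi>' X * theta V \<eta> X - theta' V \<eta> X * \<phi> X - (\<eta>\<^sup>2 - \<zeta>\<^sup>2) * J \<eta>" if Im: "0 < Im \<eta>" for \<eta>
    proof -
      have "\<phi>' X * theta V \<eta> X - theta' V \<eta> X * \<phi> X = (\<phi>' 0 * theta V \<eta> 0 - theta' V \<eta> 0 * \<phi> 0)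
          + seg 0 X (\<lambda>x. (of_real (V x - V x) - (\<zeta>\<^sup>2 - \<eta>\<^sup>2)) * (\<phi> x * theta V \<eta> x))"
        by (rule locally_ac_derivD(1)[OF wronskian_ac[OF \<phi>(1) theta_sol(1)[OF V Im]] X])
      also have "\<phi>' 0 * theta V \<eta> 0 - theta' V \<eta> 0 * \<phi> 0 = w \<eta>"
        unfolding w_def jost_function_eq[OF V Im] by (simp add: \<phi> theta_def theta'_def)
      also have "seg 0 X (\<lambda>x. (of_real (V x - V x) - (\<zeta>\<^sup>2 - \<eta>\<^sup>2)) * (\<phi> x * theta V \<eta> x)) = (\<eta>\<^sup>2 - \<zeta>\<^sup>2) * J \<eta>"
        by (simp add: J_def)
      finally show ?thesis by simp
    qed
    have split: "(w \<eta> - w \<zeta>) / (\<eta> - \<zeta>) = main \<eta> + rem \<eta>" if \<eta>: "cmod (\<eta> - \<zeta>) < Im \<zeta> / 2" "\<eta> \<noteq> \<zeta>" for \<eta>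
    proof -
      have w\<zeta>: "w \<zeta> = \<phi>' X * theta V \<zeta> X - theta' V \<zeta> X * \<phi> X" using wN[OF z] by simp
      have "w \<eta> - w \<zeta> = (?e \<eta> X - ?e \<zeta> X) * (\<phi>' X * m - \<phi> X * P) + ?e \<eta> X * (\<phi>' X * d \<eta> - \<phi> X * (\<i> * (\<eta> - \<zeta>) + e \<eta>))
          - (\<eta>\<^sup>2 - \<zeta>\<^sup>2) * J \<eta>"
        unfolding wN[OF K(2)[OF \<eta>(1)]] w\<zeta> theta_def theta'_def d_def e_def m_def P_def by (simp add: algebra_simps)
      also have "\<eta>\<^sup>2 - \<zeta>\<^sup>2 = (\<eta> - \<zeta>) * (\<eta> + \<zeta>)" by (simp add: power2_eq_square algebra_simps)
      also have "(?e \<eta> X - ?e \<zeta> X) * (\<phi>' X * m - \<phi> X * P) + ?e \<eta> X * (\<phi>' X * d \<eta> - \<phi> X * (\<i> * (\<eta> - \<zeta>) + e \<eta>))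
          - (\<eta> - \<zeta>) * (\<eta> + \<zeta>) * J \<eta> = (\<eta> - \<zeta>) * (main \<eta> + rem \<eta>)"
      proof -
        have M: "(\<eta> - \<zeta>) * main \<eta> = (?e \<eta> X - ?e \<zeta> X) * (\<phi>' X * m - \<phi> X * P) - (\<eta> - \<zeta>) * (\<i> * ?e \<eta> X * \<phi> X) - (\<eta> - \<zeta>) * (\<eta> + \<zeta>) * J \<eta>"
          "(\<eta> - \<zeta>) * rem \<eta> = ?e \<eta> X * (\<phi>' X * d \<eta> - \<phi> X * e \<eta>)"
           apply (simp add: main_def \<eta>(2) right_diff_distrib[of "\<eta> - \<zeta>"])
          apply (simp add: rem_def \<eta>(2))
          done
        show ?thesis
          unfolding distrib_left[of "\<eta> - \<zeta>" "main \<eta>" "rem \<eta>"] M by (simp add: algebra_simps)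
      qed
      finally show ?thesis using \<eta>(2) by simp
    qed
    have e_lim: "((\<lambda>\<eta>. ?e \<eta> x) \<longlongrightarrow> ?e \<zeta> x) (at \<zeta>)" for x
      by (intro tendsto_intros)
    have q_lim: "((\<lambda>\<eta>. (?e \<eta> X - ?e \<zeta> X) / (\<eta> - \<zeta>)) \<longlongrightarrow> \<i> * of_real X * ?e \<zeta> X) (at \<zeta>)"
    proof -
      have "((\<lambda>\<eta>. ?e \<eta> X) has_field_derivative \<i> * of_real X * ?e \<zeta> X) (at \<zeta>)"
        by (auto intro!: derivative_eq_intros)
      then show ?thesis by (simp add: has_field_derivative_iff)
    qed
    have J_lim: "(J \<longlongrightarrow> J \<zeta>) (at \<zeta>)"
    proof -
      define M where "M = 2 * exp (2 * (1 / cmod \<zeta>) * N)"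
      define S where "S = seg 0 X (\<lambda>t. cmod (\<phi> t))"
      \<comment> \<open>\<open>X * M\<close> comes from the exponential factor of
        \<open>theta\<close>, \<open>K * N\<close> from the factor \<open>jost_m\<close>. The growth
        in \<open>X\<close> does no harm, as \<open>X\<close> is fixed in this limit.\<close>
      have J_le: "cmod (J \<eta> - J \<zeta>) \<le> (X * M + K * N) * cmod (\<eta> - \<zeta>) * S" if \<eta>: "cmod (\<eta> - \<zeta>) < Im \<zeta> / 2" for \<eta>
      proof -
        have Im\<eta>: "0 < Im \<eta>" by (rule K(2)[OF \<eta>])
        have ct: "continuous_on {0..} (theta V \<eta>)" "continuous_on {0..} (theta V \<zeta>)"
          using sol_continuous(1)[OF theta_sol(1)[OF V Im\<eta>]] sol_continuous(1)[OF theta_sol(1)[OF V z]] .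
        have i: "seg_integrable 0 X (\<lambda>x. \<phi> x * theta V \<eta> x)" "seg_integrable 0 X (\<lambda>x. \<phi> x * theta V \<zeta> x)"
          by (intro seg_integrable_continuous continuous_on_mult \<phi>c ct order_refl)+
        have "J \<eta> - J \<zeta> = seg 0 X (\<lambda>x. \<phi> x * (theta V \<eta> x - theta V \<zeta> x))"
          unfolding J_def Bochner_Integration.integral_diff[OF i, symmetric] right_diff_distrib ..
        also have "cmod \<dots> \<le> ((X * M + K * N) * cmod (\<eta> - \<zeta>)) * seg 0 X (\<lambda>t. cmod (\<phi> t))"
        proof (rule seg_norm_mult_le)
          show "seg_integrable 0 X \<phi>" by (intro seg_integrable_continuous \<phi>c order_refl)
          show "continuous_on {0..X} (\<lambda>x. theta V \<eta> x - theta V \<zeta> x)"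
            by (rule continuous_on_subset[OF continuous_on_diff[OF ct]]) auto
          fix t assume t: "t \<in> {0..X}"
          have "theta V \<eta> t - theta V \<zeta> t = (?e \<eta> t - ?e \<zeta> t) * jost_m V \<zeta> t + ?e \<eta> t * (jost_m V \<eta> t - jost_m V \<zeta> t)"
            by (simp add: theta_def algebra_simps)
          also have "cmod \<dots> \<le> (X * cmod (\<eta> - \<zeta>)) * M + 1 * (K * cmod (\<eta> - \<zeta>) * N)"
          proof (rule order_trans[OF norm_triangle_ineq add_mono])
            have "cmod (?e \<eta> t - ?e \<zeta> t) \<le> exp 0 * cmod (\<i> * \<eta> * of_real t - \<i> * \<zeta> * of_real t)"
              using t Im\<eta> z by (intro exp_diff_le) auto
            also have "\<i> * \<eta> * of_real t - \<i> * \<zeta> * of_real t = \<i> * of_real t * (\<eta> - \<zeta>)" by (simp add: algebra_simps)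
            also have "exp 0 * cmod (\<i> * of_real t * (\<eta> - \<zeta>)) = t * cmod (\<eta> - \<zeta>)"
              using t by (simp add: norm_mult)
            also have "\<dots> \<le> X * cmod (\<eta> - \<zeta>)" using t by (intro mult_right_mono) auto
            finally have 1: "cmod (?e \<eta> t - ?e \<zeta> t) \<le> X * cmod (\<eta> - \<zeta>)" .
            have 2: "cmod (jost_m V \<zeta> t) \<le> M" using jost_m(2)[OF V z, of t] t by (simp add: M_def N_def)
            show "cmod ((?e \<eta> t - ?e \<zeta> t) * jost_m V \<zeta> t) \<le> (X * cmod (\<eta> - \<zeta>)) * M"
              unfolding norm_mult using X by (intro mult_mono 1 2) auto
            have 3: "cmod (?e \<eta> t) \<le> 1" unfolding norm_exp_i using t Im\<eta> by simp
            have "cmod (jost_m V \<eta> t - jost_m V \<zeta> t) \<le> K * cmod (\<eta> - \<zeta>) * T t" using t by (intro K(3)[OF \<eta>]) auto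
            also have "\<dots> \<le> K * cmod (\<eta> - \<zeta>) * N" using K(1) by (intro mult_left_mono TN) auto
            finally show "cmod (?e \<eta> t * (jost_m V \<eta> t - jost_m V \<zeta> t)) \<le> 1 * (K * cmod (\<eta> - \<zeta>) * N)"
              unfolding norm_mult by (intro mult_mono 3) auto
          qed
          also have "\<dots> = (X * M + K * N) * cmod (\<eta> - \<zeta>)" by (simp add: algebra_simps)
          finally show "cmod (theta V \<eta> t - theta V \<zeta> t) \<le> (X * M + K * N) * cmod (\<eta> - \<zeta>)" .
        qed
        finally show ?thesis by (simp add: S_def)
      qed
      have "((\<lambda>\<eta>. J \<eta> - J \<zeta>) \<longlongrightarrow> 0) (at \<zeta>)"
      proof (rule Lim_null_comparison)
        show "\<forall>\<^sub>F \<eta> in at \<zeta>. cmod (J \<eta> - J \<zeta>) \<le> (X * M + K * N) * cmod (\<eta> - \<zeta>) * S"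
          using near by (rule eventually_mono) (rule J_le, simp)
        have "((\<lambda>\<eta>. (X * M + K * N) * cmod (\<eta> - \<zeta>) * S) \<longlongrightarrow> (X * M + K * N) * cmod (\<zeta> - \<zeta>) * S) (at \<zeta>)"
          by (intro tendsto_intros)
        then show "((\<lambda>\<eta>. (X * M + K * N) * cmod (\<eta> - \<zeta>) * S) \<longlongrightarrow> 0) (at \<zeta>)" by simp
      qed
      then show ?thesis by (rule Lim_null[THEN iffD2])
    qed
    have main_lim: "(main \<longlongrightarrow> approx_deriv V \<gamma> \<zeta> X) (at \<zeta>)"
    proof -
      have "(main \<longlongrightarrow> \<i> * of_real X * ?e \<zeta> X * (\<phi>' X * m - \<phi> X * P) - \<i> * ?e \<zeta> X * \<phi> X - (\<zeta> + \<zeta>) * J \<zeta>) (at \<zeta>)"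
        unfolding main_def by (intro tendsto_intros q_lim J_lim)
      also have "\<i> * of_real X * ?e \<zeta> X * (\<phi>' X * m - \<phi> X * P) = \<i> * of_real X * jost_function V \<gamma> \<zeta>"
        unfolding \<phi>(5)[OF X, symmetric] m_def P_def theta_def theta'_def by (simp add: algebra_simps)
      finally show ?thesis by (simp add: approx_deriv_def J_def \<phi>_def)
    qed
    have ev1: "\<forall>\<^sub>F \<eta> in at \<zeta>. dist (main \<eta>) (approx_deriv V \<gamma> \<zeta> X) < \<epsilon>"
      using main_lim \<epsilon> by (rule tendstoD)
    have "((\<lambda>\<eta>. cmod (?e \<eta> X)) \<longlongrightarrow> cmod (?e \<zeta> X)) (at \<zeta>)" by (intro tendsto_norm e_lim)
    then have ev2: "\<forall>\<^sub>F \<eta> in at \<zeta>. cmod (?e \<eta> X) < 2 * cmod (?e \<zeta> X)"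
      by (rule order_tendstoD) simp
    show ?thesis
      using near ev1 ev2
    proof eventually_elim
      case (elim \<eta>)
      have ne: "0 < cmod (\<eta> - \<zeta>)" using elim by simp
      have rem: "cmod (rem \<eta>) \<le> C * T X"
      proof -
        have D: "cmod (d \<eta>) \<le> K * cmod (\<eta> - \<zeta>) * T X" "cmod (e \<eta>) \<le> K * cmod (\<eta> - \<zeta>) * T X"
          unfolding d_def e_def m_def P_def using elim by (intro K(3,4) X; simp)+
        have "cmod (?e \<eta> X * (\<phi>' X * d \<eta> - \<phi> X * e \<eta>))
            \<le> (2 * cmod (?e \<zeta> X)) * (cmod (\<phi>' X) * (K * cmod (\<eta> - \<zeta>) * T X) + cmod (\<phi> X) * (K * cmod (\<eta> - \<zeta>) * T X))"
          unfolding norm_mult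
        proof (rule mult_mono)
          show "cmod (\<phi>' X * d \<eta> - \<phi> X * e \<eta>) \<le> cmod (\<phi>' X) * (K * cmod (\<eta> - \<zeta>) * T X) + cmod (\<phi> X) * (K * cmod (\<eta> - \<zeta>) * T X)"
            by (rule order_trans[OF norm_triangle_ineq4]) (unfold norm_mult, intro add_mono mult_left_mono D norm_ge_zero)
        qed (use elim in auto)
        also have "\<dots> = 2 * (cmod (?e \<zeta> X * \<phi>' X) + cmod (?e \<zeta> X * \<phi> X)) * K * T X * cmod (\<eta> - \<zeta>)"
          by (simp add: norm_mult algebra_simps)
        also have "\<dots> \<le> 2 * (B2 + B1) * K * T X * cmod (\<eta> - \<zeta>)"
          using B1[OF X] B2[OF X] K(1) T0[of X] by (intro mult_right_mono mult_left_mono add_mono) auto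
        also have "\<dots> = C * T X * cmod (\<eta> - \<zeta>)" by (simp add: C_def add.commute)
        finally show ?thesis unfolding rem_def norm_divide using ne by (simp add: pos_divide_le_eq)
      qed
      have "(w \<eta> - w \<zeta>) / (\<eta> - \<zeta>) - approx_deriv V \<gamma> \<zeta> X = (main \<eta> - approx_deriv V \<gamma> \<zeta> X) + rem \<eta>"
        using split elim by simp
      show ?case
        unfolding \<open>(w \<eta> - w \<zeta>) / (\<eta> - \<zeta>) - approx_deriv V \<gamma> \<zeta> X = _\<close>
        using norm_triangle_ineq[of "main \<eta> - approx_deriv V \<gamma> \<zeta> X" "rem \<eta>"] rem elim(2)
        unfolding dist_norm by linarith
    qed
  qed
  moreover have "0 \<le> C" using B0 K(1) by (simp add: C_def)
  ultimately show ?thesis unfolding T_def w_def by blast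
qed

text \<open>\<open>X\<close> is chosen so that both the tail error and the distance of
  \<open>approx_deriv\<close> to its limit are below a third of \<open>\<epsilon>\<close>; for this
  \<open>X\<close> the last third is spent on \<open>\<eta>\<close>.\<close>

lemma jost_has_derivative:
  assumes V: "integrable halfline V" and z: "0 < Im \<zeta>"
    and A: "(approx_deriv V \<gamma> \<zeta> \<longlongrightarrow> A) at_top"
  shows "deriv (jost_function V \<gamma>) \<zeta> = A"
proof (rule DERIV_imp_deriv, unfold has_field_derivative_iff, rule tendstoI)
  fix \<epsilon> :: real assume \<epsilon>: "0 < \<epsilon>"
  from jost_difference_quotient[OF V z, of \<gamma>] obtain C where C: "0 \<le> C" "\<forall>X\<ge>0. \<forall>\<epsilon>>0. \<forall>\<^sub>F \<eta> in at \<zeta>.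
    cmod ((jost_function V \<gamma> \<eta> - jost_function V \<gamma> \<zeta>) / (\<eta> - \<zeta>) - approx_deriv V \<gamma> \<zeta> X)
      \<le> C * tail X (\<lambda>t. \<bar>V t\<bar>) + \<epsilon>" by (elim exE conjE)
  have "((\<lambda>X. C * tail X (\<lambda>t. \<bar>V t\<bar>)) \<longlongrightarrow> C * 0) at_top"
    using V by (intro tendsto_intros tail_tendsto_0) simp
  then have "\<forall>\<^sub>F X in at_top. C * tail X (\<lambda>t. \<bar>V t\<bar>) < \<epsilon> / 3"
    using \<epsilon> by (intro order_tendstoD) auto
  moreover have "\<forall>\<^sub>F X in at_top. dist (approx_deriv V \<gamma> \<zeta> X) A < \<epsilon> / 3"
    using \<epsilon> by (intro tendstoD[OF A]) simp
  ultimately have "\<forall>\<^sub>F X in at_top. C * tail X (\<lambda>t. \<bar>V t\<bar>) < \<epsilon> / 3 \<and> dist (approx_deriv V \<gamma> \<zeta> X) A < \<epsilon> / 3 \<and> 0 \<le> X"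
    by (intro eventually_conj eventually_ge_at_top)
  then obtain X where X: "C * tail X (\<lambda>t. \<bar>V t\<bar>) < \<epsilon> / 3" "dist (approx_deriv V \<gamma> \<zeta> X) A < \<epsilon> / 3" "0 \<le> X"
    using eventually_happens by force
  have "0 < \<epsilon> / 3" using \<epsilon> by simp
  from C(2)[rule_format, OF X(3) this]
  show "\<forall>\<^sub>F \<eta> in at \<zeta>. dist ((jost_function V \<gamma> \<eta> - jost_function V \<gamma> \<zeta>) / (\<eta> - \<zeta>)) A < \<epsilon>"
  proof eventually_elim
    case (elim \<eta>)
    then show ?case
      using X dist_triangle[of "(jost_function V \<gamma> \<eta> - jost_function V \<gamma> \<zeta>) / (\<eta> - \<zeta>)" A "approx_deriv V \<gamma> \<zeta> X"]
      by (simp add: dist_norm)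
  qed
qed

lemma free_jost:
  assumes z: "0 < Im \<zeta>"
  shows "0 \<le> x \<Longrightarrow> jost_m (\<lambda>x. 0) \<zeta> x = 1" "jost_P (\<lambda>x. 0) \<zeta> x = \<i> * \<zeta>"
    "jost_function (\<lambda>x. 0) \<gamma> \<zeta> = of_real \<gamma> - \<i> * \<zeta>"
proof -
  have V: "integrable halfline (\<lambda>x. 0 :: real)" by simp
  show m: "jost_m (\<lambda>x. 0) \<zeta> x = 1" if "0 \<le> x" for x
    using jost_m(3)[OF V z that] by simp
  show P: "jost_P (\<lambda>x. 0) \<zeta> x = \<i> * \<zeta>" for x
    by (simp add: jost_P_def tail_def)
  show "jost_function (\<lambda>x. 0) \<gamma> \<zeta> = of_real \<gamma> - \<i> * \<zeta>"
    using m[of 0] by (simp add: jost_function_eq[OF V z] P)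
qed

text \<open>For \<open>V = 0\<close> the tail error is zero and the difference quotient of
  \<open>\<gamma> - i \<eta>\<close> is exactly \<open>-i\<close>, so the identity holds for every
  finite \<open>X\<close> without computing the free solutions.\<close>

lemma free_approx_deriv:
  assumes z: "0 < Im \<zeta>" and X: "0 \<le> X"
  shows "approx_deriv (\<lambda>x. 0) \<gamma> \<zeta> X = - \<i>"
proof -
  have V: "integrable halfline (\<lambda>x. 0 :: real)" by simp
  have near: "\<forall>\<^sub>F \<eta> in at \<zeta>. 0 < Im \<eta> \<and> \<eta> \<noteq> \<zeta>"
    unfolding eventually_at
  proof (intro exI[of _ "Im \<zeta>"] conjI ballI impI z)
    fix \<eta> assume "\<eta> \<noteq> \<zeta> \<and> dist \<eta> \<zeta> < Im \<zeta>"
    then show "0 < Im \<eta>" "\<eta> \<noteq> \<zeta>"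
      using abs_Im_le_cmod[of "\<eta> - \<zeta>"] by (auto simp: dist_norm)
  qed
  have "cmod (- \<i> - approx_deriv (\<lambda>x. 0) \<gamma> \<zeta> X) \<le> \<epsilon>" if \<epsilon>: "0 < \<epsilon>" for \<epsilon>
  proof -
    obtain C where "\<forall>\<^sub>F \<eta> in at \<zeta>.
      cmod ((jost_function (\<lambda>x. 0) \<gamma> \<eta> - jost_function (\<lambda>x. 0) \<gamma> \<zeta>) / (\<eta> - \<zeta>) - approx_deriv (\<lambda>x. 0) \<gamma> \<zeta> X)
        \<le> C * tail X (\<lambda>t. \<bar>0 :: real\<bar>) + \<epsilon>"
      using jost_difference_quotient[OF V z, of \<gamma>] X \<epsilon> by meson
    then have "\<forall>\<^sub>F \<eta> in at \<zeta>. cmod (- \<i> - approx_deriv (\<lambda>x. 0) \<gamma> \<zeta> X) \<le> \<epsilon>"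
      using near
    proof eventually_elim
      case (elim \<eta>)
      have "(jost_function (\<lambda>x. 0) \<gamma> \<eta> - jost_function (\<lambda>x. 0) \<gamma> \<zeta>) / (\<eta> - \<zeta>) = - \<i>"
        using elim z by (simp add: free_jost field_simps)
      then show ?case using elim by (simp add: tail_def)
    qed
    then show ?thesis by simp
  qed
  then have "cmod (- \<i> - approx_deriv (\<lambda>x. 0) \<gamma> \<zeta> X) \<le> 0"
    by (rule field_le_epsilon) simp
  then show ?thesis by simp
qed

section \<open>The Green function\<close>

lemma exp_decay_integrable:
  assumes "0 < k" shows "integrable halfline (\<lambda>x. exp (- k * x))"
proof -
  have "(\<lambda>x. exp (- k * x)) integrable_on {0..}"
    using has_integral_exp_minus_to_infinity[OF assms, of 0] by (auto simp: integrable_on_def)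
  then have "(\<lambda>x. exp (- k * x)) absolutely_integrable_on {0..}"
    by (subst absolutely_integrable_on_iff_nonneg) auto
  then show ?thesis by (intro absolutely_integrable_imp_integrable) auto
qed

lemma seg_exp_const:
  assumes "0 \<le> b" "l \<noteq> 0" shows "seg 0 b (\<lambda>t. exp (l * t)) = (exp (l * b) - 1) / l"
proof -
  have s: "seg_integrable 0 x (\<lambda>t. 1 :: real)" for x by (rule seg_integrable_continuous) auto
  have "seg 0 x (\<lambda>t. 1 :: real) = x" if "0 \<le> x" for x
    using that unfolding seg_eq_integral[OF s] by simp
  then have "seg 0 b (\<lambda>t. exp (l * t)) = seg 0 b (\<lambda>t. 1 * exp (l * seg 0 t (\<lambda>t. 1 :: real)))"
    by (intro Bochner_Integration.integral_cong) auto
  also have "\<dots> = (exp (l * seg 0 b (\<lambda>t. 1 :: real)) - 1) / l"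
    using assms by (intro seg_exp s) auto
  finally show ?thesis using \<open>\<And>x. 0 \<le> x \<Longrightarrow> seg 0 x (\<lambda>t. 1 :: real) = x\<close>[OF assms(1)] by simp
qed

lemma tail_exp:
  assumes k: "0 < k" and x: "0 \<le> x" shows "tail x (\<lambda>t. exp (- k * t)) = exp (- k * x) / k"
proof -
  have "((\<lambda>X. seg 0 X (\<lambda>t. exp (- k * t))) \<longlongrightarrow> 1 / k) at_top"
  proof (rule Lim_transform_eventually)
    have "filterlim (\<lambda>X. - k * X) at_bot at_top" using k by real_asymp
    then have "((\<lambda>X. (exp (- k * X) - 1) / - k) \<longlongrightarrow> (0 - 1) / - k) at_top"
      using k by (intro tendsto_intros filterlim_compose[OF exp_at_bot]) auto
    then show "((\<lambda>X. (exp (- k * X) - 1) / - k) \<longlongrightarrow> 1 / k) at_top" by simp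
    show "\<forall>\<^sub>F X in at_top. (exp (- k * X) - 1) / - k = seg 0 X (\<lambda>t. exp (- k * t))"
      using k by (intro eventually_mono[OF eventually_ge_at_top[of 0]] seg_exp_const[symmetric]) auto
  qed
  from tendsto_unique[OF trivial_limit_at_top_linorder tendsto_seg_halfline[OF exp_decay_integrable[OF k]] this]
  have "(LINT t|halfline. exp (- k * t)) = 1 / k" .
  then show ?thesis
    using seg_exp_const[OF x, of "- k"] k by (simp add: tail_def field_simps)
qed

section \<open>Decay and the form domain\<close>

lemma sq_integrable_bound:
  assumes f: "f \<in> borel_measurable halfline" and k: "0 < k" and le: "\<And>x. 0 \<le> x \<Longrightarrow> cmod (f x) \<le> C * exp (- k * x)"
  shows "square_integrable f"
  unfolding square_integrable_def
proof (intro conjI f, rule Bochner_Integration.integrable_bound)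
  show "integrable halfline (\<lambda>x. C\<^sup>2 * exp (- (2 * k) * x))"
    using k by (intro integrable_mult_right exp_decay_integrable) auto
  show "(\<lambda>x. (cmod (f x))\<^sup>2) \<in> borel_measurable halfline" using f by measurable
  show "AE x in halfline. norm ((cmod (f x))\<^sup>2) \<le> norm (C\<^sup>2 * exp (- (2 * k) * x))"
  proof (rule AE_I2)
    fix x assume "x \<in> space halfline"
    then have "(cmod (f x))\<^sup>2 \<le> (C * exp (- k * x))\<^sup>2" by (intro power_mono le) auto
    also have "\<dots> = C\<^sup>2 * exp (- (2 * k) * x)" by (simp add: power_mult_distrib exp_double[symmetric])
    finally show "norm ((cmod (f x))\<^sup>2) \<le> norm (C\<^sup>2 * exp (- (2 * k) * x))" by simp
  qed
qed

text \<open>The squared modulus of \<open>u\<close> has the integrable derivative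
  \<open>u' cnj u + u cnj u'\<close>, so it cannot exceed its value at 0 by more than a finite
  amount.\<close>

lemma H1_bounded:
  assumes "sobolev_H1 u u'" shows "\<exists>B. \<forall>x\<ge>0. cmod (u x) \<le> B"
proof -
  have sq: "square_integrable u" "square_integrable u'" and ac: "locally_ac_deriv u u'"
    using assms by (auto simp: sobolev_H1_def)
  let ?g = "\<lambda>x. u' x * cnj (u x) + u x * cnj (u' x)"
  have gi: "integrable halfline ?g"
    by (intro Bochner_Integration.integrable_add square_integrable_mult sq)
  have g: "locally_ac_deriv (\<lambda>x. u x * cnj (u x)) ?g"
    by (intro locally_ac_deriv_mult locally_ac_deriv_cnj ac)
  define B where "B = (cmod (u 0))\<^sup>2 + (LINT t|halfline. cmod (?g t))"
  have "cmod (u x) \<le> sqrt B" if x: "0 \<le> x" for x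
  proof (rule real_le_rsqrt)
    have "(cmod (u x))\<^sup>2 = cmod (u x * cnj (u x))" by (simp add: norm_mult power2_eq_square)
    also have "\<dots> = cmod (u 0 * cnj (u 0) + seg 0 x ?g)"
      by (subst locally_ac_derivD(1)[OF g x]) simp
    also have "\<dots> \<le> cmod (u 0 * cnj (u 0)) + seg 0 x (\<lambda>t. cmod (?g t))"
      by (rule order_trans[OF norm_triangle_ineq add_left_mono[OF seg_norm_le]])
    also have "seg 0 x (\<lambda>t. cmod (?g t)) \<le> (LINT t|halfline. cmod (?g t))"
      by (rule seg_le_total) (use gi in auto)
    finally show "(cmod (u x))\<^sup>2 \<le> B" by (simp add: B_def norm_mult power2_eq_square)
  qed
  then show ?thesis by blast
qed

lemma exp_i_tendsto_0: "0 < Im \<zeta> \<Longrightarrow> ((\<lambda>x. exp (\<i> * \<zeta> * of_real x)) \<longlongrightarrow> 0) at_top"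
proof (rule tendsto_norm_zero_cancel)
  assume "0 < Im \<zeta>"
  then have "filterlim (\<lambda>x. - Im \<zeta> * x) at_bot at_top" by real_asymp
  from filterlim_compose[OF exp_at_bot this] show "((\<lambda>x. cmod (exp (\<i> * \<zeta> * of_real x))) \<longlongrightarrow> 0) at_top"
    unfolding norm_exp_i .
qed

lemma theta_bounds:
  assumes V: "integrable halfline V" and z: "0 < Im \<zeta>"
  shows "\<exists>M. \<forall>x\<ge>0. cmod (theta V \<zeta> x) \<le> M * exp (- Im \<zeta> * x) \<and> cmod (theta' V \<zeta> x) \<le> M * exp (- Im \<zeta> * x)"
    "(theta' V \<zeta> \<longlongrightarrow> 0) at_top"
proof -
  have c: "continuous_on {0..} (theta' V \<zeta>)" by (rule sol_continuous(2)[OF theta_sol(1)[OF V z]])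
  have "jost_P V \<zeta> = (\<lambda>x. exp (- (\<i> * \<zeta>) * of_real x) * theta' V \<zeta> x)"
    unfolding theta'_def exp_i_cancel ..
  then have "continuous_on {0..} (jost_P V \<zeta>)" by (simp only:) (intro continuous_on_mult continuous_exp c)
  from convergent_bounded_halfline[OF this theta_sol(3)[OF V z]]
  obtain B where B: "\<And>x. 0 \<le> x \<Longrightarrow> cmod (jost_P V \<zeta> x) \<le> B" by blast
  from convergent_bounded_halfline[OF jost_m(1)[OF V z] theta_sol(2)[OF V z]]
  obtain B' where B': "\<And>x. 0 \<le> x \<Longrightarrow> cmod (jost_m V \<zeta> x) \<le> B'" by blast
  have "cmod (theta V \<zeta> x) \<le> max B B' * exp (- Im \<zeta> * x) \<and> cmod (theta' V \<zeta> x) \<le> max B B' * exp (- Im \<zeta> * x)" if "0 \<le> x" for x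
    unfolding theta_def theta'_def norm_mult norm_exp_i mult.commute[of "exp _"]
    using B[OF that] B'[OF that] by (intro conjI mult_right_mono) auto
  then show "\<exists>M. \<forall>x\<ge>0. cmod (theta V \<zeta> x) \<le> M * exp (- Im \<zeta> * x) \<and> cmod (theta' V \<zeta> x) \<le> M * exp (- Im \<zeta> * x)"
    by blast
  have "((\<lambda>x. exp (\<i> * \<zeta> * of_real x) * jost_P V \<zeta> x) \<longlongrightarrow> 0 * (\<i> * \<zeta>)) at_top"
    by (intro tendsto_mult exp_i_tendsto_0 z theta_sol(3)[OF V z])
  then show "(theta' V \<zeta> \<longlongrightarrow> 0) at_top" unfolding theta'_def[abs_def] by simp
qed

lemma theta_H1:
  assumes V: "integrable halfline V" and z: "0 < Im \<zeta>"
  shows "sobolev_H1 (theta V \<zeta>) (theta' V \<zeta>)"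
proof -
  note c = sol_continuous[OF theta_sol(1)[OF V z]]
  show ?thesis
    using theta_bounds(1)[OF V z] theta_sol(1)[OF V z]
    unfolding sobolev_H1_def sol_def
    by (auto intro!: sq_integrable_bound[OF borel_measurable_continuous_halfline[OF c(1)] z]
        sq_integrable_bound[OF borel_measurable_continuous_halfline[OF c(2)] z])
qed

text \<open>When a solution is inserted, the integrand of the form becomes an exact derivative.
  Integration by parts thus reduces to evaluating \<open>p v\<close> at the ends of an
  interval.\<close>

lemma sol_pairing:
  assumes "sol V \<zeta> s p" "locally_ac_deriv v v'"
  shows "locally_ac_deriv (\<lambda>x. p x * v x) (\<lambda>x. p x * v' x + (of_real (V x) - \<zeta>\<^sup>2) * (s x * v x))"
proof -
  have "locally_ac_deriv (\<lambda>x. p x * v x) (\<lambda>x. (of_real (V x) - \<zeta>\<^sup>2) * s x * v x + p x * v' x)"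
    using assms unfolding sol_def by (intro locally_ac_deriv_mult) auto
  then show ?thesis by (rule locally_ac_deriv_cong) (simp_all add: algebra_simps)
qed

lemma H1_continuous: "sobolev_H1 u u' \<Longrightarrow> continuous_on {0..} u"
  unfolding sobolev_H1_def by (blast intro: locally_ac_deriv_continuous)

lemma V_pairing_integrable:
  assumes V: "integrable halfline V" and u: "sobolev_H1 u u'" and v: "sobolev_H1 v v'"
  shows "integrable halfline (\<lambda>x. of_real (V x) * u x * cnj (v x))"
proof -
  obtain A where A: "\<And>x. 0 \<le> x \<Longrightarrow> cmod (u x) \<le> A" using H1_bounded[OF u] by blast
  obtain B where B: "\<And>x. 0 \<le> x \<Longrightarrow> cmod (v x) \<le> B" using H1_bounded[OF v] by blast
  have c: "continuous_on {0..} (\<lambda>x. u x * cnj (v x))"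
    by (intro continuous_on_mult continuous_on_cnj H1_continuous[OF u] H1_continuous[OF v])
  have b: "cmod (u x * cnj (v x)) \<le> A * B" if "0 \<le> x" for x
    unfolding norm_mult complex_mod_cnj using A[OF that] B[OF that]
    by (intro mult_mono) (auto intro: order_trans[OF norm_ge_zero])
  show ?thesis
    unfolding mult.assoc by (rule V_mult_integrable[OF V c b])
qed

lemma energy_form_eq:
  assumes V: "integrable halfline V" and u: "sobolev_H1 u u'" and v: "sobolev_H1 v v'"
  shows "energy_form V \<gamma> u u' v v' - z * cinner (abs_l2 u) (abs_l2 v)
    = (LINT x|halfline. u' x * cnj (v' x) + (of_real (V x) - z) * (u x * cnj (v x))) + of_real \<gamma> * u 0 * cnj (v 0)"
    "integrable halfline (\<lambda>x. u' x * cnj (v' x) + (of_real (V x) - z) * (u x * cnj (v x)))"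
proof -
  have sq: "square_integrable u" "square_integrable u'" "square_integrable v" "square_integrable v'"
    using u v by (auto simp: sobolev_H1_def)
  have i1: "integrable halfline (\<lambda>x. u' x * cnj (v' x) + of_real (V x) * u x * cnj (v x))"
    by (intro Bochner_Integration.integrable_add square_integrable_mult sq V_pairing_integrable[OF V u v])
  have i2: "integrable halfline (\<lambda>x. z * (u x * cnj (v x)))"
    by (intro integrable_mult_right square_integrable_mult sq)
  have eq: "u' x * cnj (v' x) + (of_real (V x) - z) * (u x * cnj (v x))
      = (u' x * cnj (v' x) + of_real (V x) * u x * cnj (v x)) - z * (u x * cnj (v x))" for x
    by (simp add: algebra_simps)
  show "integrable halfline (\<lambda>x. u' x * cnj (v' x) + (of_real (V x) - z) * (u x * cnj (v x)))"
    unfolding eq by (rule Bochner_Integration.integrable_diff[OF i1 i2])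
  show "energy_form V \<gamma> u u' v v' - z * cinner (abs_l2 u) (abs_l2 v)
    = (LINT x|halfline. u' x * cnj (v' x) + (of_real (V x) - z) * (u x * cnj (v x))) + of_real \<gamma> * u 0 * cnj (v 0)"
    unfolding eq Bochner_Integration.integral_diff[OF i1 i2] cinner_abs_l2[OF sq(1,3)] energy_form_def
    by simp
qed

section \<open>Resolvents and zeros of the Jost function\<close>

lemma is_resolvent_unique:
  assumes "is_resolvent A z R" "is_resolvent A z R'" shows "R = R'"
proof
  fix f
  obtain g where g: "(R f, g) \<in> A" "g - z *\<^sub>C R f = f"
    using assms(1) unfolding is_resolvent_def by blast
  then have "R' (g - z *\<^sub>C R f) = R f" using assms(2) unfolding is_resolvent_def by blast
  then show "R f = R' f" by (simp add: g(2))
qed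

lemma resolvent_is_resolvent:
  assumes "z \<in> resolvent_set A" shows "is_resolvent A z (resolvent A z)"
proof -
  obtain R where R: "is_resolvent A z R" using assms by (auto simp: resolvent_set_def)
  show ?thesis
    unfolding resolvent_def by (rule theI[of "is_resolvent A z" R]) (simp_all add: R is_resolvent_unique[OF _ R])
qed

text \<open>A zero of the Jost function says that \<open>theta\<close> satisfies the boundary
  condition. As \<open>theta\<close> decays, it is then an eigenfunction for
  \<open>\<zeta>\<^sup>2\<close>, and a resolvent would have to map 0 to it. So \<open>theta\<close>
  would vanish almost everywhere, against its asymptotics.\<close>

lemma jost_nonzero:
  assumes V: "integrable halfline V" and z: "0 < Im \<zeta>" and res: "\<zeta>\<^sup>2 \<in> resolvent_set (schroedinger_op V \<gamma>)"
  shows "jost_function V \<gamma> \<zeta> \<noteq> 0"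
proof
  assume w: "jost_function V \<gamma> \<zeta> = 0"
  let ?t = "theta V \<zeta>" and ?p = "theta' V \<zeta>"
  note s = theta_sol(1)[OF V z]
  have H1: "sobolev_H1 ?t ?p" by (rule theta_H1[OF V z])
  have w0: "of_real \<gamma> * ?t 0 = ?p 0"
    using w unfolding jost_function_eq[OF V z] by (simp add: theta_def theta'_def)
  have "energy_form V \<gamma> ?t ?p v v' = cinner (\<zeta>\<^sup>2 *\<^sub>C abs_l2 ?t) (abs_l2 v)" if v: "sobolev_H1 v v'" for v v'
  proof -
    let ?g = "\<lambda>x. ?p x * cnj (v' x) + (of_real (V x) - \<zeta>\<^sup>2) * (?t x * cnj (v x))"
    have ac: "locally_ac_deriv (\<lambda>x. ?p x * cnj (v x)) ?g"
      using v unfolding sobolev_H1_def by (intro sol_pairing[OF s] locally_ac_deriv_cnj) auto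
    obtain B where B: "\<And>x. 0 \<le> x \<Longrightarrow> cmod (v x) \<le> B" using H1_bounded[OF v] by blast
    have "((\<lambda>x. ?p x * cnj (v x)) \<longlongrightarrow> 0) at_top"
    proof (rule Lim_null_comparison)
      show "\<forall>\<^sub>F x in at_top. cmod (?p x * cnj (v x)) \<le> cmod (?p x) * B"
        unfolding norm_mult complex_mod_cnj
        by (intro eventually_mono[OF eventually_ge_at_top[of 0]] mult_left_mono B) auto
      show "((\<lambda>x. cmod (?p x) * B) \<longlongrightarrow> 0) at_top"
        using tendsto_mult_left_zero[OF tendsto_norm_zero[OF theta_bounds(2)[OF V z]]] .
    qed
    then have "((\<lambda>x. ?p x * cnj (v x) - ?p 0 * cnj (v 0)) \<longlongrightarrow> 0 - ?p 0 * cnj (v 0)) at_top"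
      by (intro tendsto_intros)
    then have "((\<lambda>x. seg 0 x ?g) \<longlongrightarrow> - (?p 0 * cnj (v 0))) at_top"
      by (rule_tac Lim_transform_eventually[where f = "\<lambda>x. ?p x * cnj (v x) - ?p 0 * cnj (v 0)"])
         (simp, intro eventually_mono[OF eventually_ge_at_top[of 0]] locally_ac_deriv_diff(1)[OF ac order_refl])
    from tendsto_unique[OF trivial_limit_at_top_linorder tendsto_seg_halfline[OF energy_form_eq(2)[OF V H1 v]] this]
    have "energy_form V \<gamma> ?t ?p v v' - \<zeta>\<^sup>2 * cinner (abs_l2 ?t) (abs_l2 v) = - (?p 0 * cnj (v 0)) + of_real \<gamma> * ?t 0 * cnj (v 0)"
      unfolding energy_form_eq(1)[OF V H1 v] by simp
    then show ?thesis by (simp add: w0 cinner_simps)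
  qed
  then have mem: "(abs_l2 ?t, \<zeta>\<^sup>2 *\<^sub>C abs_l2 ?t) \<in> schroedinger_op V \<gamma>"
    using H1 unfolding schroedinger_op_def by blast
  obtain R where R: "is_resolvent (schroedinger_op V \<gamma>) (\<zeta>\<^sup>2) R" using res by (auto simp: resolvent_set_def)
  then have "R (\<zeta>\<^sup>2 *\<^sub>C abs_l2 ?t - \<zeta>\<^sup>2 *\<^sub>C abs_l2 ?t) = abs_l2 ?t"
    using mem unfolding is_resolvent_def by blast
  moreover have "bounded_clinear R" using R unfolding is_resolvent_def by blast
  ultimately have "abs_l2 ?t = 0"
    using linear_0[OF bounded_linear.linear[OF bounded_clinear_bounded_linear, of R]] by simp
  then have "nn_norm2 ?t = 0"
    using nn_norm2_eq_norm[of ?t] H1 by (simp add: sobolev_H1_def)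
  then have ae: "AE x in halfline. ?t x = 0"
    unfolding nn_norm2_def
    using borel_measurable_continuous_halfline[OF sol_continuous(1)[OF s]]
    by (subst (asm) nn_integral_0_iff_AE) auto
  have "\<forall>\<^sub>F x in at_top. jost_m V \<zeta> x \<noteq> 0"
    using tendsto_imp_eventually_ne[OF theta_sol(2)[OF V z], of 0] by simp
  then obtain b where b: "\<And>x. b \<le> x \<Longrightarrow> jost_m V \<zeta> x \<noteq> 0" by (auto simp: eventually_at_top_linorder)
  \<comment> \<open>From \<open>c\<close> on \<open>theta\<close> has no zero, so an interval of
    length 1 would have to be a null set.\<close>
  define c where "c = max b 0"
  have "AE x in halfline. x \<notin> {c..c+1}"
    using ae by eventually_elim (use b in \<open>auto simp: theta_def c_def\<close>)
  moreover have "{c..c+1} \<in> sets halfline" by (rule Icc_sets_halfline) (simp add: c_def)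
  ultimately have "{c..c+1} \<in> null_sets halfline"
    using AE_iff_null_sets[of "{c..c+1}" halfline] by blast
  then have "emeasure halfline {c..c+1} = 0" by (rule null_setsD1)
  moreover have "emeasure halfline {c..c+1} = 1"
    by (subst emeasure_restrict_space) (auto simp: c_def emeasure_lborel_Icc_eq)
  ultimately show False by simp
qed

section \<open>The Green function and its role in the weak equation\<close>

lemma seg_piecewise:
  fixes f g :: "real \<Rightarrow> complex"
  assumes f: "seg_integrable 0 x f" and g: "seg_integrable x b g" and x: "0 \<le> x" "x \<le> b"
  shows "seg_integrable 0 b (\<lambda>y. if y \<le> x then f y else g y)"
    "seg 0 b (\<lambda>y. if y \<le> x then f y else g y) = seg 0 x f + seg x b g"
proof -
  have fi: "integrable halfline (\<lambda>t. indicator {0..x} t *\<^sub>R f t)"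
    using f seg_integrable_halfline_iff[of 0 x f] by simp
  have gi: "integrable halfline (\<lambda>t. indicator {x..b} t *\<^sub>R g t)"
    using g seg_integrable_halfline_iff[OF x(1), of b g] by simp
  have "{x<..b} \<in> sets halfline" using x by (auto simp: sets_restrict_space_iff)
  from integrable_mult_indicator[OF this gi]
  have gi': "integrable halfline (\<lambda>t. indicator {x<..b} t *\<^sub>R g t)"
    by (rule back_subst[of "integrable halfline"]) (auto simp: indicator_def)
  have eq: "(\<lambda>t. indicator {0..b} t *\<^sub>R (if t \<le> x then f t else g t))
      = (\<lambda>t. indicator {0..x} t *\<^sub>R f t + indicator {x<..b} t *\<^sub>R g t)"
    using x by (auto simp: indicator_def)
  show "seg_integrable 0 b (\<lambda>y. if y \<le> x then f y else g y)"
    unfolding seg_integrable_halfline_iff[OF order_refl] eq by (rule Bochner_Integration.integrable_add[OF fi gi'])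
  have "AE t in lebesgue. t \<noteq> x" by (rule AE_completion) (rule AE_lborel_singleton)
  then have ne: "AE t in halfline. t \<noteq> x" by (subst AE_restrict_space_iff) auto
  have "(LINT t|halfline. indicator {x<..b} t *\<^sub>R g t) = (LINT t|halfline. indicator {x..b} t *\<^sub>R g t)"
    using ne by (intro integral_cong_AE borel_measurable_integrable gi gi') (auto simp: indicator_def elim!: eventually_mono)
  then show "seg 0 b (\<lambda>y. if y \<le> x then f y else g y) = seg 0 x f + seg x b g"
    unfolding seg_halfline[OF order_refl] seg_halfline[OF x(1)] eq
    using Bochner_Integration.integral_add[OF fi gi'] by simp
qed

lemma seg_if_left: "b \<le> x \<Longrightarrow> seg 0 b (\<lambda>y. if y \<le> x then f y else g y) = seg 0 b f"
  "b \<le> x \<Longrightarrow> seg_integrable 0 b (\<lambda>y. if y \<le> x then f y else g y) \<longleftrightarrow> seg_integrable 0 b f"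
  by (intro Bochner_Integration.integral_cong Bochner_Integration.integrable_cong; simp)+

text \<open>Only the values have to match at \<open>x\<close>; the derivatives may jump, as those of
  the Green function do on the diagonal.\<close>

lemma locally_ac_deriv_piecewise:
  assumes u: "locally_ac_deriv u u'" and v: "locally_ac_deriv v v'" and x: "0 \<le> x" "u x = v x"
  shows "locally_ac_deriv (\<lambda>y. if y \<le> x then u y else v y) (\<lambda>y. if y \<le> x then u' y else v' y)"
proof (rule locally_ac_derivI)
  fix b :: real assume b: "0 \<le> b"
  show "seg_integrable 0 b (\<lambda>y. if y \<le> x then u' y else v' y)"
  proof (cases "b \<le> x")
    case True
    then show ?thesis using locally_ac_derivD(2)[OF u b] by (simp add: seg_if_left)
  next
    case False
    then show ?thesis
      using x by (intro seg_piecewise(1) locally_ac_derivD(2)[OF u] locally_ac_deriv_diff(2)[OF v]) auto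
  qed
  show "(if b \<le> x then u b else v b) = (if 0 \<le> x then u 0 else v 0) + seg 0 b (\<lambda>y. if y \<le> x then u' y else v' y)"
  proof (cases "b \<le> x")
    case True
    then show ?thesis using locally_ac_derivD(1)[OF u b] x by (simp add: seg_if_left)
  next
    case False
    then have "seg 0 b (\<lambda>y. if y \<le> x then u' y else v' y) = seg 0 x u' + seg x b v'"
      using x by (intro seg_piecewise(2) locally_ac_derivD(2)[OF u] locally_ac_deriv_diff(2)[OF v]) auto
    also have "\<dots> = (u x - u 0) + (v b - v x)"
      using locally_ac_derivD(1)[OF u x(1)] locally_ac_deriv_diff(1)[OF v x(1), of b] False by simp
    finally show ?thesis using x False by simp
  qed
qed

definition green :: "(real \<Rightarrow> real) \<Rightarrow> real \<Rightarrow> complex \<Rightarrow> real \<Rightarrow> real \<Rightarrow> complex" where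
  "green V \<gamma> \<zeta> x y = (if y \<le> x then theta V \<zeta> x / jost_function V \<gamma> \<zeta> * regular_solution V \<gamma> \<zeta> y
     else regular_solution V \<gamma> \<zeta> x / jost_function V \<gamma> \<zeta> * theta V \<zeta> y)"

text \<open>The derivative in the second variable, with the left-hand formula taken on the
  diagonal.\<close>

definition green' :: "(real \<Rightarrow> real) \<Rightarrow> real \<Rightarrow> complex \<Rightarrow> real \<Rightarrow> real \<Rightarrow> complex" where
  "green' V \<gamma> \<zeta> x y = (if y \<le> x then theta V \<zeta> x / jost_function V \<gamma> \<zeta> * hderiv (regular_solution V \<gamma> \<zeta>) y
     else regular_solution V \<gamma> \<zeta> x / jost_function V \<gamma> \<zeta> * theta' V \<zeta> y)"

lemma piecewise_square_integrable:
  assumes u: "continuous_on {0..} u" and v: "continuous_on {0..} v"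
    and k: "0 < k" and le: "\<And>y. 0 \<le> y \<Longrightarrow> cmod (v y) \<le> C * exp (- k * y)" and x: "0 \<le> x"
  shows "square_integrable (\<lambda>y. if y \<le> x then u y else v y)"
proof -
  have "compact (u ` {0..x})"
    using u by (intro compact_continuous_image) (auto elim: continuous_on_subset)
  then obtain B where B: "\<And>y. y \<in> {0..x} \<Longrightarrow> cmod (u y) \<le> B"
    using compact_imp_bounded bounded_iff by (metis imageI)
  have m: "{y \<in> space halfline. y \<le> x} \<in> sets halfline"
    by (rule back_subst[of "\<lambda>S. S \<in> sets halfline", OF Icc_sets_halfline[OF order_refl, of x]]) auto
  show ?thesis
  proof (rule sq_integrable_bound[OF _ k])
    show "(\<lambda>y. if y \<le> x then u y else v y) \<in> borel_measurable halfline"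
      by (rule measurable_If[OF borel_measurable_continuous_halfline[OF u] borel_measurable_continuous_halfline[OF v] m])
    fix y :: real assume y: "0 \<le> y"
    have B0: "0 \<le> B" using B[of 0] x norm_ge_zero[of "u 0"] by (meson atLeastAtMost_iff order_refl order_trans)
    have C0: "0 \<le> C" using order_trans[OF norm_ge_zero le[of 0]] by simp
    show "cmod (if y \<le> x then u y else v y) \<le> (B * exp (k * x) + C) * exp (- k * y)"
    proof (cases "y \<le> x")
      case True
      have "cmod (u y) \<le> B * 1" using B[of y] y True by simp
      also have "\<dots> \<le> B * exp (k * x - k * y)"
        using True k by (intro mult_left_mono B0) simp
      also have "\<dots> = B * exp (k * x) * exp (- k * y)" by (simp add: exp_diff exp_minus field_simps)
      also have "\<dots> \<le> (B * exp (k * x) + C) * exp (- k * y)" using C0 by (intro mult_right_mono) auto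
      finally show ?thesis using True by simp
    next
      case False
      have "C * exp (- k * y) \<le> (B * exp (k * x) + C) * exp (- k * y)" using B0 by (intro mult_right_mono) auto
      with le[OF y] have "cmod (v y) \<le> (B * exp (k * x) + C) * exp (- k * y)" by (rule order_trans)
      then show ?thesis using False by simp
    qed
  qed
qed

lemma green_H1:
  assumes V: "integrable halfline V" and z: "0 < Im \<zeta>" and x: "0 \<le> x"
  shows "sobolev_H1 (green V \<gamma> \<zeta> x) (green' V \<gamma> \<zeta> x)"
proof -
  define w where "w = jost_function V \<gamma> \<zeta>"
  let ?f = "regular_solution V \<gamma> \<zeta>" and ?t = "theta V \<zeta>"
  note \<phi> = regular_props[OF V z, where \<gamma> = \<gamma>]
  note cf = sol_continuous[OF \<phi>(1)] and ct = sol_continuous[OF theta_sol(1)[OF V z]]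
  obtain M where M: "\<forall>x\<ge>0. cmod (theta V \<zeta> x) \<le> M * exp (- Im \<zeta> * x) \<and> cmod (theta' V \<zeta> x) \<le> M * exp (- Im \<zeta> * x)"
    using theta_bounds(1)[OF V z] by blast
  have M': "cmod (c * theta V \<zeta> y) \<le> (cmod c * M) * exp (- Im \<zeta> * y)"
    "cmod (c * theta' V \<zeta> y) \<le> (cmod c * M) * exp (- Im \<zeta> * y)" if "0 \<le> y" for c y
    unfolding norm_mult mult.assoc using M that by (auto intro!: mult_left_mono)
  show ?thesis
    unfolding sobolev_H1_def
  proof (intro conjI)
    show "square_integrable (green V \<gamma> \<zeta> x)"
      unfolding green_def
      by (rule piecewise_square_integrable[OF _ _ z M'(1) x]) (intro continuous_on_mult continuous_on_const cf ct)+
    show "square_integrable (green' V \<gamma> \<zeta> x)"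
      unfolding green'_def
      by (rule piecewise_square_integrable[OF _ _ z M'(2) x]) (intro continuous_on_mult continuous_on_const cf ct)+
    show "locally_ac_deriv (green V \<gamma> \<zeta> x) (green' V \<gamma> \<zeta> x)"
      unfolding green_def green'_def
      using \<phi>(1) theta_sol(1)[OF V z] unfolding sol_def
      by (intro locally_ac_deriv_piecewise locally_ac_deriv_cmult x) auto
  qed
qed

lemma cnj_H1: "sobolev_H1 u u' \<Longrightarrow> sobolev_H1 (\<lambda>x. cnj (u x)) (\<lambda>x. cnj (u' x))"
proof -
  have m: "(\<lambda>x. cnj (f x)) \<in> borel_measurable halfline" if "f \<in> borel_measurable halfline" for f
  proof -
    have "cnj \<in> borel_measurable borel"
      by (intro borel_measurable_continuous_onI continuous_on_cnj continuous_on_id)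
    from measurable_compose[OF that this] show ?thesis .
  qed
  assume "sobolev_H1 u u'"
  then show ?thesis
    unfolding sobolev_H1_def square_integrable_def by (auto intro: m locally_ac_deriv_cnj)
qed

text \<open>The Green function decays exponentially away from the diagonal.\<close>

lemma green_l2_bound:
  assumes V: "integrable halfline V" and z: "0 < Im \<zeta>"
  shows "\<exists>M. \<forall>x\<ge>0. norm (abs_l2 (green V \<gamma> \<zeta> x)) \<le> M \<and> norm (abs_l2 (\<lambda>y. cnj (green V \<gamma> \<zeta> x y))) \<le> M"
proof -
  define k where "k = Im \<zeta>"
  have k: "0 < k" using z by (simp add: k_def)
  define w where "w = jost_function V \<gamma> \<zeta>"
  obtain M where M: "\<And>x. 0 \<le> x \<Longrightarrow> cmod (theta V \<zeta> x) \<le> M * exp (- k * x)"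
    using theta_bounds(1)[OF V z] unfolding k_def by blast
  obtain C where C: "\<And>x. 0 \<le> x \<Longrightarrow> cmod (regular_solution V \<gamma> \<zeta> x) \<le> C * exp (k * x)"
    using regular_props(4)[OF V z, where \<gamma> = \<gamma>] unfolding k_def by blast
  have M0: "0 \<le> M" using order_trans[OF norm_ge_zero M[of 0]] by simp
  have C0: "0 \<le> C" using order_trans[OF norm_ge_zero C[of 0]] by simp
  define D where "D = M * C / cmod w"
  have D0: "0 \<le> D" using M0 C0 by (simp add: D_def)
  have le: "cmod (green V \<gamma> \<zeta> x y) \<le> D * exp (- k * \<bar>x - y\<bar>)" if x: "0 \<le> x" and y: "0 \<le> y" for x y
  proof (cases "y \<le> x")
    case True
    have "cmod (green V \<gamma> \<zeta> x y) = cmod (theta V \<zeta> x) * cmod (regular_solution V \<gamma> \<zeta> y) / cmod w"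
      using True by (simp add: green_def w_def norm_mult norm_divide)
    also have "\<dots> \<le> (M * exp (- k * x)) * (C * exp (k * y)) / cmod w"
      using M0 by (intro divide_right_mono mult_mono M C x y) auto
    also have "\<dots> = D * (exp (- k * x) * exp (k * y))" by (simp add: D_def)
    also have "exp (- k * x) * exp (k * y) = exp (- k * \<bar>x - y\<bar>)"
      using True by (simp add: exp_add[symmetric] algebra_simps)
    finally show ?thesis .
  next
    case False
    have "cmod (green V \<gamma> \<zeta> x y) = cmod (theta V \<zeta> y) * cmod (regular_solution V \<gamma> \<zeta> x) / cmod w"
      using False by (simp add: green_def w_def norm_mult norm_divide)
    also have "\<dots> \<le> (M * exp (- k * y)) * (C * exp (k * x)) / cmod w"
      using M0 by (intro divide_right_mono mult_mono M C x y) auto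
    also have "\<dots> = D * (exp (- k * y) * exp (k * x))" by (simp add: D_def)
    also have "exp (- k * y) * exp (k * x) = exp (- k * \<bar>x - y\<bar>)"
      using False by (simp add: exp_add[symmetric] algebra_simps)
    finally show ?thesis .
  qed
  have bound: "(norm (abs_l2 f))\<^sup>2 \<le> D\<^sup>2 / k"
    if x: "0 \<le> x" and f: "square_integrable f" "\<And>y. cmod (f y) = cmod (green V \<gamma> \<zeta> x y)" for f x
  proof -
    \<comment> \<open>The function \<open>exp (-2 k \<bar>x - y\<bar>)\<close>, split at the
      diagonal so that its two integrals are instances of \<open>seg\<close> and
      \<open>tail\<close>.\<close>
    let ?E = "\<lambda>y. indicator {0..x} y *\<^sub>R (exp (- (2 * k) * x) * exp (2 * k * y))
      + (exp (2 * k * x) * (exp (- (2 * k) * y) - indicator {0..x} y *\<^sub>R exp (- (2 * k) * y)))"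
    have k2: "0 < 2 * k" using k by simp
    have e1: "integrable halfline (\<lambda>y. indicator {0..x} y *\<^sub>R (exp (- (2 * k) * x) * exp (2 * k * y)))"
    proof -
      have "seg_integrable 0 x (\<lambda>y. exp (- (2 * k) * x) * exp (2 * k * y))"
        by (intro seg_integrable_continuous continuous_intros) simp
      then show ?thesis by (subst (asm) seg_integrable_halfline_iff) auto
    qed
    note e2 = tail_eq[OF exp_decay_integrable[OF k2], of x]
    have Ei: "integrable halfline ?E"
      by (intro Bochner_Integration.integrable_add e1 integrable_mult_right e2(2))
    have "(norm (abs_l2 f))\<^sup>2 = (LINT y|halfline. (cmod (f y))\<^sup>2)"
    proof -
      have "complex_of_real ((norm (abs_l2 f))\<^sup>2) = of_real (LINT y|halfline. (cmod (f y))\<^sup>2)"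
        unfolding cinner_self_norm[symmetric] cinner_abs_l2[OF f(1) f(1)]
        by (simp add: complex_norm_square[symmetric] flip: of_real_power)
      then show ?thesis by (simp only: of_real_eq_iff)
    qed
    also have "\<dots> \<le> (LINT y|halfline. D\<^sup>2 * ?E y)"
    proof (rule integral_mono)
      show "integrable halfline (\<lambda>y. (cmod (f y))\<^sup>2)" using f(1) by (simp add: square_integrable_def)
      show "integrable halfline (\<lambda>y. D\<^sup>2 * ?E y)" by (intro integrable_mult_right Ei)
      fix y assume "y \<in> space halfline"
      then have y: "0 \<le> y" by simp
      have "(cmod (f y))\<^sup>2 \<le> (D * exp (- k * \<bar>x - y\<bar>))\<^sup>2"
        unfolding f(2) by (intro power_mono le x y) auto
      also have "\<dots> = D\<^sup>2 * exp (- (2 * k) * \<bar>x - y\<bar>)" by (simp add: power_mult_distrib exp_double[symmetric])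
      also have "exp (- (2 * k) * \<bar>x - y\<bar>) = ?E y"
        using y by (cases "y \<le> x") (auto simp: exp_add[symmetric] algebra_simps)
      finally show "(cmod (f y))\<^sup>2 \<le> D\<^sup>2 * ?E y" .
    qed
    also have "\<dots> = D\<^sup>2 * (LINT y|halfline. ?E y)" by simp
    also have "(LINT y|halfline. ?E y) = exp (- (2 * k) * x) * seg 0 x (\<lambda>y. exp (2 * k * y)) + exp (2 * k * x) * tail x (\<lambda>y. exp (- (2 * k) * y))"
    proof -
      have "(LINT y|halfline. ?E y) = (LINT y|halfline. indicator {0..x} y *\<^sub>R (exp (- (2 * k) * x) * exp (2 * k * y)))
        + (LINT y|halfline. exp (2 * k * x) * (exp (- (2 * k) * y) - indicator {0..x} y *\<^sub>R exp (- (2 * k) * y)))"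
        by (rule Bochner_Integration.integral_add[OF e1 integrable_mult_right[OF e2(2)]])
      also have "\<dots> = seg 0 x (\<lambda>y. exp (- (2 * k) * x) * exp (2 * k * y)) + exp (2 * k * x) * tail x (\<lambda>y. exp (- (2 * k) * y))"
        unfolding e2(1) seg_halfline[OF order_refl] by (simp only: integral_mult_right_zero)
      finally show ?thesis by (simp only: integral_mult_right_zero)
    qed
    also have "\<dots> = (1 - exp (- (2 * k) * x)) / (2 * k) + 1 / (2 * k)"
      unfolding seg_exp_const[OF x k2[THEN less_imp_neq, THEN not_sym]] tail_exp[OF k2 x]
      using k by (simp add: exp_minus field_simps)
    also have "D\<^sup>2 * \<dots> \<le> D\<^sup>2 * (1 / k)"
      using k by (intro mult_left_mono) (auto simp: field_simps)
    finally show ?thesis by simp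
  qed
  have "norm (abs_l2 f) \<le> sqrt (D\<^sup>2 / k)"
    if "0 \<le> x" "square_integrable f" "\<And>y. cmod (f y) = cmod (green V \<gamma> \<zeta> x y)" for f x
    by (rule real_le_rsqrt) (rule bound[OF that])
  then show ?thesis
    using green_H1[OF V z] cnj_H1[OF green_H1[OF V z]] unfolding sobolev_H1_def
    by (intro exI[of _ "sqrt (D\<^sup>2 / k)"]) simp
qed

text \<open>The test function is the conjugate of the Green function. Integrating by parts on both
  sides of \<open>x\<close> leaves the jump of its derivative there, a Wronskian divided by
  \<open>w\<close>, hence exactly \<open>u x\<close>. The term at infinity vanishes, and that at 0
  cancels against the boundary term of the form because \<open>\<phi>\<close> satisfies the boundary
  condition.\<close>

lemma weak_solution_eval:
  assumes V: "integrable halfline V" and z: "0 < Im \<zeta>" and w: "jost_function V \<gamma> \<zeta> \<noteq> 0"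
    and u: "sobolev_H1 u u'" and x: "0 \<le> x"
    and weak: "\<And>v v'. sobolev_H1 v v' \<Longrightarrow>
      energy_form V \<gamma> u u' v v' - \<zeta>\<^sup>2 * cinner (abs_l2 u) (abs_l2 v) = cinner f (abs_l2 v)"
  shows "u x = cinner f (abs_l2 (\<lambda>y. cnj (green V \<gamma> \<zeta> x y)))"
proof -
  let ?G = "green V \<gamma> \<zeta> x" and ?G' = "green' V \<gamma> \<zeta> x"
  let ?w = "jost_function V \<gamma> \<zeta>" and ?\<phi> = "regular_solution V \<gamma> \<zeta>" and ?\<theta> = "theta V \<zeta>" and ?\<theta>' = "theta' V \<zeta>"
  let ?\<phi>' = "hderiv ?\<phi>"
  note \<phi> = regular_props[OF V z, where \<gamma> = \<gamma>]
  note H1 = cnj_H1[OF green_H1[OF V z x, of \<gamma>]]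
  let ?h = "\<lambda>y. u' y * ?G' y + (of_real (V y) - \<zeta>\<^sup>2) * (u y * ?G y)"
  have hi: "integrable halfline ?h"
    using energy_form_eq(2)[OF V u H1, of "\<zeta>\<^sup>2"] by simp
  have eval: "cinner f (abs_l2 (\<lambda>y. cnj (?G y))) = (LINT y|halfline. ?h y) + of_real \<gamma> * u 0 * ?G 0"
    using weak[OF H1] energy_form_eq(1)[OF V u H1, of \<gamma> "\<zeta>\<^sup>2"] by simp
  have acu: "locally_ac_deriv u u'" using u by (simp add: sobolev_H1_def)
  define a where "a = ?\<theta> x / ?w"
  define b where "b = ?\<phi> x / ?w"
  define f1 where "f1 y = ?\<phi>' y * u' y + (of_real (V y) - \<zeta>\<^sup>2) * (?\<phi> y * u y)" for y
  define f2 where "f2 y = ?\<theta>' y * u' y + (of_real (V y) - \<zeta>\<^sup>2) * (?\<theta> y * u y)" for y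
  have ac1: "locally_ac_deriv (\<lambda>y. ?\<phi>' y * u y) f1"
    unfolding f1_def by (rule sol_pairing[OF \<phi>(1) acu])
  have ac2: "locally_ac_deriv (\<lambda>y. ?\<theta>' y * u y) f2"
    unfolding f2_def by (rule sol_pairing[OF theta_sol(1)[OF V z] acu])
  have h_eq: "?h = (\<lambda>y. if y \<le> x then a * f1 y else b * f2 y)"
    by (rule ext) (simp add: green_def green'_def a_def b_def f1_def f2_def algebra_simps)
  have seg_h: "seg 0 X ?h = a * (?\<phi>' x * u x - ?\<phi>' 0 * u 0) + b * (?\<theta>' X * u X - ?\<theta>' x * u x)" if X: "x \<le> X" for X
  proof -
    have i: "seg_integrable 0 x (\<lambda>y. a * f1 y)" "seg_integrable x X (\<lambda>y. b * f2 y)"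
      using locally_ac_deriv_diff(2)[OF ac1 order_refl x] locally_ac_deriv_diff(2)[OF ac2 x X] by simp_all
    show ?thesis
      unfolding h_eq seg_piecewise(2)[OF i x X] locally_ac_deriv_diff(1)[OF ac1 order_refl x]
        locally_ac_deriv_diff(1)[OF ac2 x X] by simp
  qed
  obtain B where B: "\<And>x. 0 \<le> x \<Longrightarrow> cmod (u x) \<le> B" using H1_bounded[OF u] by blast
  have lim0: "((\<lambda>X. ?\<theta>' X * u X) \<longlongrightarrow> 0) at_top"
  proof (rule Lim_null_comparison)
    show "\<forall>\<^sub>F X in at_top. cmod (?\<theta>' X * u X) \<le> cmod (?\<theta>' X) * B"
      unfolding norm_mult
      by (intro eventually_mono[OF eventually_ge_at_top[of 0]] mult_left_mono B) auto
    show "((\<lambda>X. cmod (?\<theta>' X) * B) \<longlongrightarrow> 0) at_top"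
      using tendsto_mult_left_zero[OF tendsto_norm_zero[OF theta_bounds(2)[OF V z]]] .
  qed
  have "((\<lambda>X. a * (?\<phi>' x * u x - ?\<phi>' 0 * u 0) + b * (?\<theta>' X * u X - ?\<theta>' x * u x))
      \<longlongrightarrow> a * (?\<phi>' x * u x - ?\<phi>' 0 * u 0) + b * (0 - ?\<theta>' x * u x)) at_top"
    by (intro tendsto_intros lim0)
  then have "((\<lambda>X. seg 0 X ?h) \<longlongrightarrow> a * (?\<phi>' x * u x - ?\<phi>' 0 * u 0) + b * (0 - ?\<theta>' x * u x)) at_top"
    by (rule Lim_transform_eventually) (intro eventually_mono[OF eventually_ge_at_top[of x]] seg_h[symmetric])
  from tendsto_unique[OF trivial_limit_at_top_linorder tendsto_seg_halfline[OF hi] this]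
  have "(LINT y|halfline. ?h y) = (?\<phi>' x * ?\<theta> x - ?\<theta>' x * ?\<phi> x) * u x / ?w - a * of_real \<gamma> * u 0"
    using \<phi>(3) by (simp add: a_def b_def diff_divide_distrib algebra_simps)
  also have "\<dots> = u x - a * of_real \<gamma> * u 0" unfolding \<phi>(5)[OF x] using w by simp
  finally have L: "(LINT y|halfline. ?h y) = u x - a * of_real \<gamma> * u 0" .
  have "?G 0 = a" using x \<phi>(2) by (simp add: green_def a_def)
  then show ?thesis unfolding eval L by simp
qed

lemma resolvent_weak:
  assumes "is_resolvent (schroedinger_op V \<gamma>) z R"
  shows "\<exists>u u'. R f = abs_l2 u \<and> sobolev_H1 u u' \<and> (\<forall>v v'. sobolev_H1 v v' \<longrightarrow>
      energy_form V \<gamma> u u' v v' - z * cinner (abs_l2 u) (abs_l2 v) = cinner f (abs_l2 v))"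
proof -
  obtain g where g: "(R f, g) \<in> schroedinger_op V \<gamma>" "g - z *\<^sub>C R f = f"
    using assms unfolding is_resolvent_def by blast
  from g(1)[unfolded schroedinger_op_def mem_Collect_eq] obtain u h u' where u0: "(R f, g) = (abs_l2 u, h)" "sobolev_H1 u u'"
    "\<forall>v v'. sobolev_H1 v v' \<longrightarrow> energy_form V \<gamma> u u' v v' = cinner h (abs_l2 v)"
    by (elim exE conjE)
  then have u: "R f = abs_l2 u" "\<And>v v'. sobolev_H1 v v' \<Longrightarrow> energy_form V \<gamma> u u' v v' = cinner g (abs_l2 v)"
    by simp_all
  have "energy_form V \<gamma> u u' v v' - z * cinner (abs_l2 u) (abs_l2 v) = cinner f (abs_l2 v)" if "sobolev_H1 v v'" for v v'
  proof -
    have "cinner f (abs_l2 v) = cinner g (abs_l2 v) - z * cinner (abs_l2 u) (abs_l2 v)"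
      by (subst g(2)[symmetric]) (simp add: u(1) cinner_simps)
    then show ?thesis using u(2)[OF that] by simp
  qed
  then show ?thesis using u(1) u0(2) by (intro exI[of _ u] exI[of _ u'] conjI allI impI)
qed

text \<open>With \<open>u = R f\<close> and \<open>b = R\<^sub>0 (cnj g)\<close>, testing the weak equation for \<open>u\<close> with \<open>cnj b\<close> and
  the one for \<open>b\<close> with \<open>cnj u\<close> and \<open>cnj (R\<^sub>0 f)\<close> leaves only \<open>\<integral> V u b\<close>.\<close>

lemma resolvent_difference:
  assumes V: "integrable halfline V" and z: "0 < Im \<zeta>"
    and R: "is_resolvent (schroedinger_op V \<gamma>) (\<zeta>\<^sup>2) R"
    and R0: "is_resolvent (schroedinger_op (\<lambda>x. 0) \<gamma>) (\<zeta>\<^sup>2) R0"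
    and w: "jost_function V \<gamma> \<zeta> \<noteq> 0" "jost_function (\<lambda>x. 0) \<gamma> \<zeta> \<noteq> 0"
  defines "K \<equiv> \<lambda>x. abs_l2 (\<lambda>y. cnj (green V \<gamma> \<zeta> x y))" and "K0 \<equiv> \<lambda>x. abs_l2 (green (\<lambda>x. 0) \<gamma> \<zeta> x)"
  shows "cinner (R0 f - R f) g = (LINT x|halfline. of_real (V x) * (cinner f (K x) * cinner (K0 x) g))"
    "(\<lambda>x. cinner f (K x)) \<in> borel_measurable halfline" "(\<lambda>x. cinner (K0 x) g) \<in> borel_measurable halfline"
proof -
  have V0: "integrable halfline (\<lambda>x. 0 :: real)" by simp
  let ?V0 = "\<lambda>x. 0 :: real"
  have sqg: "square_integrable (rep_l2 g)" by (rule square_integrable_rep)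
  have sqc: "square_integrable (\<lambda>x. cnj (rep_l2 g x))"
  proof -
    have "cnj \<in> borel_measurable borel"
      by (intro borel_measurable_continuous_onI continuous_on_cnj continuous_on_id)
    from measurable_compose[OF borel_measurable_square_integrable[OF sqg] this]
    show ?thesis using sqg by (simp add: square_integrable_def)
  qed
  \<comment> \<open>Conjugating \<open>g\<close> turns the sesquilinear pairing into a bilinear one.
    As \<open>\<gamma>\<close> is real, the free form is symmetric as a bilinear form, so
    \<open>R0\<close> at the same \<open>\<zeta>\<^sup>2\<close> is its own transpose and no
    resolvent at the conjugate point is called for.\<close>
  define g' where "g' = abs_l2 (\<lambda>x. cnj (rep_l2 g x))"
  have g': "cinner g' (abs_l2 (\<lambda>x. cnj (v x))) = cinner (abs_l2 v) g" if v: "square_integrable v" "square_integrable (\<lambda>x. cnj (v x))" for v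
  proof -
    have "cinner (abs_l2 v) g = cinner (abs_l2 v) (abs_l2 (rep_l2 g))" by (simp add: abs_rep_l2)
    then show ?thesis
      unfolding g'_def cinner_abs_l2[OF sqc v(2)] by (simp add: cinner_abs_l2[OF v(1) sqg] mult.commute)
  qed
  obtain u u' where u: "R f = abs_l2 u" "sobolev_H1 u u'" "\<And>v v'. sobolev_H1 v v' \<Longrightarrow>
      energy_form V \<gamma> u u' v v' - \<zeta>\<^sup>2 * cinner (abs_l2 u) (abs_l2 v) = cinner f (abs_l2 v)"
    using resolvent_weak[OF R] by blast
  obtain a a' where a: "R0 f = abs_l2 a" "sobolev_H1 a a'" "\<And>v v'. sobolev_H1 v v' \<Longrightarrow>
      energy_form ?V0 \<gamma> a a' v v' - \<zeta>\<^sup>2 * cinner (abs_l2 a) (abs_l2 v) = cinner f (abs_l2 v)"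
    using resolvent_weak[OF R0] by blast
  obtain b b' where b: "sobolev_H1 b b'" "\<And>v v'. sobolev_H1 v v' \<Longrightarrow>
      energy_form ?V0 \<gamma> b b' v v' - \<zeta>\<^sup>2 * cinner (abs_l2 b) (abs_l2 v) = cinner g' (abs_l2 v)"
    using resolvent_weak[OF R0, of g'] by blast
  note cu = cnj_H1[OF u(2)] and ca = cnj_H1[OF a(2)] and cb = cnj_H1[OF b(1)]
  have sym: "cinner (abs_l2 v) g = (LINT x|halfline. v' x * b' x + (0 - \<zeta>\<^sup>2) * (v x * b x)) + of_real \<gamma> * v 0 * b 0"
    if v: "sobolev_H1 v v'" for v v'
  proof -
    note cv = cnj_H1[OF v]
    have "cinner (abs_l2 v) g = cinner g' (abs_l2 (\<lambda>x. cnj (v x)))"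
      using v cv by (intro g'[symmetric]) (auto simp: sobolev_H1_def)
    also have "\<dots> = (LINT x|halfline. b' x * cnj (cnj (v' x)) + (of_real 0 - \<zeta>\<^sup>2) * (b x * cnj (cnj (v x)))) + of_real \<gamma> * b 0 * cnj (cnj (v 0))"
      unfolding b(2)[OF cv, symmetric] by (rule energy_form_eq(1)[OF V0 b(1) cv])
    finally show ?thesis by (simp add: mult_ac)
  qed
  have f1: "cinner f (abs_l2 (\<lambda>x. cnj (b x))) = (LINT x|halfline. u' x * b' x + (of_real (V x) - \<zeta>\<^sup>2) * (u x * b x)) + of_real \<gamma> * u 0 * b 0"
    using energy_form_eq(1)[OF V u(2) cb, of \<gamma> "\<zeta>\<^sup>2"] u(3)[OF cb] by simp
  have f2: "cinner f (abs_l2 (\<lambda>x. cnj (b x))) = (LINT x|halfline. a' x * b' x + (0 - \<zeta>\<^sup>2) * (a x * b x)) + of_real \<gamma> * a 0 * b 0"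
    using energy_form_eq(1)[OF V0 a(2) cb, of \<gamma> "\<zeta>\<^sup>2"] a(3)[OF cb] by simp
  have i1: "integrable halfline (\<lambda>x. u' x * b' x + (of_real (V x) - \<zeta>\<^sup>2) * (u x * b x))"
    using energy_form_eq(2)[OF V u(2) cb, of "\<zeta>\<^sup>2"] by simp
  have i2: "integrable halfline (\<lambda>x. u' x * b' x + (0 - \<zeta>\<^sup>2) * (u x * b x))"
    using energy_form_eq(2)[OF V0 u(2) cb, of "\<zeta>\<^sup>2"] by simp
  have "cinner (R0 f - R f) g = cinner (abs_l2 a) g - cinner (abs_l2 u) g"
    by (simp add: a(1) u(1) cinner_simps)
  also have "\<dots> = (LINT x|halfline. u' x * b' x + (of_real (V x) - \<zeta>\<^sup>2) * (u x * b x)) - (LINT x|halfline. u' x * b' x + (0 - \<zeta>\<^sup>2) * (u x * b x))"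
    unfolding sym[OF a(2)] sym[OF u(2)] using f1 f2 by simp
  also have "\<dots> = (LINT x|halfline. of_real (V x) * (u x * b x))"
    unfolding Bochner_Integration.integral_diff[OF i1 i2, symmetric]
    by (intro Bochner_Integration.integral_cong refl) (simp add: algebra_simps)
  finally have main: "cinner (R0 f - R f) g = (LINT x|halfline. of_real (V x) * (u x * b x))" .
  have ux: "u x = cinner f (K x)" if "0 \<le> x" for x
    unfolding K_def by (rule weak_solution_eval[OF V z w(1) u(2) that u(3)])
  have bx: "b x = cinner (K0 x) g" if x: "0 \<le> x" for x
  proof -
    have "b x = cinner g' (abs_l2 (\<lambda>y. cnj (green ?V0 \<gamma> \<zeta> x y)))"
      by (rule weak_solution_eval[OF V0 z w(2) b(1) x b(2)])
    also have "\<dots> = cinner (K0 x) g"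
      unfolding K0_def using green_H1[OF V0 z x, of \<gamma>] cnj_H1[OF green_H1[OF V0 z x, of \<gamma>]]
      by (intro g') (auto simp: sobolev_H1_def)
    finally show ?thesis .
  qed
  show "cinner (R0 f - R f) g = (LINT x|halfline. of_real (V x) * (cinner f (K x) * cinner (K0 x) g))"
    unfolding main by (intro Bochner_Integration.integral_cong refl) (simp add: ux bx)
  show "(\<lambda>x. cinner f (K x)) \<in> borel_measurable halfline"
    using borel_measurable_continuous_halfline[OF H1_continuous[OF u(2)]]
    by (subst measurable_cong[where g = u]) (simp_all add: ux)
  show "(\<lambda>x. cinner (K0 x) g) \<in> borel_measurable halfline"
    using borel_measurable_continuous_halfline[OF H1_continuous[OF b(1)]]
    by (subst measurable_cong[where g = b]) (simp_all add: bx)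
qed

section \<open>The trace formula\<close>

text \<open>The integral of the product of the kernels over \<open>y\<close> is
  \<open>J / (W0 W)\<close> with \<open>J = f2 I1 + f1 I2\<close>. The Wronskians \<open>w1\<close>,
  \<open>w2\<close> of free with perturbed solutions have derivatives \<open>-V f1\<close>,
  \<open>-V f2\<close>, while \<open>I1\<close>, \<open>I2\<close> have derivatives
  \<open>f1\<close>, \<open>-f2\<close>. So the derivative of \<open>E = w2 I1 + w1 I2\<close> is
  \<open>-V J + (w2 f1 - w1 f2)\<close>. Regrouping the products of the four solutions turns the
  bracket into \<open>g\<close>, in which only the Wronskians \<open>W\<close> and \<open>W0\<close>
  remain.\<close>

lemma trace_kernel_integral:
  fixes V :: "real \<Rightarrow> real" and \<gamma> :: real and \<zeta> :: complex
  assumes V: "integrable halfline V" and z: "0 < Im \<zeta>"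
    and w: "jost_function V \<gamma> \<zeta> \<noteq> 0" "jost_function (\<lambda>x. 0) \<gamma> \<zeta> \<noteq> 0"
  defines "K \<equiv> \<lambda>x. abs_l2 (\<lambda>y. cnj (green V \<gamma> \<zeta> x y))" and "K0 \<equiv> \<lambda>x. abs_l2 (green (\<lambda>x. 0) \<gamma> \<zeta> x)"
  shows "(LINT x|halfline. of_real (V x) * cinner (K0 x) (K x)) = 1 / (2 * \<zeta>) *
      (deriv (jost_function V \<gamma>) \<zeta> / jost_function V \<gamma> \<zeta> + \<i> / (of_real \<gamma> - \<i> * \<zeta>))"
proof -
  have z0: "\<zeta> \<noteq> 0" using z by auto
  let ?V0 = "\<lambda>x::real. 0 :: real"
  have V0: "integrable halfline ?V0" by simp
  define k where "k = Im \<zeta>"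
  have k: "0 < k" "0 < 2 * k" using z by (auto simp: k_def)
  let ?e = "\<lambda>x. exp (\<i> * \<zeta> * complex_of_real x)"
  define W W0 where "W = jost_function V \<gamma> \<zeta>" and "W0 = jost_function ?V0 \<gamma> \<zeta>"
  have W: "W \<noteq> 0" "W0 \<noteq> 0" using w by (simp_all add: W_def W0_def)
  define \<phi> \<phi>0 where "\<phi> = regular_solution V \<gamma> \<zeta>" and "\<phi>0 = regular_solution ?V0 \<gamma> \<zeta>"
  define \<phi>' \<phi>0' where "\<phi>' x = hderiv \<phi> x" and "\<phi>0' x = hderiv \<phi>0 x" for x
  define \<theta> \<theta>0 where "\<theta> = theta V \<zeta>" and "\<theta>0 = theta ?V0 \<zeta>"
  define \<theta>' \<theta>0' where "\<theta>' = theta' V \<zeta>" and "\<theta>0' = theta' ?V0 \<zeta>"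
  note \<phi> = regular_props[OF V z, where \<gamma> = \<gamma>, folded \<phi>_def, folded \<phi>'_def, folded \<theta>_def \<theta>'_def W_def]
  note \<phi>0 = regular_props[OF V0 z, where \<gamma> = \<gamma>, folded \<phi>0_def, folded \<phi>0'_def, folded \<theta>0_def \<theta>0'_def W0_def]
  note \<theta> = theta_sol[OF V z, folded \<theta>_def \<theta>'_def] and \<theta>0 = theta_sol[OF V0 z, folded \<theta>0_def \<theta>0'_def]
  note c = sol_continuous(1)[OF \<phi>(1)] sol_continuous(1)[OF \<phi>0(1)] sol_continuous(1)[OF \<theta>(1)] sol_continuous(1)[OF \<theta>0(1)]
  obtain C where C: "\<And>x. 0 \<le> x \<Longrightarrow> cmod (\<phi> x) \<le> C * exp (k * x)" using \<phi>(4) unfolding k_def by blast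
  obtain C0 where C0: "\<And>x. 0 \<le> x \<Longrightarrow> cmod (\<phi>0 x) \<le> C0 * exp (k * x)" using \<phi>0(4) unfolding k_def by blast
  obtain M where M: "\<And>x. 0 \<le> x \<Longrightarrow> cmod (\<theta> x) \<le> M * exp (- k * x)"
    using theta_bounds(1)[OF V z] unfolding k_def \<theta>_def by blast
  obtain M0 where M0: "\<And>x. 0 \<le> x \<Longrightarrow> cmod (\<theta>0 x) \<le> M0 * exp (- k * x)"
    using theta_bounds(1)[OF V0 z] unfolding k_def \<theta>0_def by blast
  define f1 where "f1 x = \<phi>0 x * \<phi> x" for x
  define f2 where "f2 x = \<theta>0 x * \<theta> x" for x
  have f1c: "continuous_on {0..} f1" and f2c: "continuous_on {0..} f2"
    unfolding f1_def f2_def by (intro continuous_on_mult c)+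
  have nonneg: "0 \<le> D" if "cmod y \<le> D * exp (r::real)" for y D r
    using order_trans[OF norm_ge_zero that] by (simp add: zero_le_mult_iff)
  have f1_le: "cmod (f1 x) \<le> (C0 * C) * exp (2 * k * x)" if "0 \<le> x" for x
  proof -
    have "cmod (f1 x) \<le> (C0 * exp (k * x)) * (C * exp (k * x))"
      unfolding f1_def norm_mult using nonneg[OF C0[OF that]] by (intro mult_mono C C0 that) auto
    also have "\<dots> = (C0 * C) * (exp (k * x) * exp (k * x))" by simp
    also have "exp (k * x) * exp (k * x) = exp (2 * k * x)" by (simp add: exp_add[symmetric])
    finally show ?thesis .
  qed
  have f2_le: "cmod (f2 x) \<le> (M0 * M) * exp (- (2 * k) * x)" if "0 \<le> x" for x
  proof -
    have "cmod (f2 x) \<le> (M0 * exp (- k * x)) * (M * exp (- k * x))"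
      unfolding f2_def norm_mult using nonneg[OF M0[OF that]] by (intro mult_mono M M0 that) auto
    also have "\<dots> = (M0 * M) * (exp (- k * x) * exp (- k * x))" by simp
    also have "exp (- k * x) * exp (- k * x) = exp (- (2 * k) * x)" by (simp add: exp_add[symmetric])
    finally show ?thesis .
  qed
  have f2i: "integrable halfline f2"
  proof (rule Bochner_Integration.integrable_bound)
    show "integrable halfline (\<lambda>x. (M0 * M) * exp (- (2 * k) * x))"
      by (intro integrable_mult_right exp_decay_integrable k)
    show "f2 \<in> borel_measurable halfline" by (rule borel_measurable_continuous_halfline[OF f2c])
    show "AE x in halfline. norm (f2 x) \<le> norm ((M0 * M) * exp (- (2 * k) * x))"
    proof (rule AE_I2)
      fix x assume "x \<in> space halfline"
      then have "norm (f2 x) \<le> (M0 * M) * exp (- (2 * k) * x)" by (intro f2_le) simp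
      then show "norm (f2 x) \<le> norm ((M0 * M) * exp (- (2 * k) * x))"
        unfolding real_norm_def by (rule order_trans[OF _ abs_ge_self])
    qed
  qed
  have f1s: "seg_integrable 0 b f1" for b by (intro seg_integrable_continuous f1c order_refl)
  define I1 where "I1 x = seg 0 x f1" for x
  define I2 where "I2 x = tail x f2" for x
  define J where "J x = f2 x * I1 x + f1 x * I2 x" for x
  have kernel: "cinner (K0 x) (K x) = J x / (W0 * W)" if x: "0 \<le> x" for x
  proof -
    have "cinner (K0 x) (K x) = (LINT y|halfline. green ?V0 \<gamma> \<zeta> x y * cnj (cnj (green V \<gamma> \<zeta> x y)))"
      unfolding K_def K0_def using green_H1[OF V0 z x, of \<gamma>] cnj_H1[OF green_H1[OF V z x, of \<gamma>]]
      by (intro cinner_abs_l2) (auto simp: sobolev_H1_def)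
    also have "\<dots> = (LINT y|halfline. f2 x / (W0 * W) * (indicator {0..x} y *\<^sub>R f1 y)
        + f1 x / (W0 * W) * (f2 y - indicator {0..x} y *\<^sub>R f2 y))"
    proof (intro Bochner_Integration.integral_cong refl)
      fix y assume "y \<in> space halfline"
      then show "green ?V0 \<gamma> \<zeta> x y * cnj (cnj (green V \<gamma> \<zeta> x y)) = f2 x / (W0 * W) * (indicator {0..x} y *\<^sub>R f1 y)
        + f1 x / (W0 * W) * (f2 y - indicator {0..x} y *\<^sub>R f2 y)"
        by (cases "y \<le> x") (simp_all add: green_def f1_def f2_def \<phi>_def \<phi>0_def \<theta>_def \<theta>0_def W_def W0_def)
    qed
    also have "\<dots> = f2 x / (W0 * W) * I1 x + f1 x / (W0 * W) * I2 x"
    proof -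
      have i: "integrable halfline (\<lambda>y. indicator {0..x} y *\<^sub>R f1 y)"
        using f1s[of x] seg_integrable_halfline_iff[of 0 x f1] by simp
      show ?thesis
        unfolding Bochner_Integration.integral_add[OF integrable_mult_right[OF i] integrable_mult_right[OF tail_eq(2)[OF f2i]]]
          integral_mult_right_zero tail_eq(1)[OF f2i, symmetric] seg_halfline[OF order_refl, symmetric] I1_def I2_def ..
    qed
    finally show ?thesis by (simp add: J_def add_divide_distrib)
  qed
  have ac1: "locally_ac_deriv I1 f1"
    using locally_ac_deriv_seg[OF f1s, of 0] by (simp add: I1_def[abs_def])
  have f2s: "seg_integrable 0 b f2" for b by (intro seg_integrable_continuous f2c order_refl)
  have ac2: "locally_ac_deriv I2 (\<lambda>x. 0 - f2 x)"
    using locally_ac_deriv_diff'[OF locally_ac_deriv_const[of "LINT t|halfline. f2 t"] locally_ac_deriv_seg[OF f2s, of 0]]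
    by (simp add: I2_def[abs_def] tail_def)
  have Jc: "continuous_on {0..} J"
    unfolding J_def by (intro continuous_on_add continuous_on_mult f1c f2c locally_ac_deriv_continuous[OF ac1] locally_ac_deriv_continuous[OF ac2])
  obtain B where B: "\<And>x. 0 \<le> x \<Longrightarrow> norm (K x) \<le> B"
    using green_l2_bound[OF V z, of \<gamma>] unfolding K_def by blast
  obtain B0 where B0: "\<And>x. 0 \<le> x \<Longrightarrow> norm (K0 x) \<le> B0"
    using green_l2_bound[OF V0 z, of \<gamma>] unfolding K0_def by blast
  \<comment> \<open>Growth of \<open>f1\<close> and decay of \<open>f2\<close> compensate each other
    in \<open>J\<close>; the bound is read off from the norms of the rows of the two
    kernels.\<close>
  have Jb: "cmod (J x) \<le> cmod (W0 * W) * (B0 * B)" if x: "0 \<le> x" for x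
  proof -
    have "J x = W0 * W * cinner (K0 x) (K x)" using kernel[OF x] W by simp
    also have "cmod \<dots> \<le> cmod (W0 * W) * (B0 * B)"
      unfolding norm_mult[of "W0 * W"]
    proof (intro mult_left_mono norm_ge_zero)
      have "cmod (cinner (K0 x) (K x)) \<le> norm (K0 x) * norm (K x)" by (rule cmod_cinner_le)
      also have "\<dots> \<le> B0 * B"
        using B[OF x] B0[OF x] order_trans[OF norm_ge_zero B0[OF x]] by (intro mult_mono) auto
      finally show "cmod (cinner (K0 x) (K x)) \<le> B0 * B" .
    qed
    finally show ?thesis .
  qed
  have VJi: "integrable halfline (\<lambda>x. of_real (V x) * J x)" by (rule V_mult_integrable[OF V Jc Jb])
  define Tr where "Tr = (LINT x|halfline. of_real (V x) * J x)"
  have trace: "(LINT x|halfline. of_real (V x) * cinner (K0 x) (K x)) = Tr / (W0 * W)"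
  proof -
    have "(LINT x|halfline. of_real (V x) * cinner (K0 x) (K x)) = (LINT x|halfline. of_real (V x) * J x / (W0 * W))"
      by (intro Bochner_Integration.integral_cong refl) (simp add: kernel)
    then show ?thesis by (simp add: Tr_def)
  qed
  define w1 where "w1 x = \<phi>0' x * \<phi> x - \<phi>' x * \<phi>0 x" for x
  define w2 where "w2 x = \<theta>0' x * \<theta> x - \<theta>' x * \<theta>0 x" for x
  have acw1: "locally_ac_deriv w1 (\<lambda>x. (of_real (0 - V x) - (\<zeta>\<^sup>2 - \<zeta>\<^sup>2)) * (\<phi>0 x * \<phi> x))"
    unfolding w1_def[abs_def] by (rule wronskian_ac[OF \<phi>0(1) \<phi>(1)])
  have acw2: "locally_ac_deriv w2 (\<lambda>x. (of_real (0 - V x) - (\<zeta>\<^sup>2 - \<zeta>\<^sup>2)) * (\<theta>0 x * \<theta> x))"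
    unfolding w2_def[abs_def] by (rule wronskian_ac[OF \<theta>0(1) \<theta>(1)])
  define E where "E x = w2 x * I1 x + w1 x * I2 x" for x
  define g where "g x = W * (\<phi>0 x * \<theta>0 x) - W0 * (\<phi> x * \<theta> x)" for x
  have gs: "seg_integrable 0 b g" for b
    unfolding g_def by (intro seg_integrable_continuous continuous_on_diff continuous_on_mult continuous_on_const c order_refl)
  have acE: "locally_ac_deriv E (\<lambda>x. g x - of_real (V x) * J x)"
  proof (rule locally_ac_deriv_cong)
    show "locally_ac_deriv E (\<lambda>x. ((of_real (0 - V x) - (\<zeta>\<^sup>2 - \<zeta>\<^sup>2)) * (\<theta>0 x * \<theta> x) * I1 x + w2 x * f1 x)
        + ((of_real (0 - V x) - (\<zeta>\<^sup>2 - \<zeta>\<^sup>2)) * (\<phi>0 x * \<phi> x) * I2 x + w1 x * (0 - f2 x)))"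
      unfolding E_def[abs_def] by (intro locally_ac_deriv_add locally_ac_deriv_mult acw1 acw2 ac1 ac2)
    fix x :: real assume x: "0 \<le> x"
    have "w2 x * f1 x - w1 x * f2 x = (\<phi>' x * \<theta> x - \<theta>' x * \<phi> x) * (\<phi>0 x * \<theta>0 x) - (\<phi>0' x * \<theta>0 x - \<theta>0' x * \<phi>0 x) * (\<phi> x * \<theta> x)"
      by (simp add: w1_def w2_def f1_def f2_def algebra_simps)
    also have "\<dots> = g x" unfolding \<phi>(5)[OF x] \<phi>0(5)[OF x] g_def ..
    finally show "((of_real (0 - V x) - (\<zeta>\<^sup>2 - \<zeta>\<^sup>2)) * (\<theta>0 x * \<theta> x) * I1 x + w2 x * f1 x)
        + ((of_real (0 - V x) - (\<zeta>\<^sup>2 - \<zeta>\<^sup>2)) * (\<phi>0 x * \<phi> x) * I2 x + w1 x * (0 - f2 x)) = g x - of_real (V x) * J x"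
      by (simp add: J_def f1_def f2_def algebra_simps)
  qed simp
  have E0: "E 0 = 0"
    using \<phi> \<phi>0 by (simp add: E_def I1_def w1_def)
  have EX: "seg 0 X (\<lambda>x. of_real (V x) * J x) + E X = seg 0 X g" if X: "0 \<le> X" for X
  proof -
    have "E X = seg 0 X (\<lambda>x. g x - of_real (V x) * J x)"
      using locally_ac_derivD(1)[OF acE X] E0 by simp
    also have "\<dots> = seg 0 X g - seg 0 X (\<lambda>x. of_real (V x) * J x)"
      by (rule Bochner_Integration.integral_diff[OF gs halfline_seg_integrable[OF VJi order_refl]])
    finally show ?thesis by simp
  qed
  have Elim: "(E \<longlongrightarrow> 0) at_top"
  proof -
    \<comment> \<open>Up to the factors \<open>exp (-2 i \<zeta> x)\<close> and
      \<open>exp (2 i \<zeta> x)\<close> these are \<open>w1\<close> and \<open>w2\<close>. Both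
      tend to zero since the leading asymptotics cancel in a Wronskian of two growing or two
      decaying solutions. The split-off exponentials match the decay of \<open>I2\<close> and the
      growth of \<open>I1\<close>.\<close>
    define y1 where "y1 x = ?e x * \<phi>0' x * (?e x * \<phi> x) - ?e x * \<phi>' x * (?e x * \<phi>0 x)" for x
    define y2 where "y2 x = jost_P ?V0 \<zeta> x * jost_m V \<zeta> x - jost_P V \<zeta> x * jost_m ?V0 \<zeta> x" for x
    have "(y1 \<longlongrightarrow> W0 / 2 * (- W / (2 * \<i> * \<zeta>)) - W / 2 * (- W0 / (2 * \<i> * \<zeta>))) at_top"
      unfolding y1_def by (intro tendsto_intros \<phi>(6,7) \<phi>0(6,7))
    then have y1: "(y1 \<longlongrightarrow> 0) at_top" by simp
    have "(y2 \<longlongrightarrow> \<i> * \<zeta> * 1 - \<i> * \<zeta> * 1) at_top"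
      unfolding y2_def by (intro tendsto_intros \<theta>(2,3) \<theta>0(2,3))
    then have y2: "(y2 \<longlongrightarrow> 0) at_top" by simp
    have e2: "cmod (?e x) * cmod (?e x) = exp (- (2 * k) * x)" for x
      unfolding norm_exp_i k_def by (simp add: exp_add[symmetric])
    have CC: "0 \<le> C0 * C" using nonneg[OF f1_le[of 0]] by simp
    have MM: "0 \<le> M0 * M" using nonneg[OF f2_le[of 0]] by simp
    have 1: "cmod (w2 x * I1 x) \<le> cmod (y2 x) * (C0 * C / (2 * k))" if x: "0 \<le> x" for x
    proof -
      have "w2 x = ?e x * ?e x * y2 x"
        by (simp add: w2_def y2_def \<theta>_def \<theta>0_def \<theta>'_def \<theta>0'_def theta_def theta'_def algebra_simps)
      then have "cmod (w2 x) = exp (- (2 * k) * x) * cmod (y2 x)" by (simp only: norm_mult e2)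
      moreover have "cmod (I1 x) \<le> C0 * C * (exp (2 * k * x) / (2 * k))"
      proof -
        have "cmod (I1 x) \<le> seg 0 x (\<lambda>t. cmod (f1 t))" unfolding I1_def by (rule seg_norm_le)
        also have "\<dots> \<le> seg 0 x (\<lambda>t. (C0 * C) * exp (2 * k * t))"
        proof (rule integral_mono)
          show "seg_integrable 0 x (\<lambda>t. cmod (f1 t))" using f1s[of x] by simp
          show "seg_integrable 0 x (\<lambda>t. (C0 * C) * exp (2 * k * t))"
            by (intro seg_integrable_continuous continuous_intros order_refl)
        qed (use f1_le in auto)
        also have "\<dots> = (C0 * C) * ((exp (2 * k * x) - 1) / (2 * k))"
          using seg_exp_const[OF x, of "2 * k"] k by simp
        also have "\<dots> \<le> (C0 * C) * (exp (2 * k * x) / (2 * k))"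
          using k by (intro mult_left_mono CC divide_right_mono) auto
        finally show ?thesis .
      qed
      ultimately have "cmod (w2 x * I1 x) \<le> (exp (- (2 * k) * x) * cmod (y2 x)) * (C0 * C * (exp (2 * k * x) / (2 * k)))"
        unfolding norm_mult by (intro mult_mono) auto
      also have "\<dots> = cmod (y2 x) * (C0 * C / (2 * k)) * (exp (- (2 * k) * x) * exp (2 * k * x))" by simp
      also have "exp (- (2 * k) * x) * exp (2 * k * x) = 1" by (simp add: exp_add[symmetric])
      finally show ?thesis by simp
    qed
    have 2: "cmod (w1 x * I2 x) \<le> cmod (y1 x) * (M0 * M / (2 * k))" if x: "0 \<le> x" for x
    proof -
      have "?e x * ?e x * w1 x = y1 x" by (simp add: w1_def y1_def algebra_simps)
      then have y: "cmod (y1 x) = exp (- (2 * k) * x) * cmod (w1 x)"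
        by (metis e2 norm_mult)
      have I2: "cmod (I2 x) \<le> (M0 * M) * (exp (- (2 * k) * x) / (2 * k))"
      proof -
        have "cmod (1 * tail x f2) \<le> tail x (\<lambda>t. (M0 * M) * exp (- (2 * k) * t))"
        proof (rule tail_norm_le[OF f2i])
          show "integrable halfline (\<lambda>t. (M0 * M) * exp (- (2 * k) * t))"
            by (intro integrable_mult_right exp_decay_integrable k)
          show "cmod (1 * f2 t) \<le> (M0 * M) * exp (- (2 * k) * t)" if "0 \<le> t" for t
            using f2_le[OF that] by simp
        qed
        also have "\<dots> = (M0 * M) * (exp (- (2 * k) * x) / (2 * k))"
          unfolding tail_cmult tail_exp[OF k(2) x] ..
        finally show ?thesis by (simp add: I2_def)
      qed
      have "cmod (w1 x * I2 x) \<le> cmod (w1 x) * ((M0 * M) * (exp (- (2 * k) * x) / (2 * k)))"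
        unfolding norm_mult by (intro mult_left_mono I2) auto
      then show ?thesis unfolding y by (simp add: mult_ac)
    qed
    show ?thesis
    proof (rule Lim_null_comparison)
      show "\<forall>\<^sub>F x in at_top. cmod (E x) \<le> cmod (y2 x) * (C0 * C / (2 * k)) + cmod (y1 x) * (M0 * M / (2 * k))"
        unfolding E_def
        by (intro eventually_mono[OF eventually_ge_at_top[of 0]] order_trans[OF norm_triangle_ineq add_mono] 1 2)
      have "((\<lambda>x. cmod (y2 x) * (C0 * C / (2 * k)) + cmod (y1 x) * (M0 * M / (2 * k))) \<longlongrightarrow>
          cmod 0 * (C0 * C / (2 * k)) + cmod 0 * (M0 * M / (2 * k))) at_top"
        by (intro tendsto_add tendsto_mult tendsto_norm tendsto_const y1 y2)
      then show "((\<lambda>x. cmod (y2 x) * (C0 * C / (2 * k)) + cmod (y1 x) * (M0 * M / (2 * k))) \<longlongrightarrow> 0) at_top" by simp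
    qed
  qed
  have glim: "((\<lambda>X. seg 0 X g) \<longlongrightarrow> Tr + 0) at_top"
  proof (rule Lim_transform_eventually)
    show "((\<lambda>X. seg 0 X (\<lambda>x. of_real (V x) * J x) + E X) \<longlongrightarrow> Tr + 0) at_top"
      unfolding Tr_def by (intro tendsto_add tendsto_seg_halfline VJi Elim)
  qed (intro eventually_mono[OF eventually_ge_at_top[of 0]] EX)
  \<comment> \<open>The free identity \<open>A0\<close>, multiplied by \<open>W / W0\<close>,
    eliminates the term linear in \<open>X\<close>.\<close>
  have approx: "approx_deriv V \<gamma> \<zeta> X = (2 * \<zeta> * seg 0 X g + \<i> * W * (?e X * \<phi>0 X) - \<i> * W0 * (?e X * \<phi> X) - \<i> * W) / W0"
    if X: "0 \<le> X" for X
  proof -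
    have i: "seg_integrable 0 X (\<lambda>x. \<phi>0 x * \<theta>0 x)" "seg_integrable 0 X (\<lambda>x. \<phi> x * \<theta> x)"
      by (intro seg_integrable_continuous continuous_on_mult c order_refl)+
    define s s0 where "s = seg 0 X (\<lambda>x. \<phi> x * \<theta> x)" and "s0 = seg 0 X (\<lambda>x. \<phi>0 x * \<theta>0 x)"
    have sg: "seg 0 X g = W * s0 - W0 * s"
      unfolding g_def s_def s0_def using i by simp
    have A: "approx_deriv V \<gamma> \<zeta> X = \<i> * of_real X * W - \<i> * ?e X * \<phi> X - 2 * \<zeta> * s"
      by (simp add: approx_deriv_def W_def \<phi>_def \<theta>_def s_def)
    have A0: "\<i> * of_real X * W0 - \<i> * ?e X * \<phi>0 X - 2 * \<zeta> * s0 = - \<i>"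
      using free_approx_deriv[OF z X, of \<gamma>] by (simp add: approx_deriv_def W0_def \<phi>0_def \<theta>0_def s0_def)
    have "W0 * approx_deriv V \<gamma> \<zeta> X
        = W * (\<i> * of_real X * W0 - \<i> * ?e X * \<phi>0 X - 2 * \<zeta> * s0) + 2 * \<zeta> * seg 0 X g + \<i> * W * (?e X * \<phi>0 X) - \<i> * W0 * (?e X * \<phi> X)"
      unfolding A sg by (simp add: algebra_simps)
    then show ?thesis unfolding A0 using W by (simp add: field_simps)
  qed
  \<comment> \<open>The two boundary terms have limits of equal size and opposite sign, so only
    \<open>Tr\<close> and the constant \<open>-i W\<close> from the free identity survive.\<close>
  have "((\<lambda>X. (2 * \<zeta> * seg 0 X g + \<i> * W * (?e X * \<phi>0 X) - \<i> * W0 * (?e X * \<phi> X) - \<i> * W) / W0) \<longlongrightarrow>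
      (2 * \<zeta> * (Tr + 0) + \<i> * W * (- W0 / (2 * \<i> * \<zeta>)) - \<i> * W0 * (- W / (2 * \<i> * \<zeta>)) - \<i> * W) / W0) at_top"
    using W by (intro tendsto_intros glim \<phi>(6) \<phi>0(6))
  then have "(approx_deriv V \<gamma> \<zeta> \<longlongrightarrow>
      (2 * \<zeta> * (Tr + 0) + \<i> * W * (- W0 / (2 * \<i> * \<zeta>)) - \<i> * W0 * (- W / (2 * \<i> * \<zeta>)) - \<i> * W) / W0) at_top"
    by (rule Lim_transform_eventually)
       (intro eventually_mono[OF eventually_ge_at_top[of 0]] approx[symmetric])
  from jost_has_derivative[OF V z this]
  have deriv: "deriv (jost_function V \<gamma>) \<zeta> = (2 * \<zeta> * Tr - \<i> * W) / W0" by (simp add: mult_ac)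
  have W0eq: "W0 = of_real \<gamma> - \<i> * \<zeta>" unfolding W0_def by (rule free_jost(3)[OF z])
  have "1 / (2 * \<zeta>) * ((2 * \<zeta> * Tr - \<i> * W) / W0 / W + \<i> / W0) = Tr / (W0 * W)"
    using W z0 by (simp add: field_simps)
  then show ?thesis unfolding trace deriv W_def[symmetric] W0eq[symmetric] by simp
qed

theorem theorem1p1:
  fixes V :: "real \<Rightarrow> real" and \<gamma> :: real and z \<zeta> :: complex
  assumes V: "integrable (lebesgue_on {0..}) V"
    and z: "z \<in> resolvent_set (schroedinger_op V \<gamma>) \<inter> resolvent_set (schroedinger_op (\<lambda>x. 0) \<gamma>)"
    and \<zeta>: "\<zeta>\<^sup>2 = z" "Im \<zeta> > 0"
  defines "T \<equiv> (\<lambda>f. resolvent (schroedinger_op (\<lambda>x. 0) \<gamma>) z f - resolvent (schroedinger_op V \<gamma>) z f)"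
  shows "trace_class T \<and>
    op_trace T = 1 / (2 * \<zeta>) *
      (deriv (jost_function V \<gamma>) \<zeta> / jost_function V \<gamma> \<zeta> + \<i> / (complex_of_real \<gamma> - \<i> * \<zeta>))"
proof -
  have V0: "integrable halfline (\<lambda>x. 0 :: real)" by simp
  define R where "R = resolvent (schroedinger_op V \<gamma>) z"
  define R0 where "R0 = resolvent (schroedinger_op (\<lambda>x. 0) \<gamma>) z"
  have R: "is_resolvent (schroedinger_op V \<gamma>) (\<zeta>\<^sup>2) R" and R0: "is_resolvent (schroedinger_op (\<lambda>x. 0) \<gamma>) (\<zeta>\<^sup>2) R0"
    unfolding R_def R0_def \<zeta>(1) using z by (auto intro: resolvent_is_resolvent)
  have w: "jost_function V \<gamma> \<zeta> \<noteq> 0" "jost_function (\<lambda>x. 0) \<gamma> \<zeta> \<noteq> 0"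
    using z unfolding \<zeta>(1)[symmetric] by (intro jost_nonzero V V0 \<zeta>(2); blast)+
  have T: "T = (\<lambda>f. R0 f - R f)" by (simp add: T_def R_def R0_def)
  have "bounded_clinear R" "bounded_clinear R0"
    using R R0 by (simp_all add: is_resolvent_def)
  then have bT: "bounded_clinear T"
    unfolding T bounded_clinear_def by (auto intro: bounded_linear_sub simp: cscale.scale_right_diff_distrib)
  obtain M where M: "\<forall>x\<ge>0. norm (abs_l2 (\<lambda>y. cnj (green V \<gamma> \<zeta> x y))) \<le> M"
    using green_l2_bound[OF V \<zeta>(2), of \<gamma>] by blast
  obtain M0 where M0: "\<forall>x\<ge>0. norm (abs_l2 (green (\<lambda>x. 0) \<gamma> \<zeta> x)) \<le> M0"
    using green_l2_bound[OF V0 \<zeta>(2), of \<gamma>] by blast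
  note D = resolvent_difference[OF V \<zeta>(2) R R0 w]
  have "norm (abs_l2 (\<lambda>y. cnj (green V \<gamma> \<zeta> x y))) \<le> max M M0" "norm (abs_l2 (green (\<lambda>x. 0) \<gamma> \<zeta> x)) \<le> max M M0"
    if "0 \<le> x" for x
    using M M0 that by (auto simp: le_max_iff_disj)
  note tc = trace_class_of_kernel[OF bT V this D(2,3) D(1)[folded T[THEN fun_cong]]]
  show ?thesis
    using tc trace_kernel_integral[OF V \<zeta>(2) w] by simp
qed

end
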